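(* Let $F$ be a non-archimedean local field, $G=\mathrm{PGL}(2,F)$, and let $(\pi,\mathcal V_\pi)$ be an irreducible supercuspidal (smooth, complex) representation of $G$. Then $$\dim_{\mathbb C}\mathrm{Hom}_G\bigl(\mathcal V_\pi,\ H^1_c(\tilde X_{n(\pi)},\mathbb C)\bigr)=1 .$$
   Context: Let $\mathfrak o$ be the ring of integers of $F$ and $\mathfrak p$ its maximal ideal. $\Gamma_0(\mathfrak p^0)$ is the image of $\mathrm{GL}(2,\mathfrak o)$ in $G$; for $n\ge 1$, $\Gamma_0(\mathfrak p^n)$ is the image in $G$ of the group of matrices $\begin{pmatrix}a&b\\c&d\end{pmatrix}$ with $a,d\in\mathfrak o^\times$, $b\in\mathfrak o$, $c\in\mathfrak p^n$. By a theorem of Casselman there is an integer $n(\pi)\ge 0$ such that $\mathcal V_\pi^{\Gamma_0(\mathfrak p^{n(\pi)+1})}\ne 0$ and $\mathcal V_\pi^{\Gamma_0(\mathfrak p^{n(\pi)})}=0$. Let $X$ be the Bruhat-Tits tree of $G$. For $k\ge 0$, a $k$-path in $X$ is an injective sequence $(s_0,\dots,s_k)$ of vertices with $\{s_i,s_{i+1}\}$ an edge of $X$ for $0\le i\le k-1$. The directed graph $\tilde X_k$ has as vertex set $\tilde X_k^0$ the set of $k$-paths and as edge set $\tilde X_k^1$ the set of $(k+1)$-paths; the edge $a=(t_0,\dots,t_{k+1})$ has head $a^+=(t_1,\dots,t_{k+1})$ and tail $a^-=(t_0,\dots,t_k)$. $G$ acts naturally on $\tilde X_k$. $C^i_c(\tilde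 X_k,\mathbb C)$, $i=0,1$, is the space of finitely supported complex functions on $\tilde X_k^i$, with the natural $G$-action; $d:C_c^0(\tilde X_k,\mathbb C)\to C_c^1(\tilde X_k,\mathbb C)$ is $df(a)=f(a^+)-f(a^-)$; and $H^1_c(\tilde X_k,\mathbb C)=C^1_c(\tilde X_k,\mathbb C)/dC^0_c(\tilde X_k,\mathbb C)$ as a smooth $G$-module. *)

theory Defs
  imports
    "HOL-Analysis.Analysis"
    "HOL-Algebra.Group_Action"
    "HOL-Algebra.Ideal_Product"
    "Jordan_Normal_Form.Missing_VectorSpace"
begin

hide_const (open) Multiset.mult

section \<open>Non-archimedean local fields\<close>

text \<open>A non-archimedean local field is a field that is locally compact for the topology of a
  nontrivial ultrametric absolute value. The absolute value of \<open>x\<close> is \<open>dist x 0\<close>; it is not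
  required to be normalized.\<close>

class nonarch_local_field = field + metric_space +
  assumes dist_translate: "dist (x + z) (y + z) = dist x y"
    and dist_0_mult: "dist (x * y) 0 = dist x 0 * dist y 0"
    and dist_ultrametric: "dist x z \<le> max (dist x y) (dist y z)"
    and dist_0_nontrivial: "\<exists>x. x \<noteq> 0 \<and> dist x 0 \<noteq> 1"
    and locally_compact_0: "\<exists>U K. open U \<and> 0 \<in> U \<and> U \<subseteq> K \<and> compact K"

definition integer_ring :: "'f::nonarch_local_field ring"
  where "integer_ring =
    \<lparr>carrier = {x. dist x 0 \<le> 1}, mult = (*), one = 1, zero = 0, add = (+)\<rparr>"

definition max_ideal :: "'f::nonarch_local_field set"
  where "max_ideal = {x. dist x 0 < 1}"

primrec max_ideal_pow :: "nat \<Rightarrow> 'f::nonarch_local_field set"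
  where
    "max_ideal_pow 0 = carrier integer_ring"
  | "max_ideal_pow (Suc n) = ideal_prod integer_ring max_ideal (max_ideal_pow n)"


section \<open>The topological group PGL(2,F)\<close>

definition GL2 :: "('f::nonarch_local_field ^ 2 ^ 2) monoid"
  where "GL2 = \<lparr>carrier = {A. invertible A}, mult = (**), one = mat 1\<rparr>"

definition scalar_matrices :: "('f::nonarch_local_field ^ 2 ^ 2) set"
  where "scalar_matrices = {mat c | c. c \<noteq> 0}"

definition PGL2 :: "('f::nonarch_local_field ^ 2 ^ 2) set monoid"
  where "PGL2 = GL2 Mod scalar_matrices"

definition pgl :: "'f::nonarch_local_field ^ 2 ^ 2 \<Rightarrow> ('f ^ 2 ^ 2) set"
  where "pgl A = scalar_matrices #>\<^bsub>GL2\<^esub> A"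

text \<open>GL(2,F) has the subspace topology of the space of matrices, PGL(2,F) the quotient
  topology.\<close>

definition open_PGL2 :: "('f::nonarch_local_field ^ 2 ^ 2) set set \<Rightarrow> bool"
  where "open_PGL2 U \<longleftrightarrow>
    U \<subseteq> carrier PGL2 \<and> openin (top_of_set (carrier GL2)) {A \<in> carrier GL2. pgl A \<in> U}"

definition GL2_integers :: "('f::nonarch_local_field ^ 2 ^ 2) set"
  where "GL2_integers =
    {A. (\<forall>i j. A $ i $ j \<in> carrier integer_ring) \<and> det A \<in> Units integer_ring}"

definition Gamma0 :: "nat \<Rightarrow> ('f::nonarch_local_field ^ 2 ^ 2) set set"
  where "Gamma0 n =
    (if n = 0 then pgl ` GL2_integers
     else pgl ` {A. A $ 1 $ 1 \<in> Units integer_ring \<and> A $ 2 $ 2 \<in> Units integer_ring \<and>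
                    A $ 1 $ 2 \<in> carrier integer_ring \<and> A $ 2 $ 1 \<in> max_ideal_pow n})"

definition upper_unipotents :: "('f::nonarch_local_field ^ 2 ^ 2) set set"
  where "upper_unipotents = pgl ` {A. A $ 1 $ 1 = 1 \<and> A $ 2 $ 2 = 1 \<and> A $ 2 $ 1 = 0}"


section \<open>Complex vector spaces\<close>

definition complex_ring :: "complex ring"
  where "complex_ring = \<lparr>carrier = UNIV, mult = (*), one = 1, zero = 0, add = (+)\<rparr>"

text \<open>The ring multiplication and unit that a module record carries play no role in vector
  spaces; they are left undefined in the spaces constructed below.\<close>

definition quotient_space :: "(complex, 'v) module \<Rightarrow> 'v set \<Rightarrow> (complex, 'v set) module"
  where "quotient_space V W =
    \<lparr>carrier = a_rcosets\<^bsub>V\<^esub> W,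
     mult = undefined,
     one = undefined,
     zero = W,
     add = set_add V,
     smult = (\<lambda>c X. \<Union>x\<in>X. W +>\<^bsub>V\<^esub> (c \<odot>\<^bsub>V\<^esub> x))\<rparr>"

text \<open>Finitely supported functions on \<open>S\<close> are extended by zero outside \<open>S\<close>.\<close>

definition finsupp_space :: "'x set \<Rightarrow> (complex, 'x \<Rightarrow> complex) module"
  where "finsupp_space S =
    \<lparr>carrier = {f. finite {x. f x \<noteq> 0} \<and> {x. f x \<noteq> 0} \<subseteq> S},
     mult = undefined,
     one = undefined,
     zero = (\<lambda>x. 0),
     add = (\<lambda>f g x. f x + g x),
     smult = (\<lambda>c f x. c * f x)\<rparr>"


section \<open>Representations\<close>

definition representation ::
    "'g monoid \<Rightarrow> (complex, 'v) module \<Rightarrow> ('g \<Rightarrow> 'v \<Rightarrow> 'v) \<Rightarrow> bool"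
  where "representation G V \<pi> \<longleftrightarrow>
    group G \<and> vectorspace complex_ring V \<and>
    (\<forall>g\<in>carrier G. \<pi> g \<in> module_hom complex_ring V V) \<and>
    (\<forall>v\<in>carrier V. \<pi> \<one>\<^bsub>G\<^esub> v = v) \<and>
    (\<forall>g\<in>carrier G. \<forall>h\<in>carrier G. \<forall>v\<in>carrier V. \<pi> (g \<otimes>\<^bsub>G\<^esub> h) v = \<pi> g (\<pi> h v))"

definition irreducible_rep ::
    "'g monoid \<Rightarrow> (complex, 'v) module \<Rightarrow> ('g \<Rightarrow> 'v \<Rightarrow> 'v) \<Rightarrow> bool"
  where "irreducible_rep G V \<pi> \<longleftrightarrow>
    representation G V \<pi> \<and> carrier V \<noteq> {\<zero>\<^bsub>V\<^esub>} \<and>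
    (\<forall>W. VectorSpace.subspace complex_ring W V \<and> (\<forall>g\<in>carrier G. \<pi> g ` W \<subseteq> W) \<longrightarrow>
         W = {\<zero>\<^bsub>V\<^esub>} \<or> W = carrier V)"

definition smooth_rep ::
    "(complex, 'v) module \<Rightarrow> (('f::nonarch_local_field ^ 2 ^ 2) set \<Rightarrow> 'v \<Rightarrow> 'v) \<Rightarrow> bool"
  where "smooth_rep V \<pi> \<longleftrightarrow>
    representation PGL2 V \<pi> \<and> (\<forall>v\<in>carrier V. open_PGL2 (stabilizer PGL2 \<pi> v))"

text \<open>Up to conjugacy the upper triangular Borel subgroup is the only proper parabolic subgroup,
  so that supercuspidality is the vanishing of a single Jacquet module.\<close>

definition jacquet_module ::
    "(complex, 'v) module \<Rightarrow> (('f::nonarch_local_field ^ 2 ^ 2) set \<Rightarrow> 'v \<Rightarrow> 'v) \<Rightarrow>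
     (complex, 'v set) module"
  where "jacquet_module V \<pi> =
    quotient_space V
      (LinearCombinations.module.span complex_ring V
         {\<pi> u v \<ominus>\<^bsub>V\<^esub> v | u v. u \<in> upper_unipotents \<and> v \<in> carrier V})"

definition irreducible_supercuspidal ::
    "(complex, 'v) module \<Rightarrow> (('f::nonarch_local_field ^ 2 ^ 2) set \<Rightarrow> 'v \<Rightarrow> 'v) \<Rightarrow> bool"
  where "irreducible_supercuspidal V \<pi> \<longleftrightarrow>
    smooth_rep V \<pi> \<and> irreducible_rep PGL2 V \<pi> \<and>
    carrier (jacquet_module V \<pi>) = {\<zero>\<^bsub>jacquet_module V \<pi>\<^esub>}"

definition fixed_vectors ::
    "(complex, 'v) module \<Rightarrow> ('g \<Rightarrow> 'v \<Rightarrow> 'v) \<Rightarrow> 'g set \<Rightarrow> 'v set"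
  where "fixed_vectors V \<pi> H = {v \<in> carrier V. \<forall>g\<in>H. \<pi> g v = v}"

text \<open>Since the groups \<open>Gamma0 n\<close> decrease, at most one \<open>n\<close> has the defining property; that one
  exists for irreducible supercuspidal representations is a theorem of Casselman.\<close>

definition conductor_index ::
    "(complex, 'v) module \<Rightarrow> (('f::nonarch_local_field ^ 2 ^ 2) set \<Rightarrow> 'v \<Rightarrow> 'v) \<Rightarrow> nat"
  where "conductor_index V \<pi> =
    (THE n. fixed_vectors V \<pi> (Gamma0 (n + 1)) \<noteq> {\<zero>\<^bsub>V\<^esub>} \<and>
            fixed_vectors V \<pi> (Gamma0 n) = {\<zero>\<^bsub>V\<^esub>})"

definition Hom_rep ::
    "'g monoid \<Rightarrow> (complex, 'v) module \<Rightarrow> ('g \<Rightarrow> 'v \<Rightarrow> 'v) \<Rightarrow>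
     (complex, 'w) module \<Rightarrow> ('g \<Rightarrow> 'w \<Rightarrow> 'w) \<Rightarrow> (complex, 'v \<Rightarrow> 'w) module"
  where "Hom_rep G V \<pi> W \<rho> =
    \<lparr>carrier = {\<phi> \<in> module_hom complex_ring V W \<inter> extensional (carrier V).
                 \<forall>g\<in>carrier G. \<forall>v\<in>carrier V. \<phi> (\<pi> g v) = \<rho> g (\<phi> v)},
     mult = undefined,
     one = undefined,
     zero = (\<lambda>v\<in>carrier V. \<zero>\<^bsub>W\<^esub>),
     add = (\<lambda>\<phi> \<psi>. \<lambda>v\<in>carrier V. \<phi> v \<oplus>\<^bsub>W\<^esub> \<psi> v),
     smult = (\<lambda>c \<phi>. \<lambda>v\<in>carrier V. c \<odot>\<^bsub>W\<^esub> \<phi> v)\<rparr>"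

text \<open>The library's \<open>dim\<close> is only meaningful for finite-dimensional spaces.\<close>

definition has_dimension :: "(complex, 'v) module \<Rightarrow> nat \<Rightarrow> bool"
  where "has_dimension V n \<longleftrightarrow>
    vectorspace complex_ring V \<and> vectorspace.fin_dim complex_ring V \<and>
    vectorspace.dim complex_ring V = n"


section \<open>The Bruhat-Tits tree\<close>

text \<open>A lattice is the \<open>integer_ring\<close>-span of a basis of \<open>F ^ 2\<close>, here the columns of \<open>A\<close>.\<close>

definition integer_lattice :: "('f::nonarch_local_field ^ 2) set \<Rightarrow> bool"
  where "integer_lattice L \<longleftrightarrow>
    (\<exists>A :: 'f ^ 2 ^ 2. invertible A \<and> L = (*v) A ` {x. \<forall>i. x $ i \<in> carrier integer_ring})"

definition homothety_class :: "('f::nonarch_local_field ^ 2) set \<Rightarrow> ('f ^ 2) set set"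
  where "homothety_class L = {(*s) c ` L | c. c \<noteq> 0}"

definition tree_vertices :: "('f::nonarch_local_field ^ 2) set set set"
  where "tree_vertices = homothety_class ` {L. integer_lattice L}"

definition tree_edge :: "('f::nonarch_local_field ^ 2) set set \<Rightarrow> ('f ^ 2) set set \<Rightarrow> bool"
  where "tree_edge s t \<longleftrightarrow>
    s \<in> tree_vertices \<and> t \<in> tree_vertices \<and>
    (\<exists>L\<in>s. \<exists>M\<in>t. {c *s x | c x. c \<in> max_ideal \<and> x \<in> L} \<subset> M \<and> M \<subset> L)"

definition act_vertex ::
    "('f::nonarch_local_field ^ 2 ^ 2) set \<Rightarrow> ('f ^ 2) set set \<Rightarrow> ('f ^ 2) set set"
  where "act_vertex g s = {(*v) A ` L | A L. A \<in> g \<and> L \<in> s}"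


section \<open>The path graphs and their cohomology with compact support\<close>

text \<open>The vertices of the graph of index \<open>k\<close> are the \<open>k\<close>-paths, and its edges the
  \<open>(k + 1)\<close>-paths; the head of an edge \<open>a\<close> is \<open>tl a\<close>, its tail \<open>butlast a\<close>.\<close>

definition tree_paths :: "nat \<Rightarrow> ('f::nonarch_local_field ^ 2) set set list set"
  where "tree_paths k =
    {p. length p = k + 1 \<and> distinct p \<and> set p \<subseteq> tree_vertices \<and>
        (\<forall>i<k. tree_edge (p ! i) (p ! (i + 1)))}"

definition cochains0 ::
    "nat \<Rightarrow> (complex, ('f::nonarch_local_field ^ 2) set set list \<Rightarrow> complex) module"
  where "cochains0 k = finsupp_space (tree_paths k)"

definition cochains1 ::
    "nat \<Rightarrow> (complex, ('f::nonarch_local_field ^ 2) set set list \<Rightarrow> complex) module"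
  where "cochains1 k = finsupp_space (tree_paths (k + 1))"

definition coboundary ::
    "nat \<Rightarrow> (('f::nonarch_local_field ^ 2) set set list \<Rightarrow> complex) \<Rightarrow>
     ('f ^ 2) set set list \<Rightarrow> complex"
  where "coboundary k f = (\<lambda>a. if a \<in> tree_paths (k + 1) then f (tl a) - f (butlast a) else 0)"

definition act_cochain1 ::
    "nat \<Rightarrow> ('f::nonarch_local_field ^ 2 ^ 2) set \<Rightarrow>
     (('f ^ 2) set set list \<Rightarrow> complex) \<Rightarrow> ('f ^ 2) set set list \<Rightarrow> complex"
  where "act_cochain1 k g f =
    (\<lambda>a. if a \<in> tree_paths (k + 1) then f (map (act_vertex (inv\<^bsub>PGL2\<^esub> g)) a) else 0)"

definition H1c ::
    "nat \<Rightarrow> (complex, (('f::nonarch_local_field ^ 2) set set list \<Rightarrow> complex) set) module"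
  where "H1c k = quotient_space (cochains1 k) (coboundary k ` carrier (cochains0 k))"

text \<open>Applied to a coset \<open>f + dC\<close>, the image is the coset of the translate of \<open>f\<close>, because the
  space \<open>dC\<close> of coboundaries is stable.\<close>

definition act_H1c ::
    "nat \<Rightarrow> ('f::nonarch_local_field ^ 2 ^ 2) set \<Rightarrow>
     (('f ^ 2) set set list \<Rightarrow> complex) set \<Rightarrow> (('f ^ 2) set set list \<Rightarrow> complex) set"
  where "act_H1c k g X = act_cochain1 k g ` X"

end

(*
  Let K be the image of the group of level n+1, n = n(pi), and let w0 be a nonzero K-fixed vector.

  Multiplicity one. Averaging the translates by g over K defines operators T_g on the K-fixed
  vectors, and these operators span the Hecke algebra. Since the larger group of level n has no
  fixed vector, T_g vanishes for most double cosets; for all others T_g and T_h coincide for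
  h = g^-1. So the T_g commute, and since the representation is irreducible, the K-fixed vectors
  form a line. That there are fixed vectors at all, but none under the Iwahori group, follows from
  the vanishing of the Jacquet module: it makes the matrix coefficients compactly supported.

  The homomorphism. G acts transitively on the (n+1)-paths of the tree, and K is the stabilizer of
  the standard one. A vector w therefore defines the cochain s(w) sending the path g x0 to the
  K-fixed component of g^-1 w relative to w0; it has finite support. Conversely a cochain h is sent
  to the sum of h(g x0) g w0. This kills coboundaries, because the sum of the g w0 over the paths
  extending a given n-path is fixed by a group of level n; and s(w0) is sent to a nonzero multiple
  of w0 by Schur orthogonality. So the class of s(w) defines a nonzero element of Hom_G.

  Uniqueness. Given a homomorphism, the image of w0 has a representative Y that is fixed by K. The
  orthogonality relation writes w0 as a combination of its translates with coefficients s(w0), and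
  the corresponding combination of the translates of Y is a multiple of s(w0) as K-invariant
  functionals are unique up to scalars.
*)

theory Submission
  imports
    Defs
    "HOL-Library.Function_Algebras"
    "HOL-Computational_Algebra.Fundamental_Theorem_Algebra"
begin

section \<open>The valuation\<close>

text \<open>A smooth vector is fixed by some \<open>Kc m\<close>, so every integral over a compact
  group becomes a finite sum over a transversal. Vectors are realized as functions on matrices, with
  pointwise operations. Inversion does not preserve every double coset of \<open>K\<close>, so
  commutativity is a fact about operators and not about cosets. Two groups above \<open>K\<close>
  are used: \<open>Kp\<close> enlarges the lower left entry, and its conjugate \<open>Km\<close>
  under \<open>Dg unif 1\<close> enlarges the upper right one; neither has nonzero fixed vectors.
  Apart from cosets that inversion visibly preserves, they leave only those of
  \<open>\<omega> ** k\<close> with \<open>k\<close> in \<open>Kp\<close> outside \<open>K\<close>.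
  There the vanishing of the sum over a \<open>Kp\<close>-orbit forces the operator to be a fixed
  multiple of translation by \<open>\<omega>\<close>. Unitarity is not assumed. The conjugate
  symmetry of the coefficient \<open>ell (rho g w0)\<close> is deduced from its finite support and
  from the uniqueness of \<open>K\<close>-invariant functionals, and \<open>N0\<close> is nonzero as
  a sum of squares.\<close>

abbreviation nrm :: "'f::nonarch_local_field \<Rightarrow> real"
  where "nrm x \<equiv> dist x 0"

lemma nrm_add_le: "nrm (x + y) \<le> max (nrm x) (nrm y)" for x y :: "'f::nonarch_local_field"
  using dist_ultrametric[of "x + y" 0 y] dist_translate[of x y 0] by simp

lemma nrm_minus [simp]: "nrm (- x) = nrm x" for x :: "'f::nonarch_local_field"
  using dist_translate[of "-x" x 0] by (simp add: dist_commute)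

lemma dist_eq_nrm: "dist x y = nrm (x - y)" for x y :: "'f::nonarch_local_field"
  using dist_translate[of x "-y" y] by simp

lemma nrm_one [simp]: "nrm (1 :: 'f::nonarch_local_field) = 1"
  using dist_0_mult[of "1::'f" 1] by simp

lemma nrm_inverse: "nrm (inverse x) = inverse (nrm x)" if "x \<noteq> 0" for x :: "'f::nonarch_local_field"
  using dist_0_mult[of x "inverse x"] that by (simp add: field_simps)

lemma nrm_divide: "nrm (x / y) = nrm x / nrm y" for x y :: "'f::nonarch_local_field"
  by (cases "y = 0") (auto simp: divide_inverse dist_0_mult nrm_inverse)

lemma nrm_power: "nrm (x ^ n) = nrm x ^ n" for x :: "'f::nonarch_local_field"
  by (induction n) (simp_all add: dist_0_mult)

text \<open>Multiplication by a high power of an element of norm greater than 1 carries a small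
  compact ball around 0 to a compact set containing the given closed ball.\<close>

lemma compact_cball_0: "compact (cball (0::'f::nonarch_local_field) r)"
proof -
  obtain U K :: "'f set" where UK: "open U" "0 \<in> U" "U \<subseteq> K" "compact K"
    using locally_compact_0 by blast
  obtain e where e: "e > 0" "cball 0 e \<subseteq> U"
    using UK open_contains_cball by metis
  have ce: "compact (cball (0::'f) e)"
  proof -
    have "K \<inter> cball 0 e = cball 0 e" using e UK by blast
    then show ?thesis using compact_Int_closed[OF \<open>compact K\<close> closed_cball[of 0 e]] by simp
  qed
  obtain x0 :: 'f where x0: "x0 \<noteq> 0" "nrm x0 \<noteq> 1" using dist_0_nontrivial by blast
  obtain x :: 'f where x: "x \<noteq> 0" "nrm x > 1"
  proof (cases "nrm x0 > 1")
    case False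
    then have "nrm (inverse x0) > 1" using x0 nrm_inverse[of x0] one_less_inverse[of "nrm x0"] by simp
    then show ?thesis using that[of "inverse x0"] x0 by simp
  qed (use x0 that in blast)
  obtain n where n: "r / e < nrm x ^ n" using real_arch_pow[OF x(2)] by blast
  let ?a = "x ^ n"
  have a0: "?a \<noteq> 0" using x by simp
  have "continuous_on (cball 0 e) (\<lambda>y. ?a * y)"
  proof (rule continuous_onI)
    fix y :: 'f and d :: real assume "d > 0"
    have eq: "dist (?a * z) (?a * y) = nrm ?a * dist z y" for z
      using dist_0_mult[of ?a "z - y"] dist_eq_nrm[of z y] dist_eq_nrm[of "?a * z" "?a * y"]
      by (simp add: algebra_simps)
    have pos: "nrm ?a > 0" using a0 by simp
    show "\<exists>da>0. \<forall>z\<in>cball 0 e. dist z y < da \<longrightarrow> dist (?a * z) (?a * y) \<le> d"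
    proof (rule exI[of _ "d / nrm ?a"], intro conjI ballI impI)
      show "0 < d / nrm ?a" using pos \<open>d > 0\<close> by simp
      fix z assume "dist z y < d / nrm ?a"
      then show "dist (?a * z) (?a * y) \<le> d"
        unfolding eq using pos by (simp add: field_simps)
    qed
  qed
  then have c: "compact ((\<lambda>y. ?a * y) ` cball 0 e)" using ce compact_continuous_image by blast
  have "cball 0 r \<subseteq> (\<lambda>y. ?a * y) ` cball 0 e"
  proof
    fix z :: 'f assume "z \<in> cball 0 r"
    then have "nrm z \<le> r" by (simp add: dist_commute)
    then have "nrm (inverse ?a * z) \<le> e"
      using n e a0 x by (simp add: dist_0_mult nrm_inverse nrm_power nrm_divide field_simps)
    then have "inverse ?a * z \<in> cball 0 e" by (simp add: dist_commute)
    moreover have "z = ?a * (inverse ?a * z)" using a0 by simp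
    ultimately show "z \<in> (\<lambda>y. ?a * y) ` cball 0 e" by blast
  qed
  then show ?thesis
    using compact_Int_closed[OF c closed_cball[of 0 r]] by (metis Int_absorb1)
qed

text \<open>The elements of norm less than 1 form a closed set by the ultrametric inequality, hence
  a compact one, and the norm attains its maximum there. Nontriviality of the absolute value makes
  the maximum positive.\<close>

lemma ex_uniformizer:
  "\<exists>p::'f::nonarch_local_field. 0 < nrm p \<and> nrm p < 1 \<and> (\<forall>x::'f. nrm x < 1 \<longrightarrow> nrm x \<le> nrm p)"
proof -
  let ?M = "{x::'f. nrm x < 1}"
  have "closed ?M"
    unfolding closed_def open_dist
  proof (intro ballI)
    fix x :: 'f assume "x \<in> - ?M"
    then have x: "nrm x \<ge> 1" by simp
    show "\<exists>e>0. \<forall>y. dist y x < e \<longrightarrow> y \<in> - ?M"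
    proof (rule exI[of _ 1], intro conjI allI impI)
      fix y assume "dist y x < 1"
      then show "y \<in> - ?M" using dist_ultrametric[of x 0 y] x by (auto simp: dist_commute)
    qed simp
  qed
  then have "compact ?M"
    using compact_Int_closed[OF compact_cball_0[of 1], of ?M]
    by (metis (mono_tags, lifting) Int_absorb1 dist_commute less_imp_le mem_Collect_eq mem_cball subsetI)
  moreover have "?M \<noteq> {}" by (auto intro!: exI[of _ 0])
  moreover have "continuous_on ?M nrm" by (intro continuous_intros)
  ultimately obtain p where p: "p \<in> ?M" "\<forall>x\<in>?M. nrm x \<le> nrm p"
    using continuous_attains_sup[of ?M nrm] by blast
  obtain x0 :: 'f where x0: "x0 \<noteq> 0" "nrm x0 \<noteq> 1" using dist_0_nontrivial by blast
  have "\<exists>x::'f. x \<noteq> 0 \<and> nrm x < 1"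
  proof (cases "nrm x0 < 1")
    case False
    then have "nrm (inverse x0) < 1" using x0 nrm_inverse[of x0] by (simp add: inverse_less_1_iff)
    then show ?thesis using x0 by (intro exI[of _ "inverse x0"]) simp
  qed (use x0 in blast)
  then obtain x :: 'f where "x \<noteq> 0" "nrm x < 1" by blast
  then have "0 < nrm p" using p(2) by (metis (mono_tags) dist_pos_lt mem_Collect_eq order_less_le_trans)
  then show ?thesis using p by auto
qed

definition unif :: "'f::nonarch_local_field"
  where "unif = (SOME p. 0 < nrm p \<and> nrm p < 1 \<and> (\<forall>x::'f. nrm x < 1 \<longrightarrow> nrm x \<le> nrm p))"

lemma unif:
  fixes x :: "'f::nonarch_local_field"
  shows "0 < nrm (unif::'f)" "nrm (unif::'f) < 1" "nrm x < 1 \<Longrightarrow> nrm x \<le> nrm (unif::'f)"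
proof -
  have *: "0 < nrm (unif::'f) \<and> nrm (unif::'f) < 1 \<and> (\<forall>x::'f. nrm x < 1 \<longrightarrow> nrm x \<le> nrm (unif::'f))"
    unfolding unif_def by (rule someI_ex[OF ex_uniformizer])
  show "0 < nrm (unif::'f)" "nrm (unif::'f) < 1" by (rule *[THEN conjunct1], rule *[THEN conjunct2, THEN conjunct1])
  show "nrm x < 1 \<Longrightarrow> nrm x \<le> nrm (unif::'f)"
    using *[THEN conjunct2, THEN conjunct2] by blast
qed

lemma unif_nz [simp]: "(unif::'f::nonarch_local_field) \<noteq> 0"
  using unif(1) by force

lemma nrm_powi: "nrm (x powi n) = nrm x powi n" if "x \<noteq> 0" for x :: "'f::nonarch_local_field"
proof -
  show ?thesis using that by (auto simp: power_int_def nrm_power nrm_inverse)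
qed

text \<open>Rounding the quotient of logarithms down puts the norm of
  \<open>x * unif powi (- n)\<close> above that of \<open>unif\<close> and at most at 1; the
  maximality of \<open>nrm unif\<close> leaves only the value 1.\<close>

lemma ex_val: "\<exists>n::int. nrm x = nrm (unif::'f) powi n" if "x \<noteq> 0" for x :: "'f::nonarch_local_field"
proof -
  let ?p = "nrm (unif::'f)"
  define n where "n = \<lfloor>ln (nrm x) / ln ?p\<rfloor>"
  have lp: "ln ?p < 0" using unif[where 'f='f] by simp
  have x: "nrm x > 0" using that by simp
  have pw: "ln (?p powi k) = real_of_int k * ln ?p" for k
    using unif(1)[where 'f='f] by (subst powr_real_of_int'[symmetric]) (auto simp: ln_powr)
  have pos: "?p powi k > 0" for k using unif(1)[where 'f='f] by simp
  have "real_of_int n \<le> ln (nrm x) / ln ?p" "ln (nrm x) / ln ?p < real_of_int n + 1"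
    unfolding n_def by linarith+
  then have "ln (nrm x) \<le> real_of_int n * ln ?p" "real_of_int (n + 1) * ln ?p < ln (nrm x)"
    using lp by (auto simp: field_simps)
  then have b: "nrm x \<le> ?p powi n" "?p powi (n + 1) < nrm x"
    using x pos[of n] pos[of "n + 1"] ln_le_cancel_iff[OF x pos[of n]] ln_less_cancel_iff[OF pos[of "n + 1"] x]
    unfolding pw by simp_all
  let ?y = "x * unif powi (- n)"
  have ny: "nrm ?y = nrm x / ?p powi n"
    using nrm_powi[of "unif :: 'f" "- n"] by (simp add: dist_0_mult power_int_minus divide_inverse)
  have "nrm ?y \<le> 1" using b(1) pos[of n] ny by simp
  moreover have "\<not> nrm ?y < 1"
  proof
    assume "nrm ?y < 1"
    then have "nrm ?y \<le> ?p" using unif(3) by blast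
    moreover have "?p powi (n + 1) = ?p powi n * ?p" using unif(1)[where 'f='f] by (simp add: power_int_add)
    ultimately show False using b(2) ny pos[of n] by (simp add: field_simps)
  qed
  ultimately have "nrm ?y = 1" by simp
  then show ?thesis using ny pos[of n] by (intro exI[of _ n]) (simp add: field_simps)
qed

text \<open>The valuation of zero is a junk value.\<close>

definition val :: "'f::nonarch_local_field \<Rightarrow> int"
  where "val x = (SOME n. nrm x = nrm (unif::'f) powi n)"

lemma nrm_val: "nrm x = nrm (unif::'f) powi (val x)" if "x \<noteq> 0" for x :: "'f::nonarch_local_field"
  unfolding val_def using someI_ex[OF ex_val[OF that]] .

lemma unif_powi_le_iff: "nrm (unif::'f::nonarch_local_field) powi m \<le> nrm (unif::'f) powi n \<longleftrightarrow> n \<le> m"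
proof -
  have s: "m < n \<Longrightarrow> nrm (unif::'f) powi n < nrm (unif::'f) powi m" for m n
    using unif[where 'f='f] by (intro power_int_strict_decreasing) auto
  show ?thesis using s[of m n] s[of n m] by (cases m n rule: linorder_cases) auto
qed

text \<open>The powers of the maximal ideal as fractional ideals. Negative exponents occur for large
  compact groups of unipotents and for the upper right entries of \<open>Km\<close>.\<close>

definition P :: "int \<Rightarrow> 'f::nonarch_local_field set"
  where "P n = {x. nrm x \<le> nrm (unif::'f) powi n}"

lemma P_iff: "x \<in> P n \<longleftrightarrow> x = 0 \<or> n \<le> val x" for x :: "'f::nonarch_local_field"
proof (cases "x = 0")
  case True
  then show ?thesis using unif(1)[where 'f='f] by (simp add: P_def)
next
  case False
  then show ?thesis using unif_powi_le_iff[where 'f='f, of "val x" n] False by (simp add: P_def nrm_val[OF False])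
qed

lemma val_eqI: "val x = n" if "x \<noteq> 0" "nrm x = nrm (unif::'f) powi n" for x :: "'f::nonarch_local_field"
  using that nrm_val[OF that(1)] unif_powi_le_iff[where 'f='f] by (metis order_antisym order_refl)

lemma val_mult: "val (x * y) = val x + val y" if "x \<noteq> 0" "y \<noteq> 0" for x y :: "'f::nonarch_local_field"
  using that unif(1)[where 'f='f] by (intro val_eqI) (auto simp: dist_0_mult nrm_val[OF that(1)] nrm_val[OF that(2)] power_int_add)

lemma val_one [simp]: "val (1::'f::nonarch_local_field) = 0"
  by (rule val_eqI) auto

lemma val_unif_powi [simp]: "val (unif powi n :: 'f::nonarch_local_field) = n"
  by (rule val_eqI) (auto simp: nrm_powi)

lemma val_unif [simp]: "val (unif :: 'f::nonarch_local_field) = 1"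
  using val_unif_powi[of 1] by simp

lemma val_inverse: "val (inverse x) = - val x" if "x \<noteq> 0" for x :: "'f::nonarch_local_field"
  using val_mult[of x "inverse x"] that by simp

lemma val_divide: "val (x / y) = val x - val y" if "x \<noteq> 0" "y \<noteq> 0" for x y :: "'f::nonarch_local_field"
  using val_mult[of x "inverse y"] that by (simp add: val_inverse divide_inverse)

lemma val_minus [simp]: "val (- x) = val x" for x :: "'f::nonarch_local_field"
  unfolding val_def by simp

lemma P_0 [simp]: "0 \<in> P n" by (simp add: P_iff)

lemma P_1 [simp]: "1 \<in> P 0" by (simp add: P_iff)

lemma P_add: "x \<in> P n \<Longrightarrow> y \<in> P n \<Longrightarrow> x + y \<in> P n" for x y :: "'f::nonarch_local_field"
  using nrm_add_le[of x y] by (auto simp: P_def)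

lemma P_minus: "x \<in> P n \<Longrightarrow> - x \<in> P n" for x :: "'f::nonarch_local_field"
  by (auto simp: P_def)

lemma P_minus_iff [simp]: "- x \<in> P n \<longleftrightarrow> x \<in> P n" for x :: "'f::nonarch_local_field"
  by (auto simp: P_def)

lemma P_diff: "x \<in> P n \<Longrightarrow> y \<in> P n \<Longrightarrow> x - y \<in> P n" for x y :: "'f::nonarch_local_field"
  using P_add[of x n "-y"] by simp

lemma P_mult: "x \<in> P m \<Longrightarrow> y \<in> P n \<Longrightarrow> x * y \<in> P (m + n)" for x y :: "'f::nonarch_local_field"
  by (cases "x = 0 \<or> y = 0") (auto simp: P_iff val_mult)

lemma P_mono: "x \<in> P m \<Longrightarrow> n \<le> m \<Longrightarrow> x \<in> P n" by (auto simp: P_iff)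

lemma P_mult_le: "x \<in> P m \<Longrightarrow> y \<in> P n \<Longrightarrow> k \<le> m + n \<Longrightarrow> x * y \<in> P k"
  using P_mult P_mono by blast

definition unit :: "'f::nonarch_local_field \<Rightarrow> bool" where "unit x \<longleftrightarrow> nrm x = 1"

lemma unit_val: "unit x \<longleftrightarrow> x \<noteq> 0 \<and> val x = 0" for x :: "'f::nonarch_local_field"
proof (cases "x = 0")
  case False
  show ?thesis
  proof
    assume "unit x"
    then show "x \<noteq> 0 \<and> val x = 0" using val_eqI[of x 0] False by (simp add: unit_def)
  next
    assume "x \<noteq> 0 \<and> val x = 0"
    then show "unit x" using nrm_val[of x] by (simp add: unit_def)
  qed
qed (simp add: unit_def)

lemma unit_P: "unit x \<longleftrightarrow> x \<in> P 0 \<and> x \<notin> P 1" for x :: "'f::nonarch_local_field"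
  by (auto simp: unit_val P_iff)

lemma unit_nz: "unit x \<Longrightarrow> x \<noteq> 0" by (simp add: unit_val)
lemma unit_in_P: "unit x \<Longrightarrow> x \<in> P 0" by (simp add: unit_P)
lemma unit_1 [simp]: "unit 1" by (simp add: unit_def)
lemma unit_minus [simp]: "unit (- x) \<longleftrightarrow> unit x" by (simp add: unit_def)
lemma unit_mult: "unit x \<Longrightarrow> unit y \<Longrightarrow> unit (x * y)" by (simp add: unit_def dist_0_mult)
lemma unit_inverse: "unit x \<Longrightarrow> unit (inverse x)" by (auto simp: unit_val val_inverse)
lemma unit_divide: "unit x \<Longrightarrow> unit y \<Longrightarrow> unit (x / y)"
  by (simp add: divide_inverse unit_mult unit_inverse)

lemma unit_mult_P: "unit u \<Longrightarrow> u * x \<in> P n \<longleftrightarrow> x \<in> P n" for x :: "'f::nonarch_local_field"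
  by (cases "x = 0") (auto simp: unit_val P_iff val_mult)

lemma unit_mult_P': "unit u \<Longrightarrow> x * u \<in> P n \<longleftrightarrow> x \<in> P n" for x :: "'f::nonarch_local_field"
  using unit_mult_P[of u x n] by (simp add: mult.commute)

lemma unit_divide_P: "unit u \<Longrightarrow> x / u \<in> P n \<longleftrightarrow> x \<in> P n" for x :: "'f::nonarch_local_field"
  using unit_mult_P'[of "inverse u" x n] by (simp add: divide_inverse unit_inverse)

lemma val_add_eq:
  assumes "x \<noteq> 0" "y \<in> P (val x + 1)"
  shows "x + y \<noteq> 0" "val (x + y) = val x"
proof -
  show nz: "x + y \<noteq> 0"
  proof
    assume "x + y = 0"
    then have "x = - y" by (metis add.inverse_inverse minus_unique)
    then show False using assms by (auto simp: P_iff)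
  qed
  have "x + y \<in> P (val x)" using assms by (intro P_add) (auto simp: P_iff)
  moreover have "x + y \<notin> P (val x + 1)"
  proof
    assume "x + y \<in> P (val x + 1)"
    then have "(x + y) - y \<in> P (val x + 1)" using assms(2) P_diff by blast
    then show False using assms by (auto simp: P_iff)
  qed
  ultimately show "val (x + y) = val x" using nz by (auto simp: P_iff)
qed

lemma unit_add_P: "unit x \<Longrightarrow> y \<in> P 1 \<Longrightarrow> unit (x + y)" for x y :: "'f::nonarch_local_field"
  using val_add_eq[of x y] by (auto simp: unit_val)

lemma unit_diff_P: "unit x \<Longrightarrow> y \<in> P 1 \<Longrightarrow> unit (x - y)"
  using unit_add_P[of x "-y"] by simp

lemma unit_1_plus: "x \<in> P 1 \<Longrightarrow> unit (1 + x)" "x \<in> P 1 \<Longrightarrow> unit (1 - x)"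
  using unit_add_P[of 1 x] unit_diff_P[of 1 x] by auto

lemma unif_powi_P [simp]: "(unif powi n :: 'f::nonarch_local_field) \<in> P m \<longleftrightarrow> m \<le> n"
  by (auto simp: P_iff)

lemma unif_powi_mult_P: "unif powi n * x \<in> P m \<longleftrightarrow> x \<in> P (m - n)" for x :: "'f::nonarch_local_field"
  by (cases "x = 0") (auto simp: P_iff val_mult)

text \<open>\<open>P a\<close> is a compact ball, hence totally bounded, and the ball of radius
  \<open>nrm unif powi b\<close> around \<open>r\<close> lies in the coset of \<open>r\<close>
  modulo \<open>P b\<close>. This finiteness is the source of all finite averages.\<close>

lemma finite_reps_P:
  "\<exists>R::'f::nonarch_local_field set. finite R \<and> R \<subseteq> P a \<and> (\<forall>x\<in>P a. \<exists>r\<in>R. x - r \<in> P b)"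
proof -
  let ?p = "nrm (unif::'f)"
  have P: "P a = cball (0::'f) (?p powi a)"
    unfolding P_def cball_def by (simp only: dist_commute[of 0])
  have e: "?p powi b > 0" using unif(1)[where 'f='f] by simp
  have sc: "seq_compact (P a :: 'f set)" unfolding P using compact_cball_0 compact_eq_seq_compact_metric by blast
  have "\<exists>R. finite R \<and> R \<subseteq> P a \<and> (P a :: 'f set) \<subseteq> (\<Union>x\<in>R. ball x (?p powi b))"
    by (rule seq_compact_imp_totally_bounded[OF sc, rule_format, OF e])
  then obtain R where "finite R" "R \<subseteq> P a" "(P a :: 'f set) \<subseteq> (\<Union>x\<in>R. ball x (?p powi b))"
    by blast
  moreover have "x \<in> ball r (?p powi b) \<Longrightarrow> x - r \<in> P b" for x r :: 'f
    unfolding P_def mem_ball dist_commute[of r] dist_eq_nrm[of x r] by simp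
  ultimately show ?thesis by (intro exI[of _ R]) blast
qed

lemma carrier_integer_ring: "carrier integer_ring = P 0"
  by (simp add: integer_ring_def P_def)

lemma Units_integer_ring: "Units integer_ring = {x. unit x}"
proof -
  have "nrm x = 1" if "nrm x \<le> 1" "nrm y \<le> 1" "x * y = 1" for x y :: 'a
  proof -
    have "nrm x * nrm y = 1" using that dist_0_mult[of x y] by simp
    moreover have "nrm x * nrm y \<le> nrm x * 1" using that(2) by (intro mult_left_mono) auto
    ultimately show ?thesis using that(1) by simp
  qed
  moreover have "\<exists>y. nrm y \<le> 1 \<and> y * x = 1 \<and> x * y = 1" if "nrm x = 1" for x :: 'a
  proof (cases "x = 0")
    case False
    then show ?thesis using that by (intro exI[of _ "inverse x"]) (auto simp: nrm_inverse)
  qed (use that in simp)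
  ultimately show ?thesis by (fastforce simp: Units_def integer_ring_def unit_def)
qed

lemma max_ideal_P: "max_ideal = P 1"
  using unif(3) unif(2) by (auto simp: max_ideal_def P_def intro: order_le_less_trans)

lemma max_ideal_pow_P: "max_ideal_pow n = P (int n)"
proof (induction n)
  case 0
  then show ?case by (simp add: carrier_integer_ring)
next
  case (Suc n)
  have 1: "x \<in> P (int (Suc n))" if "x \<in> ideal_prod integer_ring (P 1) (P (int n))" for x :: 'a
    using that
  proof (induction rule: ideal_prod.induct)
    case (prod i j)
    then show ?case using P_mult[of i 1 j "int n"] by (simp add: integer_ring_def)
  next
    case (sum s1 s2)
    then show ?case by (simp add: integer_ring_def P_add)
  qed
  have 2: "x \<in> ideal_prod integer_ring (P 1) (P (int n))" if "x \<in> P (int (Suc n))" for x :: 'a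
  proof -
    have "inverse unif * x \<in> P (int n)"
      using that by (cases "x = 0") (auto simp: P_iff val_mult val_inverse)
    moreover have "unif \<in> P 1" by (simp add: P_iff)
    ultimately have "unif * (inverse unif * x) \<in> ideal_prod integer_ring (P 1) (P (int n))"
      using ideal_prod.prod[of unif "P 1" "inverse unif * x" "P (int n)" integer_ring]
      by (simp add: integer_ring_def)
    then show ?thesis by (simp add: mult.assoc[symmetric])
  qed
  have "max_ideal_pow (Suc n) = ideal_prod integer_ring (P 1) (P (int n) :: 'a set)"
    unfolding max_ideal_pow.simps max_ideal_P Suc ..
  also have "\<dots> = P (int (Suc n))"
  proof (intro subset_antisym subsetI)
    fix x :: 'a
    show "x \<in> ideal_prod integer_ring (P 1) (P (int n)) \<Longrightarrow> x \<in> P (int (Suc n))"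
      by (rule 1)
    show "x \<in> P (int (Suc n)) \<Longrightarrow> x \<in> ideal_prod integer_ring (P 1) (P (int n))"
      by (rule 2)
  qed
  finally show ?case .
qed

section \<open>Two by two matrices\<close>

definition mat2 :: "'a \<Rightarrow> 'a \<Rightarrow> 'a \<Rightarrow> 'a \<Rightarrow> 'a::zero ^ 2 ^ 2"
  where "mat2 a b c d = vector [vector [a, b], vector [c, d]]"

lemma mat2_nth [simp]:
  "mat2 a b c d $ 1 $ 1 = a" "mat2 a b c d $ 1 $ 2 = b"
  "mat2 a b c d $ 2 $ 1 = c" "mat2 a b c d $ 2 $ 2 = d"
  by (simp_all add: mat2_def)

lemma mat2_eq_iff: "A = B \<longleftrightarrow> A$1$1 = B$1$1 \<and> A$1$2 = B$1$2 \<and> A$2$1 = B$2$1 \<and> A$2$2 = B$2$2"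
  for A B :: "'a ^ 2 ^ 2"
  by (auto simp: vec_eq_iff forall_2)

lemma mat2_inject [simp]: "mat2 a b c d = mat2 a' b' c' d' \<longleftrightarrow> a = a' \<and> b = b' \<and> c = c' \<and> d = d'"
  by (simp add: mat2_eq_iff)

lemma mat2_cases: obtains a b c d where "A = mat2 a b c d"
proof -
  have "A = mat2 (A$1$1) (A$1$2) (A$2$1) (A$2$2)" by (simp add: mat2_eq_iff)
  then show ?thesis using that by blast
qed

lemma mat2_mult [simp]:
  "mat2 a b c d ** mat2 a' b' c' d' =
    mat2 (a * a' + b * c') (a * b' + b * d') (c * a' + d * c') (c * b' + d * d')"
  for a b c d :: "'a::comm_ring_1"
  by (simp add: mat2_eq_iff matrix_matrix_mult_def sum_2)

lemma mat_mat2: "mat c = mat2 c 0 0 c" by (simp add: mat2_eq_iff mat_def)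

lemma det_mat2 [simp]: "det (mat2 a b c d) = a * d - b * c" for a :: "'a::comm_ring_1"
  by (simp add: det_2)

lemma invertible_mat2: "invertible (mat2 a b c d) \<longleftrightarrow> a * d - b * c \<noteq> 0" for a :: "'a::field"
  by (simp add: invertible_det_nz)

definition inv2 :: "'a::field ^ 2 ^ 2 \<Rightarrow> 'a ^ 2 ^ 2"
  where "inv2 A = mat2 (A$2$2 / det A) (- A$1$2 / det A) (- A$2$1 / det A) (A$1$1 / det A)"

lemma inv2: assumes "invertible A" shows "A ** inv2 A = mat 1" "inv2 A ** A = mat 1"
proof -
  obtain a b c d where A: "A = mat2 a b c d" by (rule mat2_cases)
  then have nz: "a * d - b * c \<noteq> 0" using assms by (simp add: invertible_mat2)
  show "A ** inv2 A = mat 1" "inv2 A ** A = mat 1"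
    unfolding A inv2_def using nz by (simp_all add: mat_mat2 divide_simps)
qed

lemma invertible_inv2: "invertible A \<Longrightarrow> invertible (inv2 A)"
  using inv2 unfolding invertible_def by blast

lemma invertible_mm: "invertible A \<Longrightarrow> invertible B \<Longrightarrow> invertible (A ** B)" for A B :: "'a::field ^ 2 ^ 2"
  by (simp add: invertible_det_nz det_mul)

lemma inv2_unique:
  fixes A B :: "'a::field ^ 2 ^ 2"
  assumes "A ** B = mat 1"
  shows "inv2 A = B"
proof -
  have "det A * det B = 1" using assms det_mul[of A B] by simp
  then have "invertible A" by (auto simp: invertible_det_nz)
  then have "inv2 A ** (A ** B) = B" by (simp add: matrix_mul_assoc inv2)
  then show ?thesis using assms by simp
qed

lemma inv2_mm: assumes "invertible A" "invertible B" shows "inv2 (A ** B) = inv2 B ** inv2 A"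
proof (rule inv2_unique)
  have "A ** B ** (inv2 B ** inv2 A) = A ** (B ** inv2 B) ** inv2 A" by (simp add: matrix_mul_assoc)
  then show "A ** B ** (inv2 B ** inv2 A) = mat 1" using assms by (simp add: inv2)
qed

lemma inv2_inv2: "invertible A \<Longrightarrow> inv2 (inv2 A) = A"
  using inv2(2) inv2_unique by blast

lemma inv2_mat2: "a * d - b * c \<noteq> 0 \<Longrightarrow> inv2 (mat2 a b c d) =
   mat2 (d / (a * d - b * c)) (- b / (a * d - b * c)) (- c / (a * d - b * c)) (a / (a * d - b * c))"
  for a :: "'a::field"
  by (simp add: inv2_def)

lemma inv2_cancel: "invertible A \<Longrightarrow> inv2 A ** (A ** B) = B" "invertible A \<Longrightarrow> A ** (inv2 A ** B) = B"
  "invertible A \<Longrightarrow> B ** A ** inv2 A = B" "invertible A \<Longrightarrow> B ** inv2 A ** A = B"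
  for A B :: "'a::field ^ 2 ^ 2"
     apply (simp_all add: matrix_mul_assoc inv2)
  by (simp_all add: matrix_mul_assoc[symmetric] inv2)

lemma inv2_one [simp]: "inv2 (mat 1) = (mat 1 :: 'a::field^2^2)"
  by (rule inv2_unique) simp

lemma invertible_mat1 [simp]: "invertible (mat c :: 'a::field^2^2) \<longleftrightarrow> c \<noteq> 0"
  by (simp add: mat_mat2 invertible_mat2)

subsection \<open>Subgroups\<close>

definition U :: "'a \<Rightarrow> 'a::zero_neq_one ^ 2 ^ 2" where "U x = mat2 1 x 0 1"
definition Lo :: "'a \<Rightarrow> 'a::zero_neq_one ^ 2 ^ 2" where "Lo x = mat2 1 0 x 1"
definition Dg :: "'a \<Rightarrow> 'a \<Rightarrow> 'a::zero ^ 2 ^ 2" where "Dg a d = mat2 a 0 0 d"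

text \<open>A group when \<open>b + c\<close> is at least 1; \<open>Kg 0 n\<close> lies over
  \<open>Gamma0 n\<close> for positive \<open>n\<close>. Two independent exponents are kept because
  conjugation by diagonal matrices shifts them in opposite directions.\<close>

definition Kg :: "int \<Rightarrow> int \<Rightarrow> ('f::nonarch_local_field ^ 2 ^ 2) set"
  where "Kg b c = {A. unit (A$1$1) \<and> unit (A$2$2) \<and> A$1$2 \<in> P b \<and> A$2$1 \<in> P c}"

definition GO :: "('f::nonarch_local_field ^ 2 ^ 2) set"
  where "GO = {A. A$1$1 \<in> P 0 \<and> A$1$2 \<in> P 0 \<and> A$2$1 \<in> P 0 \<and> A$2$2 \<in> P 0 \<and> unit (det A)}"

text \<open>For positive \<open>m\<close> these are the principal congruence subgroups, a
  neighbourhood basis of the identity.\<close>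

definition Kc :: "int \<Rightarrow> ('f::nonarch_local_field ^ 2 ^ 2) set"
  where "Kc m = {A. A$1$1 - 1 \<in> P m \<and> A$1$2 \<in> P m \<and> A$2$1 \<in> P m \<and> A$2$2 - 1 \<in> P m}"

lemma mat2_Kg [simp]: "mat2 a b c d \<in> Kg i j \<longleftrightarrow> unit a \<and> unit d \<and> b \<in> P i \<and> c \<in> P j"
  by (auto simp: Kg_def)

lemma mat2_GO [simp]: "mat2 a b c d \<in> GO \<longleftrightarrow> a \<in> P 0 \<and> b \<in> P 0 \<and> c \<in> P 0 \<and> d \<in> P 0 \<and> unit (a * d - b * c)"
  by (auto simp: GO_def)

lemma mat2_Kc [simp]: "mat2 a b c d \<in> Kc m \<longleftrightarrow> a - 1 \<in> P m \<and> b \<in> P m \<and> c \<in> P m \<and> d - 1 \<in> P m"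
  by (auto simp: Kc_def)

lemma Kg_det: assumes "A \<in> Kg b c" "b + c \<ge> 1" shows "unit (det A)"
proof -
  obtain p q r s where A: "A = mat2 p q r s" by (rule mat2_cases)
  have "q * r \<in> P 1" using assms by (auto simp: A intro: P_mult_le)
  moreover have "unit (p * s)" using assms by (auto simp: A intro: unit_mult)
  ultimately show ?thesis by (simp add: A unit_diff_P)
qed

lemma Kg_inv: "A \<in> Kg b c \<Longrightarrow> b + c \<ge> 1 \<Longrightarrow> invertible A"
  using Kg_det[of A b c] by (auto simp: invertible_det_nz unit_val)

lemma GO_inv: "A \<in> GO \<Longrightarrow> invertible A"
  by (auto simp: invertible_det_nz GO_def unit_val)

lemma Kg_mm: assumes "A \<in> Kg b c" "B \<in> Kg b c" "b + c \<ge> 1" shows "A ** B \<in> Kg b c"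
proof -
  obtain p q r s where A: "A = mat2 p q r s" by (rule mat2_cases)
  obtain p' q' r' s' where B: "B = mat2 p' q' r' s'" by (rule mat2_cases)
  have h: "unit p" "unit s" "q \<in> P b" "r \<in> P c" "unit p'" "unit s'" "q' \<in> P b" "r' \<in> P c"
    using assms by (auto simp: A B)
  have "unit (p * p' + q * r')" using h assms(3) by (intro unit_add_P unit_mult) (auto intro: P_mult_le)
  moreover have "unit (r * q' + s * s')" unfolding add.commute[of "r * q'"]
    using h assms(3) by (intro unit_add_P unit_mult) (auto intro: P_mult_le)
  moreover have "p * q' + q * s' \<in> P b" "r * p' + s * r' \<in> P c"
    using h by (auto intro!: P_add simp: unit_mult_P unit_mult_P')
  ultimately show ?thesis by (simp add: A B)
qed

lemma Kg_inv2: assumes "A \<in> Kg b c" "b + c \<ge> 1" shows "inv2 A \<in> Kg b c"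
proof -
  obtain p q r s where A: "A = mat2 p q r s" by (rule mat2_cases)
  have u: "unit (p * s - q * r)" using Kg_det[OF assms] by (simp add: A)
  then show ?thesis using assms unit_nz[OF u]
    by (simp add: A inv2_mat2 unit_divide unit_divide_P minus_divide_left[symmetric])
qed

lemma one_Kg [simp]: "mat 1 \<in> Kg b c" by (simp add: mat_mat2)
lemma one_GO [simp]: "mat 1 \<in> GO" by (simp add: mat_mat2)

lemma GO_mm: assumes "A \<in> GO" "B \<in> GO" shows "A ** B \<in> GO"
proof -
  obtain p q r s where A: "A = mat2 p q r s" by (rule mat2_cases)
  obtain p' q' r' s' where B: "B = mat2 p' q' r' s'" by (rule mat2_cases)
  have "det (A ** B) = det A * det B" by (rule det_mul)
  then have "unit (det (A ** B))" using assms by (auto simp: GO_def unit_mult)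
  moreover have "x * y + z * w \<in> P 0" if "x \<in> P 0" "y \<in> P 0" "z \<in> P 0" "w \<in> P 0" for x y z w :: 'a
    using that by (intro P_add) (auto intro: P_mult_le)
  ultimately show ?thesis using assms by (auto simp: GO_def A B)
qed

lemma GO_inv2: assumes "A \<in> GO" shows "inv2 A \<in> GO"
proof -
  obtain p q r s where A: "A = mat2 p q r s" by (rule mat2_cases)
  have u: "unit (p * s - q * r)" using assms by (simp add: A)
  have "det A * det (inv2 A) = 1" using inv2(1)[OF GO_inv[OF assms]] det_mul[of A "inv2 A"] by simp
  then have "det (inv2 A) = inverse (det A)" by (metis inverse_unique)
  then have "unit (det (inv2 A))" using u by (simp add: A unit_inverse)
  then show ?thesis using assms u by (simp add: GO_def inv2_def A unit_divide_P minus_divide_left[symmetric])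
qed

lemma Kg_GO: "A \<in> Kg b c \<Longrightarrow> 0 \<le> b \<Longrightarrow> 0 \<le> c \<Longrightarrow> b + c \<ge> 1 \<Longrightarrow> A \<in> GO"
  using Kg_det[of A b c] by (auto simp: Kg_def GO_def unit_in_P intro: P_mono)

lemma Kc_Kg: "A \<in> Kc m \<Longrightarrow> 1 \<le> m \<Longrightarrow> b \<le> m \<Longrightarrow> c \<le> m \<Longrightarrow> A \<in> Kg b c"
  using unit_1_plus(1)[of "A$1$1 - 1"] unit_1_plus(1)[of "A$2$2 - 1"] P_mono
  by (auto simp: Kg_def Kc_def)

lemma Kc_inv: "A \<in> Kc m \<Longrightarrow> 1 \<le> m \<Longrightarrow> invertible A"
  using Kc_Kg[of A m 1 1] Kg_inv[of A 1 1] by simp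

lemma Kc_mono: "A \<in> Kc m \<Longrightarrow> n \<le> m \<Longrightarrow> A \<in> Kc n" by (auto simp: Kc_def intro: P_mono)

text \<open>Gauss elimination with the unit in the upper left corner as pivot (Iwahori
  factorization). It reduces invariance under \<open>Kg b c\<close> to unipotent and diagonal
  matrices.\<close>

lemma Kg_decomp: assumes "A \<in> Kg b c" "b + c \<ge> 1"
  obtains x u v y where "A = Lo y ** Dg u v ** U x" "unit u" "unit v" "x \<in> P b" "y \<in> P c"
proof -
  obtain p q r s where A: "A = mat2 p q r s" by (rule mat2_cases)
  have h: "unit p" "unit s" "q \<in> P b" "r \<in> P c" using assms by (auto simp: A)
  have "A = Lo (r / p) ** Dg p (s - q * r / p) ** U (q / p)"
    using unit_nz[OF h(1)] by (simp add: A Lo_def Dg_def U_def field_simps)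
  moreover have "unit (s - q * r / p)" using h assms(2)
    by (intro unit_diff_P) (auto simp: unit_divide_P intro: P_mult_le)
  ultimately show ?thesis using that[of "r/p" p "s - q * r / p" "q/p"] h by (simp add: unit_divide_P)
qed

subsection \<open>Transversals\<close>

text \<open>Sums over such a set of representatives take the place of Haar integrals over
  \<open>H\<close>.\<close>

definition transv :: "('x \<Rightarrow> 'x \<Rightarrow> bool) \<Rightarrow> 'x set \<Rightarrow> 'x set \<Rightarrow> bool"
  where "transv E H R \<longleftrightarrow> finite R \<and> R \<subseteq> H \<and> (\<forall>h\<in>H. \<exists>r\<in>R. E h r) \<and> (\<forall>r\<in>R. \<forall>r'\<in>R. E r r' \<longrightarrow> r = r')"

text \<open>\<open>R0\<close> only has to bound the number of classes and may lie outside
  \<open>H\<close>; a choice that depends on the class alone moves its elements into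
  \<open>H\<close>.\<close>

lemma ex_transv:
  assumes E: "equivp E" and R0: "finite R0" "\<And>h. h \<in> H \<Longrightarrow> \<exists>r\<in>R0. E h r"
  shows "\<exists>R. transv E H R"
proof -
  define F where "F h = (SOME h'. h' \<in> H \<and> E h h')" for h
  have F: "F h \<in> H \<and> E h (F h)" if "h \<in> H" for h
    unfolding F_def by (rule someI[of _ h]) (use that equivp_reflp[OF E] in auto)
  have Feq: "F h = F h'" if "E h h'" for h h'
  proof -
    have "E h = E h'" using that E unfolding equivp_def by blast
    then show ?thesis by (simp add: F_def)
  qed
  have "F ` H \<subseteq> F ` R0" using R0(2) Feq by blast
  then have "finite (F ` H)" using R0(1) finite_subset by blast
  moreover have "F h = F h'" if "E (F h) (F h')" "h \<in> H" "h' \<in> H" for h h'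
    using that F Feq equivp_transp[OF E] equivp_symp[OF E] by metis
  ultimately show ?thesis unfolding transv_def using F by (intro exI[of _ "F ` H"]) blast
qed

text \<open>The finite form of the invariance of Haar measure: a map that is injective on classes
  permutes the finitely many representatives. It is applied to translations, unit dilations and
  inversions.\<close>

lemma transv_sum_reindex:
  assumes E: "equivp E" and R: "transv E H R"
    and b: "\<And>h. h \<in> H \<Longrightarrow> b h \<in> H" "\<And>h h'. h \<in> H \<Longrightarrow> h' \<in> H \<Longrightarrow> E (b h) (b h') \<Longrightarrow> E h h'"
    and f: "\<And>h h'. h \<in> H \<Longrightarrow> h' \<in> H \<Longrightarrow> E h h' \<Longrightarrow> f h = f h'"
  shows "(\<Sum>r\<in>R. f (b r)) = (\<Sum>r\<in>R. f r)"
proof -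
  have RH: "R \<subseteq> H" "finite R" using R by (auto simp: transv_def)
  define c where "c r = (SOME r'. r' \<in> R \<and> E (b r) r')" for r
  have c: "c r \<in> R \<and> E (b r) (c r)" if "r \<in> R" for r
  proof -
    have "\<exists>r'. r' \<in> R \<and> E (b r) r'" using R b(1) that RH unfolding transv_def by blast
    then show ?thesis unfolding c_def by (rule someI_ex)
  qed
  have "inj_on c R"
  proof (rule inj_onI)
    fix r r' assume h: "r \<in> R" "r' \<in> R" "c r = c r'"
    then have "E (b r) (b r')" using c equivp_transp[OF E] equivp_symp[OF E] by metis
    then have "E r r'" using b(2) h RH by blast
    then show "r = r'" using R h unfolding transv_def by blast
  qed
  moreover have "c ` R \<subseteq> R" using c by blast
  ultimately have "c ` R = R" using RH(2) endo_inj_surj by blast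
  have "(\<Sum>r\<in>R. f (b r)) = (\<Sum>r\<in>R. f (c r))"
    using c RH b(1) by (intro sum.cong refl f) blast+
  also have "\<dots> = (\<Sum>r\<in>c ` R. f r)" using sum.reindex[OF \<open>inj_on c R\<close>, of f] by simp
  finally show ?thesis using \<open>c ` R = R\<close> by simp
qed

lemma transv_card_pos: "transv E H R \<Longrightarrow> h \<in> H \<Longrightarrow> card R > 0"
  by (auto simp: transv_def card_gt_0_iff)

definition Ea :: "int \<Rightarrow> 'f::nonarch_local_field \<Rightarrow> 'f \<Rightarrow> bool" where "Ea m x y \<longleftrightarrow> x - y \<in> P m"

lemma equivp_Ea: "equivp (Ea m :: 'f::nonarch_local_field \<Rightarrow> 'f \<Rightarrow> bool)"
proof (rule equivpI)
  show "reflp (Ea m :: 'f \<Rightarrow> 'f \<Rightarrow> bool)" by (auto simp: reflp_def Ea_def)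
  show "symp (Ea m :: 'f \<Rightarrow> 'f \<Rightarrow> bool)"
  proof (rule sympI)
    fix x y :: 'f assume "Ea m x y"
    then show "Ea m y x" using P_minus[of "x - y" m] by (simp add: Ea_def)
  qed
  show "transp (Ea m :: 'f \<Rightarrow> 'f \<Rightarrow> bool)"
  proof (rule transpI)
    fix x y z :: 'f assume "Ea m x y" "Ea m y z"
    then show "Ea m x z" using P_add[of "x - y" m "y - z"] by (simp add: Ea_def)
  qed
qed

lemma ex_transv_Ea: assumes "H \<subseteq> P a" shows "\<exists>R. transv (Ea m :: 'f::nonarch_local_field \<Rightarrow> 'f \<Rightarrow> bool) H R"
proof -
  obtain R :: "'f set" where "finite R" "\<forall>x\<in>P a. \<exists>r\<in>R. x - r \<in> P m" using finite_reps_P by blast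
  then show ?thesis using assms by (intro ex_transv[OF equivp_Ea]) (auto simp: Ea_def)
qed

text \<open>On \<open>GO\<close> this is the relation of lying in the same left coset of
  \<open>Kc m\<close>, expressed entry by entry so that finiteness of the number of classes is
  immediate.\<close>

definition Em :: "int \<Rightarrow> 'f::nonarch_local_field ^ 2 ^ 2 \<Rightarrow> 'f ^ 2 ^ 2 \<Rightarrow> bool"
  where "Em m A B \<longleftrightarrow> (\<forall>i j. Ea m (A$i$j) (B$i$j))"

lemma equivp_Em: "equivp (Em m)"
proof (rule equivpI)
  show "reflp (Em m)" unfolding reflp_def Em_def using equivp_reflp[OF equivp_Ea] by blast
  show "symp (Em m)" unfolding symp_def Em_def using equivp_symp[OF equivp_Ea] by blast
  show "transp (Em m)" unfolding transp_def Em_def using equivp_transp[OF equivp_Ea] by blast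
qed

lemma ex_transv_Em: assumes "H \<subseteq> GO" shows "\<exists>R. transv (Em m) H (R :: ('f::nonarch_local_field^2^2) set)"
proof -
  obtain R :: "'f set" where R: "finite R" "\<forall>x\<in>P 0. \<exists>r\<in>R. x - r \<in> P m" using finite_reps_P by blast
  let ?R = "(\<lambda>(a, b, c, d). mat2 a b c d) ` (R \<times> R \<times> R \<times> R)"
  show ?thesis
  proof (rule ex_transv[OF equivp_Em, of ?R])
    show "finite ?R" using R by blast
    fix h :: "'f^2^2" assume "h \<in> H"
    then have "h \<in> GO" using assms by blast
    obtain a b c d where h: "h = mat2 a b c d" by (rule mat2_cases)
    obtain a' b' c' d' where "a' \<in> R" "b' \<in> R" "c' \<in> R" "d' \<in> R"
      "a - a' \<in> P m" "b - b' \<in> P m" "c - c' \<in> P m" "d - d' \<in> P m"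
      using R(2) \<open>h \<in> GO\<close> unfolding h mat2_GO by meson
    then show "\<exists>r\<in>?R. Em m h r"
      by (intro bexI[of _ "mat2 a' b' c' d'"] image_eqI[of _ _ "(a', b', c', d')"])
        (auto simp: Em_def Ea_def h forall_2)
  qed
qed

lemma Em_mult: assumes "Em m A B" "C \<in> GO" shows "Em m (C ** A) (C ** B)" "Em m (A ** C) (B ** C)"
proof -
  obtain p q r s where A: "A = mat2 p q r s" by (rule mat2_cases)
  obtain p' q' r' s' where B: "B = mat2 p' q' r' s'" by (rule mat2_cases)
  obtain x y z w where C: "C = mat2 x y z w" by (rule mat2_cases)
  have h: "p - p' \<in> P m" "q - q' \<in> P m" "r - r' \<in> P m" "s - s' \<in> P m" "x \<in> P 0" "y \<in> P 0" "z \<in> P 0" "w \<in> P 0"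
    using assms by (auto simp: A B C Em_def Ea_def forall_2)
  have k: "(a * b + c * d) - (a * b' + c * d') \<in> P m"
    "(b * a + d * c) - (b' * a + d' * c) \<in> P m"
    if "a \<in> P 0" "c \<in> P 0" "b - b' \<in> P m" "d - d' \<in> P m" for a b c d b' d' :: 'a
  proof -
    have "a * (b - b') + c * (d - d') \<in> P m" using that by (intro P_add) (auto intro: P_mult_le)
    then show "(a * b + c * d) - (a * b' + c * d') \<in> P m" "(b * a + d * c) - (b' * a + d' * c) \<in> P m"
      by (simp_all add: algebra_simps)
  qed
  show "Em m (C ** A) (C ** B)" "Em m (A ** C) (B ** C)"
    using h by (auto simp: A B C Em_def Ea_def forall_2 intro!: k)
qed

lemma Em_mult_iff: assumes "C \<in> GO"
  shows "Em m (C ** A) (C ** B) \<longleftrightarrow> Em m A B" "Em m (A ** C) (B ** C) \<longleftrightarrow> Em m A B"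
proof -
  note i = GO_inv[OF assms] and g = GO_inv2[OF assms]
  show "Em m (C ** A) (C ** B) \<longleftrightarrow> Em m A B"
    using Em_mult(1)[OF _ assms, of m A B] Em_mult(1)[OF _ g, of m "C ** A" "C ** B"]
    unfolding inv2_cancel[OF i] by blast
  show "Em m (A ** C) (B ** C) \<longleftrightarrow> Em m A B"
    using Em_mult(2)[OF _ assms, of m A B] Em_mult(2)[OF _ g, of m "A ** C" "B ** C"]
    unfolding inv2_cancel[OF i] by blast
qed

lemma Em_inv: assumes "A \<in> GO" "B \<in> GO" shows "Em m (inv2 A) (inv2 B) \<longleftrightarrow> Em m A B"
proof -
  have "Em m (inv2 A) (inv2 B) \<longleftrightarrow> Em m (A ** inv2 A ** B) (A ** inv2 B ** B)"
    using Em_mult_iff(1)[OF assms(1), of m "inv2 A" "inv2 B"]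
      Em_mult_iff(2)[OF assms(2), of m "A ** inv2 A" "A ** inv2 B"] by simp
  also have "\<dots> \<longleftrightarrow> Em m B A" 
    using GO_inv[OF assms(1)] GO_inv[OF assms(2)] by (simp add: inv2 inv2_cancel)
  also have "\<dots> \<longleftrightarrow> Em m A B" using equivp_symp[OF equivp_Em] by blast
  finally show ?thesis .
qed

lemma Em_Kc: assumes "Em m A B" "A \<in> GO" obtains C where "C \<in> Kc m" "B = A ** C"
proof (rule that[of "inv2 A ** B"])
  have "Em m (inv2 A ** A) (inv2 A ** B)" using assms GO_inv2 Em_mult by blast
  then have "Em m (mat 1) (inv2 A ** B)" using assms by (simp add: inv2 GO_inv)
  then have e: "1 - (inv2 A ** B)$1$1 \<in> P m" "0 - (inv2 A ** B)$1$2 \<in> P m" "0 - (inv2 A ** B)$2$1 \<in> P m"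
     "1 - (inv2 A ** B)$2$2 \<in> P m"
    by (auto simp: mat_mat2 Em_def Ea_def forall_2)
  show "inv2 A ** B \<in> Kc m" unfolding Kc_def using e P_minus_iff[of "1 - (inv2 A ** B)$1$1" m]
     P_minus_iff[of "1 - (inv2 A ** B)$2$2" m] by simp
  show "B = A ** (inv2 A ** B)" by (simp add: inv2_cancel GO_inv assms)
qed

section \<open>Representations by right translation\<close>

lemmas fun_simps = plus_fun_apply zero_fun_apply minus_apply uminus_apply fun_eq_iff

declare plus_fun_apply [simp del] zero_fun_apply [simp del] minus_apply [simp del] uminus_apply [simp del]

lemma sum_fun_apply: "(\<Sum>i\<in>A. f i) x = (\<Sum>i\<in>A. f i x)" for f :: "'i \<Rightarrow> 'x \<Rightarrow> 'b::comm_monoid_add"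
  by (induction A rule: infinite_finite_induct) (simp_all add: plus_fun_apply zero_fun_apply)

definition rho :: "'f::nonarch_local_field ^ 2 ^ 2 \<Rightarrow> ('f ^ 2 ^ 2 \<Rightarrow> complex) \<Rightarrow> 'f ^ 2 ^ 2 \<Rightarrow> complex"
  where "rho g w = (\<lambda>x. w (x ** g))"

definition sc :: "complex \<Rightarrow> ('x \<Rightarrow> complex) \<Rightarrow> 'x \<Rightarrow> complex"
  where "sc c w = (\<lambda>x. c * w x)"

lemma rho_mult: "rho g (rho h w) = rho (g ** h) w" by (simp add: rho_def matrix_mul_assoc)
lemma rho_one [simp]: "rho (mat 1) w = w" by (simp add: rho_def)
lemma rho_add: "rho g (v + w) = rho g v + rho g w" by (simp add: rho_def fun_simps)
lemma rho_diff: "rho g (v - w) = rho g v - rho g w" by (simp add: rho_def fun_simps)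
lemma rho_0 [simp]: "rho g 0 = 0" by (simp add: rho_def fun_simps)
lemma rho_sc: "rho g (sc c w) = sc c (rho g w)" by (simp add: rho_def sc_def)
lemma rho_sum: "rho g (\<Sum>i\<in>A. f i) = (\<Sum>i\<in>A. rho g (f i))"
  by (simp add: rho_def fun_simps sum_fun_apply)

lemma sc_add: "sc c (v + w) = sc c v + sc c w" by (simp add: sc_def fun_simps algebra_simps)
lemma sc_diff: "sc c (v - w) = sc c v - sc c w" by (simp add: sc_def fun_simps algebra_simps)
lemma sc_add_left: "sc (c + d) v = sc c v + sc d v" by (simp add: sc_def fun_simps algebra_simps)
lemma sc_diff_left: "sc (c - d) v = sc c v - sc d v" by (simp add: sc_def fun_simps algebra_simps)
lemma sc_sc [simp]: "sc c (sc d v) = sc (c * d) v" by (simp add: sc_def fun_simps)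
lemma sc_1 [simp]: "sc 1 v = v" by (simp add: sc_def)
lemma sc_0 [simp]: "sc 0 v = 0" "sc c 0 = 0" by (simp_all add: sc_def fun_simps)
lemma sc_sum: "sc c (\<Sum>i\<in>A. f i) = (\<Sum>i\<in>A. sc c (f i))"
  by (simp add: sc_def fun_simps sum_fun_apply sum_distrib_left)
lemma sc_eq_0: "sc c v = 0 \<longleftrightarrow> c = 0 \<or> v = 0" by (auto simp: sc_def fun_simps)
lemma sc_minus_1: "sc (- 1) v = - v" by (simp add: sc_def fun_simps)
lemma sum_const_sc: "(\<Sum>i\<in>A. v) = sc (of_nat (card A)) v" for v :: "'x \<Rightarrow> complex"
  by (simp add: fun_simps sum_fun_apply sc_def)

text \<open>The parameter \<open>N\<close> is kept because the unipotents \<open>U u\<close> with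
  \<open>u\<close> in \<open>P (- N)\<close> form a compact group, and averaging over it kills these
  vectors. The union over all \<open>N\<close> is the kernel of the map to the Jacquet
  module.\<close>

inductive_set J :: "('f::nonarch_local_field ^ 2 ^ 2 \<Rightarrow> complex) set \<Rightarrow> int \<Rightarrow> ('f ^ 2 ^ 2 \<Rightarrow> complex) set"
  for W N
  where
    J_0: "0 \<in> J W N"
  | J_step: "w \<in> J W N \<Longrightarrow> x \<in> W \<Longrightarrow> u \<in> P (- N) \<Longrightarrow> w + (rho (U u) x - x) \<in> J W N"

lemma J_mono: "w \<in> J W N \<Longrightarrow> N \<le> N' \<Longrightarrow> w \<in> J W N'"
proof (induction rule: J.induct)
  case J_0
  show ?case by (rule J.J_0)
next
  case (J_step w x u)
  then show ?case by (intro J.J_step) (auto intro: P_mono)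
qed

lemma J_add: "w \<in> J W N \<Longrightarrow> v \<in> J W N \<Longrightarrow> v + w \<in> J W N"
proof (induction rule: J.induct)
  case (J_step w x u)
  then show ?case using J.J_step[of "v + w"] by (simp add: add.assoc)
qed simp

lemma J_sc_closed: assumes "w \<in> J W N" "\<And>x. x \<in> W \<Longrightarrow> sc a x \<in> W" shows "sc a w \<in> J W N"
  using assms(1)
proof (induction rule: J.induct)
  case J_0
  show ?case by (simp add: J.J_0)
next
  case (J_step w x u)
  show ?case unfolding sc_add sc_diff rho_sc[symmetric] by (rule J.J_step[OF J_step.IH assms(2)[OF J_step.hyps(2)] J_step.hyps(3)])
qed

text \<open>What the proof uses of the representation, realized on functions: trivial central
  character, smoothness, irreducibility, and the vanishing of the Jacquet module in the form
  \<open>cusp\<close>.\<close>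

locale cuspidal_model =
  fixes W :: "('f::nonarch_local_field ^ 2 ^ 2 \<Rightarrow> complex) set"
  assumes W_0: "0 \<in> W"
    and W_add: "v \<in> W \<Longrightarrow> w \<in> W \<Longrightarrow> v + w \<in> W"
    and W_sc: "w \<in> W \<Longrightarrow> sc c w \<in> W"
    and W_rho: "invertible g \<Longrightarrow> w \<in> W \<Longrightarrow> rho g w \<in> W"
    and rho_mat: "a \<noteq> 0 \<Longrightarrow> w \<in> W \<Longrightarrow> rho (mat a) w = w"
    and smooth: "w \<in> W \<Longrightarrow> \<exists>m\<ge>1. \<forall>h\<in>Kc m. rho h w = w"
    and irred: "V \<subseteq> W \<Longrightarrow> 0 \<in> V \<Longrightarrow> (\<And>v w. v \<in> V \<Longrightarrow> w \<in> V \<Longrightarrow> v + w \<in> V) \<Longrightarrow>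
        (\<And>c v. v \<in> V \<Longrightarrow> sc c v \<in> V) \<Longrightarrow> (\<And>g v. invertible g \<Longrightarrow> v \<in> V \<Longrightarrow> rho g v \<in> V) \<Longrightarrow>
        V \<noteq> {0} \<Longrightarrow> V = W"
    and W_nonzero: "W \<noteq> {0}"
    and cusp: "w \<in> W \<Longrightarrow> \<exists>N. w \<in> J W N"
begin

lemma W_sum: "(\<And>i. i \<in> A \<Longrightarrow> f i \<in> W) \<Longrightarrow> (\<Sum>i\<in>A. f i) \<in> W"
  by (induction A rule: infinite_finite_induct) (simp_all add: W_0 W_add)

lemma W_minus: "w \<in> W \<Longrightarrow> - w \<in> W"
  using W_sc[of w "-1"] by (simp add: sc_minus_1)

lemma W_diff: "v \<in> W \<Longrightarrow> w \<in> W \<Longrightarrow> v - w \<in> W"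
  using W_add[of v "- w"] W_minus by simp

definition Fx :: "('f ^ 2 ^ 2) set \<Rightarrow> ('f ^ 2 ^ 2 \<Rightarrow> complex) set"
  where "Fx H = {w \<in> W. \<forall>h\<in>H. rho h w = w}"

lemma Fx_W: "w \<in> Fx H \<Longrightarrow> w \<in> W" by (simp add: Fx_def)
lemma Fx_rho: "w \<in> Fx H \<Longrightarrow> h \<in> H \<Longrightarrow> rho h w = w" by (simp add: Fx_def)
lemma Fx_mono: "H \<subseteq> H' \<Longrightarrow> w \<in> Fx H' \<Longrightarrow> w \<in> Fx H" by (auto simp: Fx_def)
lemma Fx_0: "0 \<in> Fx H" by (simp add: Fx_def W_0)
lemma Fx_add: "v \<in> Fx H \<Longrightarrow> w \<in> Fx H \<Longrightarrow> v + w \<in> Fx H" by (simp add: Fx_def W_add rho_add)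
lemma Fx_sc: "w \<in> Fx H \<Longrightarrow> sc c w \<in> Fx H" by (simp add: Fx_def W_sc rho_sc)
lemma Fx_sum: "(\<And>i. i \<in> A \<Longrightarrow> f i \<in> Fx H) \<Longrightarrow> (\<Sum>i\<in>A. f i) \<in> Fx H"
  by (induction A rule: infinite_finite_induct) (simp_all add: Fx_0 Fx_add)

lemma Fx_KcI: "w \<in> W \<Longrightarrow> \<exists>m\<ge>1. w \<in> Fx (Kc m)"
  using smooth[of w] by (auto simp: Fx_def)

lemma Fx_Kc_mono: "w \<in> Fx (Kc m) \<Longrightarrow> m \<le> n \<Longrightarrow> w \<in> Fx (Kc n)"
  by (rule Fx_mono[of "Kc n" "Kc m"]) (auto intro: Kc_mono)

lemma common_level:
  assumes "finite A" "A \<subseteq> W"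
  shows "\<exists>m\<ge>1. \<forall>m'\<ge>m. A \<subseteq> Fx (Kc m')"
  using assms
proof (induction A rule: finite_induct)
  case empty
  then show ?case by auto
next
  case (insert x A)
  then obtain m where m: "m \<ge> 1" "\<And>m'. m' \<ge> m \<Longrightarrow> A \<subseteq> Fx (Kc m')" by blast
  obtain n where n: "n \<ge> 1" "x \<in> Fx (Kc n)" using Fx_KcI[of x] insert.prems by blast
  show ?case
    using m n Fx_Kc_mono[OF n(2)] by (intro exI[of _ "max m n"]) auto
qed

lemma rho_inv2: "invertible g \<Longrightarrow> rho (inv2 g) (rho g w) = w" "invertible g \<Longrightarrow> rho g (rho (inv2 g) w) = w"
  by (simp_all add: rho_mult inv2)

lemma rho_scalar: "c \<noteq> 0 \<Longrightarrow> w \<in> W \<Longrightarrow> rho (mat c ** g) w = rho g w"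
  "c \<noteq> 0 \<Longrightarrow> w \<in> W \<Longrightarrow> rho (g ** mat c) w = rho g w"
proof -
  assume c: "c \<noteq> 0" "w \<in> W"
  show *: "rho (g ** mat c) w = rho g w" using rho_mat[OF c] by (simp add: rho_mult[symmetric])
  obtain p q r s where g: "g = mat2 p q r s" by (rule mat2_cases)
  have "mat c ** g = g ** mat c" by (simp add: g mat_mat2 mult.commute)
  then show "rho (mat c ** g) w = rho g w" using * by simp
qed

lemma Em_rho: assumes "Em m A B" "A \<in> GO" "w \<in> Fx (Kc m)" shows "rho A w = rho B w"
proof -
  obtain C where C: "C \<in> Kc m" "B = A ** C" using Em_Kc[OF assms(1,2)] by blast
  then show ?thesis using Fx_rho[OF assms(3) C(1)] by (simp add: rho_mult[symmetric])
qed

lemma finite_orbit: assumes "w \<in> W" shows "finite {rho k w |k. k \<in> GO}"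
proof -
  obtain m where m: "w \<in> Fx (Kc m)" using Fx_KcI[OF assms] by blast
  obtain R :: "('f^2^2) set" where R: "transv (Em m) GO R" using ex_transv_Em[of GO m] by blast
  have sub: "{rho k w |k. k \<in> GO} \<subseteq> (\<lambda>k. rho k w) ` R"
  proof clarify
    fix k :: "'f^2^2" assume "k \<in> GO"
    then obtain r where "r \<in> R" "Em m k r" using R by (auto simp: transv_def)
    then show "rho k w \<in> (\<lambda>k. rho k w) ` R" using Em_rho[OF _ \<open>k \<in> GO\<close> m] by blast
  qed
  have "finite R" using R by (simp add: transv_def)
  then show ?thesis by (rule finite_subset[OF sub finite_imageI])
qed

subsection \<open>Averaging\<close>

text \<open>The average of a vector over \<open>K\<close> is a finite sum because the vector is fixed by a
  principal congruence subgroup.\<close>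

definition TR :: "int \<Rightarrow> int \<Rightarrow> ('f ^ 2 ^ 2) set"
  where "TR c m = (SOME R. transv (Em m) (Kg 0 c) R)"

definition eav :: "int \<Rightarrow> int \<Rightarrow> ('f ^ 2 ^ 2 \<Rightarrow> complex) \<Rightarrow> 'f ^ 2 ^ 2 \<Rightarrow> complex"
  where "eav c m w = sc (1 / of_nat (card (TR c m))) (\<Sum>r\<in>TR c m. rho r w)"

text \<open>No single level serves all vectors, so the level is chosen for each vector; by
  \<open>eK_eq\<close> every admissible level gives the same average, which is what makes the
  projector linear.\<close>

definition eK :: "int \<Rightarrow> ('f ^ 2 ^ 2 \<Rightarrow> complex) \<Rightarrow> 'f ^ 2 ^ 2 \<Rightarrow> complex"
  where "eK c w = eav c (SOME m. m \<ge> 1 \<and> w \<in> Fx (Kc m)) w"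

end

locale cuspidal_level = cuspidal_model W for W :: "('f::nonarch_local_field ^ 2 ^ 2 \<Rightarrow> complex) set" +
  fixes c :: int
  assumes c1: "1 \<le> c"
begin

abbreviation K :: "('f^2^2) set" where "K \<equiv> Kg 0 c"

lemma K_GO: "k \<in> K \<Longrightarrow> k \<in> GO" by (rule Kg_GO) (use c1 in auto)
lemma K_inv: "k \<in> K \<Longrightarrow> invertible k" by (rule GO_inv[OF K_GO])
lemma K_mm: "k \<in> K \<Longrightarrow> h \<in> K \<Longrightarrow> k ** h \<in> K" by (rule Kg_mm) (use c1 in auto)
lemma K_inv2: "k \<in> K \<Longrightarrow> inv2 k \<in> K" by (rule Kg_inv2) (use c1 in auto)

lemma TR: "transv (Em m) K (TR c m)"
  unfolding TR_def by (rule someI_ex, rule ex_transv_Em) (use K_GO in blast)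

lemma TR_K: "r \<in> TR c m \<Longrightarrow> r \<in> K" using TR[of m] by (auto simp: transv_def)
lemma TR_card: "card (TR c m) > 0" using transv_card_pos[OF TR, of "mat 1"] by simp

lemma eav_left: assumes "k \<in> K" "w \<in> Fx (Kc m)" shows "rho k (eav c m w) = eav c m w"
proof -
  have "(\<Sum>r\<in>TR c m. rho (k ** r) w) = (\<Sum>r\<in>TR c m. rho r w)"
    by (rule transv_sum_reindex[OF equivp_Em TR, where b = "\<lambda>r. k ** r" and f = "\<lambda>r. rho r w"])
      (simp_all add: K_mm K_GO Em_mult_iff Em_rho assms)
  then show ?thesis by (simp add: eav_def rho_sc rho_sum rho_mult)
qed

lemma eav_right: assumes "k \<in> K" "w \<in> Fx (Kc m)" shows "eav c m (rho k w) = eav c m w"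
proof -
  have "(\<Sum>r\<in>TR c m. rho (r ** k) w) = (\<Sum>r\<in>TR c m. rho r w)"
    by (rule transv_sum_reindex[OF equivp_Em TR, where b = "\<lambda>r. r ** k" and f = "\<lambda>r. rho r w"])
      (simp_all add: K_mm K_GO Em_mult_iff Em_rho assms)
  then show ?thesis by (simp add: eav_def rho_sc rho_sum rho_mult)
qed

lemma eav_W: "w \<in> W \<Longrightarrow> eav c m w \<in> W"
  unfolding eav_def by (intro W_sc W_sum W_rho) (auto simp: TR_K K_inv)

lemma eav_fix: assumes "w \<in> Fx K" shows "eav c m w = w"
proof -
  have "(\<Sum>r\<in>TR c m. rho r w) = (\<Sum>r\<in>TR c m. w)"
    using assms TR_K by (intro sum.cong) (auto simp: Fx_rho)
  then show ?thesis using TR_card[of m] by (simp add: eav_def sum_const_sc del: sum_constant)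
qed

lemma eav_in: "w \<in> Fx (Kc m) \<Longrightarrow> eav c m w \<in> Fx K"
  using eav_W eav_left by (simp add: Fx_def)

lemma eav_sum: "eav c m (\<Sum>i\<in>A. f i) = (\<Sum>i\<in>A. eav c m (f i))"
  unfolding eav_def rho_sum sc_sum[symmetric] by (subst sum.swap) simp

lemma eav_sc: "eav c m (sc a w) = sc a (eav c m w)"
  by (simp add: eav_def rho_sc sc_sum[symmetric] mult.commute)

text \<open>The average at level \<open>m\<close> is already fixed by \<open>K\<close>, so averaging
  it again at level \<open>n\<close> changes nothing; on the other hand the outer average absorbs
  every translation in the inner one.\<close>

lemma eav_indep: assumes "w \<in> Fx (Kc m)" "m \<le> n" shows "eav c m w = eav c n w"
proof -
  have n: "w \<in> Fx (Kc n)" using assms Fx_Kc_mono by blast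
  have "eav c m w = eav c n (eav c m w)" using eav_fix[OF eav_in[OF assms(1)]] by simp
  also have "\<dots> = sc (1 / of_nat (card (TR c m))) (\<Sum>r\<in>TR c m. eav c n (rho r w))"
    by (simp add: eav_def[of c m] eav_sc eav_sum)
  also have "\<dots> = sc (1 / of_nat (card (TR c m))) (\<Sum>r\<in>TR c m. eav c n w)"
    using eav_right[OF TR_K n] by simp
  also have "\<dots> = eav c n w" using TR_card[of m] by (simp add: sum_const_sc del: sum_constant)
  finally show ?thesis .
qed

lemma eK_eq: assumes "w \<in> Fx (Kc m)" "m \<ge> 1" shows "eK c w = eav c m w"
proof -
  define n where "n = (SOME m. m \<ge> 1 \<and> w \<in> Fx (Kc m))"
  have n: "n \<ge> 1 \<and> w \<in> Fx (Kc n)" unfolding n_def by (rule someI[of _ m]) (use assms in blast)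
  have "eav c n w = eav c m w"
  proof (cases "m \<le> n")
    case True
    show ?thesis by (rule eav_indep[OF assms(1) True, symmetric])
  next
    case False
    then show ?thesis using n by (intro eav_indep) auto
  qed
  then show ?thesis by (simp add: eK_def n_def)
qed

lemma eK_in: assumes "w \<in> W" shows "eK c w \<in> Fx K"
proof -
  obtain m where "m \<ge> 1" "w \<in> Fx (Kc m)" using Fx_KcI[OF assms] by blast
  then show ?thesis using eK_eq eav_in by simp
qed

lemma eK_fix: assumes "w \<in> Fx K" shows "eK c w = w"
proof -
  obtain m where "m \<ge> 1" "w \<in> Fx (Kc m)" using Fx_KcI[OF Fx_W[OF assms]] by blast
  then show ?thesis using eK_eq eav_fix[OF assms] by simp
qed

lemma eK_sum: assumes "finite A" "\<And>i. i \<in> A \<Longrightarrow> f i \<in> W" shows "eK c (\<Sum>i\<in>A. f i) = (\<Sum>i\<in>A. eK c (f i))"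
proof -
  obtain m where m: "m \<ge> 1" "f ` A \<subseteq> Fx (Kc m)" using common_level[of "f ` A"] assms by blast
  then have "(\<Sum>i\<in>A. f i) \<in> Fx (Kc m)" by (intro Fx_sum) blast
  then have "eK c (\<Sum>i\<in>A. f i) = eav c m (\<Sum>i\<in>A. f i)" using m eK_eq by blast
  also have "\<dots> = (\<Sum>i\<in>A. eK c (f i))" unfolding eav_sum
    by (rule sum.cong) (use m eK_eq in auto)
  finally show ?thesis .
qed

lemma eK_sc: assumes "w \<in> W" shows "eK c (sc a w) = sc a (eK c w)"
proof -
  obtain m where "m \<ge> 1" "w \<in> Fx (Kc m)" using Fx_KcI[OF assms] by blast
  then show ?thesis using eK_eq[of w m] eK_eq[of "sc a w" m] by (simp add: Fx_sc eav_sc)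
qed

lemma eK_add: assumes "v \<in> W" "w \<in> W" shows "eK c (v + w) = eK c v + eK c w"
  using eK_sum[of "{True, False}" "\<lambda>b. if b then v else w"] assms by simp

lemma eK_diff: assumes "v \<in> W" "w \<in> W" shows "eK c (v - w) = eK c v - eK c w"
proof -
  have "eK c (- w) = - eK c w" using eK_sc[OF assms(2), of "-1"] by (simp add: sc_minus_1)
  then show ?thesis using eK_add[OF assms(1) W_minus[OF assms(2)]] by simp
qed

lemma eK_rho: assumes "w \<in> W" "k \<in> K" shows "eK c (rho k w) = eK c w"
proof -
  obtain m where m: "m \<ge> 1" "{w, rho k w} \<subseteq> Fx (Kc m)"
    using common_level[of "{w, rho k w}"] assms W_rho K_inv by auto
  then show ?thesis using eK_eq[of w m] eK_eq[of "rho k w" m] eav_right[OF assms(2)] by simp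
qed

end

lemma U_mult: "U x ** U y = U (x + y)" for x :: "'a::comm_ring_1" by (simp add: U_def add.commute)
lemma U_0 [simp]: "U 0 = (mat 1 :: 'a::comm_ring_1^2^2)" by (simp add: U_def mat_mat2)
lemma invertible_U [simp]: "invertible (U x)" for x :: "'a::field" by (simp add: U_def invertible_mat2)
lemma invertible_Lo [simp]: "invertible (Lo x)" for x :: "'a::field" by (simp add: Lo_def invertible_mat2)
lemma invertible_Dg [simp]: "invertible (Dg a d) \<longleftrightarrow> a \<noteq> 0 \<and> d \<noteq> 0" for a :: "'a::field"
  by (simp add: Dg_def invertible_mat2)
lemma U_Kc [simp]: "U x \<in> Kc m \<longleftrightarrow> x \<in> P m" by (simp add: U_def)
lemma Lo_Kc [simp]: "Lo x \<in> Kc m \<longleftrightarrow> x \<in> P m" by (simp add: Lo_def)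
lemma U_Kg [simp]: "U x \<in> Kg b c \<longleftrightarrow> x \<in> P b" by (simp add: U_def)
lemma Lo_Kg [simp]: "Lo x \<in> Kg b c \<longleftrightarrow> x \<in> P c" by (simp add: Lo_def)
lemma Dg_Kg [simp]: "Dg u v \<in> Kg b c \<longleftrightarrow> unit u \<and> unit v" by (simp add: Dg_def)
lemma Dg_GO [simp]: "unit u \<Longrightarrow> unit v \<Longrightarrow> Dg u v \<in> GO" by (simp add: Dg_def unit_in_P unit_mult)
lemma Dg_U: "q \<noteq> 0 \<Longrightarrow> Dg p q ** U x = U (p * x / q) ** Dg p q" for p :: "'a::field"
  by (simp add: Dg_def U_def)
lemma U_Dg: "p \<noteq> 0 \<Longrightarrow> U x ** Dg p q = Dg p q ** U (x * q / p)" for p :: "'a::field"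
  by (simp add: Dg_def U_def)
lemma Lo_Dg: "q \<noteq> 0 \<Longrightarrow> Lo y ** Dg p q = Dg p q ** Lo (y * p / q)" for p :: "'a::field"
  by (simp add: Dg_def Lo_def)
lemma Dg_Dg: "Dg a b ** Dg c d = Dg (a * c) (b * d)" for a :: "'a::comm_ring_1" by (simp add: Dg_def)
lemma mat_Dg: "mat a ** Dg b c = Dg (a * b) (a * c)" for a :: "'a::comm_ring_1" by (simp add: mat_mat2 Dg_def)

lemma Kc_Em: "h \<in> Kc m \<longleftrightarrow> Em m (mat 1) h"
proof -
  have s: "1 - y \<in> P m \<longleftrightarrow> y - 1 \<in> P m" for y :: 'a using P_minus_iff[of "1 - y" m] by simp
  show ?thesis by (auto simp: Kc_def Em_def Ea_def forall_2 mat_mat2 s)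
qed

lemma Kc_conj: assumes "k \<in> GO" "h \<in> Kc m" shows "k ** h ** inv2 k \<in> Kc m"
proof -
  have "Em m (k ** mat 1 ** inv2 k) (k ** h ** inv2 k)"
    using assms by (simp only: Kc_Em Em_mult_iff GO_inv2)
  then show ?thesis using assms by (simp add: Kc_Em inv2 GO_inv)
qed

lemma orbit_sum_fix:
  assumes "finite S" "\<And>x. x \<in> S \<Longrightarrow> rho g x \<in> S" "invertible g"
  shows "rho g (\<Sum>x\<in>S. x) = (\<Sum>x\<in>S. x)"
proof -
  have inj: "inj_on (rho g) S"
  proof (rule inj_onI)
    fix x y assume "rho g x = rho g y"
    then have "rho (inv2 g) (rho g x) = rho (inv2 g) (rho g y)" by simp
    then show "x = y" using assms(3) by (simp add: rho_mult inv2)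
  qed
  have "rho g ` S \<subseteq> S" using assms(2) by blast
  then have eq: "rho g ` S = S" using endo_inj_surj[OF assms(1)] inj by blast
  have "(\<Sum>x\<in>S. rho g x) = (\<Sum>x\<in>rho g ` S. x)" by (simp only: sum.reindex[OF inj] comp_def)
  then show ?thesis by (simp only: rho_sum eq)
qed

subsection \<open>Eigenvectors\<close>

text \<open>The polynomial \<open>p\<close> in the operator \<open>A\<close>, evaluated at
  \<open>w\<close>. Only the orbit of \<open>w\<close> enters, so \<open>A\<close> may be linear
  merely on a subspace.\<close>

definition papp :: "(('x \<Rightarrow> complex) \<Rightarrow> ('x \<Rightarrow> complex)) \<Rightarrow> complex poly \<Rightarrow> ('x \<Rightarrow> complex) \<Rightarrow> 'x \<Rightarrow> complex"
  where "papp A p w = (\<Sum>i\<le>degree p. sc (coeff p i) ((A ^^ i) w))"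

lemma papp_le: assumes "degree p \<le> n" shows "papp A p w = (\<Sum>i\<le>n. sc (coeff p i) ((A ^^ i) w))"
  unfolding papp_def
  by (rule sum.mono_neutral_left) (use assms in \<open>auto simp: coeff_eq_0\<close>)

lemma papp_closed:
  assumes "w \<in> S" "\<And>v. v \<in> S \<Longrightarrow> A v \<in> S" "\<And>u v. u \<in> S \<Longrightarrow> v \<in> S \<Longrightarrow> u + v \<in> S" "\<And>a v. v \<in> S \<Longrightarrow> sc a v \<in> S"
  shows "papp A p w \<in> S"
proof -
  have it: "(A ^^ i) w \<in> S" for i by (induction i) (use assms in auto)
  have "(\<Sum>i\<le>n. sc (coeff p i) ((A ^^ i) w)) \<in> S" for n
  proof (induction n)
    case 0
    then show ?case using assms(4)[OF it[of 0]] by simp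
  next
    case (Suc n)
    show ?case unfolding sum.atMost_Suc by (rule assms(3)[OF Suc assms(4)[OF it]])
  qed
  then show ?thesis by (simp add: papp_def)
qed

lemma papp_linear_factor:
  assumes A: "\<And>v w. v \<in> S \<Longrightarrow> w \<in> S \<Longrightarrow> A (v + w) = A v + A w" "\<And>a v. v \<in> S \<Longrightarrow> A (sc a v) = sc a (A v)"
    and S: "w \<in> S" "\<And>v. v \<in> S \<Longrightarrow> A v \<in> S" "\<And>u v. u \<in> S \<Longrightarrow> v \<in> S \<Longrightarrow> u + v \<in> S"
      "\<And>a v. v \<in> S \<Longrightarrow> sc a v \<in> S"
  shows "papp A ([:- z, 1:] * q) w = A (papp A q w) - sc z (papp A q w)"
proof -
  let ?n = "degree q"
  have it: "(A ^^ i) w \<in> S" for i by (induction i) (use S in auto)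
  have S0: "0 \<in> S" using S(4)[OF S(1), of 0] by simp
  have Ssum: "(\<Sum>i\<in>I. sc (f i) ((A ^^ i) w)) \<in> S" if "finite I" for I f
    using that by (induction I rule: finite_induct) (auto simp: S0 intro!: S(3,4) it)
  have A0: "A 0 = 0" using A(2)[OF S0, of 0] by simp
  have Asum: "A (\<Sum>i\<in>I. sc (f i) ((A ^^ i) w)) = (\<Sum>i\<in>I. sc (f i) ((A ^^ Suc i) w))" if "finite I" for I f
    using that
  proof (induction I rule: finite_induct)
    case (insert x F)
    have "A (sc (f x) ((A ^^ x) w) + (\<Sum>i\<in>F. sc (f i) ((A ^^ i) w))) =
        sc (f x) ((A ^^ Suc x) w) + (\<Sum>i\<in>F. sc (f i) ((A ^^ Suc i) w))"
      using A(1)[OF S(4)[OF it] Ssum[OF insert.hyps(1)]] A(2)[OF it] insert.IH by simp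
    then show ?case using insert.hyps by simp
  qed (simp add: A0)
  have e: "[:- z, 1:] * q = pCons 0 q - Polynomial.smult z q" by simp
  have "degree ([:- z, 1:] * q) \<le> Suc ?n" using degree_mult_le[of "[:- z, 1:]" q] by simp
  then have "papp A ([:- z, 1:] * q) w =
      (\<Sum>i\<le>Suc ?n. sc (coeff (pCons 0 q) i) ((A ^^ i) w)) - (\<Sum>i\<le>Suc ?n. sc (z * coeff q i) ((A ^^ i) w))"
    by (simp only: papp_le e coeff_diff coeff_smult sc_diff_left sum_subtractf)
  also have "(\<Sum>i\<le>Suc ?n. sc (coeff (pCons 0 q) i) ((A ^^ i) w)) = (\<Sum>i\<le>?n. sc (coeff q i) ((A ^^ Suc i) w))"
    by (subst sum.atMost_Suc_shift) simp
  also have "\<dots> = A (papp A q w)" unfolding papp_def by (rule Asum[symmetric]) simp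
  also have "(\<Sum>i\<le>Suc ?n. sc (z * coeff q i) ((A ^^ i) w)) = sc z (papp A q w)"
    using papp_le[of q "Suc ?n" A w] by (simp only: sc_sum sc_sc le_Suc_eq order_refl simp_thms)
  finally show ?thesis .
qed

text \<open>Linear factors are split off one at a time: either the cofactor still annihilates
  \<open>w\<close> and has smaller degree, or its value at \<open>w\<close> is an
  eigenvector.\<close>

lemma ex_eigenvector:
  assumes A: "\<And>v w. v \<in> S \<Longrightarrow> w \<in> S \<Longrightarrow> A (v + w) = A v + A w" "\<And>a v. v \<in> S \<Longrightarrow> A (sc a v) = sc a (A v)"
    and S: "w \<in> S" "\<And>v. v \<in> S \<Longrightarrow> A v \<in> S" "\<And>u v. u \<in> S \<Longrightarrow> v \<in> S \<Longrightarrow> u + v \<in> S"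
      "\<And>a v. v \<in> S \<Longrightarrow> sc a v \<in> S"
    and p: "w \<noteq> 0" "p \<noteq> 0" "papp A p w = 0"
  shows "\<exists>v\<in>S. v \<noteq> 0 \<and> (\<exists>z. A v = sc z v)"
  using p(2,3)
proof (induction "degree p" arbitrary: p)
  case 0
  then have "coeff p 0 \<noteq> 0" by (metis leading_coeff_0_iff)
  then show ?case using 0 p(1) by (simp add: papp_def sc_eq_0)
next
  case (Suc n)
  then have "\<not> constant (poly p)" by (simp add: Fundamental_Theorem_Algebra.constant_degree)
  then obtain z where "poly p z = 0" using Fundamental_Theorem_Algebra.fundamental_theorem_of_algebra by blast
  then obtain q where q: "p = [:- z, 1:] * q" using poly_eq_0_iff_dvd by (metis dvdE)
  show ?case
  proof (cases "papp A q w = 0")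
    case True
    have "q \<noteq> 0" using q Suc.prems by auto
    moreover have "n = degree q" using Suc.hyps(2) \<open>q \<noteq> 0\<close> unfolding q by (subst (asm) degree_mult_eq) auto
    ultimately show ?thesis using Suc.hyps(1) True by blast
  next
    case False
    have "papp A ([:- z, 1:] * q) w = A (papp A q w) - sc z (papp A q w)"
      by (rule papp_linear_factor[where S = S]) (fact A S)+
    then have "A (papp A q w) - sc z (papp A q w) = 0" using Suc.prems(2) q by simp
    moreover have "papp A q w \<in> S" by (rule papp_closed) (fact S)+
    ultimately show ?thesis using False by (intro bexI[of _ "papp A q w"]) auto
  qed
qed

section \<open>Averages over compact groups of unipotents\<close>

context cuspidal_model
begin

lemma J_W: "w \<in> J W N \<Longrightarrow> w \<in> W"
  by (induction rule: J.induct) (simp_all add: W_0 W_add W_diff W_rho)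

lemma J_map:
  assumes "w \<in> J W N" and F: "\<And>v w. F (v + w) = F v + F w" "F 0 = 0"
    and s: "\<And>x u. x \<in> W \<Longrightarrow> u \<in> P (- N) \<Longrightarrow> \<exists>x'\<in>W. \<exists>u'\<in>P (- N'). F (rho (U u) x - x) = rho (U u') x' - x'"
  shows "F w \<in> J W N'"
  using assms(1)
proof (induction rule: J.induct)
  case J_0
  then show ?case using J.J_0[of W N'] F by simp
next
  case (J_step w x u)
  obtain x' u' where x': "x' \<in> W" "u' \<in> P (- N')" "F (rho (U u) x - x) = rho (U u') x' - x'"
    using s[OF J_step(2,3)] by blast
  show ?case unfolding F(1) x'(3) by (rule J.J_step[OF J_step.IH x'(1,2)])
qed

lemma J_rho_U: assumes "w \<in> J W N" shows "rho (U v) w \<in> J W N"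
proof (rule J_map[OF assms])
  fix x and u :: 'f assume "x \<in> W" "u \<in> P (- N)"
  moreover have "rho (U v) (rho (U u) x - x) = rho (U u) (rho (U v) x) - rho (U v) x"
    by (simp add: rho_diff rho_mult U_mult add.commute)
  ultimately show "\<exists>x'\<in>W. \<exists>u'\<in>P (- N). rho (U v) (rho (U u) x - x) = rho (U u') x' - x'"
    using W_rho[OF invertible_U] by blast
qed (simp_all add: rho_add)

lemma J_sc: "w \<in> J W N \<Longrightarrow> sc a w \<in> J W N"
  by (rule J_sc_closed[OF _ W_sc])

text \<open>Conjugation by the diagonal matrix dilates the unipotent parameter by
  \<open>p / q\<close>. For \<open>p = unif\<close> and \<open>q = 1\<close> the index drops by one,
  which drives the descent in \<open>iwahori_fixed_zero\<close>.\<close>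

lemma J_rho_Dg: assumes "w \<in> J W N" "p \<noteq> 0" "q \<noteq> 0" shows "rho (Dg p q) w \<in> J W (N - (val p - val q))"
proof (rule J_map[OF assms(1)])
  fix x and u :: 'f assume h: "x \<in> W" "u \<in> P (- N)"
  have "p * u / q \<in> P (- (N - (val p - val q)))"
    using h(2) assms(2,3) by (cases "u = 0") (auto simp: P_iff val_mult val_divide)
  moreover have "rho (Dg p q) (rho (U u) x - x) = rho (U (p * u / q)) (rho (Dg p q) x) - rho (Dg p q) x"
    using assms(3) by (simp add: rho_diff rho_mult Dg_U)
  moreover have "rho (Dg p q) x \<in> W" using h(1) assms by (simp add: W_rho)
  ultimately show "\<exists>x'\<in>W. \<exists>u'\<in>P (- (N - (val p - val q))). rho (Dg p q) (rho (U u) x - x) = rho (U u') x' - x'"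
    by blast
qed (simp_all add: rho_add)

lemma Ea_rho: assumes "Ea n r s" "\<And>t. t \<in> P n \<Longrightarrow> rho (U t) x = x" shows "rho (U r) x = rho (U s) x"
proof -
  have "rho (U r) x = rho (U s) (rho (U (r - s)) x)" by (simp add: rho_mult U_mult)
  then show ?thesis using assms by (simp add: Ea_def)
qed

lemma Fx_Kc_U: "x \<in> Fx (Kc n) \<Longrightarrow> t \<in> P n \<Longrightarrow> rho (U t) x = x"
  by (rule Fx_rho[of x "Kc n"]) simp_all

text \<open>Each generator cancels because adding \<open>u\<close> permutes the classes of
  \<open>P (- N)\<close>. The precision \<open>n\<close> has to be fine enough that the translates
  of the vectors involved depend on the class alone.\<close>

lemma J_average:
  assumes "w \<in> J W N"
  shows "\<exists>m. \<forall>n\<ge>m. \<forall>R. transv (Ea n) (P (- N)) R \<longrightarrow> (\<Sum>r\<in>R. rho (U r) w) = 0"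
  using assms
proof (induction rule: J.induct)
  case J_0
  then show ?case by simp
next
  case (J_step w x u)
  obtain m where m: "\<And>n R. n \<ge> m \<Longrightarrow> transv (Ea n) (P (- N)) R \<Longrightarrow> (\<Sum>r\<in>R. rho (U r) w) = 0"
    using J_step.IH by blast
  obtain l where l: "x \<in> Fx (Kc l)" using Fx_KcI[OF J_step(2)] by blast
  have "(\<Sum>r\<in>R. rho (U r) (w + (rho (U u) x - x))) = 0"
    if n: "n \<ge> max m l" and R: "transv (Ea n) (P (- N)) R" for n R
  proof -
    have xn: "x \<in> Fx (Kc n)" using Fx_Kc_mono[OF l] n by simp
    have "(\<Sum>r\<in>R. rho (U (r + u)) x) = (\<Sum>r\<in>R. rho (U r) x)"
    proof (rule transv_sum_reindex[OF equivp_Ea R, where b = "\<lambda>r. r + u" and f = "\<lambda>r. rho (U r) x"])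
      fix h h' :: 'f assume "Ea n h h'"
      then show "rho (U h) x = rho (U h') x" by (rule Ea_rho) (rule Fx_Kc_U[OF xn])
    qed (use J_step(3) P_add in \<open>auto simp: Ea_def\<close>)
    then have "(\<Sum>r\<in>R. rho (U r) (rho (U u) x - x)) = 0"
      by (simp add: rho_diff rho_mult U_mult sum_subtractf)
    then show ?thesis using m[of n R] n R by (simp add: rho_add sum.distrib)
  qed
  then show ?case by blast
qed

lemma J_fixed_zero:
  assumes "w \<in> J W N" "\<And>t. t \<in> P (- N) \<Longrightarrow> rho (U t) w = w"
  shows "w = 0"
proof -
  obtain m where m: "\<And>R. transv (Ea m) (P (- N)) R \<Longrightarrow> (\<Sum>r\<in>R. rho (U r) w) = 0"
    using J_average[OF assms(1)] by blast
  obtain R :: "'f set" where R: "transv (Ea m) (P (- N)) R" using ex_transv_Ea[of "P (- N)" "- N" m] by blast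
  have "(\<Sum>r\<in>R. rho (U r) w) = (\<Sum>r\<in>R. w)"
    by (rule sum.cong) (use assms(2) R in \<open>auto simp: transv_def\<close>)
  then have "sc (of_nat (card R)) w = 0" using m[OF R] by (simp only: sum_const_sc)
  moreover have "card R > 0" by (rule transv_card_pos[OF R, of 0]) simp
  ultimately show ?thesis by (simp add: sc_eq_0)
qed

subsection \<open>There are no vectors fixed by the Iwahori subgroup\<close>

text \<open>The number of these representatives is the cardinality of the residue field.\<close>

definition RI :: "'f set" where "RI = (SOME R. transv (Ea 0) (P (- 1)) R)"

lemma RI: "transv (Ea 0) (P (- 1)) RI"
  unfolding RI_def by (rule someI_ex, rule ex_transv_Ea) (rule order_refl)

lemma RI_P: "r \<in> RI \<Longrightarrow> r \<in> P (- 1)" using RI by (auto simp: transv_def)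

text \<open>Followed by \<open>rho (Dg unif 1)\<close> this is the classical U-operator of Iwahori
  level: the sum of the translates by \<open>U s ** Dg unif 1\<close> with \<open>s\<close> running
  modulo the maximal ideal.\<close>

definition S1 :: "('f ^ 2 ^ 2 \<Rightarrow> complex) \<Rightarrow> 'f ^ 2 ^ 2 \<Rightarrow> complex"
  where "S1 v = (\<Sum>r\<in>RI. rho (U r) v)"

lemma I_Ea: assumes "v \<in> Fx (Kg 0 1)" "Ea 0 r s" shows "rho (U r) v = rho (U s) v"
  by (rule Ea_rho[OF assms(2)]) (rule Fx_rho[OF assms(1)], simp)

text \<open>The reflection \<open>?w\<close> permutes all terms of \<open>S1 v\<close> other than
  \<open>v\<close> itself. If the sum vanishes, comparison with its translate shows that
  \<open>?w\<close> fixes \<open>v\<close>. Then \<open>v\<close> is fixed by \<open>U r\<close> for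
  every \<open>r\<close> in \<open>RI\<close>, so that \<open>S1 v\<close> is a positive multiple of
  \<open>v\<close>.\<close>

lemma S1_zero: assumes v: "v \<in> Fx (Kg 0 1)" and z: "S1 v = 0" shows "v = 0"
proof -
  let ?H = "P (- 1) - P 0 :: 'f set"
  let ?w = "mat2 0 (1 / unif) unif 0 :: 'f^2^2"
  obtain r0 where r0: "r0 \<in> RI" "r0 \<in> P 0"
  proof -
    obtain r0 where "r0 \<in> RI" "Ea 0 0 r0" using RI unfolding transv_def by (metis P_0)
    then show ?thesis using that[of r0] by (simp add: Ea_def)
  qed
  have fin: "finite RI" using RI by (simp add: transv_def)
  have R': "transv (Ea 0) ?H (RI - {r0})"
    unfolding transv_def
  proof (intro conjI ballI impI)
    show "finite (RI - {r0})" using fin by simp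
    show "RI - {r0} \<subseteq> ?H"
    proof
      fix r assume r: "r \<in> RI - {r0}"
      have "r \<notin> P 0"
      proof
        assume "r \<in> P 0"
        then have "Ea 0 r r0" using r0 P_diff by (simp add: Ea_def)
        then show False using RI r r0 by (auto simp: transv_def)
      qed
      then show "r \<in> ?H" using r RI_P by blast
    qed
    show "\<exists>r\<in>RI - {r0}. Ea 0 h r" if h: "h \<in> ?H" for h
    proof -
      obtain r where r: "r \<in> RI" "Ea 0 h r" using RI h by (auto simp: transv_def)
      have "r \<noteq> r0"
      proof
        assume "r = r0"
        then have "(h - r) + r \<in> P 0" using r r0 by (intro P_add) (auto simp: Ea_def)
        then show False using h by simp
      qed
      then show ?thesis using r by blast
    qed
    show "r = r'" if "r \<in> RI - {r0}" "r' \<in> RI - {r0}" "Ea 0 r r'" for r r'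
      using that RI by (auto simp: transv_def)
  qed
  have split: "S1 v = v + (\<Sum>r\<in>RI - {r0}. rho (U r) v)"
    using sum.remove[OF fin r0(1), of "\<lambda>r. rho (U r) v"] Fx_rho[OF v, of "U r0"] r0(2) by (simp add: S1_def)
  have sH: "r \<noteq> 0 \<and> val r = - 1" if "r \<in> ?H" for r using that by (auto simp: P_iff)
  have move: "rho ?w (rho (U r) v) = rho (U (1 / (unif * unif * r))) v" if r: "r \<in> ?H" for r
  proof -
    let ?M = "mat2 (- (1 / (unif * r))) 0 unif (unif * r)"
    have u: "unit (unif * r)" using sH[OF r] by (simp add: unit_val val_mult)
    have "?M \<in> Kg 0 1" using u unit_inverse[OF u] by (simp add: P_iff divide_inverse)
    moreover have "?w ** U r = U (1 / (unif * unif * r)) ** ?M"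
      using sH[OF r] by (simp add: U_def)
    ultimately show ?thesis using Fx_rho[OF v, of ?M] by (simp add: rho_mult) (simp add: rho_mult[symmetric])
  qed
  have "(\<Sum>r\<in>RI - {r0}. rho (U (1 / (unif * unif * r))) v) = (\<Sum>r\<in>RI - {r0}. rho (U r) v)"
  proof (rule transv_sum_reindex[OF equivp_Ea R', where b = "\<lambda>r. 1 / (unif * unif * r)" and f = "\<lambda>r. rho (U r) v"])
    show "1 / (unif * unif * h) \<in> ?H" if "h \<in> ?H" for h
      using sH[OF that] by (simp add: P_iff val_divide val_mult)
    show "Ea 0 h h'" if h: "h \<in> ?H" "h' \<in> ?H" "Ea 0 (1 / (unif * unif * h)) (1 / (unif * unif * h'))" for h h'
    proof -
      have "h - h' = - ((unif * unif * h * h') * (1 / (unif * unif * h) - 1 / (unif * unif * h')))"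
        using sH h by (simp add: field_simps)
      moreover have "(unif * unif * h * h') * (1 / (unif * unif * h) - 1 / (unif * unif * h')) \<in> P 0"
      proof (rule P_mult_le)
        show "unif * unif * h * h' \<in> P 0" using sH[OF h(1)] sH[OF h(2)] by (simp add: P_iff val_mult)
        show "1 / (unif * unif * h) - 1 / (unif * unif * h') \<in> P 0" using h(3) by (simp only: Ea_def)
      qed simp
      ultimately show ?thesis by (simp add: Ea_def)
    qed
  qed (rule I_Ea[OF v])
  then have "rho ?w (S1 v) = rho ?w v + (\<Sum>r\<in>RI - {r0}. rho (U r) v)"
    unfolding split rho_add rho_sum using R' move by (simp add: transv_def subset_iff)
  then have wv: "rho ?w v = v" using z split by (simp add: add_eq_0_iff)
  have "rho (U r) v = v" if "r \<in> RI" for r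
  proof -
    have "U r ** ?w = ?w ** Lo (unif * unif * r)" by (simp add: U_def Lo_def)
    moreover have "unif * unif * r \<in> P 1"
    proof (rule P_mult_le[OF _ RI_P[OF that]])
      show "unif * unif \<in> P 2" by (simp add: P_iff val_mult)
    qed simp
    ultimately have "rho (U r) (rho ?w v) = rho ?w v"
      using Fx_rho[OF v, of "Lo (unif * unif * r)"] by (simp add: rho_mult) (simp add: rho_mult[symmetric])
    then show ?thesis by (simp add: wv)
  qed
  then have "S1 v = sc (of_nat (card RI)) v" by (simp add: S1_def sum_const_sc del: sum_constant)
  then show ?thesis using z transv_card_pos[OF RI, of 0] by (simp add: sc_eq_0)
qed

lemma S1_rho_U: assumes v: "v \<in> Fx (Kg 0 1)" and t: "t \<in> P (- 1)" shows "rho (U t) (S1 v) = S1 v"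
proof -
  have "(\<Sum>r\<in>RI. rho (U (t + r)) v) = (\<Sum>r\<in>RI. rho (U r) v)"
    by (rule transv_sum_reindex[OF equivp_Ea RI, where b = "\<lambda>r. t + r" and f = "\<lambda>r. rho (U r) v"])
      (use t P_add I_Ea[OF v] in \<open>auto simp: Ea_def\<close>)
  then show ?thesis by (simp add: S1_def rho_sum rho_mult U_mult)
qed

lemma S1_rho_Dg: assumes v: "v \<in> Fx (Kg 0 1)" and u: "unit a" "unit d" shows "rho (Dg a d) (S1 v) = S1 v"
proof -
  have ad: "unit (a / d)" using u by (rule unit_divide)
  have e: "rho (Dg a d) (rho (U r) v) = rho (U (a / d * r)) v" for r
    using Fx_rho[OF v, of "Dg a d"] u unit_nz[OF u(2)]
    by (simp add: rho_mult Dg_U) (simp add: rho_mult[symmetric])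
  have "(\<Sum>r\<in>RI. rho (U (a / d * r)) v) = (\<Sum>r\<in>RI. rho (U r) v)"
  proof (rule transv_sum_reindex[OF equivp_Ea RI, where b = "\<lambda>r. a / d * r" and f = "\<lambda>r. rho (U r) v"])
    show "a / d * h \<in> P (- 1)" if "h \<in> P (- 1)" for h using that by (simp only: unit_mult_P[OF ad])
    show "Ea 0 h h'" if "Ea 0 (a / d * h) (a / d * h')" for h h'
      using that unfolding Ea_def right_diff_distrib[symmetric] unit_mult_P[OF ad] .
  qed (rule I_Ea[OF v])
  then show ?thesis by (simp add: S1_def rho_sum e)
qed

lemma S1_rho_Lo: assumes v: "v \<in> Fx (Kg 0 1)" and y: "y \<in> P 2" shows "rho (Lo y) (S1 v) = S1 v"
proof -
  have "rho (Lo y) (rho (U r) v) = rho (U r) v" if r: "r \<in> RI" for r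
  proof -
    have yr: "y * r \<in> P 1" using P_mult[OF y RI_P[OF r]] by simp
    have u: "unit (1 + y * r)" using unit_1_plus(1)[OF yr] .
    let ?r = "r / (1 + y * r)"
    let ?M = "mat2 (1 - y * ?r) 0 y (1 + y * r)"
    have "y * ?r = y * r / (1 + y * r)" by simp
    then have "y * ?r \<in> P 1" by (simp only: unit_divide_P[OF u] yr)
    then have "?M \<in> Kg 0 1" using u y unit_1_plus(2) by (auto intro: P_mono)
    moreover have "Lo y ** U r = U ?r ** ?M" using unit_nz[OF u] by (simp add: Lo_def U_def field_simps)
    moreover have "Ea 0 ?r r"
    proof -
      have "?r - r = - ((y * r) * r / (1 + y * r))" using unit_nz[OF u] by (simp add: field_simps)
      moreover have "(y * r) * r \<in> P 0" using yr RI_P[OF r] by (rule P_mult_le) simp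
      ultimately show ?thesis by (simp add: Ea_def unit_divide_P[OF u])
    qed
    ultimately show ?thesis
      using Fx_rho[OF v, of ?M] I_Ea[OF v] by (simp add: rho_mult) (simp add: rho_mult[symmetric])
  qed
  then show ?thesis by (simp add: S1_def rho_sum)
qed

text \<open>\<open>S1 v\<close> is fixed by \<open>U\<close> on \<open>P (- 1)\<close>, by diagonal
  units and by \<open>Lo\<close> on \<open>P 2\<close>; conjugation by \<open>Dg unif 1\<close>
  turns these into the three factors of the Iwahori subgroup.\<close>

lemma S1_shift: assumes v: "v \<in> Fx (Kg 0 1)" shows "rho (Dg unif 1) (S1 v) \<in> Fx (Kg 0 1)"
proof -
  have S1W: "S1 v \<in> W" unfolding S1_def using v Fx_W by (intro W_sum W_rho) auto
  have "rho k (rho (Dg unif 1) (S1 v)) = rho (Dg unif 1) (S1 v)" if k: "k \<in> Kg 0 1" for k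
  proof -
    obtain x a d y where kd: "k = Lo y ** Dg a d ** U x" "unit a" "unit d" "x \<in> P 0" "y \<in> P 1"
      by (rule Kg_decomp[OF k]) (auto intro: that)
    have "x / unif \<in> P (- 1)" using kd(4) by (cases "x = 0") (auto simp: P_iff val_divide)
    then have 1: "rho (U x) (rho (Dg unif 1) (S1 v)) = rho (Dg unif 1) (S1 v)"
      using S1_rho_U[OF v, of "x / unif"] by (simp add: rho_mult U_Dg) (simp add: rho_mult[symmetric])
    have 2: "rho (Dg a d) (rho (Dg unif 1) (S1 v)) = rho (Dg unif 1) (S1 v)"
    proof -
      have "rho (Dg a d) (rho (Dg unif 1) (S1 v)) = rho (Dg unif 1) (rho (Dg a d) (S1 v))"
        by (simp add: rho_mult Dg_Dg mult.commute)
      then show ?thesis using S1_rho_Dg[OF v kd(2,3)] by simp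
    qed
    have "y * unif \<in> P 2" using kd(5) by (cases "y = 0") (auto simp: P_iff val_mult)
    then have 3: "rho (Lo y) (rho (Dg unif 1) (S1 v)) = rho (Dg unif 1) (S1 v)"
      using S1_rho_Lo[OF v, of "y * unif"] by (simp add: rho_mult Lo_Dg) (simp add: rho_mult[symmetric])
    show ?thesis unfolding kd(1) rho_mult[symmetric] 1 2 3 ..
  qed
  then show ?thesis using S1W by (simp add: Fx_def W_rho)
qed

text \<open>Descent on the index of \<open>J\<close>: the shifted operator \<open>S1\<close>
  preserves Iwahori-fixed vectors, lowers the index by one and is injective. At index 0 the vector
  is fixed by the very group over which its average vanishes.\<close>

lemma iwahori_fixed_zero: assumes "v \<in> Fx (Kg 0 1)" shows "v = 0"
proof -
  have main: "v \<in> Fx (Kg 0 1) \<Longrightarrow> v \<in> J W (int n) \<Longrightarrow> v = 0" for n v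
  proof (induction n arbitrary: v)
    case 0
    show ?case
    proof (rule J_fixed_zero)
      show "v \<in> J W 0" using 0 by simp
      show "rho (U t) v = v" if "t \<in> P (- 0)" for t using Fx_rho[OF 0(1), of "U t"] that by simp
    qed
  next
    case (Suc n)
    have "S1 v \<in> J W (int (Suc n))"
    proof -
      have "finite A \<Longrightarrow> (\<Sum>r\<in>A. rho (U r) v) \<in> J W (int (Suc n))" for A
      proof (induction A rule: finite_induct)
        case (insert x F)
        then show ?case using J_add[OF insert.IH J_rho_U[OF Suc.prems(2)]] by simp
      qed (simp add: J.J_0)
      then show ?thesis using RI by (simp add: S1_def transv_def)
    qed
    from J_rho_Dg[OF this, of unif 1] have "rho (Dg unif 1) (S1 v) \<in> J W (int n)" by simp
    then have "rho (Dg unif 1) (S1 v) = 0" using Suc.IH S1_shift[OF Suc.prems(1)] by blast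
    then have "rho (inv2 (Dg unif 1)) (rho (Dg unif 1) (S1 v)) = 0" by simp
    then have "S1 v = 0" by (simp add: rho_inv2)
    then show ?case using S1_zero Suc.prems(1) by blast
  qed
  obtain N where "v \<in> J W N" using cusp[OF Fx_W[OF assms]] by blast
  then have "v \<in> J W (int (nat N))" by (rule J_mono) simp
  then show ?thesis by (rule main[OF assms])
qed

end

context cuspidal_model
begin

subsection \<open>Existence of vectors fixed by a Hecke subgroup\<close>

text \<open>Pigeonhole in the finite quotient of \<open>P a\<close> by \<open>P m\<close>. It gives
  \<open>rho (U r)\<close> a finite order on vectors fixed by \<open>U\<close> on
  \<open>P m\<close>, hence an annihilating polynomial \<open>monom 1 k - 1\<close>, in any
  characteristic.\<close>

lemma finite_order_mod:
  fixes r :: 'f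
  assumes "r \<in> P a"
  shows "\<exists>k>0. of_nat k * r \<in> P m"
proof -
  obtain R :: "'f set" where R: "transv (Ea m) (P a) R" using ex_transv_Ea[of "P a" a m] by blast
  have nP: "of_nat i * r \<in> P a" for i
  proof (induction i)
    case (Suc i)
    then show ?case using P_add[OF Suc assms] by (simp add: algebra_simps)
  qed simp
  define F where "F i = (SOME s. s \<in> R \<and> Ea m (of_nat i * r) s)" for i :: nat
  have F: "F i \<in> R \<and> Ea m (of_nat i * r) (F i)" for i
    unfolding F_def by (rule someI_ex) (use R nP[of i] in \<open>auto simp: transv_def\<close>)
  have "\<not> inj F"
  proof
    assume "inj F"
    then have "finite (UNIV :: nat set)"
      using R F by (intro inj_on_finite[of F UNIV R]) (auto simp: transv_def)
    then show False by simp
  qed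
  then obtain i j where ij: "F i = F j" "i < j" unfolding inj_def by (metis linorder_neqE_nat)
  have "Ea m (of_nat j * r) (of_nat i * r)"
  proof (rule equivp_transp[OF equivp_Ea])
    show "Ea m (of_nat j * r) (F j)" using F[of j] by simp
    show "Ea m (F j) (of_nat i * r)" using equivp_symp[OF equivp_Ea, of m "of_nat i * r" "F j"] F[of i] ij(1) by simp
  qed
  then have "of_nat (j - i) * r \<in> P m" using ij(2) by (simp add: Ea_def of_nat_diff algebra_simps)
  then show ?thesis using ij(2) by (intro exI[of _ "j - i"]) simp
qed

inductive_set OS :: "int \<Rightarrow> ('f ^ 2 ^ 2 \<Rightarrow> complex) \<Rightarrow> ('f ^ 2 ^ 2 \<Rightarrow> complex) set" for a v
  where
    OS_0: "0 \<in> OS a v"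
  | OS_step: "w \<in> OS a v \<Longrightarrow> u \<in> P a \<Longrightarrow> w + sc z (rho (U u) v) \<in> OS a v"

lemma OS_add: "w \<in> OS a v \<Longrightarrow> x \<in> OS a v \<Longrightarrow> x + w \<in> OS a v"
proof (induction rule: OS.induct)
  case (OS_step w u z)
  show ?case unfolding add.assoc[symmetric] by (rule OS.OS_step[OF OS_step.IH[OF OS_step.prems] OS_step.hyps(2)])
qed simp

lemma OS_sc: "w \<in> OS a v \<Longrightarrow> sc y w \<in> OS a v"
proof (induction rule: OS.induct)
  case (OS_step w u z)
  show ?case unfolding sc_add sc_sc by (rule OS.OS_step[OF OS_step.IH OS_step.hyps(2)])
qed (simp add: OS.OS_0)

lemma OS_rho: "w \<in> OS a v \<Longrightarrow> t \<in> P a \<Longrightarrow> rho (U t) w \<in> OS a v"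
proof (induction rule: OS.induct)
  case (OS_step w u z)
  show ?case unfolding rho_add rho_sc rho_mult U_mult
    by (rule OS.OS_step[OF OS_step.IH[OF OS_step.prems] P_add[OF OS_step.prems OS_step.hyps(2)]])
qed (simp add: OS.OS_0)

lemma OS_base: "v \<in> OS a v"
  using OS.OS_step[where u = 0 and z = 1, OF OS.OS_0, of a v] by simp

lemma OS_inv: assumes "w \<in> OS a v" and F: "0 \<in> F" "\<And>x y. x \<in> F \<Longrightarrow> y \<in> F \<Longrightarrow> x + y \<in> F" "\<And>z x. x \<in> F \<Longrightarrow> sc z x \<in> F"
    "\<And>u. u \<in> P a \<Longrightarrow> rho (U u) v \<in> F"
  shows "w \<in> F"
  using assms(1)
proof (induction rule: OS.induct)
  case OS_0
  show ?case by (rule F(1))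
next
  case (OS_step w u z)
  show ?case by (rule F(2)[OF OS_step.IH F(3)[OF F(4)[OF OS_step.hyps(2)]]])
qed

lemma papp_monom_diff: "papp A (monom 1 k - 1) w = (A ^^ k) w - w" if "k > 0"
proof -
  have "papp A (monom 1 k - 1) w = (\<Sum>i\<le>k. sc (coeff (monom 1 k) i - coeff 1 i) ((A ^^ i) w))"
    by (subst papp_le[of _ k]) (auto intro!: degree_diff_le simp: degree_monom_le)
  also have "\<dots> = (\<Sum>i\<le>k. (if i = k then (A ^^ i) w else 0)) - (\<Sum>i\<le>k. (if i = 0 then (A ^^ i) w else 0))"
    unfolding sum_subtractf[symmetric] using that by (intro sum.cong) (auto simp: sc_diff_left)
  also have "\<dots> = (A ^^ k) w - w" by (simp add: sum.delta)
  finally show ?thesis .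
qed

text \<open>The operators of the representatives commute and have finite order, so they are
  diagonalized one after the other; every step stays inside the joint eigenspace of the earlier
  ones.\<close>

lemma ex_character_vector:
  assumes v: "v \<in> Fx (Kc m)" "v \<noteq> 0"
  obtains x \<psi> where "x \<in> OS a v" "x \<noteq> 0" "\<And>u. u \<in> P a \<Longrightarrow> rho (U u) x = sc (\<psi> u) x"
proof -
  obtain R :: "'f set" where R: "transv (Ea m) (P a) R" using ex_transv_Ea[of "P a" a m] by blast
  have RP: "R \<subseteq> P a" "finite R" using R by (auto simp: transv_def)
  have fixU: "rho (U t) x = x" if "x \<in> OS a v" "t \<in> P m" for x t
  proof -
    have "x \<in> {x. rho (U t) x = x}"
      using that(1)
    proof (rule OS_inv)
      fix u :: 'f assume "u \<in> P a"
      show "rho (U u) v \<in> {x. rho (U t) x = x}"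
        using Fx_Kc_U[OF v(1) that(2)] rho_mult[of "U t" "U u" v] rho_mult[of "U u" "U t" v]
        by (simp add: U_mult add.commute)
    qed (simp_all add: rho_add rho_sc)
    then show ?thesis by simp
  qed
  have joint: "\<exists>x\<in>OS a v. x \<noteq> 0 \<and> (\<forall>r\<in>R'. \<exists>z. rho (U r) x = sc z x)" if "finite R'" "R' \<subseteq> R" for R'
    using that
  proof (induction R' rule: finite_induct)
    case empty
    show ?case using OS_base v(2) by blast
  next
    case (insert r R')
    have "R' \<subseteq> R" using insert.prems by simp
    from insert.IH[OF this]
    obtain x where x: "x \<in> OS a v" "x \<noteq> 0" "\<forall>r\<in>R'. \<exists>z. rho (U r) x = sc z x" by auto
    obtain l where l: "\<forall>s\<in>R'. rho (U s) x = sc (l s) x" using bchoice[OF x(3)] by auto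
    have rP: "r \<in> P a" using insert.prems RP by blast
    obtain k where k: "k > 0" "of_nat k * r \<in> P m" using finite_order_mod[OF rP] by blast
    have it: "(rho (U r) ^^ i) x = rho (U (of_nat i * r)) x" for i
      by (induction i) (simp_all add: rho_mult U_mult algebra_simps)
    let ?S = "{y \<in> OS a v. \<forall>s\<in>R'. rho (U s) y = sc (l s) y}"
    have "\<exists>y\<in>?S. y \<noteq> 0 \<and> (\<exists>z. rho (U r) y = sc z y)"
    proof (rule ex_eigenvector[where p = "monom 1 k - 1" and w = x])
      show "papp (rho (U r)) (monom 1 k - 1) x = 0"
        using k(1) fixU[OF x(1) k(2)] by (simp add: papp_monom_diff it)
      show "monom 1 k - 1 \<noteq> (0 :: complex poly)"
      proof
        assume "monom 1 k - 1 = (0 :: complex poly)"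
        then have "coeff (monom 1 k - 1 :: complex poly) k = 0" by simp
        then show False using k(1) by simp
      qed
      show "rho (U r) y \<in> ?S" if "y \<in> ?S" for y
      proof -
        have "rho (U s) (rho (U r) y) = rho (U r) (rho (U s) y)" for s
          by (simp add: rho_mult U_mult add.commute)
        then show ?thesis using that OS_rho[OF _ rP] by (simp add: rho_sc)
      qed
    qed (use x l OS.OS_0 in \<open>auto simp: rho_add rho_sc sc_add OS_add OS_sc mult.commute\<close>)
    then show ?case by auto
  qed
  obtain x where x: "x \<in> OS a v" "x \<noteq> 0" "\<forall>r\<in>R. \<exists>z. rho (U r) x = sc z x"
    using joint[OF RP(2) order_refl] by blast
  have "\<exists>z. rho (U u) x = sc z x" if u: "u \<in> P a" for u
  proof -
    obtain r where r: "r \<in> R" "Ea m u r" using R u by (auto simp: transv_def)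
    have "rho (U u) x = rho (U r) x" by (rule Ea_rho[OF r(2)]) (rule fixU[OF x(1)])
    then show ?thesis using x(3) r(1) by simp
  qed
  then have "\<forall>u\<in>P a. \<exists>z. rho (U u) x = sc z x" by simp
  from bchoice[OF this] obtain \<psi> where psi: "\<forall>u\<in>P a. rho (U u) x = sc (\<psi> u) x" by auto
  show ?thesis by (rule that[OF x(1,2)]) (use psi in simp)
qed

lemma sc_cancel: "sc a x = sc b x \<Longrightarrow> x \<noteq> 0 \<Longrightarrow> a = b"
proof -
  assume h: "sc a x = sc b x" "x \<noteq> 0"
  then have "sc (a - b) x = 0" by (simp add: sc_diff_left)
  then show "a = b" using h(2) by (simp add: sc_eq_0)
qed

text \<open>A vector on which a large compact group of unipotents acts by a character is a projection of
  a fixed vector; the translates of it under the unit torus belong to distinct characters, so that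
  their sum does not vanish.\<close>

lemma ex_torus_fixed: "\<exists>z\<in>W. z \<noteq> 0 \<and> (\<forall>a d. unit a \<longrightarrow> unit d \<longrightarrow> rho (Dg a d) z = z)"
proof -
  obtain v where v: "v \<in> W" "v \<noteq> 0" using W_nonzero W_0 by blast
  obtain m where m: "m \<ge> 1" "v \<in> Fx (Kc m)" using Fx_KcI[OF v(1)] by blast
  obtain N0 where N0: "v \<in> J W N0" using cusp[OF v(1)] by blast
  \<comment> \<open>The part \<open>N0\<close> makes the character nontrivial on \<open>P a\<close>;
    the part \<open>m\<close> leaves room to divide by \<open>inverse t - 1\<close> of valuation
    less than \<open>m\<close>, so that the character detects every unit dilation outside
    \<open>1 + P m\<close>.\<close>
  define N where "N = max N0 0 + m"
  define a where "a = - N"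
  have am: "a \<le> m" "a \<le> 0" using m by (simp_all add: a_def N_def)
  obtain x \<psi> where x: "x \<in> OS a v" "x \<noteq> 0" and psi: "\<And>u. u \<in> P a \<Longrightarrow> rho (U u) x = sc (\<psi> u) x"
    using ex_character_vector[OF m(2) v(2)] by blast
  obtain R :: "'f set" where R: "transv (Ea m) (P a) R" using ex_transv_Ea[of "P a" a m] by blast
  have RP: "R \<subseteq> P a" "finite R" using R by (auto simp: transv_def)
  have xW: "x \<in> W" by (rule OS_inv[OF x(1)]) (use W_0 W_add W_sc W_rho v in auto)
  have xJ: "x \<in> J W N0" by (rule OS_inv[OF x(1)]) (use J.J_0 J_add J_sc J_rho_U N0 in auto)
  have vU: "rho (U t) v = v" if "t \<in> P m" for t by (rule Fx_Kc_U[OF m(2) that])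
  have psi_add: "\<psi> (s + t) = \<psi> s * \<psi> t" if "s \<in> P a" "t \<in> P a" for s t
  proof -
    have "sc (\<psi> (s + t)) x = sc (\<psi> t * \<psi> s) x"
      using psi[OF P_add[OF that]] psi[OF that(1)] psi[OF that(2)] rho_mult[of "U s" "U t" x]
      by (simp add: rho_sc U_mult)
    then show ?thesis using sc_cancel x(2) by (simp add: mult.commute)
  qed
  have psi_0: "\<psi> 0 = 1" using psi[of 0] sc_cancel[of 1 x "\<psi> 0"] x(2) by simp
  have psi_nz: "\<psi> s \<noteq> 0" if "s \<in> P a" for s
    using psi_add[OF that P_minus[OF that]] psi_0 by auto
  have psi_m: "\<psi> t = 1" if "t \<in> P m" for t
  proof -
    have "x \<in> {x. rho (U t) x = x}"
      using x(1)
    proof (rule OS_inv)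
      fix u :: 'f assume "u \<in> P a"
      show "rho (U u) v \<in> {x. rho (U t) x = x}"
        using vU[OF that] rho_mult[of "U t" "U u" v] rho_mult[of "U u" "U t" v]
        by (simp add: U_mult add.commute)
    qed (simp_all add: rho_add rho_sc)
    then have "sc (\<psi> t) x = sc 1 x" using psi[of t] P_mono[OF that am(1)] by simp
    then show ?thesis using sc_cancel x(2) by blast
  qed
  have psi_Ea: "\<psi> s = \<psi> t" if "s \<in> P a" "t \<in> P a" "Ea m s t" for s t
    using psi_add[of "s - t" t] psi_m[of "s - t"] that P_diff[OF that(1,2)] by (simp add: Ea_def)
  \<comment> \<open>Up to the factor \<open>card R\<close> the projector onto the vectors on which
    the unipotents act by \<open>\<psi>\<close>.\<close>
  define Q where "Q y = (\<Sum>r\<in>R. sc (1 / \<psi> r) (rho (U r) y))" for y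
  have Q_sc: "Q (sc z y) = sc z (Q y)" for z y
    by (simp add: Q_def rho_sc sc_sum mult.commute)
  have Q_add: "Q (y + y') = Q y + Q y'" for y y'
    by (simp add: Q_def rho_add sc_add sum.distrib)
  have Q_0: "Q 0 = 0" by (simp add: Q_def)
  have Q_rho: "Q (rho (U u) y) = rho (U u) (Q y)" for u y
    by (simp add: Q_def rho_sum rho_sc rho_mult U_mult add.commute)
  have Q_eig: "rho (U u) (Q y) = sc (\<psi> u) (Q y)"
    if u: "u \<in> P a" and y: "\<And>t. t \<in> P m \<Longrightarrow> rho (U t) y = y" for u y
  proof -
    have 1: "(\<Sum>r\<in>R. sc (1 / \<psi> (u + r)) (rho (U (u + r)) y)) = (\<Sum>r\<in>R. sc (1 / \<psi> r) (rho (U r) y))"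
    proof (rule transv_sum_reindex[OF equivp_Ea R, where b = "\<lambda>r. u + r" and f = "\<lambda>r. sc (1 / \<psi> r) (rho (U r) y)"])
      show "sc (1 / \<psi> h) (rho (U h) y) = sc (1 / \<psi> h') (rho (U h') y)"
        if "h \<in> P a" "h' \<in> P a" "Ea m h h'" for h h'
        using psi_Ea[OF that] Ea_rho[OF that(3) y] by simp
    qed (use u P_add in \<open>auto simp: Ea_def\<close>)
    have "rho (U u) (Q y) = (\<Sum>r\<in>R. sc (1 / \<psi> r) (rho (U (u + r)) y))"
      by (simp add: Q_def rho_sum rho_sc rho_mult U_mult)
    also have "\<dots> = (\<Sum>r\<in>R. sc (\<psi> u) (sc (1 / \<psi> (u + r)) (rho (U (u + r)) y)))"
      using psi_add[OF u] psi_nz[OF u] RP by (intro sum.cong) auto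
    also have "\<dots> = sc (\<psi> u) (Q y)" by (simp only: sc_sum[symmetric] 1 Q_def)
    finally show ?thesis .
  qed
  have Qx: "Q x = sc (of_nat (card R)) x"
  proof -
    have "Q x = (\<Sum>r\<in>R. x)" unfolding Q_def using psi psi_nz RP by (intro sum.cong) auto
    then show ?thesis by (simp only: sum_const_sc)
  qed
  have cR: "card R > 0" by (rule transv_card_pos[OF R, of 0]) simp
  \<comment> \<open>\<open>Q\<close> sends every \<open>rho (U u) v\<close> to a multiple of
    \<open>Q v\<close>, and \<open>x\<close> is a multiple of \<open>Q x\<close>; invariance of
    \<open>x\<close> can thus be read off from \<open>v\<close>.\<close>
  obtain \<kappa> where kappa: "x = sc \<kappa> (Q v)"
  proof -
    have "x \<in> {y. \<exists>k. Q y = sc k (Q v)}"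
      using x(1)
    proof (rule OS_inv)
      show "0 \<in> {y. \<exists>k. Q y = sc k (Q v)}" using Q_0 by (auto intro: exI[of _ 0])
      show "y + y' \<in> {y. \<exists>k. Q y = sc k (Q v)}" if "y \<in> {y. \<exists>k. Q y = sc k (Q v)}" "y' \<in> {y. \<exists>k. Q y = sc k (Q v)}" for y y'
        using that by (auto simp: Q_add sc_add_left[symmetric])
      show "sc z y \<in> {y. \<exists>k. Q y = sc k (Q v)}" if "y \<in> {y. \<exists>k. Q y = sc k (Q v)}" for y z
        using that by (auto simp: Q_sc)
      show "rho (U u) v \<in> {y. \<exists>k. Q y = sc k (Q v)}" if "u \<in> P a" for u
        using Q_eig[OF that vU] by (auto simp: Q_rho)
    qed
    then obtain k where "Q x = sc k (Q v)" by blast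
    then have "sc (1 / of_nat (card R)) (sc (of_nat (card R)) x) = sc (1 / of_nat (card R)) (sc k (Q v))"
      by (simp only: Qx)
    then have "x = sc (1 / of_nat (card R) * k) (Q v)" using cR by simp
    then show ?thesis using that by blast
  qed
  \<comment> \<open>A unit dilation that preserves the character lies in \<open>1 + P m\<close>; it
    therefore fixes \<open>v\<close>, and with it \<open>x\<close>.\<close>
  have stab: "rho (Dg t 1) x = x" if t: "unit t" and inv: "\<And>u. u \<in> P a \<Longrightarrow> \<psi> (u / t) = \<psi> u" for t
  proof -
    have tP: "u / t \<in> P n \<longleftrightarrow> u \<in> P n" for u n by (rule unit_divide_P[OF t])
    \<comment> \<open>If \<open>x\<close> were fixed by \<open>U\<close> on all of
      \<open>P (- N0)\<close>, it would vanish because it lies in \<open>J W N0\<close>.\<close>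
    obtain u0 where u0: "u0 \<in> P (- N0)" "rho (U u0) x \<noteq> x" using J_fixed_zero[OF xJ] x(2) by blast
    have u0a: "u0 \<in> P a" using u0(1) by (rule P_mono) (use m in \<open>simp add: a_def N_def\<close>)
    have u0': "\<psi> u0 \<noteq> 1" using u0(2) psi[OF u0a] by auto
    have "inverse t - 1 \<in> P m"
    proof (rule ccontr)
      assume n: "inverse t - 1 \<notin> P m"
      let ?s = "inverse t - 1"
      have s: "?s \<noteq> 0" "val ?s < m" using n by (auto simp: P_iff)
      have "u0 / ?s \<in> P a" using u0(1) s by (cases "u0 = 0") (auto simp: P_iff val_divide a_def N_def)
      from inv[OF this] psi_add[OF this, of "u0"] have "\<psi> (u0 / ?s / t) = \<psi> (u0 / ?s)" by simp
      moreover have "u0 / ?s / t = u0 / ?s + u0" using s(1) unit_nz[OF t] by (simp add: field_simps)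
      ultimately have "\<psi> (u0 / ?s) * \<psi> u0 = \<psi> (u0 / ?s)" using psi_add[OF \<open>u0 / ?s \<in> P a\<close> u0a] by simp
      then show False using psi_nz[OF \<open>u0 / ?s \<in> P a\<close>] u0' by simp
    qed
    moreover have "t - 1 = - (t * (inverse t - 1))" using unit_nz[OF t] by (simp add: algebra_simps)
    ultimately have "t - 1 \<in> P m" using unit_mult_P[OF t] by simp
    then have "Dg t 1 \<in> Kc m" by (simp add: Dg_def)
    then have vD: "rho (Dg t 1) v = v" by (rule Fx_rho[OF m(2)])
    have "rho (Dg t 1) (rho (U r) v) = rho (U (t * r)) v" for r
      using vD by (simp add: rho_mult Dg_U) (simp add: rho_mult[symmetric])
    then have "rho (Dg t 1) (Q v) = (\<Sum>r\<in>R. sc (1 / \<psi> r) (rho (U (t * r)) v))"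
      by (simp add: Q_def rho_sum rho_sc)
    also have "\<dots> = (\<Sum>r\<in>R. sc (1 / \<psi> (t * r)) (rho (U (t * r)) v))"
    proof (rule sum.cong[OF refl])
      fix r assume "r \<in> R"
      then have "t * r \<in> P a" using RP unit_mult_P[OF t] by blast
      from inv[OF this] show "sc (1 / \<psi> r) (rho (U (t * r)) v) = sc (1 / \<psi> (t * r)) (rho (U (t * r)) v)"
        using unit_nz[OF t] by simp
    qed
    also have "\<dots> = Q v" unfolding Q_def
    proof (rule transv_sum_reindex[OF equivp_Ea R, where b = "\<lambda>r. t * r" and f = "\<lambda>r. sc (1 / \<psi> r) (rho (U r) v)"])
      show "sc (1 / \<psi> h) (rho (U h) v) = sc (1 / \<psi> h') (rho (U h') v)"
        if "h \<in> P a" "h' \<in> P a" "Ea m h h'" for h h'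
        using psi_Ea[OF that] Ea_rho[OF that(3) vU] by simp
      show "Ea m h h'" if "Ea m (t * h) (t * h')" for h h'
        using that unfolding Ea_def right_diff_distrib[symmetric] unit_mult_P[OF t] .
      show "t * h \<in> P a" if "h \<in> P a" for h using that by (simp only: unit_mult_P[OF t])
    qed
    finally have "rho (Dg t 1) (sc \<kappa> (Q v)) = sc \<kappa> (Q v)" by (simp only: rho_sc)
    then show ?thesis by (simp only: kappa[symmetric])
  qed
  let ?O = "{rho (Dg t 1) x |t. unit t}"
  \<comment> \<open>The sum runs over the distinct vectors of the orbit, so \<open>x\<close> occurs
    exactly once, whatever its stabilizer in the torus.\<close>
  define z where "z = (\<Sum>y\<in>?O. y)"
  have fin: "finite ?O"
    by (rule finite_subset[OF _ finite_orbit[OF xW]]) (use Dg_GO unit_1 in blast)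
  have xO: "x \<in> ?O" using unit_1 by (intro CollectI exI[of _ 1]) (simp add: Dg_def mat_mat2[symmetric])
  have Q_other: "Q y = 0" if y: "y \<in> ?O - {x}" for y
  proof -
    obtain t where t: "y = rho (Dg t 1) x" "unit t" using y by blast
    have eig: "rho (U u) y = sc (\<psi> (u / t)) y" if "u \<in> P a" for u
    proof -
      have "u / t \<in> P a" using that unit_divide_P[OF t(2)] by blast
      then show ?thesis using psi[of "u / t"] unit_nz[OF t(2)] unfolding t(1)
        by (simp add: rho_mult U_Dg) (simp add: rho_mult[symmetric] rho_sc)
    qed
    have yU: "rho (U u) y = y" if "u \<in> P m" for u
      using eig[of u] psi_m[of "u / t"] that unit_divide_P[OF t(2)] P_mono[OF that am(1)] by simp
    have "\<not> (\<forall>u\<in>P a. \<psi> (u / t) = \<psi> u)" using stab[OF t(2)] y t(1) by auto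
    then obtain u where u: "u \<in> P a" "\<psi> (u / t) \<noteq> \<psi> u" by blast
    have e: "sc (\<psi> u) (Q y) = sc (\<psi> (u / t)) (Q y)"
      using Q_eig[OF u(1) yU] Q_rho[of u y] eig[OF u(1)] by (simp add: Q_sc)
    show ?thesis
    proof (rule ccontr)
      assume "Q y \<noteq> 0"
      from sc_cancel[OF e this] show False using u(2) by simp
    qed
  qed
  have Qsum: "Q (\<Sum>y\<in>A. y) = (\<Sum>y\<in>A. Q y)" for A
    by (induction A rule: infinite_finite_induct) (simp_all add: Q_0 Q_add)
  have "Q z = Q x + (\<Sum>y\<in>?O - {x}. Q y)" unfolding z_def Qsum by (rule sum.remove[OF fin xO])
  also have "(\<Sum>y\<in>?O - {x}. Q y) = 0" by (rule sum.neutral) (use Q_other in blast)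
  finally have "Q z \<noteq> 0" using Qx cR x(2) by (simp add: sc_eq_0)
  then have znz: "z \<noteq> 0" using Q_0 by auto
  have OW: "?O \<subseteq> W" using xW by (auto intro!: W_rho simp: unit_nz)
  have zW: "z \<in> W" unfolding z_def by (rule W_sum) (use OW in blast)
  have zt: "rho (Dg t 1) z = z" if t: "unit t" for t
    unfolding z_def
  proof (rule orbit_sum_fix[OF fin])
    fix y assume "y \<in> ?O"
    then obtain s where s: "y = rho (Dg s 1) x" "unit s" by blast
    have "rho (Dg t 1) y = rho (Dg (t * s) 1) x" by (simp add: s(1) rho_mult Dg_Dg)
    then show "rho (Dg t 1) y \<in> ?O" using unit_mult[OF t s(2)] by blast
  qed (use unit_nz[OF t] in simp)
  have "rho (Dg s d) z = z" if "unit s" "unit d" for s d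
  proof -
    have "Dg s d = mat d ** Dg (s / d) 1" using unit_nz[OF that(2)] by (simp add: mat_Dg)
    then have "rho (Dg s d) z = rho (Dg (s / d) 1) z"
      using rho_scalar(1)[of d z "Dg (s / d) 1"] unit_nz[OF that(2)] zW by simp
    then show ?thesis using zt[OF unit_divide[OF that]] by simp
  qed
  then show ?thesis using zW znz by blast
qed

lemma Fx_Kg_I:
  assumes "b + c \<ge> 1" "w \<in> W" "\<And>x. x \<in> P b \<Longrightarrow> rho (U x) w = w" "\<And>y. y \<in> P c \<Longrightarrow> rho (Lo y) w = w"
    "\<And>a d. unit a \<Longrightarrow> unit d \<Longrightarrow> rho (Dg a d) w = w"
  shows "w \<in> Fx (Kg b c)"
proof -
  have "rho k w = w" if k: "k \<in> Kg b c" for k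
  proof -
    obtain x a d y where kd: "k = Lo y ** Dg a d ** U x" "unit a" "unit d" "x \<in> P b" "y \<in> P c"
      by (rule Kg_decomp[OF k assms(1)]) (auto intro: that)
    show ?thesis unfolding kd(1) rho_mult[symmetric] using kd assms by simp
  qed
  then show ?thesis using assms(2) by (simp add: Fx_def)
qed

lemma Fx_Kg_shift:
  assumes "w \<in> Fx (Kg b c)" "b + c \<ge> 1" "p \<noteq> 0"
  shows "rho (Dg p 1) w \<in> Fx (Kg (b + val p) (c - val p))"
proof (rule Fx_Kg_I)
  show "rho (Dg p 1) w \<in> W" using assms Fx_W W_rho by simp
  show "rho (U x) (rho (Dg p 1) w) = rho (Dg p 1) w" if "x \<in> P (b + val p)" for x
  proof -
    have "x / p \<in> P b" using that assms(3) by (cases "x = 0") (auto simp: P_iff val_divide)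
    then show ?thesis using Fx_rho[OF assms(1), of "U (x / p)"] assms(3)
      by (simp add: rho_mult U_Dg) (simp add: rho_mult[symmetric])
  qed
  show "rho (Lo y) (rho (Dg p 1) w) = rho (Dg p 1) w" if "y \<in> P (c - val p)" for y
  proof -
    have "y * p \<in> P c" using that assms(3) by (cases "y = 0") (auto simp: P_iff val_mult)
    then show ?thesis using Fx_rho[OF assms(1), of "Lo (y * p)"]
      by (simp add: rho_mult Lo_Dg) (simp add: rho_mult[symmetric])
  qed
  show "rho (Dg a d) (rho (Dg p 1) w) = rho (Dg p 1) w" if "unit a" "unit d" for a d
    using Fx_rho[OF assms(1), of "Dg a d"] that
      rho_mult[of "Dg a d" "Dg p 1" w] rho_mult[of "Dg p 1" "Dg a d" w] by (simp add: Dg_Dg mult.commute)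
qed (use assms in simp)

text \<open>A torus-fixed vector of level \<open>M\<close> is fixed by \<open>Kg M M\<close>; the
  diagonal shift by \<open>unif powi (- M)\<close> makes the upper right exponent 0 and doubles the
  lower left one.\<close>

lemma ex_Hecke_fixed: "\<exists>n\<ge>1. \<exists>w\<in>Fx (Kg 0 n). w \<noteq> 0"
proof -
  obtain z where z: "z \<in> W" "z \<noteq> 0" "\<And>a d. unit a \<Longrightarrow> unit d \<Longrightarrow> rho (Dg a d) z = z"
    using ex_torus_fixed by blast
  obtain M where M: "M \<ge> 1" "z \<in> Fx (Kc M)" using Fx_KcI[OF z(1)] by blast
  have "z \<in> Fx (Kg M M)"
  proof (rule Fx_Kg_I)
    show "rho (U x) z = z" if "x \<in> P M" for x by (rule Fx_rho[OF M(2)]) (use that in simp)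
    show "rho (Lo y) z = z" if "y \<in> P M" for y by (rule Fx_rho[OF M(2)]) (use that in simp)
    show "1 \<le> M + M" using M(1) by simp
    show "z \<in> W" by (rule z(1))
    show "rho (Dg a d) z = z" if "unit a" "unit d" for a d by (rule z(3)[OF that])
  qed
  then have zM: "z \<in> Fx (Kg M M)" .
  define p :: 'f where "p = unif powi (- M)"
  have p: "p \<noteq> 0" "val p = - M" unfolding p_def by (simp, rule val_unif_powi)
  have "rho (Dg p 1) z \<in> Fx (Kg (M + val p) (M - val p))"
    by (rule Fx_Kg_shift[OF zM _ p(1)]) (use M(1) in simp)
  then have f: "rho (Dg p 1) z \<in> Fx (Kg 0 (2 * M))" unfolding p(2) by simp
  have nz: "rho (Dg p 1) z \<noteq> 0"
  proof
    assume "rho (Dg p 1) z = 0"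
    then have "rho (inv2 (Dg p 1)) (rho (Dg p 1) z) = 0" by simp
    moreover have "rho (inv2 (Dg p 1)) (rho (Dg p 1) z) = z" by (rule rho_inv2(1)) (simp add: p(1))
    ultimately show False using z(2) by simp
  qed
  show ?thesis by (rule exI[of _ "2 * M"]) (use M(1) f nz in auto)
qed

end

subsection \<open>The Cartan decomposition\<close>

text \<open>Elimination with the lower right entry as pivot. The Schur complement \<open>x\<close>
  is integral because the pivot has maximal norm; its valuation is the exponent
  \<open>j\<close>.\<close>

lemma cartan_corner:
  fixes g :: "'f::nonarch_local_field ^ 2 ^ 2"
  assumes "invertible g" "g$2$2 \<noteq> 0" "g$1$1 / g$2$2 \<in> P 0" "g$1$2 / g$2$2 \<in> P 0" "g$2$1 / g$2$2 \<in> P 0"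
  shows "\<exists>a k1 k2 j. a \<noteq> 0 \<and> k1 \<in> GO \<and> k2 \<in> GO \<and> g = mat a ** (k1 ** Dg (unif powi int j) 1 ** k2)"
proof -
  obtain p q r s where g: "g = mat2 p q r s" by (rule mat2_cases)
  have h: "s \<noteq> 0" "p / s \<in> P 0" "q / s \<in> P 0" "r / s \<in> P 0" "p * s - q * r \<noteq> 0"
    using assms by (auto simp: g invertible_mat2)
  define x where "x = p / s - q / s * (r / s)"
  have "q / s * (r / s) \<in> P 0" by (rule P_mult_le[OF h(3,4)]) simp
  then have x: "x \<in> P 0" unfolding x_def by (rule P_diff[OF h(2)])
  have "x = (p * s - q * r) / (s * s)" using h(1) by (simp add: x_def field_simps)
  then have xnz: "x \<noteq> 0" using h by simp
  define j where "j = nat (val x)"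
  have j: "int j = val x" using x xnz by (simp add: j_def P_iff)
  define u where "u = x / unif powi int j"
  have u: "unit u" using xnz by (simp add: u_def unit_val val_divide j)
  have "g = mat s ** (U (q / s) ** Dg u 1 ** Dg (unif powi int j) 1 ** Lo (r / s))"
    using h(1) by (simp add: g u_def U_def Dg_def Lo_def mat_mat2 x_def)
  moreover have "U (q / s) ** Dg u 1 \<in> GO" "Lo (r / s) \<in> GO"
    using h u by (auto intro!: GO_mm simp: U_def Lo_def)
  ultimately show ?thesis using h(1) by blast
qed

text \<open>Exchanging rows and columns moves an entry of maximal norm to the lower right
  corner.\<close>

lemma cartan:
  fixes g :: "'f::nonarch_local_field ^ 2 ^ 2"
  assumes "invertible g"
  obtains a k1 k2 j where "a \<noteq> 0" "k1 \<in> GO" "k2 \<in> GO" "g = mat a ** (k1 ** Dg (unif powi int j) 1 ** k2)"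
proof -
  let ?C = "\<lambda>g::'f^2^2. \<exists>a k1 k2 j. a \<noteq> 0 \<and> k1 \<in> GO \<and> k2 \<in> GO \<and> g = mat a ** (k1 ** Dg (unif powi int j) 1 ** k2)"
  let ?w = "mat2 0 1 1 0 :: 'f^2^2"
  have w: "?w \<in> GO" "?w ** ?w = mat 1" by (simp_all add: mat_mat2)
  have matc: "k ** mat a = mat a ** k" for a and k :: "'f^2^2"
    by (cases k rule: mat2_cases) (simp add: mat_mat2 mult.commute)
  have C_left: "?C g" if C: "?C (?w ** g)" for g
  proof -
    obtain a k1 k2 j where h: "a \<noteq> 0" "k1 \<in> GO" "k2 \<in> GO" "?w ** g = mat a ** (k1 ** Dg (unif powi int j) 1 ** k2)"
      using C by blast
    have "g = ?w ** (?w ** g)" using w by (simp only: matrix_mul_assoc matrix_mul_lid)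
    also have "\<dots> = ?w ** mat a ** (k1 ** Dg (unif powi int j) 1 ** k2)" unfolding h(4) by (simp only: matrix_mul_assoc)
    also have "\<dots> = mat a ** ((?w ** k1) ** Dg (unif powi int j) 1 ** k2)" unfolding matc by (simp only: matrix_mul_assoc)
    finally show ?thesis using h w GO_mm by blast
  qed
  have C_right: "?C g" if C: "?C (g ** ?w)" for g
  proof -
    obtain a k1 k2 j where h: "a \<noteq> 0" "k1 \<in> GO" "k2 \<in> GO" "g ** ?w = mat a ** (k1 ** Dg (unif powi int j) 1 ** k2)"
      using C by blast
    have "g = (g ** ?w) ** ?w" using w by (simp only: matrix_mul_assoc[symmetric] matrix_mul_rid)
    also have "\<dots> = mat a ** (k1 ** Dg (unif powi int j) 1 ** (k2 ** ?w))" unfolding h(4) by (simp only: matrix_mul_assoc)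
    finally show ?thesis using h w GO_mm by blast
  qed
  obtain p q r s where g: "g = mat2 p q r s" by (rule mat2_cases)
  have det: "p * s - q * r \<noteq> 0" using assms by (simp add: g invertible_mat2)
  have corner: "?C (mat2 p' q' r' s')"
    if "p' * s' - q' * r' \<noteq> 0" "nrm p' \<le> nrm s'" "nrm q' \<le> nrm s'" "nrm r' \<le> nrm s'" for p' q' r' s' :: 'f
  proof -
    have s: "s' \<noteq> 0" using that by auto
    have "y / s' \<in> P 0" if "nrm y \<le> nrm s'" for y using that s by (simp add: P_def nrm_divide)
    then show ?thesis using that s by (intro cartan_corner) (simp_all add: invertible_mat2)
  qed
  consider "nrm p \<le> nrm s" "nrm q \<le> nrm s" "nrm r \<le> nrm s" | "nrm q \<le> nrm p" "nrm r \<le> nrm p" "nrm s \<le> nrm p"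
    | "nrm p \<le> nrm q" "nrm r \<le> nrm q" "nrm s \<le> nrm q" | "nrm p \<le> nrm r" "nrm q \<le> nrm r" "nrm s \<le> nrm r"
    by linarith
  then have "?C g"
  proof cases
    case 1
    then show ?thesis using corner[of p s q r] det by (simp add: g)
  next
    case 2
    then have "?C (?w ** (g ** ?w))" using corner[of s p r q] det by (simp add: g algebra_simps)
    then show ?thesis by (intro C_right[of g] C_left[of "g ** ?w"])
  next
    case 3
    have "r * q - s * p \<noteq> 0" using det by (simp add: algebra_simps)
    then have "?C (?w ** g)" using corner[of r q s p] 3 by (simp add: g)
    then show ?thesis by (rule C_left)
  next
    case 4
    have "q * r - p * s \<noteq> 0" using det by (simp add: algebra_simps)
    then have "?C (g ** ?w)" using corner[of q r p s] 4 by (simp add: g)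
    then show ?thesis by (rule C_right)
  qed
  then show ?thesis using that by blast
qed

context cuspidal_level
begin

text \<open>For large \<open>j\<close> conjugation by \<open>k1 ** Dg (unif powi int j) 1\<close>
  contracts the unipotents that generate \<open>J W N\<close> into \<open>Kc c\<close>, which is
  stable under conjugation by \<open>GO\<close> and contained in \<open>K\<close>; the average over
  \<open>K\<close> then cancels each generator. One bound serves all \<open>k2\<close> because the
  \<open>GO\<close>-orbit of \<open>w\<close> is finite. With \<open>cartan\<close> this is
  compactness of the support modulo the centre.\<close>

lemma eK_vanish:
  assumes "w \<in> W"
  shows "\<exists>D::nat. \<forall>j\<ge>D. \<forall>k1\<in>GO. \<forall>k2\<in>GO. eK c (rho (k1 ** Dg (unif powi int j) 1 ** k2) w) = 0"
proof -
  let ?O = "{rho k w |k. k \<in> GO}"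
  have OW: "?O \<subseteq> W" using W_rho GO_inv assms by blast
  have "\<exists>N. A \<subseteq> J W N" if "finite A" "A \<subseteq> W" for A
    using that
  proof (induction A rule: finite_induct)
    case (insert x A)
    then obtain N where N: "A \<subseteq> J W N" by blast
    obtain N' where N': "x \<in> J W N'" using cusp insert.prems by blast
    have "A \<subseteq> J W (max N N')" using N J_mono[of _ W N "max N N'"] by auto
    moreover have "x \<in> J W (max N N')" by (rule J_mono[OF N']) simp
    ultimately show ?case by blast
  qed simp
  then obtain N where N: "?O \<subseteq> J W N" using finite_orbit[OF assms] OW by blast
  have main: "eK c (rho (k1 ** Dg (unif powi int j) 1) v) = 0"
    if j: "int j \<ge> c + N" and k1: "k1 \<in> GO" and v: "v \<in> J W N" for j k1 v
    using v
  proof (induction rule: J.induct)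
    case J_0
    have "eK c (0 :: 'f^2^2 \<Rightarrow> complex) = 0" using eK_fix[OF Fx_0] .
    then show ?case by simp
  next
    case (J_step v x u)
    let ?t = "Dg (unif powi int j) 1 :: 'f^2^2"
    let ?g = "k1 ** ?t"
    have g: "invertible ?g" using GO_inv[OF k1] by (intro invertible_mm) simp_all
    have vW: "v \<in> W" using J_W J_step(1) by blast
    let ?h = "k1 ** U (unif powi int j * u) ** inv2 k1"
    \<comment> \<open>This is the origin of the bound \<open>c + N\<close> for \<open>j\<close>: the
      valuation of a nonzero \<open>u\<close> is at least \<open>- N\<close>.\<close>
    have "unif powi int j * u \<in> P c" using P_mono[OF J_step(3), of "c - int j"] j by (simp add: unif_powi_mult_P del: power_int_of_nat)
    then have "?h \<in> Kc c" by (intro Kc_conj[OF k1]) simp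
    then have h: "?h \<in> K" using c1 by (intro Kc_Kg) auto
    have "?h ** ?g = ?g ** U u"
    proof -
      have "?h ** ?g = k1 ** U (unif powi int j * u) ** (inv2 k1 ** (k1 ** ?t))" by (simp only: matrix_mul_assoc)
      also have "\<dots> = k1 ** (U (unif powi int j * u) ** ?t)"
        unfolding inv2_cancel(1)[OF GO_inv[OF k1]] by (simp only: matrix_mul_assoc)
      also have "\<dots> = ?g ** U u" by (simp add: Dg_U matrix_mul_assoc[symmetric])
      finally show ?thesis .
    qed
    then have "rho ?g (rho (U u) x) = rho ?h (rho ?g x)" by (simp only: rho_mult)
    then have "eK c (rho ?g (rho (U u) x - x)) = 0"
      using eK_rho[OF W_rho[OF g J_step(2)] h] W_rho[OF g J_step(2)]
        W_rho[OF K_inv[OF h] W_rho[OF g J_step(2)]] by (simp add: rho_diff eK_diff)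
    then show ?case
      using J_step.IH W_rho[OF g vW] W_rho[OF g W_diff[OF W_rho[OF invertible_U J_step(2)] J_step(2)]]
      by (simp only: rho_add eK_add add_0)
  qed
  show ?thesis
  proof (intro exI allI ballI impI)
    fix j and k1 k2 :: "'f^2^2" assume j: "j \<ge> nat (c + N)" and k: "k1 \<in> GO" "k2 \<in> GO"
    have "rho k2 w \<in> J W N" using N k(2) by blast
    then show "eK c (rho (k1 ** Dg (unif powi int j) 1 ** k2) w) = 0"
      using main[of j k1 "rho k2 w"] j k(1) by (simp add: rho_mult)
  qed
qed

end

section \<open>Multiplicity one for newforms\<close>

text \<open>The bound \<open>c2\<close> is available for the representation because level 1 is the
  Iwahori subgroup, which has no nonzero fixed vectors.\<close>

locale cuspidal_newform = cuspidal_level W c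
  for W :: "('f::nonarch_local_field ^ 2 ^ 2 \<Rightarrow> complex) set" and c :: int +
  assumes c2: "2 \<le> c"
    and old_zero: "w \<in> Fx (Kg 0 (c - 1)) \<Longrightarrow> w = 0"
begin

abbreviation Kp :: "('f^2^2) set" where "Kp \<equiv> Kg 0 (c - 1)"
text \<open>Conjugate to \<open>Kp\<close> by \<open>Dg unif 1\<close>, hence also without nonzero
  fixed vectors. The two groups together enlarge \<open>K\<close> in both unipotent
  directions.\<close>

abbreviation Km :: "('f^2^2) set" where "Km \<equiv> Kg (- 1) c"

abbreviation T :: "'f^2^2 \<Rightarrow> ('f ^ 2 ^ 2 \<Rightarrow> complex) \<Rightarrow> 'f ^ 2 ^ 2 \<Rightarrow> complex"
  where "T g v \<equiv> eK c (rho g v)"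

lemma T_W: "invertible g \<Longrightarrow> v \<in> W \<Longrightarrow> T g v \<in> Fx K"
  by (intro eK_in W_rho)

lemma T_left: "k \<in> K \<Longrightarrow> invertible g \<Longrightarrow> v \<in> W \<Longrightarrow> T (k ** g) v = T g v"
  using eK_rho[OF W_rho] by (simp add: rho_mult[symmetric])

lemma T_right: "v \<in> Fx K \<Longrightarrow> k \<in> K \<Longrightarrow> T (g ** k) v = T g v"
  using Fx_rho[of v K k] by (simp add: rho_mult[symmetric])

lemma T_scalar: "a \<noteq> 0 \<Longrightarrow> v \<in> W \<Longrightarrow> T (mat a ** g) v = T g v"
  by (simp add: rho_scalar)

lemma Kp_GO: "k \<in> Kp \<Longrightarrow> k \<in> GO" by (rule Kg_GO) (use c2 in auto)

lemma Km_conj: assumes "k \<in> Km" shows "Dg unif 1 ** k ** inv2 (Dg unif 1) \<in> Kp"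
proof -
  obtain p q r s where k: "k = mat2 p q r s" by (rule mat2_cases)
  have "unif * q \<in> P 0" using assms by (cases "q = 0") (auto simp: k P_iff val_mult)
  moreover have "r / unif \<in> P (c - 1)" using assms by (cases "r = 0") (auto simp: k P_iff val_divide)
  ultimately show ?thesis using assms by (simp add: k Dg_def inv2_mat2)
qed

lemma finite_orbit_Kp: "v \<in> W \<Longrightarrow> finite {rho k v |k. k \<in> Kp}"
  by (rule finite_subset[OF _ finite_orbit]) (use Kp_GO in blast)

text \<open>\<open>Km\<close> is not contained in \<open>GO\<close>, so its orbits are transported
  to orbits of \<open>Kp\<close> by conjugation.\<close>

lemma finite_orbit_Km: assumes "v \<in> W" shows "finite {rho k v |k. k \<in> Km}"
proof -
  let ?t = "Dg unif 1 :: 'f^2^2"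
  have t: "invertible ?t" by simp
  have "{rho k v |k. k \<in> Km} \<subseteq> rho (inv2 ?t) ` {rho k (rho ?t v) |k. k \<in> Kp}"
  proof clarify
    fix k :: "'f^2^2" assume k: "k \<in> Km"
    have "inv2 ?t ** (?t ** k ** inv2 ?t ** ?t) = k"
      using inv2_cancel[OF t] by (simp only: matrix_mul_assoc)
    then have "rho k v = rho (inv2 ?t) (rho (?t ** k ** inv2 ?t) (rho ?t v))" by (simp only: rho_mult)
    then show "rho k v \<in> rho (inv2 ?t) ` {rho k (rho ?t v) |k. k \<in> Kp}" using Km_conj[OF k] by blast
  qed
  moreover have "finite {rho k (rho ?t v) |k. k \<in> Kp}" by (rule finite_orbit_Kp) (simp add: W_rho assms)
  ultimately show ?thesis by (rule finite_subset[OF _ finite_imageI])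
qed

lemma Km_zero: assumes "w \<in> Fx Km" shows "w = 0"
proof -
  have "rho (Dg unif 1) w \<in> Fx Kp" using Fx_Kg_shift[OF assms, of unif] c2 by simp
  then have "rho (Dg unif 1) w = 0" by (rule old_zero)
  then have "rho (inv2 (Dg unif 1)) (rho (Dg unif 1) w) = 0" by simp
  then show ?thesis by (simp add: rho_inv2)
qed

lemma orbit_sum_zero:
  assumes "v \<in> W" "K' = Kp \<or> K' = Km"
  shows "finite {rho k v |k. k \<in> K'}" "(\<Sum>x\<in>{rho k v |k. k \<in> K'}. x) = 0"
proof -
  let ?O = "{rho k v |k. k \<in> K'}"
  have inv: "invertible k" if "k \<in> K'" for k
    using that assms(2) Kg_inv[of k 0 "c - 1"] Kg_inv[of k "- 1" c] c2 by auto
  have mm: "k ** h \<in> K'" if "k \<in> K'" "h \<in> K'" for k h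
    using that assms(2) Kg_mm[of k 0 "c - 1" h] Kg_mm[of k "- 1" c h] c2 by auto
  show fin: "finite ?O" using assms finite_orbit_Kp finite_orbit_Km by auto
  have "(\<Sum>x\<in>?O. x) \<in> W"
  proof (rule W_sum)
    fix x assume "x \<in> ?O"
    then show "x \<in> W" using W_rho[OF inv assms(1)] by blast
  qed
  moreover have "rho k (\<Sum>x\<in>?O. x) = (\<Sum>x\<in>?O. x)" if k: "k \<in> K'" for k
  proof (rule orbit_sum_fix[OF fin _ inv[OF k]])
    fix x assume "x \<in> ?O"
    then obtain h where "x = rho h v" "h \<in> K'" by blast
    then show "rho k x \<in> ?O" using mm[OF k] by (auto simp: rho_mult)
  qed
  ultimately have "(\<Sum>x\<in>?O. x) \<in> Fx K'" by (simp add: Fx_def)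
  then show "(\<Sum>x\<in>?O. x) = 0" using assms(2) old_zero Km_zero by auto
qed

lemma T_zero_of_sum:
  assumes "finite S" "S \<noteq> {}" "S \<subseteq> W" "(\<Sum>x\<in>S. x) = 0" "invertible g"
    and "\<And>x. x \<in> S \<Longrightarrow> T g x = y"
  shows "y = 0"
proof -
  have "0 = T g (\<Sum>x\<in>S. x)" using assms(4) eK_fix[OF Fx_0] by simp
  also have "\<dots> = (\<Sum>x\<in>S. T g x)" unfolding rho_sum
    by (rule eK_sum[OF assms(1)]) (use assms(3,5) W_rho in blast)
  also have "\<dots> = (\<Sum>x\<in>S. y)" by (rule sum.cong) (use assms(6) in auto)
  also have "\<dots> = sc (of_nat (card S)) y" by (rule sum_const_sc)
  finally have "sc (of_nat (card S)) y = 0" ..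
  moreover have "card S \<noteq> 0" using assms(1,2) by simp
  ultimately show ?thesis by (simp add: sc_eq_0)
qed

text \<open>If \<open>K' g \<subseteq> K g K\<close> for one of the larger groups \<open>K'\<close>, then the double coset of \<open>g\<close> is stable
  under \<open>K'\<close>, and the operator of \<open>g\<close> factors through vectors fixed by \<open>K'\<close>.\<close>

lemma T_vanish_left:
  assumes v: "v \<in> Fx K" and g: "invertible g" and K': "K' = Kp \<or> K' = Km"
    and s: "\<And>k'. k' \<in> K' \<Longrightarrow> \<exists>k\<in>K. \<exists>h\<in>K. k' ** g = k ** g ** h"
  shows "T g v = 0" "T (inv2 g) v = 0"
proof -
  have vW: "v \<in> W" using v by (rule Fx_W)
  have inv: "invertible k" if "k \<in> K'" for k
    using that K' Kg_inv[of k 0 "c - 1"] Kg_inv[of k "- 1" c] c2 by auto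
  have inv2: "inv2 k \<in> K'" if "k \<in> K'" for k
    using that K' Kg_inv2[of k 0 "c - 1"] Kg_inv2[of k "- 1" c] c2 by auto
  have one: "mat 1 \<in> K'" using K' by auto
  show "T g v = 0"
  proof (rule T_zero_of_sum[where g = "mat 1"])
    let ?O = "{rho k (rho g v) |k. k \<in> K'}"
    show "finite ?O" "(\<Sum>x\<in>?O. x) = 0" using orbit_sum_zero[OF W_rho[OF g vW] K'] .
    show "?O \<noteq> {}" using one by blast
    show "?O \<subseteq> W" using W_rho[OF inv W_rho[OF g vW]] by blast
    fix x assume "x \<in> ?O"
    then obtain k' where k': "x = rho k' (rho g v)" "k' \<in> K'" by blast
    obtain k h where kh: "k \<in> K" "h \<in> K" "k' ** g = k ** g ** h" using s[OF k'(2)] by blast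
    have "x = rho k (rho g (rho h v))" unfolding k'(1) rho_mult kh(3) matrix_mul_assoc ..
    then show "T (mat 1) x = T g v" using Fx_rho[OF v kh(2)] eK_rho[OF W_rho[OF g vW] kh(1)] by simp
  qed simp
  show "T (inv2 g) v = 0"
  proof (rule T_zero_of_sum[where g = "inv2 g"])
    let ?O = "{rho k v |k. k \<in> K'}"
    show "finite ?O" "(\<Sum>x\<in>?O. x) = 0" using orbit_sum_zero[OF vW K'] .
    show "?O \<noteq> {}" using one by blast
    show "?O \<subseteq> W" using W_rho[OF inv vW] by blast
    show "invertible (inv2 g)" by (rule invertible_inv2[OF g])
    fix x assume "x \<in> ?O"
    then obtain k' where k': "x = rho k' v" "k' \<in> K'" by blast
    obtain k h where kh: "k \<in> K" "h \<in> K" "inv2 k' ** g = k ** g ** h" using s[OF inv2[OF k'(2)]] by blast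
    have "inv2 g ** k' = inv2 (inv2 k' ** g)"
      using inv2_mm[OF invertible_inv2[OF inv[OF k'(2)]] g] inv2_inv2[OF inv[OF k'(2)]] by simp
    also have "\<dots> = inv2 h ** (inv2 g ** inv2 k)"
      unfolding kh(3) using kh g K_inv by (simp add: inv2_mm invertible_mm)
    finally have "T (inv2 g) x = T (inv2 h ** (inv2 g ** inv2 k)) v" by (simp add: k'(1) rho_mult)
    also have "\<dots> = T (inv2 g ** inv2 k) v"
      by (rule T_left[OF K_inv2[OF kh(2)] _ vW]) (intro invertible_mm invertible_inv2 g K_inv kh)
    also have "\<dots> = T (inv2 g) v" by (rule T_right[OF v K_inv2[OF kh(1)]])
    finally show "T (inv2 g) x = T (inv2 g) v" .
  qed
qed

text \<open>The hypothesis is that of \<open>T_vanish_left\<close> for the inverse of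
  \<open>g\<close>, so the two conclusions trade places.\<close>

lemma T_vanish_right:
  assumes v: "v \<in> Fx K" and g: "invertible g" and K': "K' = Kp \<or> K' = Km"
    and s: "\<And>k'. k' \<in> K' \<Longrightarrow> \<exists>k\<in>K. \<exists>h\<in>K. g ** k' = h ** g ** k"
  shows "T g v = 0" "T (inv2 g) v = 0"
proof -
  have inv: "invertible k" if "k \<in> K'" for k
    using that K' Kg_inv[of k 0 "c - 1"] Kg_inv[of k "- 1" c] c2 by auto
  have inv2: "inv2 k \<in> K'" if "k \<in> K'" for k
    using that K' Kg_inv2[of k 0 "c - 1"] Kg_inv2[of k "- 1" c] c2 by auto
  have "\<exists>k\<in>K. \<exists>h\<in>K. k' ** inv2 g = k ** inv2 g ** h" if k': "k' \<in> K'" for k'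
  proof -
    obtain k h where kh: "k \<in> K" "h \<in> K" "g ** inv2 k' = h ** g ** k" using s[OF inv2[OF k']] by blast
    have "k' ** inv2 g = inv2 (g ** inv2 k')"
      using inv2_mm[OF g invertible_inv2[OF inv[OF k']]] inv2_inv2[OF inv[OF k']] by simp
    also have "\<dots> = inv2 k ** inv2 g ** inv2 h"
      unfolding kh(3) using kh g K_inv by (simp add: inv2_mm invertible_mm matrix_mul_assoc)
    finally show ?thesis using kh K_inv2 by blast
  qed
  from T_vanish_left[OF v invertible_inv2[OF g] K' this]
  show "T g v = 0" "T (inv2 g) v = 0" by (simp_all add: inv2_inv2[OF g])
qed

text \<open>The coset of an element of \<open>Km\<close> under left multiplication by
  \<open>K\<close> is determined by the ratio of its first row; likewise for \<open>Kp\<close>,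
  right multiplication and the first column in \<open>Kp_coset\<close>.\<close>

lemma Km_coset:
  assumes "k \<in> Km" "e \<in> Km" "k$1$2 * e$1$1 = k$1$1 * e$1$2"
  shows "k ** inv2 e \<in> K"
proof -
  have "k ** inv2 e \<in> Km" using assms c2 by (intro Kg_mm Kg_inv2) auto
  moreover obtain p q r s where k: "k = mat2 p q r s" by (rule mat2_cases)
  moreover obtain x y z w where e: "e = mat2 x y z w" by (rule mat2_cases)
  moreover have "x * w - y * z \<noteq> 0" using Kg_inv[OF assms(2)] c2 by (simp add: e invertible_mat2)
  moreover have "(k ** inv2 e)$1$2 = 0" using assms(3) calculation by (simp add: inv2_mat2 k e)
  ultimately show ?thesis by (simp add: Kg_def)
qed

lemma Kp_coset:
  assumes "k \<in> Kp" "e \<in> Kp" "k$2$1 * e$1$1 = k$1$1 * e$2$1"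
  shows "inv2 e ** k \<in> K"
proof -
  have "inv2 e ** k \<in> Kp" using assms c2 by (intro Kg_mm Kg_inv2) auto
  moreover obtain p q r s where k: "k = mat2 p q r s" by (rule mat2_cases)
  moreover obtain x y z w where e: "e = mat2 x y z w" by (rule mat2_cases)
  moreover have "x * w - y * z \<noteq> 0" using Kg_inv[OF assms(2)] c2 by (simp add: e invertible_mat2)
  moreover have "(inv2 e ** k)$2$1 = 0" using assms(3) calculation by (simp add: inv2_mat2 k e) (simp add: field_simps)
  ultimately show ?thesis by (simp add: Kg_def)
qed

text \<open>By \<open>Km_coset\<close> it suffices to find, for each ratio \<open>r\<close> of the
  first row, one matrix of \<open>Km\<close> that conjugation by the inverse of \<open>g\<close>
  carries into \<open>K\<close>.\<close>

lemma vanish_Km: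
  assumes v: "v \<in> Fx K" and g: "invertible g"
    and e: "\<And>r. r \<in> P (- 1) \<Longrightarrow> \<exists>e\<in>Km. \<exists>h\<in>K. e$1$2 = r * e$1$1 \<and> e ** g = g ** h"
  shows "T g v = 0" "T (inv2 g) v = 0"
proof -
  have "\<exists>k\<in>K. \<exists>h\<in>K. k' ** g = k ** g ** h" if k': "k' \<in> Km" for k'
  proof -
    have u: "unit (k'$1$1)" "k'$1$2 \<in> P (- 1)" using k' by (auto simp: Kg_def)
    obtain e h where eh: "e \<in> Km" "h \<in> K" "e$1$2 = k'$1$2 / k'$1$1 * e$1$1" "e ** g = g ** h"
      using e[of "k'$1$2 / k'$1$1"] u by (auto simp: unit_divide_P)
    have "k' ** inv2 e \<in> K"
      by (rule Km_coset[OF k' eh(1)]) (use eh(3) unit_nz[OF u(1)] in simp)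
    moreover have "k' ** g = (k' ** inv2 e) ** g ** h"
    proof -
      have "(k' ** inv2 e) ** g ** h = k' ** (inv2 e ** (e ** g))" unfolding eh(4) by (simp only: matrix_mul_assoc)
      then show ?thesis using Kg_inv[OF eh(1)] c2 by (simp add: inv2_cancel)
    qed
    ultimately show ?thesis using eh(2) by blast
  qed
  from T_vanish_left[where K' = Km, OF v g _ this] show "T g v = 0" "T (inv2 g) v = 0" by simp_all
qed

lemma vanish_Kp:
  assumes v: "v \<in> Fx K" and g: "invertible g"
    and e: "\<And>r. r \<in> P (c - 1) \<Longrightarrow> \<exists>e\<in>Kp. \<exists>h\<in>K. e$2$1 = r * e$1$1 \<and> g ** e = h ** g"
  shows "T g v = 0" "T (inv2 g) v = 0"
proof -
  have "\<exists>k\<in>K. \<exists>h\<in>K. g ** k' = h ** g ** k" if k': "k' \<in> Kp" for k'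
  proof -
    have u: "unit (k'$1$1)" "k'$2$1 \<in> P (c - 1)" using k' by (auto simp: Kg_def)
    obtain e h where eh: "e \<in> Kp" "h \<in> K" "e$2$1 = k'$2$1 / k'$1$1 * e$1$1" "g ** e = h ** g"
      using e[of "k'$2$1 / k'$1$1"] u by (auto simp: unit_divide_P)
    have "inv2 e ** k' \<in> K"
      by (rule Kp_coset[OF k' eh(1)]) (use eh(3) unit_nz[OF u(1)] in simp)
    moreover have "g ** k' = h ** g ** (inv2 e ** k')"
    proof -
      have "h ** g ** (inv2 e ** k') = g ** (e ** (inv2 e ** k'))" unfolding eh(4)[symmetric] by (simp only: matrix_mul_assoc)
      then show ?thesis using Kg_inv[OF eh(1)] c2 by (simp add: inv2_cancel)
    qed
    ultimately show ?thesis using eh(2) by blast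
  qed
  from T_vanish_right[where K' = Kp, OF v g _ this] show "T g v = 0" "T (inv2 g) v = 0" by simp_all
qed

section \<open>Families of double cosets on which the operators vanish\<close>

context
  fixes v \<beta> \<gamma> \<delta>
  assumes v: "v \<in> Fx K" and inv: "\<delta> - \<beta> * \<gamma> \<noteq> (0::'f)"
begin

abbreviation "gg \<equiv> mat2 1 \<beta> \<gamma> \<delta>"

lemma gg_inv: "invertible gg" using inv by (simp add: invertible_mat2)

text \<open>The witness is the conjugate by \<open>gg\<close> of
  \<open>U (z * (\<delta> - \<beta> * \<gamma>))\<close>, that is, the identity plus
  \<open>z\<close> times a nilpotent matrix. The formula for \<open>z\<close> makes its first row
  have ratio \<open>r\<close>, and \<open>g2\<close> keeps its lower left entry in
  \<open>P c\<close>.\<close>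

lemma vanish_1:
  assumes D: "\<delta> - \<beta> * \<gamma> \<in> P 1" and g2: "\<gamma> * \<gamma> \<in> P (c + 1)"
  shows "T gg v = 0" "T (inv2 gg) v = 0"
proof -
  have gP: "\<gamma> \<in> P 2" using g2 c2 by (cases "\<gamma> = 0") (auto simp: P_iff val_mult)
  have "\<exists>e\<in>Km. \<exists>h\<in>K. e$1$2 = r * e$1$1 \<and> e ** gg = gg ** h" if r: "r \<in> P (- 1)" for r
  proof -
    have rg: "r * \<gamma> \<in> P 1" using P_mult[OF r gP] by simp
    have u: "unit (1 + r * \<gamma>)" by (rule unit_1_plus(1)[OF rg])
    define z where "z = r / (1 + r * \<gamma>)"
    have z: "z \<in> P (- 1)" using r unit_divide_P[OF u] by (simp add: z_def)
    have zg: "z * \<gamma> \<in> P 1" using P_mult[OF z gP] by simp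
    let ?e = "mat2 (1 - z * \<gamma>) z (- (z * (\<gamma> * \<gamma>))) (1 + z * \<gamma>)"
    have "z * (\<gamma> * \<gamma>) \<in> P c" using P_mult[OF z g2] by simp
    then have "?e \<in> Km" using z unit_1_plus[OF zg] by simp
    moreover have "U (z * (\<delta> - \<beta> * \<gamma>)) \<in> K" using P_mult[OF z D] by simp
    moreover have "?e$1$2 = r * ?e$1$1" using unit_nz[OF u] by (simp add: z_def field_simps)
    moreover have "?e ** gg = gg ** U (z * (\<delta> - \<beta> * \<gamma>))" by (simp add: U_def algebra_simps)
    ultimately show ?thesis by blast
  qed
  then show "T gg v = 0" "T (inv2 gg) v = 0" using vanish_Km[OF v gg_inv] by blast+
qed

text \<open>The mirror image of \<open>vanish_1\<close>: a lower unipotent conjugated by the inverse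
  of \<open>gg\<close> gives the witness in \<open>Kp\<close>, and \<open>b2\<close> keeps its upper
  right entry integral.\<close>

lemma vanish_2:
  assumes D: "\<delta> - \<beta> * \<gamma> \<in> P 1" and b2: "\<beta> * \<beta> \<in> P (1 - c)"
  shows "T gg v = 0" "T (inv2 gg) v = 0"
proof -
  have "\<exists>e\<in>Kp. \<exists>h\<in>K. e$2$1 = r * e$1$1 \<and> gg ** e = h ** gg" if r: "r \<in> P (c - 1)" for r
  proof -
    have rb: "r' * \<beta> \<in> P 1" if "r' \<in> P (c - 1)" for r'
      using that b2 c2 by (cases "r' = 0"; cases "\<beta> = 0") (auto simp: P_iff val_mult)
    have u: "unit (1 + r * \<beta>)" by (rule unit_1_plus(1)[OF rb[OF r]])
    define z where "z = r / (1 + r * \<beta>)"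
    have z: "z \<in> P (c - 1)" using r unit_divide_P[OF u] by (simp add: z_def)
    let ?e = "mat2 (1 - z * \<beta>) (- (z * (\<beta> * \<beta>))) z (1 + z * \<beta>)"
    have "z * (\<beta> * \<beta>) \<in> P 0" using P_mult[OF z b2] by simp
    then have "?e \<in> Kp" using z unit_1_plus[OF rb[OF z]] by simp
    moreover have "Lo (z * (\<delta> - \<beta> * \<gamma>)) \<in> K" using P_mult[OF z D] by simp
    moreover have "?e$2$1 = r * ?e$1$1" using unit_nz[OF u] by (simp add: z_def field_simps)
    moreover have "gg ** ?e = Lo (z * (\<delta> - \<beta> * \<gamma>)) ** gg" by (simp add: Lo_def algebra_simps)
    ultimately show ?thesis by blast
  qed
  then show "T gg v = 0" "T (inv2 gg) v = 0" using vanish_Kp[OF v gg_inv] by blast+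
qed

text \<open>Here the witness is a diagonal matrix conjugated by \<open>gg\<close>. The ratio
  \<open>r\<close> forces its eigenvalue to be \<open>\<beta> / e * (1 + r * \<gamma>)\<close>; it
  is a unit because \<open>r * \<delta>\<close> is integral while \<open>\<beta>\<close> is not, so
  that \<open>e\<close> has the valuation of \<open>\<beta>\<close>.\<close>

lemma vanish_3:
  assumes g: "\<gamma> \<in> P 2" and b: "\<beta> \<notin> P 0" and d: "\<delta> \<in> P 1" and q: "\<gamma> * \<delta> / \<beta> \<in> P (c + 1)"
  shows "T gg v = 0" "T (inv2 gg) v = 0"
proof -
  have b0: "\<beta> \<noteq> 0" "val \<beta> < 0" using b by (auto simp: P_iff)
  have "\<exists>e\<in>Km. \<exists>h\<in>K. e$1$2 = r * e$1$1 \<and> e ** gg = gg ** h" if r: "r \<in> P (- 1)" for r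
  proof -
    define e where "e = \<beta> + r * \<delta>"
    have "r * \<delta> \<in> P (val \<beta> + 1)" using P_mult[OF r d] b0 by (auto intro: P_mono)
    then have e: "e \<noteq> 0" "val e = val \<beta>" unfolding e_def using val_add_eq[OF b0(1)] by auto
    then have ube: "unit (\<beta> / e)" using b0 by (simp add: unit_val val_divide)
    have rg: "r * \<gamma> \<in> P 1" using P_mult[OF r g] by simp
    have u: "unit (1 + r * \<gamma>)" by (rule unit_1_plus(1)[OF rg])
    let ?e = "mat2 (\<beta> / e) (r * (\<beta> / e)) (- (r * (\<gamma> * \<delta> / \<beta>) * (\<beta> / e))) (1 + r * \<gamma> * (\<beta> / e))"
    have "r * (\<gamma> * \<delta> / \<beta>) \<in> P c" using P_mult[OF r q] by simp
    then have "?e \<in> Km"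
      using r rg ube by (simp add: unit_mult_P' unit_1_plus del: times_divide_eq_right times_divide_eq_left)
    moreover have "Dg (\<beta> / e * (1 + r * \<gamma>)) 1 \<in> K" using ube u by (simp add: unit_mult del: times_divide_eq_left)
    moreover have "?e$1$2 = r * ?e$1$1" by simp
    moreover have "?e ** gg = gg ** Dg (\<beta> / e * (1 + r * \<gamma>)) 1"
      using e(1) b0(1) by (simp add: Dg_def field_simps) (simp add: e_def algebra_simps)
    ultimately show ?thesis by blast
  qed
  then show "T gg v = 0" "T (inv2 gg) v = 0" using vanish_Km[OF v gg_inv] by blast+
qed

text \<open>The counterpart of \<open>vanish_3\<close> for \<open>Kp\<close>, with a diagonal matrix
  conjugated by the inverse of \<open>gg\<close> and \<open>\<gamma>\<close> in the place of
  \<open>\<beta>\<close>.\<close>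

lemma vanish_4:
  assumes g: "\<gamma> \<notin> P c" and b: "\<beta> \<in> P (2 - c)" and d: "\<delta> \<in> P 1" and q: "\<beta> * \<delta> / \<gamma> \<in> P (1 - c)"
  shows "T gg v = 0" "T (inv2 gg) v = 0"
proof -
  have g0: "\<gamma> \<noteq> 0" "val \<gamma> < c" using g by (auto simp: P_iff)
  have "\<exists>e\<in>Kp. \<exists>h\<in>K. e$2$1 = r * e$1$1 \<and> gg ** e = h ** gg" if r: "r \<in> P (c - 1)" for r
  proof -
    define e where "e = \<gamma> + r * \<delta>"
    have "r * \<delta> \<in> P (val \<gamma> + 1)" using P_mult[OF r d] g0 by (auto intro: P_mono)
    then have e: "e \<noteq> 0" "val e = val \<gamma>" unfolding e_def using val_add_eq[OF g0(1)] by auto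
    then have uge: "unit (\<gamma> / e)" using g0 by (simp add: unit_val val_divide)
    have rb: "r * \<beta> \<in> P 1" using P_mult[OF r b] by simp
    have u: "unit (1 + r * \<beta>)" by (rule unit_1_plus(1)[OF rb])
    let ?e = "mat2 (\<gamma> / e) (- (r * (\<beta> * \<delta> / \<gamma>) * (\<gamma> / e))) (r * (\<gamma> / e)) (1 + r * \<beta> * (\<gamma> / e))"
    have "r * (\<beta> * \<delta> / \<gamma>) \<in> P 0" using P_mult[OF r q] by simp
    then have "?e \<in> Kp"
      using r rb uge by (simp add: unit_mult_P' unit_1_plus del: times_divide_eq_right times_divide_eq_left)
    moreover have "Dg (\<gamma> / e * (1 + r * \<beta>)) 1 \<in> K" using uge u by (simp add: unit_mult del: times_divide_eq_left)
    moreover have "?e$2$1 = r * ?e$1$1" by simp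
    moreover have "gg ** ?e = Dg (\<gamma> / e * (1 + r * \<beta>)) 1 ** gg"
      using e(1) g0(1) by (simp add: Dg_def field_simps) (simp add: e_def algebra_simps)
    ultimately show ?thesis by blast
  qed
  then show "T gg v = 0" "T (inv2 gg) v = 0" using vanish_Kp[OF v gg_inv] by blast+
qed

end

end

context cuspidal_newform
begin

subsection \<open>The exceptional double coset\<close>

text \<open>The Atkin-Lehner element of level \<open>c\<close>: it normalizes \<open>K\<close> and
  its square is scalar.\<close>

definition \<omega> :: "'f^2^2" where "\<omega> = mat2 0 1 (unif powi c) 0"

lemma omega_inv: "invertible \<omega>" by (simp add: \<omega>_def invertible_mat2)

lemma omega_conj: assumes "k \<in> K" shows "\<exists>k'\<in>K. k ** \<omega> = \<omega> ** k'" "\<exists>k'\<in>K. \<omega> ** k = k' ** \<omega>"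
proof -
  obtain p q r s where k: "k = mat2 p q r s" by (rule mat2_cases)
  define \<pi> :: 'f where "\<pi> = unif powi c"
  have pi: "\<pi> \<noteq> 0" "val \<pi> = c" unfolding \<pi>_def by (simp, rule val_unif_powi)
  have "r / \<pi> \<in> P 0" using assms pi by (cases "r = 0") (auto simp: k P_iff val_divide)
  moreover have "q * \<pi> \<in> P c" using assms pi by (cases "q = 0") (auto simp: k P_iff val_mult)
  ultimately have m: "mat2 s (r / \<pi>) (q * \<pi>) p \<in> K" using assms by (simp add: k)
  have "k ** \<omega> = \<omega> ** mat2 s (r / \<pi>) (q * \<pi>) p" using pi(1) by (simp add: k \<omega>_def \<pi>_def[symmetric])
  then show "\<exists>k'\<in>K. k ** \<omega> = \<omega> ** k'" using m by blast
  have "\<omega> ** k = mat2 s (r / \<pi>) (q * \<pi>) p ** \<omega>" using pi(1) by (simp add: k \<omega>_def \<pi>_def[symmetric])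
  then show "\<exists>k'\<in>K. \<omega> ** k = k' ** \<omega>" using m by blast
qed

lemma rho_omega_Fx: assumes "v \<in> Fx K" shows "rho \<omega> v \<in> Fx K"
proof -
  have "rho k (rho \<omega> v) = rho \<omega> v" if k: "k \<in> K" for k
  proof -
    obtain k' where k': "k' \<in> K" "k ** \<omega> = \<omega> ** k'" using omega_conj(1)[OF k] by blast
    have "rho k (rho \<omega> v) = rho \<omega> (rho k' v)" by (simp only: rho_mult k'(2))
    then show ?thesis using Fx_rho[OF assms k'(1)] by simp
  qed
  then show ?thesis using W_rho[OF omega_inv] Fx_W[OF assms] by (simp add: Fx_def)
qed

text \<open>Up to diagonal units on the left and \<open>K\<close> on the right, every element of
  \<open>Kp\<close> outside \<open>K\<close> is the one matrix
  \<open>Lo (unif powi (c - 1))\<close>. The condition on \<open>g\<close> lets the diagonal units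
  pass to its left, where the average absorbs them.\<close>

lemma Kp_coset_T:
  assumes g: "invertible g" "\<And>k. k \<in> K \<Longrightarrow> \<exists>k'\<in>K. g ** k = k' ** g"
    and v: "v \<in> Fx K" and k: "k \<in> Kp" "k \<notin> K"
  shows "T (g ** k) v = T (g ** Lo (unif powi (c - 1))) v"
proof -
  obtain p q r s where kk: "k = mat2 p q r s" by (rule mat2_cases)
  define \<pi> :: 'f where "\<pi> = unif powi (c - 1)"
  have pi: "\<pi> \<noteq> 0" "val \<pi> = c - 1" unfolding \<pi>_def by (simp, rule val_unif_powi)
  have h: "unit p" "unit s" "q \<in> P 0" "r \<in> P (c - 1)" "r \<notin> P c" using k by (auto simp: kk)
  have r: "r \<noteq> 0" "val r = c - 1" using h by (auto simp: P_iff)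
  define u where "u = r / (p * \<pi>)"
  have u: "unit u" using r pi h(1) by (simp add: u_def unit_val val_divide val_mult)
  have "unit (s - q * r / p)" using h c2
    by (intro unit_diff_P) (auto simp: unit_divide_P intro: P_mult_le)
  then have m: "mat2 p q 0 (s - q * r / p) \<in> K" using h by simp
  have d: "Dg 1 u \<in> K" "Dg 1 (1 / u) \<in> K" using u unit_divide[OF unit_1 u] by simp_all
  have unz: "u \<noteq> 0" "p \<noteq> 0" using unit_nz[OF u] unit_nz[OF h(1)] by auto
  have up: "u * \<pi> * p = r" using pi(1) unz(2) by (simp add: u_def)
  have "k = Dg 1 u ** Lo \<pi> ** (Dg 1 (1 / u) ** mat2 p q 0 (s - q * r / p))"
    using unz up by (simp add: kk Dg_def Lo_def field_simps)
  moreover have mk: "Dg 1 (1 / u) ** mat2 p q 0 (s - q * r / p) \<in> K" by (rule K_mm[OF d(2) m])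
  moreover obtain k' where k': "k' \<in> K" "g ** Dg 1 u = k' ** g" using g(2)[OF d(1)] by blast
  ultimately have "g ** k = k' ** (g ** Lo \<pi>) ** (Dg 1 (1 / u) ** mat2 p q 0 (s - q * r / p))"
    by (simp only: matrix_mul_assoc)
  then have "T (g ** k) v = T (k' ** (g ** Lo \<pi>)) v" by (simp only: T_right[OF v mk])
  also have "\<dots> = T (g ** Lo \<pi>) v"
    by (rule T_left[OF k'(1) _ Fx_W[OF v]]) (intro invertible_mm g invertible_Lo)
  finally show ?thesis by (simp add: \<pi>_def)
qed

text \<open>The point is that the count is the same for all \<open>v\<close>, since
  \<open>T_exceptional\<close> compares \<open>v\<close> with \<open>rho \<omega> v\<close>. If two
  translates coincided, \<open>v\<close> would be fixed by some \<open>Lo y\<close> with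
  \<open>val y = c - 1\<close>, after dilation by units by all of \<open>Kp\<close>, against
  \<open>old_zero\<close>.\<close>

lemma Kp_orbit:
  assumes v: "v \<in> Fx K" "v \<noteq> 0"
  shows "card {rho k v |k. k \<in> Kp} = card RI"
    and "x \<in> {rho k v |k. k \<in> Kp} \<Longrightarrow> x \<noteq> v \<Longrightarrow> \<exists>k\<in>Kp - K. x = rho k v"
proof -
  show "\<exists>k\<in>Kp - K. x = rho k v" if "x \<in> {rho k v |k. k \<in> Kp}" "x \<noteq> v"
    using that Fx_rho[OF v(1)] by blast
  define \<pi> :: 'f where "\<pi> = unif powi c"
  have pi: "\<pi> \<noteq> 0" "val \<pi> = c" unfolding \<pi>_def by (simp, rule val_unif_powi)
  have piP: "\<pi> * x \<in> P n \<longleftrightarrow> x \<in> P (n - c)" for x n by (simp add: \<pi>_def unif_powi_mult_P)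
  let ?f = "\<lambda>r. rho (Lo (\<pi> * r)) v"
  have Lo_add: "Lo x ** Lo y = Lo (x + y)" for x y :: 'f by (simp add: Lo_def)
  have "?f ` RI = {rho k v |k. k \<in> Kp}"
  proof (intro subset_antisym subsetI)
    fix x assume "x \<in> ?f ` RI"
    then obtain r where r: "x = ?f r" "r \<in> RI" by blast
    have "Lo (\<pi> * r) \<in> Kp" using RI_P[OF r(2)] by (simp add: piP)
    then show "x \<in> {rho k v |k. k \<in> Kp}" using r(1) by blast
  next
    fix x assume "x \<in> {rho k v |k. k \<in> Kp}"
    then obtain k where k: "x = rho k v" "k \<in> Kp" by blast
    have "0 + (c - 1) \<ge> 1" using c2 by simp
    obtain x' a d y where kd: "k = Lo y ** Dg a d ** U x'" "unit a" "unit d" "x' \<in> P 0" "y \<in> P (c - 1)"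
      by (rule Kg_decomp[OF k(2) \<open>0 + (c - 1) \<ge> 1\<close>]) (auto intro: that)
    have yP: "y / \<pi> \<in> P (- 1)" using kd(5) pi by (cases "y = 0") (auto simp: P_iff val_divide)
    obtain r where r: "r \<in> RI" "Ea 0 (y / \<pi>) r" using RI yP by (auto simp: transv_def)
    have "y - \<pi> * r = \<pi> * (y / \<pi> - r)" using pi(1) by (simp add: algebra_simps)
    then have "y - \<pi> * r \<in> P c" using r(2) by (simp add: piP Ea_def)
    then have f: "rho (Lo (y - \<pi> * r)) v = v" by (intro Fx_rho[OF v(1)]) simp
    have "x = rho (Lo y) (rho (Dg a d) (rho (U x') v))" unfolding k(1) kd(1) by (simp only: rho_mult matrix_mul_assoc)
    also have "\<dots> = rho (Lo y) v" using kd Fx_rho[OF v(1), of "U x'"] Fx_rho[OF v(1), of "Dg a d"] by simp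
    also have "\<dots> = rho (Lo (\<pi> * r)) (rho (Lo (y - \<pi> * r)) v)" by (simp add: rho_mult Lo_add)
    finally have "x = ?f r" by (simp only: f)
    then show "x \<in> ?f ` RI" using r(1) by blast
  qed
  moreover have "inj_on ?f RI"
  proof (rule inj_onI)
    fix r r' assume r: "r \<in> RI" "r' \<in> RI" "?f r = ?f r'"
    have "rho (Lo (\<pi> * (r - r'))) v = rho (Lo (- (\<pi> * r'))) (?f r)"
      by (simp add: rho_mult Lo_add algebra_simps)
    also have "\<dots> = v" unfolding r(3) by (simp add: rho_mult Lo_add) (simp add: Lo_def mat_mat2[symmetric])
    finally have f: "rho (Lo (\<pi> * (r - r'))) v = v" .
    show "r = r'"
    proof (rule ccontr)
      assume "r \<noteq> r'"
      then have n: "r - r' \<notin> P 0" using RI r by (auto simp: transv_def Ea_def)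
      have rP: "r - r' \<in> P (- 1)" using RI_P r by (simp add: P_diff)
      have rr: "r - r' \<noteq> 0" "val (r - r') = - 1" using n rP by (auto simp: P_iff)
      have Lov: "rho (Lo y) v = v" if y: "y \<in> P (c - 1)" for y
      proof (cases "y \<in> P c")
        case True
        then show ?thesis by (intro Fx_rho[OF v(1)]) simp
      next
        case False
        define u where "u = y / (\<pi> * (r - r'))"
        have y0: "y \<noteq> 0" "val y = c - 1" using y False by (auto simp: P_iff)
        have u: "unit u" using y0 pi rr by (simp add: u_def unit_val val_divide val_mult)
        have uy: "u * (\<pi> * (r - r')) = y" using pi(1) rr(1) by (simp add: u_def)
        have "Lo y = Dg 1 u ** Lo (\<pi> * (r - r')) ** Dg 1 (1 / u)"
          using unit_nz[OF u] uy by (simp add: Lo_def Dg_def)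
        then have "rho (Lo y) v = rho (Dg 1 u) (rho (Lo (\<pi> * (r - r'))) (rho (Dg 1 (1 / u)) v))"
          by (simp only: rho_mult matrix_mul_assoc)
        then show ?thesis
          using f Fx_rho[OF v(1), of "Dg 1 u"] Fx_rho[OF v(1), of "Dg 1 (1 / u)"] u unit_divide[OF unit_1 u] by simp
      qed
      have "v \<in> Fx Kp"
      proof (rule Fx_Kg_I)
        show "1 \<le> 0 + (c - 1)" using c2 by simp
        show "v \<in> W" by (rule Fx_W[OF v(1)])
        show "rho (U x) v = v" if "x \<in> P 0" for x by (rule Fx_rho[OF v(1)]) (use that in simp)
        show "rho (Lo y) v = v" if "y \<in> P (c - 1)" for y by (rule Lov[OF that])
        show "rho (Dg a d) v = v" if "unit a" "unit d" for a d by (rule Fx_rho[OF v(1)]) (use that in simp)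
      qed
      then show False using old_zero v(2) by blast
    qed
  qed
  ultimately show "card {rho k v |k. k \<in> Kp} = card RI" using card_image by metis
qed

text \<open>\<open>T g\<close> is applied to the vanishing sum over the \<open>Kp\<close>-orbit of
  \<open>v\<close>: the term of \<open>v\<close> contributes \<open>rho g v\<close>, and all other
  terms agree by \<open>Kp_coset_T\<close>.\<close>

lemma exceptional_sum:
  assumes g: "invertible g" "\<And>k. k \<in> K \<Longrightarrow> \<exists>k'\<in>K. g ** k = k' ** g"
    and v: "v \<in> Fx K" "v \<noteq> 0" and k: "k \<in> Kp - K" and gv: "rho g v \<in> Fx K"
  shows "sc (of_nat (card RI - 1)) (T (g ** k) v) = - rho g v"
proof -
  let ?B = "{rho k v |k. k \<in> Kp}"
  have fin: "finite ?B" and z: "(\<Sum>x\<in>?B. x) = 0" using orbit_sum_zero[of v Kp] Fx_W[OF v(1)] by auto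
  have "mat 1 \<in> Kp" by simp
  then have vB: "v \<in> ?B" by (metis (mono_tags, lifting) mem_Collect_eq rho_one)
  have kinv: "invertible k" if "k \<in> Kp" for k using Kg_inv[OF that] c2 by simp
  have BW: "x \<in> W" if "x \<in> ?B" for x using that W_rho[OF kinv Fx_W[OF v(1)]] by blast
  have 1: "0 = T g (\<Sum>x\<in>?B. x)" using z eK_fix[OF Fx_0] by simp
  have 2: "T g (\<Sum>x\<in>?B. x) = (\<Sum>x\<in>?B. T g x)" unfolding rho_sum
    by (rule eK_sum[OF fin]) (rule W_rho[OF g(1) BW])
  have 3: "(\<Sum>x\<in>?B. T g x) = T g v + (\<Sum>x\<in>?B - {v}. T g x)" by (rule sum.remove[OF fin vB])
  have 4: "T g v = rho g v" by (rule eK_fix[OF gv])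
  have 5: "(\<Sum>x\<in>?B - {v}. T g x) = (\<Sum>x\<in>?B - {v}. T (g ** k) v)"
  proof (rule sum.cong[OF refl])
    fix x assume "x \<in> ?B - {v}"
    then obtain k' where k': "k' \<in> Kp - K" "x = rho k' v" using Kp_orbit(2)[OF v] by auto
    have "T g x = T (g ** k') v" by (simp add: k'(2) rho_mult)
    then show "T g x = T (g ** k) v"
      using Kp_coset_T[OF g v(1), of k] Kp_coset_T[OF g v(1), of k'] k k'(1) by simp
  qed
  have card: "card (?B - {v}) = card RI - 1" using card_Diff_singleton[OF vB] Kp_orbit(1)[OF v] by simp
  have 6: "(\<Sum>x\<in>?B - {v}. T (g ** k) v) = sc (of_nat (card RI - 1)) (T (g ** k) v)"
    using sum_const_sc[of "T (g ** k) v" "?B - {v}"] by (simp only: card)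
  have "0 = rho g v + sc (of_nat (card RI - 1)) (T (g ** k) v)"
    by (rule trans[OF 1 trans[OF 2 trans[OF 3]]]) (rule arg_cong2[where f = plus, OF 4 trans[OF 5 6]])
  from minus_unique[OF this[symmetric]] show ?thesis by (rule sym)
qed

text \<open>\<open>exceptional_sum\<close> is used twice: for \<open>\<omega>\<close> and
  \<open>k\<close> at \<open>v\<close>, and for the identity and the inverse of \<open>k\<close> at
  \<open>rho \<omega> v\<close>. Both sums equal \<open>- rho \<omega> v\<close>, and up to a scalar
  the second operator belongs to the inverse of \<open>\<omega> ** k\<close>.\<close>

lemma T_exceptional:
  assumes v: "v \<in> Fx K" and k: "k \<in> Kp - K"
  shows "T (\<omega> ** k) v = T (inv2 (\<omega> ** k)) v"
proof (cases "v = 0")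
  case False
  have kinv: "invertible k" using k Kg_inv[of k 0 "c - 1"] c2 by simp
  have ik: "inv2 k \<in> Kp - K"
  proof -
    have "inv2 k \<in> Kp" using k Kg_inv2[of k 0 "c - 1"] c2 by simp
    moreover have "inv2 k \<notin> K"
    proof
      assume "inv2 k \<in> K"
      then have "inv2 (inv2 k) \<in> K" by (rule K_inv2)
      then show False using k inv2_inv2[OF kinv] by simp
    qed
    ultimately show ?thesis by simp
  qed
  let ?v = "rho \<omega> v"
  have v1: "?v \<in> Fx K" by (rule rho_omega_Fx[OF v])
  have v1nz: "?v \<noteq> 0"
  proof
    assume "?v = 0"
    then have "rho (inv2 \<omega>) (rho \<omega> v) = 0" by simp
    then show False using False by (simp add: rho_inv2 omega_inv)
  qed
  have 1: "sc (of_nat (card RI - 1)) (T (\<omega> ** k) v) = - ?v"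
    by (rule exceptional_sum[OF omega_inv omega_conj(2) v False k v1])
  have "sc (of_nat (card RI - 1)) (T (mat 1 ** inv2 k) ?v) = - rho (mat 1) ?v"
    by (rule exceptional_sum[OF _ _ v1 v1nz ik]) (use v1 in auto)
  then have 2: "sc (of_nat (card RI - 1)) (T (inv2 k ** \<omega>) v) = - ?v" by (simp add: rho_mult)
  have n: "of_nat (card RI - 1) \<noteq> (0 :: complex)"
  proof
    assume "of_nat (card RI - 1) = (0 :: complex)"
    then have "- ?v = 0" using 1 by simp
    then show False using v1nz by simp
  qed
  have iw: "inv2 \<omega> = mat (1 / unif powi c) ** \<omega>" by (simp add: \<omega>_def inv2_mat2 mat_mat2)
  have "inv2 (\<omega> ** k) = inv2 k ** (mat (1 / unif powi c) ** \<omega>)" unfolding inv2_mm[OF omega_inv kinv] iw ..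
  also have "\<dots> = mat (1 / unif powi c) ** (inv2 k ** \<omega>)"
    by (cases "inv2 k" rule: mat2_cases) (simp add: mat_mat2 \<omega>_def)
  finally have "T (inv2 (\<omega> ** k)) v = T (inv2 k ** \<omega>) v" using T_scalar[OF _ Fx_W[OF v]] by simp
  moreover have "sc (of_nat (card RI - 1)) (T (\<omega> ** k) v - T (inv2 k ** \<omega>) v) = 0"
    using 1 2 by (simp add: sc_diff)
  ultimately show ?thesis using n by (simp add: sc_eq_0)
qed (simp)

subsection \<open>The operators of inverse elements coincide\<close>

text \<open>The four vanishing lemmas cover every pattern of valuations except a determinant outside
  \<open>P 1\<close> with \<open>val \<gamma> = 1\<close> and \<open>val \<beta> = 1 - c\<close>. In
  that case the matrix is a scalar times \<open>\<omega> ** k\<close> with \<open>k\<close> in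
  \<open>Kp\<close> outside \<open>K\<close>.\<close>

lemma T_reduced:
  assumes v: "v \<in> Fx K" and inv: "\<delta> - \<beta> * \<gamma> \<noteq> 0" and h: "\<gamma> \<in> P 1" "\<delta> \<in> P 1" "\<beta> \<in> P (1 - c)"
  shows "T (mat2 1 \<beta> \<gamma> \<delta>) v = T (inv2 (mat2 1 \<beta> \<gamma> \<delta>)) v"
proof (cases "\<delta> - \<beta> * \<gamma> \<in> P 1")
  case True
  show ?thesis
  proof (cases "\<gamma> * \<gamma> \<in> P (c + 1)")
    case g: True
    show ?thesis using vanish_1[OF v inv True g] by simp
  next
    case g: False
    have "\<beta> * \<beta> \<in> P (1 - c)"
    proof (rule ccontr)
      assume b: "\<beta> * \<beta> \<notin> P (1 - c)"
      have bg: "\<beta> \<noteq> 0" "\<gamma> \<noteq> 0" using b g by auto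
      have "val \<beta> + val \<beta> < 1 - c" "val \<gamma> + val \<gamma> < c + 1" using b g bg by (auto simp: P_iff val_mult)
      then have "val (\<beta> * \<gamma>) \<le> 0" using bg by (simp add: val_mult)
      then have "\<beta> * \<gamma> \<notin> P 1" using bg by (simp add: P_iff)
      moreover have "\<beta> * \<gamma> = \<delta> - (\<delta> - \<beta> * \<gamma>)" by simp
      ultimately show False using P_diff[OF h(2) True] by simp
    qed
    then show ?thesis using vanish_2[OF v inv True] by simp
  qed
next
  case False
  have bgn: "\<beta> * \<gamma> \<notin> P 1" using False P_diff[OF h(2), of "\<beta> * \<gamma>"] by blast
  then have bg: "\<beta> \<noteq> 0" "\<gamma> \<noteq> 0" "val \<beta> + val \<gamma> \<le> 0" by (auto simp: P_iff val_mult)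
  have vb: "1 - c \<le> val \<beta>" and vg: "1 \<le> val \<gamma>" using h bg by (auto simp: P_iff)
  have b0: "\<beta> \<notin> P 0" and gc: "\<gamma> \<notin> P c" using bg vb vg by (auto simp: P_iff)
  show ?thesis
  proof (cases "\<gamma> \<in> P 2 \<and> \<gamma> * \<delta> / \<beta> \<in> P (c + 1)")
    case True
    then show ?thesis using vanish_3[OF v inv _ b0 h(2)] by simp
  next
    case n3: False
    show ?thesis
    proof (cases "\<beta> \<in> P (2 - c) \<and> \<beta> * \<delta> / \<gamma> \<in> P (1 - c)")
      case True
      then show ?thesis using vanish_4[OF v inv gc _ h(2)] by simp
    next
      case n4: False
      have "val \<gamma> = 1 \<and> val \<beta> = 1 - c"
      proof (cases "\<delta> = 0")
        case True
        then show ?thesis using n3 n4 bg vb vg by (auto simp: P_iff)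
      next
        case d: False
        have vd: "1 \<le> val \<delta>" using h(2) d by (simp add: P_iff)
        have v1: "\<gamma> * \<delta> / \<beta> \<in> P (c + 1) \<longleftrightarrow> c + 1 \<le> val \<gamma> + val \<delta> - val \<beta>"
          "\<beta> * \<delta> / \<gamma> \<in> P (1 - c) \<longleftrightarrow> 1 - c \<le> val \<beta> + val \<delta> - val \<gamma>"
          "\<gamma> \<in> P 2 \<longleftrightarrow> 2 \<le> val \<gamma>" "\<beta> \<in> P (2 - c) \<longleftrightarrow> 2 - c \<le> val \<beta>"
          using bg d by (simp_all add: P_iff val_mult val_divide)
        show ?thesis using n3 n4 bg(3) vb vg vd unfolding v1 by linarith
      qed
      then have e: "val \<gamma> = 1" "val \<beta> = 1 - c" by auto
      define \<pi> :: 'f where "\<pi> = unif powi c"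
      have pi: "\<pi> \<noteq> 0" "val \<pi> = c" unfolding \<pi>_def by (simp, rule val_unif_powi)
      let ?k = "mat2 (\<gamma> / (\<pi> * \<beta>)) (\<delta> / (\<pi> * \<beta>)) (1 / \<beta>) 1"
      have "\<delta> / (\<pi> * \<beta>) \<in> P 0" using h(2) bg pi e by (cases "\<delta> = 0") (auto simp: P_iff val_divide val_mult)
      then have k: "?k \<in> Kp - K" using bg pi e by (simp add: unit_val P_iff val_divide val_mult)
      have g: "mat2 1 \<beta> \<gamma> \<delta> = mat \<beta> ** (\<omega> ** ?k)"
        using bg pi(1) by (simp add: \<omega>_def \<pi>_def[symmetric] mat_mat2)
      have kinv: "invertible (\<omega> ** ?k)" using k Kg_inv[of ?k 0 "c - 1"] c2 omega_inv invertible_mm by simp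
      have "inv2 (mat \<beta>) = mat (1 / \<beta>)" using bg(1) by (simp add: mat_mat2 inv2_mat2)
      then have "inv2 (mat2 1 \<beta> \<gamma> \<delta>) = inv2 (\<omega> ** ?k) ** mat (1 / \<beta>)"
        unfolding g using inv2_mm[OF _ kinv, of "mat \<beta>"] bg(1) by simp
      then have "T (inv2 (mat2 1 \<beta> \<gamma> \<delta>)) v = T (inv2 (\<omega> ** ?k)) v"
        using rho_scalar(2)[of "1 / \<beta>" v] bg(1) Fx_W[OF v] by simp
      moreover have "T (mat2 1 \<beta> \<gamma> \<delta>) v = T (\<omega> ** ?k) v"
        unfolding g by (rule T_scalar[OF bg(1) Fx_W[OF v]])
      ultimately show ?thesis using T_exceptional[OF v k] by simp
    qed
  qed
qed

text \<open>Diagonal units on both sides turn the matrix into its adjugate, a scalar multiple of the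
  inverse. If the diagonal vanishes, the matrix itself is such a multiple.\<close>

lemma T_eqnorm:
  assumes v: "v \<in> Fx K" and inv: "\<alpha> * \<delta> - \<beta> * \<gamma> \<noteq> (0::'f)" and n: "nrm \<alpha> = nrm \<delta>"
  shows "T (mat2 \<alpha> \<beta> \<gamma> \<delta>) v = T (inv2 (mat2 \<alpha> \<beta> \<gamma> \<delta>)) v"
proof (cases "\<alpha> = 0")
  case True
  then have d: "\<delta> = 0" "\<beta> \<noteq> 0" "\<gamma> \<noteq> 0" using n inv by auto
  have "inv2 (mat2 \<alpha> \<beta> \<gamma> \<delta>) = mat (1 / (\<beta> * \<gamma>)) ** mat2 \<alpha> \<beta> \<gamma> \<delta>"
    using inv d True by (simp add: inv2_mat2 mat_mat2)
  then show ?thesis using T_scalar[OF _ Fx_W[OF v], of "1 / (\<beta> * \<gamma>)"] d by simp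
next
  case False
  let ?g = "mat2 \<alpha> \<beta> \<gamma> \<delta>"
  have d: "\<delta> \<noteq> 0" using False n by auto
  have u: "unit (\<alpha> / \<delta>)" "unit (\<delta> / \<alpha>)" using n d False by (auto simp: unit_def nrm_divide)
  have ginv: "invertible ?g" using inv by (simp add: invertible_mat2)
  have k: "Dg 1 (- (\<alpha> / \<delta>)) \<in> K" "Dg (\<delta> / \<alpha>) (- 1) \<in> K" using u by simp_all
  have "inv2 ?g = mat (1 / (\<alpha> * \<delta> - \<beta> * \<gamma>)) ** (Dg 1 (- (\<alpha> / \<delta>)) ** ?g ** Dg (\<delta> / \<alpha>) (- 1))"
    using inv d False by (simp add: inv2_mat2 mat_mat2 Dg_def)
  then have "T (inv2 ?g) v = T (Dg 1 (- (\<alpha> / \<delta>)) ** ?g ** Dg (\<delta> / \<alpha>) (- 1)) v"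
    using T_scalar[OF _ Fx_W[OF v], of "1 / (\<alpha> * \<delta> - \<beta> * \<gamma>)"] inv by simp
  also have "\<dots> = T (Dg 1 (- (\<alpha> / \<delta>)) ** ?g) v" by (rule T_right[OF v k(2)])
  also have "\<dots> = T ?g v" by (rule T_left[OF k(1) ginv Fx_W[OF v]])
  finally show ?thesis ..
qed

lemma nrm_add_eq: "nrm x < nrm y \<Longrightarrow> nrm (x + y) = nrm y" for x y :: 'f
proof -
  assume h: "nrm x < nrm y"
  have "nrm (x + y) \<le> nrm y" using nrm_add_le[of x y] h by simp
  moreover have "nrm y \<le> max (nrm (x + y)) (nrm x)" using nrm_add_le[of "x + y" "- x"] by simp
  ultimately show ?thesis using h by auto
qed

text \<open>If \<open>\<gamma>\<close> or \<open>\<beta>\<close> is large enough, an elementary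
  matrix in \<open>K\<close> replaces \<open>\<delta>\<close> by \<open>\<delta> + \<alpha>\<close>,
  which has the norm of \<open>\<alpha>\<close>. Otherwise division by \<open>\<alpha>\<close>
  produces the shape required by \<open>T_reduced\<close>.\<close>

lemma T_gtnorm:
  assumes v: "v \<in> Fx K" and inv: "\<alpha> * \<delta> - \<beta> * \<gamma> \<noteq> (0::'f)" and n: "nrm \<delta> < nrm \<alpha>"
  shows "T (mat2 \<alpha> \<beta> \<gamma> \<delta>) v = T (inv2 (mat2 \<alpha> \<beta> \<gamma> \<delta>)) v"
proof -
  let ?g = "mat2 \<alpha> \<beta> \<gamma> \<delta>"
  have ginv: "invertible ?g" using inv by (simp add: invertible_mat2)
  have a: "\<alpha> \<noteq> 0" using n by auto
  consider (1) "nrm \<alpha> \<le> nrm \<gamma>" | (2) "\<beta> \<noteq> 0" "\<alpha> / \<beta> \<in> P c" | (3) "nrm \<gamma> < nrm \<alpha>" "\<beta> = 0 \<or> \<alpha> / \<beta> \<notin> P c" by linarith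
  then show ?thesis
  proof cases
    case 1
    then have g0: "\<gamma> \<noteq> 0" using a by auto
    have x: "\<alpha> / \<gamma> \<in> P 0" using 1 g0 by (simp add: P_def nrm_divide)
    have k: "U (\<alpha> / \<gamma>) \<in> K" using x by simp
    let ?h = "mat2 \<alpha> (\<alpha> * (\<alpha> / \<gamma>) + \<beta>) \<gamma> (\<delta> + \<alpha>)"
    have h: "?h = ?g ** U (\<alpha> / \<gamma>)" using g0 by (simp add: U_def add.commute)
    have hinv: "invertible ?h" unfolding h by (rule invertible_mm[OF ginv invertible_U])
    have "T ?h v = T (inv2 ?h) v"
      by (rule T_eqnorm[OF v]) (use hinv n nrm_add_eq in \<open>simp_all add: invertible_mat2\<close>)
    moreover have "T ?h v = T ?g v" unfolding h by (rule T_right[OF v k])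
    moreover have "T (inv2 ?h) v = T (inv2 ?g) v" unfolding h inv2_mm[OF ginv invertible_U]
      by (rule T_left[OF K_inv2[OF k] invertible_inv2[OF ginv] Fx_W[OF v]])
    ultimately show ?thesis by simp
  next
    case 2
    have k: "Lo (\<alpha> / \<beta>) \<in> K" using 2 by simp
    let ?h = "mat2 \<alpha> \<beta> (\<gamma> + \<alpha> * (\<alpha> / \<beta>)) (\<delta> + \<alpha>)"
    have h: "?h = Lo (\<alpha> / \<beta>) ** ?g" using 2 by (simp add: Lo_def add.commute)
    have hinv: "invertible ?h" unfolding h by (rule invertible_mm[OF invertible_Lo ginv])
    have "T ?h v = T (inv2 ?h) v"
      by (rule T_eqnorm[OF v]) (use hinv n nrm_add_eq in \<open>simp_all add: invertible_mat2\<close>)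
    moreover have "T ?h v = T ?g v" unfolding h by (rule T_left[OF k ginv Fx_W[OF v]])
    moreover have "T (inv2 ?h) v = T (inv2 ?g) v" unfolding h inv2_mm[OF invertible_Lo ginv]
      by (rule T_right[OF v K_inv2[OF k]])
    ultimately show ?thesis by simp
  next
    case 3
    let ?h = "mat2 1 (\<beta> / \<alpha>) (\<gamma> / \<alpha>) (\<delta> / \<alpha>)"
    have lt: "x / \<alpha> \<in> P 1" if "nrm x < nrm \<alpha>" for x
    proof -
      have "nrm (x / \<alpha>) < 1" using that a by (simp add: nrm_divide)
      then show ?thesis using max_ideal_P by (auto simp: max_ideal_def)
    qed
    have b: "\<beta> / \<alpha> \<in> P (1 - c)" using 3(2) a by (cases "\<beta> = 0") (auto simp: P_iff val_divide)
    have g: "?g = mat \<alpha> ** ?h" using a by (simp add: mat_mat2)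
    have "\<delta> / \<alpha> - \<beta> / \<alpha> * (\<gamma> / \<alpha>) = (\<alpha> * \<delta> - \<beta> * \<gamma>) / (\<alpha> * \<alpha>)" using a by (simp add: field_simps)
    then have hi: "\<delta> / \<alpha> - \<beta> / \<alpha> * (\<gamma> / \<alpha>) \<noteq> 0" using inv a by simp
    then have hinv: "invertible ?h" by (simp add: invertible_mat2)
    have "inv2 (mat \<alpha>) = mat (1 / \<alpha>)" using a by (simp add: mat_mat2 inv2_mat2)
    then have "inv2 ?g = inv2 ?h ** mat (1 / \<alpha>)" unfolding g using inv2_mm[OF _ hinv, of "mat \<alpha>"] a by simp
    then have "T (inv2 ?g) v = T (inv2 ?h) v" using rho_scalar(2)[of "1 / \<alpha>" v] a Fx_W[OF v] by simp
    moreover have "T ?g v = T ?h v" unfolding g by (rule T_scalar[OF a Fx_W[OF v]])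
    moreover have "T ?h v = T (inv2 ?h) v" by (rule T_reduced[OF v hi lt[OF 3(1)] lt[OF n] b])
    ultimately show ?thesis by simp
  qed
qed

text \<open>The case not yet covered is reduced to \<open>T_gtnorm\<close> by exchanging
  \<open>g\<close> with its inverse, whose diagonal is the swapped one up to a common
  factor.\<close>

lemma T_inv: assumes v: "v \<in> Fx K" and g: "invertible g" shows "T (inv2 g) v = T g v"
proof -
  obtain \<alpha> \<beta> \<gamma> \<delta> where gg: "g = mat2 \<alpha> \<beta> \<gamma> \<delta>" by (rule mat2_cases)
  let ?D = "\<alpha> * \<delta> - \<beta> * \<gamma>"
  have inv: "?D \<noteq> 0" using g by (simp add: gg invertible_mat2)
  consider "nrm \<alpha> = nrm \<delta>" | "nrm \<delta> < nrm \<alpha>" | "nrm \<alpha> < nrm \<delta>" by linarith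
  then show ?thesis
  proof cases
    case 1
    then show ?thesis unfolding gg by (rule T_eqnorm[OF v inv, symmetric])
  next
    case 2
    then show ?thesis unfolding gg by (rule T_gtnorm[OF v inv, symmetric])
  next
    case 3
    have ig: "inv2 g = mat2 (\<delta> / ?D) (- \<beta> / ?D) (- \<gamma> / ?D) (\<alpha> / ?D)" unfolding gg by (rule inv2_mat2[OF inv])
    have "invertible (inv2 g)" by (rule invertible_inv2[OF g])
    then have i: "\<delta> / ?D * (\<alpha> / ?D) - (- \<beta> / ?D) * (- \<gamma> / ?D) \<noteq> 0" unfolding ig invertible_mat2 .
    have "nrm (\<alpha> / ?D) < nrm (\<delta> / ?D)" using 3 inv by (simp add: nrm_divide divide_strict_right_mono)
    from T_gtnorm[OF v i this] show ?thesis unfolding ig[symmetric] inv2_inv2[OF g] .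
  qed
qed

subsection \<open>Commutativity and the dimension of the space of newforms\<close>

lemma T_T:
  assumes v: "v \<in> Fx K" and g: "invertible g" "invertible h" and m: "m \<ge> 1" "rho h v \<in> Fx (Kc m)"
  shows "T g (T h v) = sc (1 / of_nat (card (TR c m))) (\<Sum>r\<in>TR c m. T (g ** r ** h) v)"
proof -
  have vW: "v \<in> W" by (rule Fx_W[OF v])
  have W: "rho g (rho r (rho h v)) \<in> W" if "r \<in> TR c m" for r
    by (intro W_rho g K_inv TR_K[OF that] vW)
  let ?n = "1 / of_nat (card (TR c m)) :: complex"
  let ?S = "\<Sum>r\<in>TR c m. rho g (rho r (rho h v))"
  have fin: "finite (TR c m)" using TR[of m] by (simp add: transv_def)
  have SW: "?S \<in> W" by (rule W_sum) (rule W)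
  have "eK c ?S = (\<Sum>r\<in>TR c m. eK c (rho g (rho r (rho h v))))" by (rule eK_sum[OF fin W])
  moreover have "eK c (sc ?n ?S) = sc ?n (eK c ?S)" by (rule eK_sc[OF SW])
  moreover have "T g (T h v) = eK c (sc ?n ?S)" by (simp only: eK_eq[OF m(2,1)] eav_def rho_sc rho_sum)
  ultimately have "T g (T h v) = sc ?n (\<Sum>r\<in>TR c m. eK c (rho g (rho r (rho h v))))" by simp
  then show ?thesis by (simp only: rho_mult matrix_mul_assoc)
qed

text \<open>Gelfand's argument on the level of operators: \<open>T_inv\<close> inverts the two
  factors and then each product, and the average over \<open>K\<close> is unchanged when its
  variable is inverted.\<close>

lemma T_commute:
  assumes v: "v \<in> Fx K" and g: "invertible g" "invertible h"
  shows "T g (T h v) = T h (T g v)"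
proof -
  have vW: "v \<in> W" by (rule Fx_W[OF v])
  obtain m where m: "m \<ge> 1" "rho h v \<in> Fx (Kc m)" "rho (inv2 g) v \<in> Fx (Kc m)"
    using common_level[of "{rho h v, rho (inv2 g) v}"] W_rho[OF g(2) vW] W_rho[OF invertible_inv2[OF g(1)] vW] by auto
  let ?n = "1 / of_nat (card (TR c m)) :: complex"
  have 1: "T h (T g v) = T (inv2 h) (T (inv2 g) v)"
    using T_inv[OF v g(1)] T_inv[OF T_W[OF g(1) vW] g(2)] by simp
  have 2: "T (inv2 h) (T (inv2 g) v) = sc ?n (\<Sum>r\<in>TR c m. T (inv2 h ** r ** inv2 g) v)"
    by (rule T_T[OF v invertible_inv2[OF g(2)] invertible_inv2[OF g(1)] m(1,3)])
  have 3: "(\<Sum>r\<in>TR c m. T (inv2 h ** r ** inv2 g) v) = (\<Sum>r\<in>TR c m. T (g ** inv2 r ** h) v)"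
  proof (rule sum.cong[OF refl])
    fix r assume "r \<in> TR c m"
    then have r: "invertible r" by (intro K_inv TR_K)
    have "inv2 (g ** inv2 r ** h) = inv2 h ** r ** inv2 g"
      using inv2_mm[OF invertible_mm[OF g(1) invertible_inv2[OF r]] g(2)] inv2_mm[OF g(1) invertible_inv2[OF r]]
      by (simp add: inv2_inv2[OF r] matrix_mul_assoc)
    moreover have "invertible (g ** inv2 r ** h)" by (intro invertible_mm invertible_inv2 g r)
    ultimately show "T (inv2 h ** r ** inv2 g) v = T (g ** inv2 r ** h) v"
      using T_inv[OF v, of "g ** inv2 r ** h"] by simp
  qed
  have 4: "(\<Sum>r\<in>TR c m. T (g ** inv2 r ** h) v) = (\<Sum>r\<in>TR c m. T (g ** r ** h) v)"
  proof (rule transv_sum_reindex[OF equivp_Em TR, where b = inv2 and f = "\<lambda>r. T (g ** r ** h) v"])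
    show "inv2 k \<in> K" if "k \<in> K" for k by (rule K_inv2[OF that])
    show "Em m k k'" if "k \<in> K" "k' \<in> K" "Em m (inv2 k) (inv2 k')" for k k'
      using that(3) by (simp only: Em_inv[OF K_GO[OF that(1)] K_GO[OF that(2)]])
    show "T (g ** k ** h) v = T (g ** k' ** h) v" if "k \<in> K" "k' \<in> K" "Em m k k'" for k k'
      using Em_rho[OF that(3) K_GO[OF that(1)] m(2)] by (simp add: rho_mult[symmetric])
  qed
  have 5: "T g (T h v) = sc ?n (\<Sum>r\<in>TR c m. T (g ** r ** h) v)" by (rule T_T[OF v g m(1,2)])
  show ?thesis by (simp only: 1 2 3 4 5)
qed

text \<open>By \<open>cartan\<close> and \<open>eK_vanish\<close> only finitely many exponents
  \<open>j\<close> contribute, and for each of them the factors in \<open>GO\<close> produce finite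
  orbits. This bounds the dimension of the space of \<open>K\<close>-fixed vectors.\<close>

lemma T_finite: assumes "v \<in> W" shows "finite {T g v |g. invertible g}"
proof -
  obtain D where D: "\<And>j k1 k2. j \<ge> D \<Longrightarrow> k1 \<in> GO \<Longrightarrow> k2 \<in> GO \<Longrightarrow> eK c (rho (k1 ** Dg (unif powi int j) 1 ** k2) v) = 0"
    using eK_vanish[OF assms] by blast
  let ?O = "{rho k v |k. k \<in> GO}"
  let ?F = "\<Union>j<D. \<Union>x\<in>?O. {rho k (rho (Dg (unif powi int j) 1) x) |k. k \<in> GO}"
  have sub: "{T g v |g. invertible g} \<subseteq> insert 0 (eK c ` ?F)"
  proof clarify
    fix g :: "'f^2^2" assume g: "invertible g" and n: "T g v \<notin> eK c ` ?F"
    obtain a k1 k2 j where h: "a \<noteq> 0" "k1 \<in> GO" "k2 \<in> GO" "g = mat a ** (k1 ** Dg (unif powi int j) 1 ** k2)"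
      by (rule cartan[OF g])
    have e: "T g v = T (k1 ** Dg (unif powi int j) 1 ** k2) v" unfolding h(4) by (rule T_scalar[OF h(1) assms])
    show "T g v = 0"
    proof (cases "j < D")
      case True
      have "rho (k1 ** Dg (unif powi int j) 1 ** k2) v = rho k1 (rho (Dg (unif powi int j) 1) (rho k2 v))"
        by (simp add: rho_mult matrix_mul_assoc)
      moreover have "rho k1 (rho (Dg (unif powi int j) 1) (rho k2 v)) \<in> ?F"
      proof (rule UN_I)
        show "j \<in> {..<D}" using True by simp
        show "rho k1 (rho (Dg (unif powi int j) 1) (rho k2 v)) \<in>
            (\<Union>x\<in>?O. {rho k (rho (Dg (unif powi int j) 1) x) |k. k \<in> GO})"
          by (rule UN_I[of "rho k2 v"]) (use h in auto)
      qed
      ultimately have "T g v \<in> eK c ` ?F" unfolding e by simp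
      then show ?thesis using n by (rule notE[rotated])
    next
      case False
      then show ?thesis using D[of j k1 k2] h e by simp
    qed
  qed
  have "finite ?F"
  proof (intro finite_UN_I)
    show "finite {rho k (rho (Dg (unif powi int j) 1) x) |k. k \<in> GO}" if "x \<in> ?O" for j x
    proof (rule finite_orbit, rule W_rho)
      show "x \<in> W" using that W_rho[OF GO_inv assms] by blast
    qed simp
  qed (simp_all add: finite_orbit[OF assms])
  then show ?thesis by (intro finite_subset[OF sub] finite.insertI finite_imageI)
qed

inductive_set GS :: "('f ^ 2 ^ 2 \<Rightarrow> complex) \<Rightarrow> ('f ^ 2 ^ 2 \<Rightarrow> complex) set" for v
  where
    GS_0: "0 \<in> GS v"
  | GS_step: "w \<in> GS v \<Longrightarrow> invertible g \<Longrightarrow> w + sc z (rho g v) \<in> GS v"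

lemma GS_add: "w \<in> GS v \<Longrightarrow> x \<in> GS v \<Longrightarrow> x + w \<in> GS v"
proof (induction rule: GS.induct)
  case (GS_step w g z)
  show ?case unfolding add.assoc[symmetric] by (rule GS.GS_step[OF GS_step.IH[OF GS_step.prems] GS_step.hyps(2)])
qed simp

lemma GS_sc: "w \<in> GS v \<Longrightarrow> sc y w \<in> GS v"
proof (induction rule: GS.induct)
  case (GS_step w g z)
  show ?case unfolding sc_add sc_sc by (rule GS.GS_step[OF GS_step.IH GS_step.hyps(2)])
qed (simp add: GS.GS_0)

lemma GS_rho: "w \<in> GS v \<Longrightarrow> invertible h \<Longrightarrow> rho h w \<in> GS v"
proof (induction rule: GS.induct)
  case (GS_step w g z)
  show ?case unfolding rho_add rho_sc rho_mult
    by (rule GS.GS_step[OF GS_step.IH[OF GS_step.prems] invertible_mm[OF GS_step.prems GS_step.hyps(2)]])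
qed (simp add: GS.GS_0)

lemma GS_W: assumes "v \<in> W" "v \<noteq> 0" shows "GS v = W"
proof (rule irred)
  show "GS v \<subseteq> W"
  proof
    fix w assume "w \<in> GS v"
    then show "w \<in> W"
    proof (induction rule: GS.induct)
      case (GS_step w g z)
      show ?case by (rule W_add[OF GS_step.IH W_sc[OF W_rho[OF GS_step.hyps(2) assms(1)]]])
    qed (rule W_0)
  qed
  have "0 + sc 1 (rho (mat 1) v) \<in> GS v" by (rule GS.GS_step[OF GS.GS_0]) simp
  then show "GS v \<noteq> {0}" using assms(2) by auto
qed (auto intro: GS.GS_0 GS_add GS_sc GS_rho)

text \<open>Irreducibility writes \<open>w\<close> as a combination of translates of
  \<open>v\<close>; the average over \<open>K\<close> fixes \<open>w\<close> and turns the
  translates into \<open>T g v\<close>. The form of a closure rule allows it to be applied to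
  different subspaces \<open>F\<close>.\<close>

lemma Fx_spanned:
  assumes v: "v \<in> Fx K" "v \<noteq> 0" and w: "w \<in> Fx K"
    and F: "0 \<in> F" "\<And>x y. x \<in> F \<Longrightarrow> y \<in> F \<Longrightarrow> x + y \<in> F" "\<And>z x. x \<in> F \<Longrightarrow> sc z x \<in> F"
      "\<And>g. invertible g \<Longrightarrow> T g v \<in> F"
  shows "w \<in> F"
proof -
  have "w \<in> GS v" using GS_W[OF Fx_W[OF v(1)] v(2)] Fx_W[OF w] by simp
  then have "w \<in> W \<and> eK c w \<in> F"
  proof (induction rule: GS.induct)
    case GS_0
    show ?case using F(1) W_0 eK_fix[OF Fx_0] by simp
  next
    case (GS_step w g z)
    have g: "rho g v \<in> W" by (rule W_rho[OF GS_step.hyps(2) Fx_W[OF v(1)]])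
    then show ?case using GS_step.IH F(2)[OF _ F(3)[OF F(4)[OF GS_step.hyps(2)]]]
      by (simp add: W_add W_sc eK_add eK_sc)
  qed
  then show ?thesis using eK_fix[OF w] by simp
qed

text \<open>There are more powers than spanning vectors. Coinciding powers are treated apart, since
  linear dependence of a set sees each vector only once.\<close>

lemma dependent_powers:
  fixes w :: "'x \<Rightarrow> complex"
  assumes B: "finite B" and S: "\<And>i. (A ^^ i) w \<in> {(\<Sum>b\<in>B. sc (f b) b) |f. True}"
  shows "\<exists>p. p \<noteq> 0 \<and> papp A p w = 0"
proof -
  interpret vs: vector_space "sc :: complex \<Rightarrow> ('x \<Rightarrow> complex) \<Rightarrow> 'x \<Rightarrow> complex"
    by (rule vector_space.intro) (rule sc_add sc_add_left sc_sc sc_1)+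
  let ?n = "card B"
  let ?w = "\<lambda>i. (A ^^ i) w"
  have sp: "?w i \<in> vs.span B" for i
  proof -
    obtain f where f: "?w i = (\<Sum>b\<in>B. sc (f b) b)" using S[of i] by blast
    show ?thesis unfolding f by (intro vs.span_sum vs.span_scale vs.span_base)
  qed
  show ?thesis
  proof (cases "inj_on ?w {..?n}")
    case False
    then obtain i j where ij: "i \<noteq> j" "?w i = ?w j" by (auto simp: inj_on_def)
    let ?p = "monom 1 i - monom 1 j :: complex poly"
    have "coeff ?p i = 1" using ij(1) by simp
    then have "?p \<noteq> 0" by (intro notI) simp
    moreover have "papp A ?p w = 0"
    proof -
      let ?N = "max i j"
      have "degree ?p \<le> ?N" by (intro degree_diff_le) (auto intro: order_trans[OF degree_monom_le])
      then have "papp A ?p w = (\<Sum>k\<le>?N. sc (coeff ?p k) (?w k))" by (rule papp_le)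
      also have "\<dots> = (\<Sum>k\<le>?N. (if k = i then ?w k else 0)) - (\<Sum>k\<le>?N. (if k = j then ?w k else 0))"
        unfolding sum_subtractf[symmetric] by (rule sum.cong) (auto simp: sc_diff_left)
      also have "\<dots> = ?w i - ?w j" by (simp add: sum.delta)
      finally show ?thesis using ij(2) by simp
    qed
    ultimately show ?thesis by blast
  next
    case True
    let ?X = "?w ` {..?n}"
    have "card ?X = Suc ?n" using card_image[OF True] by simp
    then have "\<not> vs.independent ?X"
      using vs.independent_span_bound[OF B, of ?X] sp by auto
    then obtain u where u: "\<exists>x\<in>?X. u x \<noteq> 0" "(\<Sum>x\<in>?X. sc (u x) x) = 0"
      using vs.dependent_finite[of ?X] by auto
    define p where "p = (\<Sum>i\<le>?n. monom (u (?w i)) i)"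
    have cp: "coeff p k = (if k \<le> ?n then u (?w k) else 0)" for k
      by (simp add: p_def coeff_sum sum.delta)
    have "p \<noteq> 0"
    proof
      assume "p = 0"
      then have "u (?w k) = 0" if "k \<le> ?n" for k using cp[of k] that by simp
      then show False using u(1) by auto
    qed
    moreover have "papp A p w = 0"
    proof -
      have "degree p \<le> ?n" by (rule degree_le) (simp add: cp)
      then have "papp A p w = (\<Sum>k\<le>?n. sc (coeff p k) (?w k))" by (rule papp_le)
      also have "\<dots> = (\<Sum>k\<le>?n. sc (u (?w k)) (?w k))" by (rule sum.cong) (simp_all add: cp)
      also have "\<dots> = (\<Sum>x\<in>?X. sc (u x) x)" using sum.reindex[OF True, of "\<lambda>x. sc (u x) x"] by (simp only: comp_def)
      finally show ?thesis using u(2) by simp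
    qed
    ultimately show ?thesis by blast
  qed
qed

text \<open>An eigenspace of one operator is stable under all \<open>T h\<close> by commutativity,
  so by \<open>Fx_spanned\<close> it is the whole space. Hence all operators are scalars, while
  their values at \<open>v\<close> span.\<close>

theorem newform_unique:
  assumes v: "v \<in> Fx K" "v \<noteq> 0" and w: "w \<in> Fx K"
  shows "\<exists>z. w = sc z v"
proof -
  have scalar: "\<exists>z. T g v = sc z v" if g: "invertible g" for g
  proof -
    let ?B = "{T g v |g. invertible g}"
    let ?S = "{(\<Sum>b\<in>?B. sc (f b) b) |f. True}"
    have fin: "finite ?B" by (rule T_finite[OF Fx_W[OF v(1)]])
    have KS: "x \<in> ?S" if "x \<in> Fx K" for x
      using v that
    proof (rule Fx_spanned)
      show "0 \<in> ?S" by (auto intro!: exI[of _ "\<lambda>_. 0"])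
      show "x + y \<in> ?S" if xy: "x \<in> ?S" "y \<in> ?S" for x y
      proof -
        obtain f where f: "x = (\<Sum>b\<in>?B. sc (f b) b)" using xy by blast
        obtain h where h: "y = (\<Sum>b\<in>?B. sc (h b) b)" using xy by blast
        have "x + y = (\<Sum>b\<in>?B. sc (f b + h b) b)" unfolding f h by (simp add: sc_add_left sum.distrib)
        then show ?thesis by (intro CollectI exI[of _ "\<lambda>b. f b + h b"]) simp
      qed
      show "sc z x \<in> ?S" if x: "x \<in> ?S" for z x
      proof -
        obtain f where f: "x = (\<Sum>b\<in>?B. sc (f b) b)" using x by blast
        have "sc z x = (\<Sum>b\<in>?B. sc (z * f b) b)" unfolding f by (simp add: sc_sum)
        then show ?thesis by (intro CollectI exI[of _ "\<lambda>b. z * f b"]) simp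
      qed
      show "T h v \<in> ?S" if h: "invertible h" for h
      proof -
        have hB: "T h v \<in> ?B" by (rule CollectI, rule exI[of _ h], rule conjI[OF refl h])
        have "(\<Sum>b\<in>?B. sc (if b = T h v then 1 else 0) b) = (\<Sum>b\<in>?B. if b = T h v then b else 0)"
          by (rule sum.cong) auto
        also have "\<dots> = T h v" using fin hB by (simp add: sum.delta)
        finally show ?thesis by (intro CollectI exI[of _ "\<lambda>b. if b = T h v then 1 else 0"]) simp
      qed
    qed
    have TF: "T g x \<in> Fx K" if "x \<in> Fx K" for x by (rule T_W[OF g Fx_W[OF that]])
    have it: "(T g ^^ i) v \<in> Fx K" for i by (induction i) (use v TF in auto)
    obtain p where p: "p \<noteq> 0" "papp (T g) p v = 0" using dependent_powers[OF fin KS[OF it]] by blast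
    have "\<exists>x\<in>Fx K. x \<noteq> 0 \<and> (\<exists>z. T g x = sc z x)"
    proof (rule ex_eigenvector[OF _ _ v(1) _ _ _ v(2) p])
      show "T g (x + y) = T g x + T g y" if "x \<in> Fx K" "y \<in> Fx K" for x y
        using W_rho[OF g Fx_W[OF that(1)]] W_rho[OF g Fx_W[OF that(2)]] by (simp add: rho_add eK_add)
      show "T g (sc a x) = sc a (T g x)" if "x \<in> Fx K" for a x
        using W_rho[OF g Fx_W[OF that]] by (simp add: rho_sc eK_sc)
    qed (simp_all add: TF Fx_add Fx_sc)
    then obtain x z where x: "x \<in> Fx K" "x \<noteq> 0" "T g x = sc z x" by blast
    have "v \<in> {y \<in> Fx K. T g y = sc z y}"
      using x(1,2) v(1)
    proof (rule Fx_spanned)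
      show "0 \<in> {y \<in> Fx K. T g y = sc z y}" using eK_fix[OF Fx_0] by (simp add: Fx_0)
      show "a + b \<in> {y \<in> Fx K. T g y = sc z y}" if "a \<in> {y \<in> Fx K. T g y = sc z y}" "b \<in> {y \<in> Fx K. T g y = sc z y}" for a b
        using that W_rho[OF g Fx_W, of a K] W_rho[OF g Fx_W, of b K] by (simp add: rho_add eK_add sc_add Fx_add)
      show "sc y a \<in> {y \<in> Fx K. T g y = sc z y}" if "a \<in> {y \<in> Fx K. T g y = sc z y}" for y a
        using that W_rho[OF g Fx_W, of a K] by (simp add: rho_sc eK_sc Fx_sc mult.commute)
      show "T h x \<in> {y \<in> Fx K. T g y = sc z y}" if h: "invertible h" for h
        using T_commute[OF x(1) g h] T_W[OF h Fx_W[OF x(1)]] W_rho[OF h Fx_W[OF x(1)]] x(3)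
        by (simp add: rho_sc eK_sc)
    qed
    then show ?thesis by blast
  qed
  have "w \<in> {y. \<exists>z. y = sc z v}"
    using v w
  proof (rule Fx_spanned)
    show "0 \<in> {y. \<exists>z. y = sc z v}" by (auto intro: exI[of _ 0])
    show "a + b \<in> {y. \<exists>z. y = sc z v}" if "a \<in> {y. \<exists>z. y = sc z v}" "b \<in> {y. \<exists>z. y = sc z v}" for a b
      using that by (auto simp: sc_add_left[symmetric])
    show "sc y a \<in> {y. \<exists>z. y = sc z v}" if "a \<in> {y. \<exists>z. y = sc z v}" for y a
      using that by auto
    show "T g v \<in> {y. \<exists>z. y = sc z v}" if "invertible g" for g using scalar[OF that] by simp
  qed
  then show ?thesis by blast
qed

end

section \<open>The tree\<close>

lemma pgl_eq: "pgl A = {mat a ** A |a. a \<noteq> 0}"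
  by (auto simp: pgl_def r_coset_def scalar_matrices_def GL2_def)

lemma pgl_self: "A \<in> pgl A"
  unfolding pgl_eq by (intro CollectI exI[of _ 1]) simp

lemma mat_comm: "k ** mat a = mat a ** k" for a :: "'f::nonarch_local_field" and k :: "'f^2^2"
  by (cases k rule: mat2_cases) (simp add: mat_mat2 mult.commute)

lemma pgl_mat: assumes "a \<noteq> 0" shows "pgl (mat a ** A) = pgl A"
proof -
  have m: "mat b ** (mat a ** A) = mat (b * a) ** A" for b
    by (cases A rule: mat2_cases) (simp add: mat_mat2 mult.assoc)
  show ?thesis
  proof (intro subset_antisym subsetI)
    fix x assume "x \<in> pgl (mat a ** A)"
    then obtain b where "b \<noteq> 0" "x = mat b ** (mat a ** A)" by (auto simp: pgl_eq)
    then show "x \<in> pgl A" unfolding m using assms by (auto simp: pgl_eq)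
  next
    fix x assume "x \<in> pgl A"
    then obtain b where b: "b \<noteq> 0" "x = mat b ** A" by (auto simp: pgl_eq)
    then have "x = mat (b / a) ** (mat a ** A)" unfolding m using assms by simp
    then show "x \<in> pgl (mat a ** A)" using b assms by (auto simp: pgl_eq)
  qed
qed

definition vec2 :: "'a \<Rightarrow> 'a \<Rightarrow> 'a::zero ^ 2" where "vec2 a b = vector [a, b]"

lemma vec2_nth [simp]: "vec2 a b $ 1 = a" "vec2 a b $ 2 = b" by (simp_all add: vec2_def)

lemma vec2_eq_iff: "x = y \<longleftrightarrow> x $ 1 = y $ 1 \<and> x $ 2 = y $ 2" for x y :: "'a ^ 2"
  by (simp add: vec_eq_iff forall_2)

lemma mv_nth: "(A *v x) $ 1 = A$1$1 * x$1 + A$1$2 * x$2" "(A *v x) $ 2 = A$2$1 * x$1 + A$2$2 * x$2"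
  for A :: "'a::comm_ring_1 ^ 2 ^ 2"
  by (simp_all add: matrix_vector_mult_def sum_2)

lemma mv_mv: "A *v (B *v x) = (A ** B) *v x" for A B :: "'a::comm_ring_1 ^ 2 ^ 2"
  by (simp add: matrix_vector_mul_assoc)

lemma mv_image: "(*v) A ` ((*v) B ` L) = (*v) (A ** B) ` L" for A B :: "'a::comm_ring_1 ^ 2 ^ 2"
  by (simp add: image_image mv_mv)

lemma mat_mv: "mat a *v x = a *s x" for x :: "'a::comm_ring_1 ^ 2"
  by (simp add: vec2_eq_iff mv_nth mat_def)

lemma smult_image: "(*s) a ` L = (*v) (mat a) ` L" for L :: "('a::comm_ring_1 ^ 2) set"
  by (simp add: mat_mv)

lemma homothety_mem: "M \<in> homothety_class L \<longleftrightarrow> (\<exists>a. a \<noteq> 0 \<and> M = (*v) (mat a) ` L)"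
  by (auto simp: homothety_class_def smult_image)

lemma homothety_memI: "a \<noteq> 0 \<Longrightarrow> M = (*v) (mat a) ` L \<Longrightarrow> M \<in> homothety_class L"
  by (auto simp: homothety_mem)

lemma mat_mult: "mat a ** mat b = (mat (a * b) :: 'a::comm_ring_1 ^ 2 ^ 2)"
  by (simp add: mat_mat2)

lemma homothety_class_eqI: assumes "M \<in> homothety_class L" shows "homothety_class M = homothety_class L"
proof -
  obtain a where a: "a \<noteq> 0" "M = (*v) (mat a) ` L" using assms by (auto simp: homothety_mem)
  have "N \<in> homothety_class M \<longleftrightarrow> N \<in> homothety_class L" for N
  proof
    assume "N \<in> homothety_class M"
    then obtain b where "b \<noteq> 0" "N = (*v) (mat b) ` M" by (auto simp: homothety_mem)
    then have "b * a \<noteq> 0" "N = (*v) (mat (b * a)) ` L" using a by (simp_all add: mv_image mat_mult)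
    then show "N \<in> homothety_class L" by (rule homothety_memI)
  next
    assume "N \<in> homothety_class L"
    then obtain b where b: "b \<noteq> 0" "N = (*v) (mat b) ` L" by (auto simp: homothety_mem)
    then have "b / a \<noteq> 0" "N = (*v) (mat (b / a)) ` M" using a by (simp_all add: mv_image mat_mult)
    then show "N \<in> homothety_class M" by (rule homothety_memI)
  qed
  then show ?thesis by blast
qed

lemma homothety_self: "L \<in> homothety_class L"
  unfolding homothety_mem by (intro exI[of _ 1]) simp

abbreviation act :: "'f::nonarch_local_field ^ 2 ^ 2 \<Rightarrow> ('f ^ 2) set set \<Rightarrow> ('f ^ 2) set set"
  where "act A s \<equiv> act_vertex (pgl A) s"

lemma act_class: "act A (homothety_class L) = homothety_class ((*v) A ` L)"
proof (intro subset_antisym subsetI)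
  fix N assume "N \<in> act A (homothety_class L)"
  then obtain a b where "a \<noteq> 0" "b \<noteq> 0" "N = (*v) (mat a ** A) ` ((*v) (mat b) ` L)"
    by (auto simp: act_vertex_def pgl_eq homothety_mem)
  moreover have "mat a ** A ** mat b = mat (a * b) ** A" 
    by (cases A rule: mat2_cases) (simp add: mat_mat2 mult_ac)
  ultimately have "a * b \<noteq> 0" "N = (*v) (mat (a * b)) ` ((*v) A ` L)" by (simp_all add: mv_image)
  then show "N \<in> homothety_class ((*v) A ` L)" by (rule homothety_memI)
next
  fix N assume "N \<in> homothety_class ((*v) A ` L)"
  then obtain a where a: "a \<noteq> 0" "N = (*v) (mat a) ` ((*v) A ` L)" by (auto simp: homothety_mem)
  then have "mat a ** A \<in> pgl A" "N = (*v) (mat a ** A) ` L" by (auto simp: pgl_eq mv_image)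
  then show "N \<in> act A (homothety_class L)" using homothety_self unfolding act_vertex_def by blast
qed

definition Lat :: "int \<Rightarrow> ('f::nonarch_local_field ^ 2) set"
  where "Lat i = {x. x $ 1 \<in> P 0 \<and> x $ 2 \<in> P i}"

text \<open>The vertices of the apartment of the diagonal torus; \<open>Kg 0 n\<close> fixes those
  with index from 0 to \<open>n\<close>.\<close>

definition xv :: "int \<Rightarrow> ('f::nonarch_local_field ^ 2) set set"
  where "xv i = homothety_class (Lat i)"

lemma tree_vertices_eq: "(tree_vertices :: ('f::nonarch_local_field ^ 2) set set set) = {act A (xv 0) |A. invertible A}"
proof -
  have e: "{x :: 'f ^ 2. \<forall>i. x $ i \<in> carrier integer_ring} = Lat 0"
    by (auto simp: Lat_def carrier_integer_ring forall_2)
  have v: "tree_vertices = homothety_class ` {L :: ('f ^ 2) set. \<exists>A. invertible A \<and> L = (*v) A ` Lat 0}"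
    unfolding tree_vertices_def integer_lattice_def e ..
  show ?thesis
  proof (intro subset_antisym subsetI)
    fix s :: "('f ^ 2) set set" assume "s \<in> tree_vertices"
    then obtain A :: "'f^2^2" where "invertible A" "s = homothety_class ((*v) A ` Lat 0)" unfolding v by blast
    then show "s \<in> {act A (xv 0) |A. invertible A}" unfolding xv_def act_class by blast
  next
    fix s :: "('f ^ 2) set set" assume "s \<in> {act A (xv 0) |A. invertible A}"
    then obtain A :: "'f^2^2" where "invertible A" "s = homothety_class ((*v) A ` Lat 0)" unfolding xv_def act_class by blast
    then show "s \<in> tree_vertices" unfolding v by blast
  qed
qed

lemma vertex_class: assumes "s \<in> tree_vertices" obtains A where "invertible A" "s = homothety_class ((*v) A ` Lat 0)"
  using assms unfolding tree_vertices_eq xv_def act_class by blast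

lemma act_mult: "s \<in> tree_vertices \<Longrightarrow> act A (act B s) = act (A ** B) s"
  by (erule vertex_class) (simp add: act_class mv_image matrix_mul_assoc)

lemma act_one: "s \<in> tree_vertices \<Longrightarrow> act (mat 1) s = s"
  by (erule vertex_class) (simp add: act_class)

lemma act_vertices: "s \<in> tree_vertices \<Longrightarrow> invertible A \<Longrightarrow> act A s \<in> tree_vertices"
proof -
  assume s: "s \<in> tree_vertices" and A: "invertible A"
  obtain B where B: "invertible B" "s = homothety_class ((*v) B ` Lat 0)" using vertex_class[OF s] by blast
  then have "act A s = act (A ** B) (xv 0)" by (simp add: act_class xv_def mv_image)
  then show ?thesis using invertible_mm[OF A B(1)] unfolding tree_vertices_eq by blast
qed

lemma act_inv: assumes "s \<in> tree_vertices" "invertible A"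
  shows "act (inv2 A) (act A s) = s" "act A (act (inv2 A) s) = s"
  using assms by (simp_all add: act_mult inv2 act_one)

lemma xv_Dg: "xv i = act (Dg 1 (unif powi i)) (xv 0)"
proof -
  have "(*v) (Dg 1 (unif powi i)) ` Lat 0 = (Lat i :: ('a^2) set)"
  proof (intro subset_antisym subsetI)
    fix x :: "'a^2" assume "x \<in> (*v) (Dg 1 (unif powi i)) ` Lat 0"
    then show "x \<in> Lat i" by (auto simp: Lat_def Dg_def mv_nth unif_powi_mult_P simp del: power_int_of_nat)
  next
    fix x :: "'a^2" assume x: "x \<in> Lat i"
    have "unif powi i * (unif powi (- i) * x $ 2) = x $ 2" by (simp add: power_int_minus)
    then have "x = Dg 1 (unif powi i) *v vec2 (x $ 1) (unif powi (- i) * x $ 2)"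
      by (simp add: vec2_eq_iff Dg_def mv_nth)
    moreover have "vec2 (x $ 1) (unif powi (- i) * x $ 2) \<in> Lat 0"
      using x by (simp add: Lat_def unif_powi_mult_P del: power_int_minus)
    ultimately show "x \<in> (*v) (Dg 1 (unif powi i)) ` Lat 0" by blast
  qed
  then show ?thesis by (simp add: xv_def act_class)
qed

lemma xv_vertex: "xv i \<in> tree_vertices"
  unfolding tree_vertices_eq using xv_Dg[of i] by force

lemma Lat_add: "x \<in> Lat i \<Longrightarrow> y \<in> Lat i \<Longrightarrow> x + y \<in> Lat i" by (simp add: Lat_def P_add)
lemma Lat_smult: "x \<in> Lat i \<Longrightarrow> a \<in> P 0 \<Longrightarrow> a *s x \<in> Lat i" by (auto simp: Lat_def intro: P_mult_le)

lemma Kg_Lat: assumes "k \<in> Kg 0 n" "0 \<le> i" "i \<le> n" "1 \<le> n" shows "(*v) k ` Lat i = Lat i"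
proof -
  have sub: "(*v) k ` Lat i \<subseteq> Lat i" if "k \<in> Kg 0 n" for k :: "'a^2^2"
  proof
    fix y assume "y \<in> (*v) k ` Lat i"
    then obtain x where x: "x \<in> Lat i" "y = k *v x" by blast
    have h: "unit (k$1$1)" "unit (k$2$2)" "k$1$2 \<in> P 0" "k$2$1 \<in> P n" using that by (auto simp: Kg_def)
    have "k$1$1 * x$1 \<in> P 0" "k$2$2 * x$2 \<in> P i" using x(1) h by (simp_all add: Lat_def unit_mult_P)
    moreover have "k$1$2 * x$2 \<in> P 0" using h(3) x(1) assms(2) by (auto simp: Lat_def intro: P_mult_le)
    moreover have "k$2$1 * x$1 \<in> P i" using h(4) x(1) assms(3) by (auto simp: Lat_def intro: P_mult_le)
    ultimately show "y \<in> Lat i" by (simp add: x(2) Lat_def mv_nth P_add)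
  qed
  have ki: "inv2 k \<in> Kg 0 n" "invertible k" using Kg_inv2[OF assms(1)] Kg_inv[OF assms(1)] assms(4) by simp_all
  have "Lat i = (*v) k ` ((*v) (inv2 k) ` Lat i)" using ki(2) by (simp add: mv_image inv2)
  also have "\<dots> \<subseteq> (*v) k ` Lat i" by (rule image_mono[OF sub[OF ki(1)]])
  finally show ?thesis using sub[OF assms(1)] by blast
qed

lemma Kg_xv: "k \<in> Kg 0 n \<Longrightarrow> 0 \<le> i \<Longrightarrow> i \<le> n \<Longrightarrow> 1 \<le> n \<Longrightarrow> act k (xv i) = xv i"
  by (simp add: xv_def act_class Kg_Lat)

subsection \<open>Edges\<close>

lemma max_ideal_mult_Lat: "{a *s x |a x. a \<in> max_ideal \<and> x \<in> Lat i} = {x. x $ 1 \<in> P 1 \<and> x $ 2 \<in> P (i + 1)}"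
proof (intro subset_antisym subsetI)
  fix y :: "'a^2" assume "y \<in> {a *s x |a x. a \<in> max_ideal \<and> x \<in> Lat i}"
  then obtain a x where "y = a *s x" "a \<in> P 1" "x \<in> Lat i" by (auto simp: max_ideal_P)
  then show "y \<in> {x. x $ 1 \<in> P 1 \<and> x $ 2 \<in> P (i + 1)}" by (auto simp: Lat_def intro: P_mult_le)
next
  fix y :: "'a^2" assume y: "y \<in> {x. x $ 1 \<in> P 1 \<and> x $ 2 \<in> P (i + 1)}"
  have d: "z / unif \<in> P n" if "z \<in> P (n + 1)" for z :: 'a and n
    using that by (cases "z = 0") (auto simp: P_iff val_divide)
  have "vec2 (y$1 / unif) (y$2 / unif) \<in> Lat i" using y d[of _ 0] d[of _ i] by (simp add: Lat_def)
  moreover have "y = unif *s vec2 (y$1 / unif) (y$2 / unif)" by (simp add: vec2_eq_iff)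
  moreover have "unif \<in> max_ideal" by (simp add: max_ideal_P P_iff)
  ultimately show "y \<in> {a *s x |a x. a \<in> max_ideal \<and> x \<in> Lat i}" by blast
qed

lemma edge_std:
  fixes i :: int
  shows "tree_edge (xv i) (xv (i + 1) :: ('f::nonarch_local_field ^ 2) set set)"
proof -
  have "vec2 1 0 \<notin> {x::'f^2. x $ 1 \<in> P 1 \<and> x $ 2 \<in> P (i + 1)}" by (simp add: P_iff)
  moreover have "vec2 1 0 \<in> (Lat (i + 1) :: ('f^2) set)" by (simp add: Lat_def)
  moreover have "{x::'f^2. x $ 1 \<in> P 1 \<and> x $ 2 \<in> P (i + 1)} \<subseteq> Lat (i + 1)" by (auto simp: Lat_def intro: P_mono)
  ultimately have 1: "{a *s x |a x. a \<in> max_ideal \<and> x \<in> Lat i} \<subset> (Lat (i + 1) :: ('f^2) set)"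
    unfolding max_ideal_mult_Lat by blast
  have "vec2 0 (unif powi i) \<notin> (Lat (i + 1) :: ('f^2) set)" by (simp add: Lat_def del: power_int_of_nat)
  moreover have "vec2 0 (unif powi i) \<in> (Lat i :: ('f^2) set)" by (simp add: Lat_def del: power_int_of_nat)
  moreover have "Lat (i + 1) \<subseteq> (Lat i :: ('f^2) set)" by (auto simp: Lat_def intro: P_mono)
  ultimately have 2: "Lat (i + 1) \<subset> (Lat i :: ('f^2) set)" by blast
  have 3: "Lat i \<in> xv i" "Lat (i + 1) \<in> xv (i + 1)" by (simp_all add: xv_def homothety_self)
  show ?thesis unfolding tree_edge_def using 1 2 3 xv_vertex by blast
qed

lemma inj_mv: "invertible A \<Longrightarrow> inj ((*v) A)" for A :: "'a::field ^ 2 ^ 2"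
proof (rule injI)
  fix x y assume "invertible A" "A *v x = A *v y"
  then have "inv2 A *v (A *v x) = inv2 A *v (A *v y)" by simp
  then show "x = y" using \<open>invertible A\<close> by (simp add: mv_mv inv2)
qed

lemma scaled_image:
  fixes A :: "'f::nonarch_local_field ^ 2 ^ 2"
  shows "{a *s x |a x. a \<in> X \<and> x \<in> (*v) A ` L} = (*v) A ` {a *s x |a x. a \<in> X \<and> x \<in> L}"
proof -
  have e: "A *v (a *s x) = a *s (A *v x)" for a x by (simp add: vec2_eq_iff mv_nth algebra_simps)
  show ?thesis
  proof (intro subset_antisym subsetI)
    fix y assume "y \<in> {a *s x |a x. a \<in> X \<and> x \<in> (*v) A ` L}"
    then obtain a x where "y = A *v (a *s x)" "a \<in> X" "x \<in> L" unfolding e by blast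
    then show "y \<in> (*v) A ` {a *s x |a x. a \<in> X \<and> x \<in> L}" by blast
  next
    fix y assume "y \<in> (*v) A ` {a *s x |a x. a \<in> X \<and> x \<in> L}"
    then obtain a x where "y = A *v (a *s x)" "a \<in> X" "x \<in> L" by blast
    then show "y \<in> {a *s x |a x. a \<in> X \<and> x \<in> (*v) A ` L}" unfolding e by blast
  qed
qed

lemma edge_act: assumes "tree_edge s t" "invertible A" shows "tree_edge (act A s) (act A t)"
proof -
  obtain L M where LM: "L \<in> s" "M \<in> t" "{a *s x |a x. a \<in> max_ideal \<and> x \<in> L} \<subset> M" "M \<subset> L"
    and v: "s \<in> tree_vertices" "t \<in> tree_vertices" using assms(1) unfolding tree_edge_def by blast
  have m: "(*v) A ` L \<in> act A s" "(*v) A ` M \<in> act A t" using LM pgl_self unfolding act_vertex_def by blast+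
  note scaled_image[of max_ideal A L]
  moreover have st: "X \<subset> Y \<Longrightarrow> (*v) A ` X \<subset> (*v) A ` Y" for X Y
    by (simp add: image_strict_mono inj_on_subset[OF inj_mv[OF assms(2)]])
  ultimately have f: "{a *s x |a x. a \<in> max_ideal \<and> x \<in> (*v) A ` L} \<subset> (*v) A ` M" "(*v) A ` M \<subset> (*v) A ` L"
    using LM(3,4) by simp_all
  show ?thesis unfolding tree_edge_def
  proof (intro conjI)
    show "\<exists>L\<in>act A s. \<exists>M\<in>act A t. {c *s x |c x. c \<in> max_ideal \<and> x \<in> L} \<subset> M \<and> M \<subset> L"
      by (rule bexI[OF _ m(1)], rule bexI[OF _ m(2)], rule conjI[OF f])
  qed (rule act_vertices[OF v(1) assms(2)], rule act_vertices[OF v(2) assms(2)])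
qed

text \<open>After scaling, \<open>M\<close> lies strictly between \<open>unif\<close> times
  \<open>Lat k\<close> and \<open>Lat k\<close>, so it is a line over the residue field. A line
  other than the second axis is given by a slope \<open>b\<close>; the second axis leads to
  \<open>xv (k - 1)\<close>.\<close>

lemma edge_classify:
  fixes y :: "('f::nonarch_local_field ^ 2) set set"
  assumes e: "tree_edge (xv k) y"
  shows "(\<exists>b\<in>P k. y = act (Lo b) (xv (k + 1))) \<or> y = xv (k - 1)"
proof -
  obtain L M0 where LM: "L \<in> xv k" "M0 \<in> y" "{a *s x |a x. a \<in> max_ideal \<and> x \<in> L} \<subset> M0" "M0 \<subset> L"
    and v: "y \<in> tree_vertices" using e unfolding tree_edge_def by blast
  obtain a where a: "a \<noteq> 0" "L = (*v) (mat a) ` Lat k" using LM(1) by (auto simp: xv_def homothety_mem)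
  obtain A where A: "invertible A" "y = homothety_class ((*v) A ` Lat 0)" using vertex_class[OF v] by blast
  define M where "M = (*v) (mat (1 / a)) ` M0"
  have inva: "invertible (mat (1 / a) :: 'f^2^2)" using a(1) by simp
  have st: "X \<subset> Y \<Longrightarrow> (*v) (mat (1 / a)) ` X \<subset> (*v) (mat (1 / a)) ` Y" for X Y :: "('f^2) set"
    by (simp add: image_strict_mono inj_on_subset[OF inj_mv[OF inva]])
  have MM0: "M \<in> homothety_class M0" unfolding M_def homothety_mem using a(1) by (intro exI[of _ "1 / a"]) simp
  have yM0: "homothety_class M0 = y" using LM(2) unfolding A(2) by (rule homothety_class_eqI)
  have yM: "y = homothety_class M" using homothety_class_eqI[OF MM0] yM0 by simp
  have L': "(*v) (mat (1 / a)) ` L = Lat k" unfolding a(2) using a(1) by (simp add: mv_image mat_mult)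
  have MLat: "M \<subset> Lat k" using st[OF LM(4)] unfolding M_def L' .
  have "(*v) (mat (1 / a)) ` {b *s x |b x. b \<in> max_ideal \<and> x \<in> L} = {b *s x |b x. b \<in> max_ideal \<and> x \<in> Lat k}"
    using scaled_image[of max_ideal "mat (1 / a)" L] unfolding L' by simp
  then have mM: "{x. x $ 1 \<in> P 1 \<and> x $ 2 \<in> P (k + 1)} \<subset> M"
    using st[OF LM(3)] unfolding M_def max_ideal_mult_Lat by simp
  obtain B where B: "M = (*v) B ` Lat 0"
  proof -
    have "M \<in> homothety_class ((*v) A ` Lat 0)" using homothety_self[of M] yM A(2) by simp
    then obtain b where "M = (*v) (mat b) ` ((*v) A ` Lat 0)" unfolding homothety_mem by blast
    then show ?thesis using that[of "mat b ** A"] by (simp add: mv_image)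
  qed
  have Madd: "x + z \<in> M" if "x \<in> M" "z \<in> M" for x z
  proof -
    obtain x' z' where h: "x = B *v x'" "x' \<in> Lat 0" "z = B *v z'" "z' \<in> Lat 0" using \<open>x \<in> M\<close> \<open>z \<in> M\<close> unfolding B by blast
    have "x + z = B *v (x' + z')" by (simp add: h vec2_eq_iff mv_nth algebra_simps)
    then show ?thesis unfolding B using Lat_add h by blast
  qed
  have Msm: "b *s x \<in> M" if "x \<in> M" "b \<in> P 0" for x b
  proof -
    obtain x' where h: "x = B *v x'" "x' \<in> Lat 0" using \<open>x \<in> M\<close> unfolding B by blast
    have "b *s x = B *v (b *s x')" by (simp add: h vec2_eq_iff mv_nth algebra_simps)
    then show ?thesis unfolding B using Lat_smult[OF h(2) that(2)] by blast
  qed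
  have inM: "vec2 p q \<in> M" if "p \<in> P 1" "q \<in> P (k + 1)" for p q
  proof -
    have "vec2 p q \<in> {x. x $ 1 \<in> P 1 \<and> x $ 2 \<in> P (k + 1)}" using that by simp
    then show ?thesis using mM by blast
  qed
  have inL: "x $ 1 \<in> P 0" "x $ 2 \<in> P k" if "x \<in> M" for x
  proof -
    have "x \<in> Lat k" using MLat that by blast
    then show "x $ 1 \<in> P 0" "x $ 2 \<in> P k" by (simp_all add: Lat_def)
  qed
  have e2M: "vec2 0 q \<in> M" if d: "vec2 0 d \<in> M" "d \<noteq> 0" "val d = k" and q: "q \<in> P k" for d q
  proof -
    have "q / d \<in> P 0" using q d by (cases "q = 0") (auto simp: P_iff val_divide)
    then have "(q / d) *s vec2 0 d \<in> M" using Msm d(1) by blast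
    moreover have "(q / d) *s vec2 0 d = vec2 0 q" using d(2) by (simp add: vec2_eq_iff)
    ultimately show ?thesis by simp
  qed
  show ?thesis
  proof (cases "\<exists>m\<in>M. m $ 1 \<notin> P 1")
    case True
    then obtain m where m: "m \<in> M" "m $ 1 \<notin> P 1" by blast
    have um: "unit (m $ 1)" using m inL by (simp add: unit_P)
    have m0: "m $ 1 \<noteq> 0" by (rule unit_nz[OF um])
    define b where "b = m $ 2 / m $ 1"
    have b: "b \<in> P k" using inL[OF m(1)] unit_divide_P[OF um] by (simp add: b_def)
    \<comment> \<open>Otherwise \<open>M\<close> contains \<open>vec2 0 d\<close> with
      \<open>val d = k\<close>, and together with \<open>m\<close> this generates all of
      \<open>Lat k\<close>, although \<open>M\<close> is properly smaller.\<close>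
    have dP: "z $ 2 - b * z $ 1 \<in> P (k + 1)" if z: "z \<in> M" for z
    proof (rule ccontr)
      assume n: "z $ 2 - b * z $ 1 \<notin> P (k + 1)"
      let ?d = "z $ 2 - b * z $ 1"
      have q: "z $ 1 / m $ 1 \<in> P 0" using inL[OF z] unit_divide_P[OF um] by simp
      have "z + (- (z $ 1 / m $ 1)) *s m \<in> M" by (rule Madd[OF z Msm[OF m(1)]]) (use q in simp)
      moreover have "z + (- (z $ 1 / m $ 1)) *s m = vec2 0 ?d" using m0 by (simp add: vec2_eq_iff b_def)
      ultimately have dM: "vec2 0 ?d \<in> M" by simp
      have dk: "?d \<in> P k" using inL(2)[OF dM] by simp
      then have d: "?d \<noteq> 0" "val ?d = k" using n by (auto simp: P_iff)
      have "Lat k \<subseteq> M"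
      proof
        fix x :: "'f^2" assume x: "x \<in> Lat k"
        have "x $ 1 / m $ 1 \<in> P 0" using x unit_divide_P[OF um] by (simp add: Lat_def)
        then have 1: "(x $ 1 / m $ 1) *s m \<in> M" by (rule Msm[OF m(1)])
        have "x $ 2 - x $ 1 / m $ 1 * m $ 2 \<in> P k"
          using x 1 inL(2)[OF 1] by (intro P_diff) (simp_all add: Lat_def)
        then have "vec2 0 (x $ 2 - x $ 1 / m $ 1 * m $ 2) \<in> M" by (rule e2M[OF dM d])
        from Madd[OF 1 this] have "(x $ 1 / m $ 1) *s m + vec2 0 (x $ 2 - x $ 1 / m $ 1 * m $ 2) \<in> M" .
        moreover have "(x $ 1 / m $ 1) *s m + vec2 0 (x $ 2 - x $ 1 / m $ 1 * m $ 2) = x"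
          using m0 by (simp add: vec2_eq_iff)
        ultimately show "x \<in> M" by simp
      qed
      then show False using MLat by blast
    qed
    have "M = (*v) (Lo b) ` Lat (k + 1)"
    proof (intro subset_antisym subsetI)
      fix z assume z: "z \<in> M"
      have "z = Lo b *v vec2 (z $ 1) (z $ 2 - b * z $ 1)" by (simp add: vec2_eq_iff mv_nth Lo_def)
      moreover have "vec2 (z $ 1) (z $ 2 - b * z $ 1) \<in> Lat (k + 1)" using inL[OF z] dP[OF z] by (simp add: Lat_def)
      ultimately show "z \<in> (*v) (Lo b) ` Lat (k + 1)" by blast
    next
      fix z assume "z \<in> (*v) (Lo b) ` Lat (k + 1)"
      then obtain x where x: "z = Lo b *v x" "x $ 1 \<in> P 0" "x $ 2 \<in> P (k + 1)" by (auto simp: Lat_def)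
      have "x $ 1 / m $ 1 \<in> P 0" using x(2) unit_divide_P[OF um] by simp
      then have "(x $ 1 / m $ 1) *s m + vec2 0 (x $ 2) \<in> M" by (intro Madd Msm m(1) inM x(3)) simp_all
      moreover have "(x $ 1 / m $ 1) *s m + vec2 0 (x $ 2) = z"
        using m0 by (simp add: x(1) vec2_eq_iff mv_nth Lo_def b_def mult.commute)
      ultimately show "z \<in> M" by simp
    qed
    then have "y = act (Lo b) (xv (k + 1))" by (simp add: yM xv_def act_class)
    then show ?thesis using b by blast
  next
    case False
    obtain m where m: "m \<in> M" "\<not> (m $ 1 \<in> P 1 \<and> m $ 2 \<in> P (k + 1))" using mM by blast
    have m1: "m $ 1 \<in> P 1" using False m(1) by blast
    then have m2: "m $ 2 \<noteq> 0" "val (m $ 2) = k" using m(2) inL(2)[OF m(1)] by (auto simp: P_iff)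
    have "m + vec2 (- (m $ 1)) 0 \<in> M" using m1 by (intro Madd m(1) inM) simp_all
    moreover have "m + vec2 (- (m $ 1)) 0 = vec2 0 (m $ 2)" by (simp add: vec2_eq_iff)
    ultimately have mM': "vec2 0 (m $ 2) \<in> M" by simp
    have Meq: "M = {x. x $ 1 \<in> P 1 \<and> x $ 2 \<in> P k}"
    proof (intro subset_antisym subsetI)
      fix z assume "z \<in> M"
      then show "z \<in> {x. x $ 1 \<in> P 1 \<and> x $ 2 \<in> P k}" using False inL by blast
    next
      fix z :: "'f^2" assume z: "z \<in> {x. x $ 1 \<in> P 1 \<and> x $ 2 \<in> P k}"
      have "vec2 (z $ 1) 0 + vec2 0 (z $ 2) \<in> M" using z by (intro Madd inM e2M[OF mM' m2]) simp_all
      moreover have "vec2 (z $ 1) 0 + vec2 0 (z $ 2) = z" by (simp add: vec2_eq_iff)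
      ultimately show "z \<in> M" by simp
    qed
    have "M = (*v) (mat unif) ` Lat (k - 1)"
    proof -
      have "(*v) (mat unif) ` Lat (k - 1) = {a *s x |a (x :: 'f^2). a \<in> max_ideal \<and> x \<in> Lat (k - 1)}"
      proof (intro subset_antisym subsetI)
        fix z :: "'f^2" assume "z \<in> (*v) (mat unif) ` Lat (k - 1)"
        moreover have "unif \<in> (max_ideal :: 'f set)" by (simp add: max_ideal_P P_iff)
        ultimately show "z \<in> {a *s x |a x. a \<in> max_ideal \<and> x \<in> Lat (k - 1)}" unfolding smult_image[symmetric] by blast
      next
        fix z :: "'f^2" assume "z \<in> {a *s x |a x. a \<in> max_ideal \<and> x \<in> Lat (k - 1)}"
        then obtain a x where ax: "z = a *s x" "a \<in> P 1" "x \<in> Lat (k - 1)" by (auto simp: max_ideal_P)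
        have "a / unif \<in> P 0" using ax(2) by (cases "a = 0") (auto simp: P_iff val_divide)
        then have "(a / unif) *s x \<in> Lat (k - 1)" by (rule Lat_smult[OF ax(3)])
        moreover have "z = unif *s ((a / unif) *s x)" by (simp add: ax(1) vec2_eq_iff)
        ultimately show "z \<in> (*v) (mat unif) ` Lat (k - 1)" unfolding smult_image[symmetric] by blast
      qed
      then show ?thesis unfolding max_ideal_mult_Lat Meq by simp
    qed
    then have "M \<in> xv (k - 1)" unfolding xv_def homothety_mem by (intro exI[of _ unif]) simp
    then have "y = xv (k - 1)" unfolding yM xv_def by (rule homothety_class_eqI)
    then show ?thesis by blast
  qed
qed

subsection \<open>Paths\<close>

abbreviation actp :: "'f::nonarch_local_field ^ 2 ^ 2 \<Rightarrow> ('f ^ 2) set set list \<Rightarrow> ('f ^ 2) set set list"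
  where "actp A p \<equiv> map (act A) p"

definition xp :: "nat \<Rightarrow> ('f::nonarch_local_field ^ 2) set set list"
  where "xp k = map (\<lambda>i. xv (int i)) [0..<k + 1]"

lemma xp_Suc: "xp (Suc k) = xp k @ [xv (int (Suc k))]" by (simp add: xp_def)
lemma xp_0: "xp 0 = [xv 0]" by (simp add: xp_def)
lemma length_xp: "length (xp k) = k + 1" by (simp add: xp_def)
lemma nth_xp: "i \<le> k \<Longrightarrow> xp k ! i = xv (int i)" by (simp add: xp_def del: upt_Suc)
lemma butlast_xp: "butlast (xp (Suc k)) = xp k" by (simp add: xp_Suc)

text \<open>First coordinates force the homothety factor to be a unit; second coordinates then
  compare the exponents.\<close>

lemma xv_inj:
  assumes "xv i = (xv j :: ('f::nonarch_local_field ^ 2) set set)"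
  shows "i = j"
proof -
  have "Lat i \<in> (xv j :: ('f ^ 2) set set)" unfolding assms[symmetric] by (simp add: xv_def homothety_self)
  then obtain a :: 'f where a: "a \<noteq> 0" "Lat i = (*v) (mat a) ` Lat j" by (auto simp: xv_def homothety_mem)
  have sub: "mat a *v x \<in> Lat i" if "x \<in> Lat j" for x unfolding a(2) using that by blast
  have sup: "\<exists>x\<in>Lat j. y = mat a *v x" if "y \<in> Lat i" for y using that unfolding a(2) by blast
  have pw: "unif powi k \<noteq> (0::'f)" "val (unif powi k :: 'f) = k" for k by (simp, rule val_unif_powi)
  have "mat a *v vec2 1 0 \<in> Lat i" by (rule sub) (simp add: Lat_def)
  then have 1: "0 \<le> val a" using a(1) by (simp add: Lat_def mat_mv P_iff)
  obtain x where x: "x \<in> Lat j" "vec2 1 0 = mat a *v x" using sup[of "vec2 1 0"] by (auto simp: Lat_def)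
  have x1: "1 = a * x $ 1" using arg_cong[OF x(2), of "\<lambda>v. v $ 1"] by (simp add: mat_mv)
  then have "x $ 1 \<noteq> 0" by auto
  then have "val a + val (x $ 1) = 0" using val_mult[OF a(1), of "x $ 1"] x1 val_one by simp
  moreover have "0 \<le> val (x $ 1)" using x(1) \<open>x $ 1 \<noteq> 0\<close> by (simp add: Lat_def P_iff)
  ultimately have va: "val a = 0" using 1 by simp
  have "mat a *v vec2 0 (unif powi j) \<in> Lat i" by (rule sub) (simp add: Lat_def P_iff pw)
  then have "a * unif powi j \<in> P i" by (simp add: Lat_def mat_mv)
  then have 2: "i \<le> j" using a(1) pw va by (simp add: P_iff val_mult)
  have "vec2 0 (unif powi i) \<in> (Lat i :: ('f^2) set)" by (simp add: Lat_def P_iff pw)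
  then obtain y where y: "y \<in> Lat j" "vec2 0 (unif powi i) = mat a *v y" using sup by blast
  have y2: "unif powi i = a * y $ 2" using arg_cong[OF y(2), of "\<lambda>v. v $ 2"] by (simp add: mat_mv)
  then have "y $ 2 \<noteq> 0" using pw(1)[of i] by auto
  then have "val (y $ 2) = i" using val_mult[OF a(1), of "y $ 2"] y2 pw(2)[of i] va by simp
  then have "j \<le> i" using y(1) \<open>y $ 2 \<noteq> 0\<close> by (simp add: Lat_def P_iff)
  then show ?thesis using 2 by simp
qed

lemma act_inj: "s \<in> tree_vertices \<Longrightarrow> t \<in> tree_vertices \<Longrightarrow> invertible A \<Longrightarrow> act A s = act A t \<Longrightarrow> s = t"
  using act_inv(1) by metis

lemma tree_paths_mem:
  "p \<in> tree_paths k \<longleftrightarrow> length p = k + 1 \<and> distinct p \<and> set p \<subseteq> tree_vertices \<and> (\<forall>i<k. tree_edge (p ! i) (p ! (i + 1)))"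
  by (simp add: tree_paths_def)

lemma path_vertices: "p \<in> tree_paths k \<Longrightarrow> set p \<subseteq> tree_vertices" by (simp add: tree_paths_mem)

lemma actp_path: assumes "p \<in> tree_paths k" "invertible A" shows "actp A p \<in> tree_paths k"
proof -
  have v: "set p \<subseteq> tree_vertices" using assms(1) by (rule path_vertices)
  have "inj_on (act A) (set p)"
  proof (rule inj_onI)
    fix s t assume "s \<in> set p" "t \<in> set p" "act A s = act A t"
    then show "s = t" using act_inj[of s t A] v assms(2) by blast
  qed
  moreover have "set (actp A p) \<subseteq> tree_vertices" using v act_vertices[OF _ assms(2)] by auto
  moreover have "tree_edge (actp A p ! i) (actp A p ! (i + 1))" if "i < k" for i
    using assms(1) that edge_act[OF _ assms(2)] by (simp add: tree_paths_mem)
  ultimately show ?thesis using assms(1) by (simp add: tree_paths_mem distinct_map)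
qed

lemma actp_mult: "p \<in> tree_paths k \<Longrightarrow> actp A (actp B p) = actp (A ** B) p"
  using path_vertices[of p k] by (auto simp: act_mult)

lemma actp_one: "p \<in> tree_paths k \<Longrightarrow> actp (mat 1) p = p"
  using path_vertices[of p k] by (intro map_idI) (auto simp: act_one)

lemma actp_inv2: assumes "p \<in> tree_paths k" "invertible A"
  shows "actp (inv2 A) (actp A p) = p" "actp A (actp (inv2 A) p) = p"
  unfolding actp_mult[OF assms(1)] inv2[OF assms(2)] by (rule actp_one[OF assms(1)])+

lemma actp_scalar: "a \<noteq> 0 \<Longrightarrow> actp (mat a ** A) p = actp A p" by (simp add: pgl_mat)

lemma xp_path: "(xp k :: ('f::nonarch_local_field ^ 2) set set list) \<in> tree_paths k"
  unfolding tree_paths_mem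
proof (intro conjI allI impI)
  show "distinct (xp k :: ('f ^ 2) set set list)"
    unfolding xp_def by (auto simp: distinct_map inj_on_def simp del: upt_Suc dest: xv_inj)
  show "tree_edge (xp k ! i) (xp k ! (i + 1) :: ('f ^ 2) set set)" if "i < k" for i
  proof -
    have "xp k ! i = (xv (int i) :: ('f ^ 2) set set)" "xp k ! (i + 1) = (xv (int i + 1) :: ('f ^ 2) set set)"
      using that by (simp_all add: nth_xp add.commute)
    then show ?thesis by (simp only: edge_std of_nat_0_le_iff)
  qed
  show "set (xp k :: ('f ^ 2) set set list) \<subseteq> tree_vertices" by (auto simp: xp_def xv_vertex)
qed (rule length_xp)

lemma fix_xp: "B \<in> Kg 0 (int k) \<Longrightarrow> 1 \<le> k \<Longrightarrow> actp B (xp k) = xp k"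
  by (rule map_idI) (auto simp: xp_def Kg_xv simp del: upt_Suc)

text \<open>Once the initial part is standard, the last vertex is a neighbour of
  \<open>xv k\<close>. Injectivity of the path excludes the return to \<open>xv (k - 1)\<close>, and
  every other neighbour is reached from \<open>xv (k + 1)\<close> by some \<open>Lo b\<close> with
  \<open>b\<close> in \<open>P k\<close>, which fixes the initial part.\<close>

lemma path_transitive:
  fixes p :: "('f::nonarch_local_field ^ 2) set set list"
  assumes "p \<in> tree_paths k"
  shows "\<exists>A. invertible A \<and> p = actp A (xp k)"
  using assms
proof (induction k arbitrary: p)
  case 0
  then obtain s where "p = [s]" "s \<in> tree_vertices" by (auto simp: tree_paths_mem length_Suc_conv)
  then show ?case unfolding tree_vertices_eq xp_0 by auto
next
  case (Suc k)
  have len: "length p = Suc k + 1" and dist: "distinct p" and v: "set p \<subseteq> tree_vertices"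
    and e: "\<And>i. i < Suc k \<Longrightarrow> tree_edge (p ! i) (p ! (i + 1))" using Suc.prems by (auto simp: tree_paths_mem)
  have pne: "p \<noteq> []" using len by auto
  have lb: "length (butlast p) = k + 1" using len by simp
  have nb: "butlast p ! i = p ! i" if "i \<le> k" for i using that lb by (simp add: nth_butlast)
  have "butlast p \<in> tree_paths k"
    unfolding tree_paths_mem
  proof (intro conjI allI impI)
    show "length (butlast p) = k + 1" by (rule lb)
    show "distinct (butlast p)" using dist by (rule distinct_butlast)
    show "set (butlast p) \<subseteq> tree_vertices" using v in_set_butlastD by fast
    show "tree_edge (butlast p ! i) (butlast p ! (i + 1))" if "i < k" for i
      using e[of i] nb[of i] nb[of "i + 1"] that by simp
  qed
  then obtain A where A: "invertible A" "butlast p = actp A (xp k)" using Suc.IH by blast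
  have lastp: "last p = p ! Suc k" using len pne by (simp add: last_conv_nth)
  have lastv: "last p \<in> tree_vertices" using v pne by auto
  define y where "y = act (inv2 A) (last p)"
  have yv: "act A y = last p" unfolding y_def by (rule act_inv(2)[OF lastv A(1)])
  have pA: "p ! i = act A (xv (int i))" if "i \<le> k" for i
  proof -
    have "p ! i = butlast p ! i" by (rule nb[OF that, symmetric])
    also have "\<dots> = act A (xp k ! i)" unfolding A(2) using that by (simp add: length_xp)
    finally show ?thesis by (simp only: nth_xp[OF that])
  qed
  have "tree_edge (act A (xv (int k))) (last p)" using e[of k] pA[of k] lastp by simp
  then have "tree_edge (act (inv2 A) (act A (xv (int k)))) y" unfolding y_def
    by (rule edge_act[OF _ invertible_inv2[OF A(1)]])
  then have ed: "tree_edge (xv (int k)) y" using act_inv(1)[OF xv_vertex A(1)] by simp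
  have split: "p = butlast p @ [last p]" using pne by simp
  have key: "\<exists>B. invertible B \<and> actp B (xp k) = xp k \<and> act B (xv (int (Suc k))) = y"
    using edge_classify[OF ed]
  proof
    assume "\<exists>b\<in>P (int k). y = act (Lo b) (xv (int k + 1))"
    then obtain b where b: "b \<in> P (int k)" "y = act (Lo b) (xv (int k + 1))" by blast
    have "actp (Lo b) (xp k) = xp k"
    proof (cases "k = 0")
      case True
      have "Lo b \<in> GO" using b(1) True by (simp add: Lo_def)
      have "act (Lo b) (xv 0) = xv 0"
      proof -
        have sub: "(*v) (Lo d) ` Lat 0 \<subseteq> Lat 0" if "d \<in> P 0" for d :: 'f
        proof
          fix z assume "z \<in> (*v) (Lo d) ` Lat 0"
          then obtain x where x: "z = Lo d *v x" "x $ 1 \<in> P 0" "x $ 2 \<in> P 0" by (auto simp: Lat_def)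
          have "d * x $ 1 \<in> P 0" by (rule P_mult_le[OF that x(2)]) simp
          then show "z \<in> Lat 0" using x by (simp add: Lat_def mv_nth Lo_def P_add)
        qed
        have "Lat 0 = (*v) (Lo b) ` ((*v) (Lo (- b)) ` Lat 0)" by (simp add: mv_image Lo_def mat_mat2[symmetric])
        also have "\<dots> \<subseteq> (*v) (Lo b) ` Lat 0" by (rule image_mono, rule sub) (use b True in simp)
        finally have "(*v) (Lo b) ` Lat 0 = Lat 0" using sub[of b] b(1) True by auto
        then show ?thesis by (simp add: xv_def act_class)
      qed
      then show ?thesis using True by (simp add: xp_0)
    next
      case False
      then show ?thesis using b(1) by (intro fix_xp) auto
    qed
    then show ?thesis using b(2) by (intro exI[of _ "Lo b"]) (simp add: add.commute)
  next
    assume y: "y = xv (int k - 1)"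
    show ?thesis
    proof (cases k)
      \<comment> \<open>For a single vertex no direction is excluded. The exchange of coordinates
        fixes \<open>xv 0\<close> and sends \<open>xv 1\<close> to \<open>xv (- 1)\<close>.\<close>
      case 0
      let ?w = "mat2 0 1 1 0 :: 'f^2^2"
      have "(*v) ?w ` Lat 0 = (Lat 0 :: ('f^2) set)"
      proof (intro subset_antisym subsetI)
        fix z assume "z \<in> (*v) ?w ` Lat 0"
        then show "z \<in> Lat 0" by (auto simp: Lat_def mv_nth)
      next
        fix z :: "'f^2" assume z: "z \<in> Lat 0"
        have "z = ?w *v vec2 (z $ 2) (z $ 1)" by (simp add: vec2_eq_iff mv_nth)
        moreover have "vec2 (z $ 2) (z $ 1) \<in> Lat 0" using z by (simp add: Lat_def)
        ultimately show "z \<in> (*v) ?w ` Lat 0" by blast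
      qed
      then have w0: "act ?w (xv 0) = xv 0" by (simp add: xv_def act_class)
      have d: "z / unif \<in> P n \<longleftrightarrow> z \<in> P (n + 1)" for z :: 'f and n
        by (cases "z = 0") (auto simp: P_iff val_divide)
      have "(*v) ?w ` Lat 1 = (*v) (mat unif) ` (Lat (- 1) :: ('f^2) set)"
      proof (intro subset_antisym subsetI)
        fix z assume "z \<in> (*v) ?w ` Lat 1"
        then obtain x where x: "z = ?w *v x" "x $ 1 \<in> P 0" "x $ 2 \<in> P 1" by (auto simp: Lat_def)
        have "z = mat unif *v vec2 (x $ 2 / unif) (x $ 1 / unif)" by (simp add: x(1) vec2_eq_iff mv_nth mat_mv)
        moreover have "vec2 (x $ 2 / unif) (x $ 1 / unif) \<in> Lat (- 1)" using x by (simp add: Lat_def d)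
        ultimately show "z \<in> (*v) (mat unif) ` Lat (- 1)" by blast
      next
        fix z assume "z \<in> (*v) (mat unif) ` (Lat (- 1) :: ('f^2) set)"
        then obtain x where x: "z = mat unif *v x" "x $ 1 \<in> P 0" "x $ 2 \<in> P (- 1)" by (auto simp: Lat_def)
        have "z = ?w *v vec2 (unif * x $ 2) (unif * x $ 1)" by (simp add: x(1) vec2_eq_iff mv_nth mat_mv)
        moreover have "vec2 (unif * x $ 2) (unif * x $ 1) \<in> Lat 1"
          using x d[of "unif * x $ 2" "- 1"] d[of "unif * x $ 1" 0] by (simp add: Lat_def)
        ultimately show "z \<in> (*v) ?w ` Lat 1" by blast
      qed
      then have "act ?w (xv 1) = homothety_class ((*v) (mat unif) ` Lat (- 1))" by (simp add: xv_def act_class)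
      also have "\<dots> = xv (- 1)" unfolding xv_def
        by (rule homothety_class_eqI, rule homothety_memI[of unif]) simp_all
      finally have "act ?w (xv 1) = xv (- 1)" .
      then show ?thesis using y 0 w0 by (intro exI[of _ ?w]) (simp add: xp_0 invertible_mat2)
    next
      case (Suc k')
      have "last p = act A (xv (int k'))" using yv y Suc by simp
      then have "p ! Suc k = p ! k'" using pA[of k'] lastp Suc by simp
      then have "Suc k = k'" using dist len Suc by (simp add: nth_eq_iff_index_eq)
      then show ?thesis using Suc by simp
    qed
  qed
  then obtain B where B: "invertible B" "actp B (xp k) = xp k" "act B (xv (int (Suc k))) = y" by blast
  have "p = actp A (actp B (xp (Suc k)))"
    by (subst split) (simp only: A(2) xp_Suc map_append list.map B(2,3) yv)
  also have "\<dots> = actp (A ** B) (xp (Suc k))" by (rule actp_mult[OF xp_path])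
  finally show ?case using invertible_mm[OF A(1) B(1)] by blast
qed

section \<open>Stabilizers of paths and local finiteness of the tree\<close>

lemma preserve_Lat:
  assumes "(*v) C ` Lat k \<subseteq> (Lat k :: ('f::nonarch_local_field ^ 2) set)"
  shows "C$1$1 \<in> P 0" "C$1$2 \<in> P (- k)" "C$2$1 \<in> P k" "C$2$2 \<in> P 0" "det C \<in> P 0"
proof -
  have "vec2 1 0 \<in> (Lat k :: ('f^2) set)" by (simp add: Lat_def)
  then have "C *v vec2 1 0 \<in> Lat k" using assms by blast
  then show 1: "C$1$1 \<in> P 0" "C$2$1 \<in> P k" by (simp_all add: Lat_def mv_nth)
  have "vec2 0 (unif powi k) \<in> (Lat k :: ('f^2) set)" by (simp add: Lat_def del: power_int_of_nat)
  then have "C *v vec2 0 (unif powi k) \<in> Lat k" using assms by blast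
  then have "unif powi k * C$1$2 \<in> P 0" "unif powi k * C$2$2 \<in> P k" by (simp_all add: Lat_def mv_nth mult.commute)
  then show 2: "C$1$2 \<in> P (- k)" "C$2$2 \<in> P 0" unfolding unif_powi_mult_P by simp_all
  have "C$1$1 * C$2$2 \<in> P 0" by (rule P_mult_le[OF 1(1) 2(2)]) simp
  moreover have "C$1$2 * C$2$1 \<in> P 0" by (rule P_mult_le[OF 2(1) 1(2)]) simp
  ultimately show "det C \<in> P 0" by (simp add: det_2 P_diff)
qed

text \<open>The determinants of \<open>C\<close> and of its inverse are both integral, and their
  product is 1.\<close>

lemma stable_Lat_unit:
  assumes "(*v) C ` Lat k = (Lat k :: ('f::nonarch_local_field ^ 2) set)" "invertible C"
  shows "unit (det C)"
proof -
  have "(*v) (inv2 C) ` Lat k = (*v) (inv2 C) ` ((*v) C ` Lat k)" using assms(1) by simp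
  also have "\<dots> = Lat k" by (simp add: mv_image inv2(2)[OF assms(2)])
  finally have i: "(*v) (inv2 C) ` Lat k = Lat k" .
  have d: "det C \<in> P 0" "det (inv2 C) \<in> P 0"
    using preserve_Lat(5)[of C k] preserve_Lat(5)[of "inv2 C" k] assms(1) i by simp_all
  have "det C * det (inv2 C) = 1" using inv2(1)[OF assms(2)] det_mul[of C "inv2 C"] by simp
  moreover from this have nz: "det C \<noteq> 0" "det (inv2 C) \<noteq> 0" by auto
  ultimately have "val (det C) + val (det (inv2 C)) = 0" using val_mult[OF nz] val_one by simp
  then show ?thesis using d nz by (simp add: unit_val P_iff)
qed

text \<open>Fixing \<open>xv 0\<close> makes \<open>A\<close> a scalar times a matrix
  \<open>B\<close> that preserves \<open>Lat 0\<close>. Fixing \<open>xv k\<close> gives a second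
  scalar \<open>d\<close>; comparing determinants makes \<open>d\<close> a unit, so the lower left
  entry of \<open>B\<close> lies in \<open>P k\<close>. As \<open>k\<close> is positive, the
  diagonal entries of \<open>B\<close> are then units.\<close>

lemma stab_xp:
  fixes A :: "'f::nonarch_local_field ^ 2 ^ 2"
  assumes A: "invertible A" "actp A (xp k) = xp k" and k: "1 \<le> k"
  shows "\<exists>a B. a \<noteq> 0 \<and> B \<in> Kg 0 (int k) \<and> A = mat a ** B"
proof -
  have fixv: "act A (xv (int i)) = xv (int i)" if "i \<le> k" for i
    using arg_cong[OF A(2), of "\<lambda>l. l ! i"] that by (simp add: nth_xp length_xp)
  have 0: "act A (xv 0) = xv 0" and kk: "act A (xv (int k)) = xv (int k)" using fixv[of 0] fixv[of k] by simp_all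
  have "(*v) A ` Lat 0 \<in> xv 0" using homothety_self[of "(*v) A ` Lat 0"] 0 unfolding xv_def act_class by simp
  then obtain a where a: "a \<noteq> 0" "(*v) A ` Lat 0 = (*v) (mat a) ` Lat 0" by (auto simp: xv_def homothety_mem)
  define B where "B = mat (1 / a) ** A"
  have AB: "A = mat a ** B" unfolding B_def matrix_mul_assoc mat_mult using a(1) by simp
  have Binv: "invertible B" unfolding B_def using a(1) A(1) by (intro invertible_mm) simp_all
  have "(*v) B ` Lat 0 = (*v) (mat (1 / a)) ` ((*v) A ` Lat 0)" unfolding B_def mv_image ..
  then have B0: "(*v) B ` Lat 0 = Lat 0" unfolding a(2) using a(1) by (simp add: mv_image mat_mult)
  have uB: "unit (det B)" by (rule stable_Lat_unit[OF B0 Binv])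
  have Be: "B$1$1 \<in> P 0" "B$1$2 \<in> P 0" "B$2$1 \<in> P 0" "B$2$2 \<in> P 0"
    using preserve_Lat[of B 0] B0 by simp_all
  have "act B (xv (int k)) = xv (int k)" unfolding B_def using pgl_mat[of "1 / a" A] a(1) kk by simp
  then have "(*v) B ` Lat (int k) \<in> xv (int k)"
    using homothety_self[of "(*v) B ` Lat (int k)"] unfolding xv_def act_class by simp
  then obtain d where d: "d \<noteq> 0" "(*v) B ` Lat (int k) = (*v) (mat d) ` Lat (int k)" by (auto simp: xv_def homothety_mem)
  define C where "C = mat (1 / d) ** B"
  have BC: "B = mat d ** C" unfolding C_def matrix_mul_assoc mat_mult using d(1) by simp
  have Cinv: "invertible C" unfolding C_def using d(1) Binv by (intro invertible_mm) simp_all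
  have "(*v) C ` Lat (int k) = (*v) (mat (1 / d)) ` ((*v) B ` Lat (int k))" unfolding C_def mv_image ..
  then have Ck: "(*v) C ` Lat (int k) = Lat (int k)" unfolding d(2) using d(1) by (simp add: mv_image mat_mult)
  have uC: "unit (det C)" by (rule stable_Lat_unit[OF Ck Cinv])
  have "det B = d * d * det C" unfolding BC det_mul by (simp add: mat_mat2)
  moreover have "det C \<noteq> 0" "d * d \<noteq> 0" using uC d(1) by (auto simp: unit_val)
  ultimately have "val (det B) = val (d * d) + val (det C)" using val_mult[of "d * d" "det C"] by simp
  moreover have "val (d * d) = val d + val d" by (rule val_mult[OF d(1) d(1)])
  ultimately have "val d = 0" using uB uC by (simp add: unit_val)
  then have ud: "unit d" using d(1) by (simp add: unit_val)
  have "C$2$1 \<in> P (int k)" using preserve_Lat(3)[of C "int k"] Ck by simp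
  moreover have "B$2$1 = d * C$2$1"
    unfolding BC by (cases C rule: mat2_cases) (simp add: mat_mat2)
  ultimately have B21: "B$2$1 \<in> P (int k)" using unit_mult_P[OF ud] by simp
  have "B$1$2 * B$2$1 \<in> P 1" by (rule P_mult_le[OF Be(2) B21]) (use k in simp)
  from unit_add_P[OF uB this] have "unit (B$1$1 * B$2$2)" by (simp add: det_2)
  then have "B$1$1 \<noteq> 0" "B$2$2 \<noteq> 0" "val (B$1$1) + val (B$2$2) = 0" by (auto simp: unit_val val_mult)
  then have "unit (B$1$1)" "unit (B$2$2)" using Be by (auto simp: unit_val P_iff)
  then have "B \<in> Kg 0 (int k)" using Be B21 by (simp add: Kg_def)
  then show ?thesis using a(1) AB by blast
qed

lemma same_path:
  assumes "invertible A" "invertible B" "actp A (xp k) = actp B (xp k)" "1 \<le> k"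
  shows "\<exists>a C. a \<noteq> 0 \<and> C \<in> Kg 0 (int k) \<and> B = mat a ** (A ** C)"
proof -
  have "actp (inv2 A ** B) (xp k) = actp (inv2 A) (actp B (xp k))" by (rule actp_mult[OF xp_path, symmetric])
  also have "\<dots> = xp k" unfolding assms(3)[symmetric] by (rule actp_inv2(1)[OF xp_path assms(1)])
  finally obtain a C where C: "a \<noteq> 0" "C \<in> Kg 0 (int k)" "inv2 A ** B = mat a ** C"
    using stab_xp[OF invertible_mm[OF invertible_inv2[OF assms(1)] assms(2)] _ assms(4)] by blast
  have "B = A ** (inv2 A ** B)" by (simp add: inv2_cancel assms(1))
  also have "\<dots> = mat a ** (A ** C)" unfolding C(3) by (simp only: matrix_mul_assoc mat_comm)
  finally show ?thesis using C by blast
qed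

lemma Gamma0_eq: "1 \<le> n \<Longrightarrow> Gamma0 n = pgl ` Kg 0 (int n)"
  by (simp add: Gamma0_def Kg_def Units_integer_ring carrier_integer_ring max_ideal_pow_P)

lemma entries_common: "\<exists>l\<ge>0. A$1$1 \<in> P (- l) \<and> A$1$2 \<in> P (- l) \<and> A$2$1 \<in> P (- l) \<and> A$2$2 \<in> P (- l)"
  for A :: "'f::nonarch_local_field ^ 2 ^ 2"
proof -
  define l where "l = \<bar>val (A$1$1)\<bar> + \<bar>val (A$1$2)\<bar> + \<bar>val (A$2$1)\<bar> + \<bar>val (A$2$2)\<bar>"
  have "l \<ge> 0" "- l \<le> val (A$1$1)" "- l \<le> val (A$1$2)" "- l \<le> val (A$2$1)" "- l \<le> val (A$2$2)"
    unfolding l_def by linarith+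
  then show ?thesis by (intro exI[of _ l]) (simp add: P_iff)
qed

text \<open>Continuity of conjugation: \<open>m\<close> exceeds \<open>n\<close> by enough to absorb
  the denominators of \<open>A\<close> and of its inverse.\<close>

lemma conj_Kc:
  fixes A :: "'f::nonarch_local_field ^ 2 ^ 2"
  assumes A: "invertible A"
  shows "\<exists>m\<ge>1. \<forall>C\<in>Kc m. \<exists>B\<in>Kc n. C ** A = A ** B"
proof -
  obtain l where l: "l \<ge> 0" "A$1$1 \<in> P (- l)" "A$1$2 \<in> P (- l)" "A$2$1 \<in> P (- l)" "A$2$2 \<in> P (- l)"
    using entries_common by blast
  obtain l' where l': "l' \<ge> 0" "inv2 A$1$1 \<in> P (- l')" "inv2 A$1$2 \<in> P (- l')" "inv2 A$2$1 \<in> P (- l')" "inv2 A$2$2 \<in> P (- l')"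
    using entries_common by blast
  define m where "m = max 1 (n + l + l')"
  have "inv2 A ** C ** A \<in> Kc n" if C: "C \<in> Kc m" for C
  proof -
    obtain p q r s where a: "A = mat2 p q r s" by (rule mat2_cases)
    obtain p' q' r' s' where a': "inv2 A = mat2 p' q' r' s'" by (rule mat2_cases)
    obtain x y z w where c: "C = mat2 (1 + x) y z (1 + w)"
    proof -
      obtain x y z w where "C = mat2 x y z w" by (rule mat2_cases)
      then show ?thesis using that[of "x - 1" y z "w - 1"] by simp
    qed
    have cP: "x \<in> P m" "y \<in> P m" "z \<in> P m" "w \<in> P m" using C by (simp_all add: c)
    have one: "mat2 p' q' r' s' ** mat2 p q r s = mat 1" using inv2(2)[OF A] by (simp only: a'[symmetric]) (simp add: a)
    have t: "u * (e * v) \<in> P n" if "u \<in> P (- l')" "e \<in> P m" "v \<in> P (- l)" for u e v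
      by (rule P_mult_le[OF that(1) P_mult[OF that(2,3)]]) (simp add: m_def)
    have e4: "(u1 * (x * v1) + u1 * (y * v2)) + (u2 * (z * v1) + u2 * (w * v2)) \<in> P n"
      if "u1 \<in> P (- l')" "u2 \<in> P (- l')" "v1 \<in> P (- l)" "v2 \<in> P (- l)" for u1 u2 v1 v2
      using that cP by (intro P_add t)
    have eq: "inv2 A ** C ** A = mat2
      ((p' * p + q' * r) + ((p' * (x * p) + p' * (y * r)) + (q' * (z * p) + q' * (w * r))))
      ((p' * q + q' * s) + ((p' * (x * q) + p' * (y * s)) + (q' * (z * q) + q' * (w * s))))
      ((r' * p + s' * r) + ((r' * (x * p) + r' * (y * r)) + (s' * (z * p) + s' * (w * r))))
      ((r' * q + s' * s) + ((r' * (x * q) + r' * (y * s)) + (s' * (z * q) + s' * (w * s))))"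
      unfolding a' c by (simp add: a algebra_simps)
    have o: "p' * p + q' * r = 1" "p' * q + q' * s = 0" "r' * p + s' * r = 0" "r' * q + s' * s = 1"
      using one by (simp_all add: mat_mat2)
    have pq: "p \<in> P (- l)" "q \<in> P (- l)" "r \<in> P (- l)" "s \<in> P (- l)" using l by (simp_all add: a)
    have pq': "p' \<in> P (- l')" "q' \<in> P (- l')" "r' \<in> P (- l')" "s' \<in> P (- l')" using l' by (simp_all add: a')
    show ?thesis unfolding eq o mat2_Kc using e4 pq pq' by simp
  qed
  moreover have "C ** A = A ** (inv2 A ** C ** A)" for C
  proof -
    have "A ** (inv2 A ** C ** A) = A ** inv2 A ** (C ** A)" by (simp only: matrix_mul_assoc)
    then show ?thesis by (simp only: inv2(1)[OF A] matrix_mul_lid)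
  qed
  moreover have "1 \<le> m" by (simp add: m_def)
  ultimately show ?thesis by blast
qed

text \<open>A path is fixed by some \<open>Kc m\<close>, which has only finitely many cosets in
  \<open>GO\<close>.\<close>

lemma finite_GO_orbit:
  fixes p :: "('f::nonarch_local_field ^ 2) set set list"
  assumes "p \<in> tree_paths k" "1 \<le> k"
  shows "finite {actp g p |g. g \<in> GO}"
proof -
  obtain A where A: "invertible A" "p = actp A (xp k)" using path_transitive[OF assms(1)] by blast
  from conj_Kc[OF A(1), of "int k"]
  obtain m where m': "1 \<le> m \<and> (\<forall>C\<in>Kc m. \<exists>B\<in>Kc (int k). C ** A = A ** B)" ..
  note m = conjunct1[OF m'] conjunct2[OF m']
  have fixp: "actp C p = p" if "C \<in> Kc m" for C
  proof -
    from bspec[OF m(2) that] obtain B where B: "B \<in> Kc (int k)" "C ** A = A ** B" ..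
    have "B \<in> Kg 0 (int k)" by (rule Kc_Kg[OF B(1)]) (use assms(2) in auto)
    then have "actp B (xp k) = xp k" by (rule fix_xp[OF _ assms(2)])
    then show ?thesis unfolding A(2) actp_mult[OF xp_path] B(2) by (simp only: actp_mult[OF xp_path, symmetric])
  qed
  obtain R :: "('f^2^2) set" where R: "transv (Em m) GO R" using ex_transv_Em[of GO m] by blast
  have sub: "{actp g p |g. g \<in> GO} \<subseteq> (\<lambda>g. actp g p) ` R"
  proof clarify
    fix g :: "'f^2^2" assume g: "g \<in> GO"
    then obtain r where r: "r \<in> R" "Em m g r" using R by (auto simp: transv_def)
    obtain C where C: "C \<in> Kc m" "r = g ** C" using Em_Kc[OF r(2) g] by blast
    have "actp r p = actp g p" unfolding C(2) actp_mult[OF assms(1), symmetric] fixp[OF C(1)] ..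
    from this[symmetric] r(1) show "actp g p \<in> (\<lambda>g. actp g p) ` R" by (rule image_eqI)
  qed
  have "finite R" using R by (simp add: transv_def)
  then show ?thesis by (rule finite_subset[OF sub finite_imageI])
qed

text \<open>\<open>Dg 1 unif\<close> translates the apartment by one step. This brings the heads of
  edges under the same arguments as the tails.\<close>

lemma tl_xp: "tl (xp (Suc k)) = actp (Dg 1 unif) (xp k)"
proof -
  have e: "act (Dg 1 unif) (xv i) = xv (i + 1)" for i
  proof -
    have "act (Dg 1 unif) (xv i) = act (Dg 1 (unif powi (i + 1))) (xv 0)"
      unfolding xv_Dg[of i] act_mult[OF xv_vertex] Dg_Dg by (simp add: power_int_add mult.commute)
    then show ?thesis by (rule trans[OF _ xv_Dg[of "i + 1", symmetric]])
  qed
  show ?thesis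
    by (rule nth_equalityI) (simp_all add: length_xp nth_tl nth_xp e add.commute)
qed

lemma Kg_in_GO: "1 \<le> k \<Longrightarrow> B \<in> Kg 0 (int k) \<Longrightarrow> B \<in> GO" by (rule Kg_GO) auto

lemma finite_butlast_fiber:
  fixes p :: "('f::nonarch_local_field ^ 2) set set list"
  assumes "p \<in> tree_paths k" "1 \<le> k"
  shows "finite {a \<in> tree_paths (Suc k). butlast a = p}"
proof -
  obtain g where g: "invertible g" "p = actp g (xp k)" using path_transitive[OF assms(1)] by blast
  let ?S = "{actp B (xp (Suc k)) |B. B \<in> GO} :: ('f ^ 2) set set list set"
  have "{a \<in> tree_paths (Suc k). butlast a = p} \<subseteq> actp g ` ?S"
  proof clarify
    fix a :: "('f ^ 2) set set list" assume a: "a \<in> tree_paths (Suc k)" "p = butlast a"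
    obtain h where h: "invertible h" "a = actp h (xp (Suc k))" using path_transitive[OF a(1)] by blast
    have "actp g (xp k) = actp h (xp k)" using a(2) unfolding g(2) h(2) by (simp add: map_butlast[symmetric] butlast_xp)
    from same_path[OF g(1) h(1) this assms(2)] obtain z B where B: "z \<noteq> 0" "B \<in> Kg 0 (int k)" "h = mat z ** (g ** B)" by blast
    have "a = actp g (actp B (xp (Suc k)))" unfolding h(2) B(3) actp_scalar[OF B(1)] actp_mult[OF xp_path] ..
    then show "a \<in> actp g ` ?S" using Kg_in_GO[OF assms(2) B(2)] by blast
  qed
  moreover have "finite ?S" by (rule finite_GO_orbit[OF xp_path]) simp
  ultimately show ?thesis by (rule finite_subset[OF _ finite_imageI])
qed

lemma finite_tl_fiber:
  fixes p :: "('f::nonarch_local_field ^ 2) set set list"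
  assumes "p \<in> tree_paths k" "1 \<le> k"
  shows "finite {a \<in> tree_paths (Suc k). tl a = p}"
proof -
  obtain g where g: "invertible g" "p = actp g (xp k)" using path_transitive[OF assms(1)] by blast
  let ?t = "Dg 1 unif :: 'f^2^2"
  have ti: "invertible ?t" by simp
  let ?q = "actp (inv2 ?t) (xp (Suc k))"
  have q: "?q \<in> tree_paths (Suc k)" by (rule actp_path[OF xp_path invertible_inv2[OF ti]])
  let ?S = "{actp B ?q |B. B \<in> GO} :: ('f ^ 2) set set list set"
  have "{a \<in> tree_paths (Suc k). tl a = p} \<subseteq> actp g ` ?S"
  proof clarify
    fix a :: "('f ^ 2) set set list" assume a: "a \<in> tree_paths (Suc k)" "p = tl a"
    obtain h where h: "invertible h" "a = actp h (xp (Suc k))" using path_transitive[OF a(1)] by blast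
    have "tl a = actp h (actp ?t (xp k))" unfolding h(2) by (simp only: map_tl[symmetric] tl_xp)
    also have "\<dots> = actp (h ** ?t) (xp k)" by (rule actp_mult[OF xp_path])
    finally have "actp g (xp k) = actp (h ** ?t) (xp k)" using a(2) unfolding g(2) by simp
    from same_path[OF g(1) invertible_mm[OF h(1) ti] this assms(2)]
    obtain z B where B: "z \<noteq> 0" "B \<in> Kg 0 (int k)" "h ** ?t = mat z ** (g ** B)" by blast
    have "h = h ** ?t ** inv2 ?t" by (simp add: inv2_cancel)
    also have "\<dots> = mat z ** (g ** (B ** inv2 ?t))" unfolding B(3) by (simp only: matrix_mul_assoc)
    finally have hh: "h = mat z ** (g ** (B ** inv2 ?t))" .
    have "a = actp (g ** (B ** inv2 ?t)) (xp (Suc k))" unfolding h(2) hh by (rule actp_scalar[OF B(1)])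
    also have "\<dots> = actp g (actp B ?q)" unfolding actp_mult[OF xp_path] actp_mult[OF q] by (simp only: matrix_mul_assoc)
    finally show "a \<in> actp g ` ?S" using Kg_in_GO[OF assms(2) B(2)] by blast
  qed
  moreover have "finite ?S" by (rule finite_GO_orbit[OF q]) simp
  ultimately show ?thesis by (rule finite_subset[OF _ finite_imageI])
qed

section \<open>The newform and the cochains of matrix coefficients\<close>

definition pair :: "('x \<Rightarrow> complex) \<Rightarrow> ('x \<Rightarrow> complex) \<Rightarrow> complex"
  where "pair f F = (\<Sum>a | f a \<noteq> 0. f a * F a)"

lemma pair_eq: "finite B \<Longrightarrow> {a. f a \<noteq> 0} \<subseteq> B \<Longrightarrow> pair f F = (\<Sum>a\<in>B. f a * F a)"
  unfolding pair_def by (rule sum.mono_neutral_left) auto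

lemma pair_add:
  assumes "finite {a. f a \<noteq> 0}" "finite {a. g a \<noteq> 0}"
  shows "pair (\<lambda>a. f a + g a) F = pair f F + pair g F"
proof -
  let ?B = "{a. f a \<noteq> 0} \<union> {a. g a \<noteq> 0}"
  have B: "finite ?B" using assms by simp
  have 1: "pair (\<lambda>a. f a + g a) F = (\<Sum>a\<in>?B. (f a + g a) * F a)" by (rule pair_eq[OF B]) auto
  have 2: "pair f F = (\<Sum>a\<in>?B. f a * F a)" by (rule pair_eq[OF B]) auto
  have 3: "pair g F = (\<Sum>a\<in>?B. g a * F a)" by (rule pair_eq[OF B]) auto
  show ?thesis unfolding 1 2 3 by (simp add: sum.distrib distrib_right)
qed

lemma pair_sc: "pair (\<lambda>a. z * f a) F = z * pair f F"
proof (cases "z = 0")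
  case False
  then have "{a. z * f a \<noteq> 0} = {a. f a \<noteq> 0}" by simp
  then show ?thesis by (simp add: pair_def sum_distrib_left mult.assoc)
qed (simp add: pair_def)

lemma inj_actp: assumes "invertible (h :: 'f::nonarch_local_field ^ 2 ^ 2)" shows "inj_on (actp h) (tree_paths k)"
proof (rule inj_onI)
  fix a b :: "('f ^ 2) set set list" assume ab: "a \<in> tree_paths k" "b \<in> tree_paths k" "actp h a = actp h b"
  show "a = b" using actp_inv2(1)[OF ab(1) assms] actp_inv2(1)[OF ab(2) assms] ab(3) by simp
qed

lemma pair_shift:
  fixes h :: "'f::nonarch_local_field ^ 2 ^ 2"
  assumes h: "invertible h" and f: "\<And>a. f a \<noteq> 0 \<Longrightarrow> a \<in> tree_paths k" "\<And>a. f' a \<noteq> 0 \<Longrightarrow> a \<in> tree_paths k"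
    and s: "\<And>a. a \<in> tree_paths k \<Longrightarrow> f' (actp h a) = f a" "\<And>a. a \<in> tree_paths k \<Longrightarrow> F' (actp h a) = F a"
  shows "pair f' F' = pair f F"
proof -
  have e: "{a. f' a \<noteq> 0} = actp h ` {a. f a \<noteq> 0}"
  proof (intro subset_antisym subsetI)
    fix a assume "a \<in> {a. f' a \<noteq> 0}"
    then have a: "f' a \<noteq> 0" "a \<in> tree_paths k" using f(2) by auto
    have b: "actp (inv2 h) a \<in> tree_paths k" by (rule actp_path[OF a(2) invertible_inv2[OF h]])
    have "actp h (actp (inv2 h) a) = a" by (rule actp_inv2(2)[OF a(2) h])
    then have "f (actp (inv2 h) a) \<noteq> 0" using s(1)[OF b] a(1) by simp
    then show "a \<in> actp h ` {a. f a \<noteq> 0}" using actp_inv2(2)[OF a(2) h] by (intro image_eqI[of _ _ "actp (inv2 h) a"]) auto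
  next
    fix a assume "a \<in> actp h ` {a. f a \<noteq> 0}"
    then show "a \<in> {a. f' a \<noteq> 0}" using f(1) s(1) by auto
  qed
  have i: "inj_on (actp h) {a. f a \<noteq> 0}" by (rule inj_on_subset[OF inj_actp[OF h]]) (use f(1) in auto)
  show ?thesis unfolding pair_def e sum.reindex[OF i] comp_def by (rule sum.cong) (use f(1) s in auto)
qed

locale newform_vector = cuspidal_newform W "int (Suc n)"
  for W :: "('f::nonarch_local_field ^ 2 ^ 2 \<Rightarrow> complex) set" and n :: nat +
  fixes w0
  assumes w0: "w0 \<in> Fx (Kg 0 (int (Suc n)))" "w0 \<noteq> 0"
begin

lemma n1: "1 \<le> n" using c2 by simp

lemma w0_W: "w0 \<in> W" by (rule Fx_W[OF w0(1)])

text \<open>The coordinate, with respect to \<open>w0\<close>, of the projection to the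
  \<open>K\<close>-fixed line; the choice is determined because that line is spanned by the nonzero
  vector \<open>w0\<close>.\<close>

definition ell :: "('f ^ 2 ^ 2 \<Rightarrow> complex) \<Rightarrow> complex"
  where "ell w = (SOME z. eK (int (Suc n)) w = sc z w0)"

lemma ell_eq: assumes "w \<in> W" shows "eK (int (Suc n)) w = sc (ell w) w0"
  unfolding ell_def by (rule someI_ex, rule newform_unique[OF w0 eK_in[OF assms]])

lemma ell_eqI: assumes "w \<in> W" "eK (int (Suc n)) w = sc z w0" shows "ell w = z"
proof -
  have "sc (ell w) w0 = sc z w0" using ell_eq[OF assms(1)] assms(2) by simp
  then show ?thesis by (rule sc_cancel) (rule w0(2))
qed

lemma ell_add: assumes "v \<in> W" "w \<in> W" shows "ell (v + w) = ell v + ell w"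
  by (rule ell_eqI[OF W_add[OF assms]]) (simp only: eK_add[OF assms] ell_eq assms sc_add_left)

lemma ell_sc: assumes "w \<in> W" shows "ell (sc z w) = z * ell w"
  by (rule ell_eqI[OF W_sc[OF assms]]) (simp only: eK_sc[OF assms] ell_eq assms sc_sc)

lemma ell_rho: assumes "w \<in> W" "k \<in> K" shows "ell (rho k w) = ell w"
  by (rule ell_eqI[OF W_rho[OF K_inv[OF assms(2)] assms(1)]]) (simp only: eK_rho[OF assms] ell_eq assms)

lemma ell_w0: "ell w0 = 1"
  by (rule ell_eqI[OF w0_W]) (simp only: eK_fix[OF w0(1)] sc_1)

lemma linear_sum:
  fixes lam :: "('f ^ 2 ^ 2 \<Rightarrow> complex) \<Rightarrow> complex"
  assumes add: "\<And>v w. v \<in> W \<Longrightarrow> w \<in> W \<Longrightarrow> lam (v + w) = lam v + lam w"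
    and scal: "\<And>z w. w \<in> W \<Longrightarrow> lam (sc z w) = z * lam w"
    and A: "finite A" "\<And>i. i \<in> A \<Longrightarrow> f i \<in> W"
  shows "lam (\<Sum>i\<in>A. f i) = (\<Sum>i\<in>A. lam (f i))"
  using A
proof (induction A rule: finite_induct)
  case empty
  show ?case using scal[OF W_0, of 0] by simp
next
  case (insert x F)
  have 1: "f x \<in> W" "(\<Sum>i\<in>F. f i) \<in> W" using insert.prems by (auto intro: W_sum)
  have 2: "lam (\<Sum>i\<in>F. f i) = (\<Sum>i\<in>F. lam (f i))" using insert.prems by (intro insert.IH) auto
  show ?case unfolding sum.insert[OF insert.hyps(1,2)] add[OF 1] 2 ..
qed

text \<open>A \<open>K\<close>-invariant functional does not change under averaging over
  \<open>K\<close>, and the averages lie on the line of \<open>w0\<close>.\<close>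

lemma ell_unique:
  fixes lam :: "('f ^ 2 ^ 2 \<Rightarrow> complex) \<Rightarrow> complex"
  assumes add: "\<And>v w. v \<in> W \<Longrightarrow> w \<in> W \<Longrightarrow> lam (v + w) = lam v + lam w"
    and scal: "\<And>z w. w \<in> W \<Longrightarrow> lam (sc z w) = z * lam w"
    and inv: "\<And>k w. w \<in> W \<Longrightarrow> k \<in> K \<Longrightarrow> lam (rho k w) = lam w"
    and w: "w \<in> W"
  shows "lam w = ell w * lam w0"
proof -
  obtain m where m: "m \<ge> 1" "w \<in> Fx (Kc m)" using Fx_KcI[OF w] by blast
  let ?R = "TR (int (Suc n)) m"
  have fin: "finite ?R" using TR[of m] by (simp add: transv_def)
  have rW: "rho r w \<in> W" if "r \<in> ?R" for r by (rule W_rho[OF K_inv[OF TR_K[OF that]] w])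
  have "lam (eK (int (Suc n)) w) = 1 / of_nat (card ?R) * lam (\<Sum>r\<in>?R. rho r w)"
    unfolding eK_eq[OF m(2,1)] eav_def by (rule scal, rule W_sum[OF rW])
  moreover have "lam (\<Sum>r\<in>?R. rho r w) = (\<Sum>r\<in>?R. lam (rho r w))"
    by (rule linear_sum[OF add scal fin rW])
  moreover have "(\<Sum>r\<in>?R. lam (rho r w)) = (\<Sum>r\<in>?R. lam w)"
    by (rule sum.cong) (use inv[OF w TR_K] in auto)
  ultimately have "lam (eK (int (Suc n)) w) = lam w" using TR_card[of m] by simp
  then show ?thesis using ell_eq[OF w] scal[OF w0_W, of "ell w"] by simp
qed

abbreviation X :: "('f ^ 2) set set list set" where "X \<equiv> tree_paths (Suc n)"
abbreviation x0 :: "('f ^ 2) set set list" where "x0 \<equiv> xp (Suc n)"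

definition rep :: "('f ^ 2) set set list \<Rightarrow> 'f ^ 2 ^ 2"
  where "rep a = (SOME A. invertible A \<and> a = actp A x0)"

lemma rep: assumes "a \<in> X" shows "invertible (rep a)" "actp (rep a) x0 = a"
proof -
  have "invertible (rep a) \<and> a = actp (rep a) x0"
    unfolding rep_def by (rule someI_ex[OF path_transitive[OF assms]])
  then show "invertible (rep a)" "actp (rep a) x0 = a" by simp_all
qed

definition fv :: "('f ^ 2) set set list \<Rightarrow> 'f ^ 2 ^ 2 \<Rightarrow> complex" where "fv a = rho (rep a) w0"

text \<open>The matrix coefficient of \<open>w\<close> against \<open>ell\<close>. Because
  \<open>ell\<close> is \<open>K\<close>-invariant and scalars act trivially, any other choice of
  \<open>rep a\<close> gives the same value (\<open>sf_actp\<close>).\<close>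

definition sf :: "('f ^ 2 ^ 2 \<Rightarrow> complex) \<Rightarrow> ('f ^ 2) set set list \<Rightarrow> complex"
  where "sf w a = (if a \<in> X then ell (rho (inv2 (rep a)) w) else 0)"

lemma x0_X: "actp g x0 \<in> X" if "invertible g" by (rule actp_path[OF xp_path that])

lemma rep_actp: assumes "invertible g"
  shows "\<exists>z C. z \<noteq> 0 \<and> C \<in> K \<and> rep (actp g x0) = mat z ** (g ** C)"
  by (rule same_path[OF assms rep(1)[OF x0_X[OF assms]] rep(2)[OF x0_X[OF assms], symmetric]]) simp

lemma fv_actp: assumes "invertible g" shows "fv (actp g x0) = rho g w0"
proof -
  obtain z C where C: "z \<noteq> 0" "C \<in> K" "rep (actp g x0) = mat z ** (g ** C)" using rep_actp[OF assms] by blast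
  have "fv (actp g x0) = rho (g ** C) w0" unfolding fv_def C(3) by (rule rho_scalar[OF C(1) w0_W])
  then show ?thesis by (simp only: rho_mult[symmetric] Fx_rho[OF w0(1) C(2)])
qed

lemma fv_W: "a \<in> X \<Longrightarrow> fv a \<in> W" unfolding fv_def by (rule W_rho[OF rep(1) w0_W])

lemma fv_shift: assumes "a \<in> X" "invertible h" shows "fv (actp h a) = rho h (fv a)"
proof -
  have "actp h a = actp (h ** rep a) x0" using actp_mult[OF xp_path, of h "rep a" "Suc n"] rep(2)[OF assms(1)] by simp
  then have "fv (actp h a) = rho (h ** rep a) w0" using fv_actp[OF invertible_mm[OF assms(2) rep(1)[OF assms(1)]]] by simp
  then show ?thesis by (simp only: fv_def rho_mult)
qed

lemma sf_actp: assumes "invertible g" "w \<in> W" shows "sf w (actp g x0) = ell (rho (inv2 g) w)"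
proof -
  obtain z C where C: "z \<noteq> 0" "C \<in> K" "rep (actp g x0) = mat z ** (g ** C)" using rep_actp[OF assms(1)] by blast
  have r: "invertible (rep (actp g x0))" by (rule rep(1)[OF x0_X[OF assms(1)]])
  define x where "x = rho (inv2 (rep (actp g x0))) w"
  have xW: "x \<in> W" unfolding x_def by (rule W_rho[OF invertible_inv2[OF r] assms(2)])
  have "w = rho (rep (actp g x0)) x" unfolding x_def by (rule rho_inv2(2)[OF r, symmetric])
  then have "w = rho (g ** C) x" unfolding C(3) rho_scalar[OF C(1) xW] .
  then have "w = rho g (rho C x)" by (simp only: rho_mult)
  then have "rho (inv2 g) w = rho C x" using rho_inv2(1)[OF assms(1), of "rho C x"] by simp
  then have "ell (rho (inv2 g) w) = ell x" using ell_rho[OF xW C(2)] by simp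
  then show ?thesis using x0_X[OF assms(1)] by (simp add: sf_def x_def)
qed

lemma sf_X: "sf w a \<noteq> 0 \<Longrightarrow> a \<in> X" by (simp add: sf_def split: if_splits)

lemma sf_add: assumes "v \<in> W" "w \<in> W" shows "sf (v + w) = (\<lambda>a. sf v a + sf w a)"
proof
  fix a
  show "sf (v + w) a = sf v a + sf w a"
    using ell_add[OF W_rho W_rho, of "inv2 (rep a)" v "inv2 (rep a)" w] invertible_inv2[OF rep(1)] assms
    by (simp add: sf_def rho_add)
qed

lemma sf_sc: assumes "w \<in> W" shows "sf (sc z w) = (\<lambda>a. z * sf w a)"
proof
  fix a
  show "sf (sc z w) a = z * sf w a"
    using ell_sc[OF W_rho, of "inv2 (rep a)" w] invertible_inv2[OF rep(1)] assms by (simp add: sf_def rho_sc)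
qed

lemma sf_shift: assumes "a \<in> X" "invertible h" "w \<in> W" shows "sf (rho h w) (actp h a) = sf w a"
proof -
  have r: "invertible (rep a)" by (rule rep(1)[OF assms(1)])
  have "actp h a = actp (h ** rep a) x0" using actp_mult[OF xp_path, of h "rep a" "Suc n"] rep(2)[OF assms(1)] by simp
  then have "sf (rho h w) (actp h a) = ell (rho (inv2 (h ** rep a)) (rho h w))"
    using sf_actp[OF invertible_mm[OF assms(2) r] W_rho[OF assms(2,3)]] by simp
  moreover have "rho (inv2 (h ** rep a)) (rho h w) = rho (inv2 (rep a)) w"
    by (simp only: inv2_mm[OF assms(2) r] rho_mult[symmetric] rho_inv2(1)[OF assms(2)])
  ultimately show ?thesis using assms(1) by (simp add: sf_def)
qed

lemma sf_translate: assumes "a \<in> X" "invertible h" "w \<in> W" shows "sf (rho h w) a = sf w (actp (inv2 h) a)"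
  using sf_shift[OF actp_path[OF assms(1) invertible_inv2[OF assms(2)]] assms(2,3)] actp_inv2(2)[OF assms(1,2)] by simp

text \<open>\<open>eK_vanish\<close> bounds the Cartan exponent of the inverse of
  \<open>rep a\<close> on the support, and the paths with bounded exponent fill finitely many finite
  \<open>GO\<close>-orbits.\<close>

lemma finite_sf: assumes w: "w \<in> W" shows "finite {a. sf w a \<noteq> 0}"
proof -
  obtain D :: nat where D: "\<And>j k1 k2. j \<ge> D \<Longrightarrow> k1 \<in> GO \<Longrightarrow> k2 \<in> GO \<Longrightarrow>
      eK (int (Suc n)) (rho (k1 ** Dg (unif powi int j) 1 ** k2) w) = 0"
    using eK_vanish[OF w] by blast
  let ?d = "\<lambda>j. Dg (unif powi int j) 1 :: 'f^2^2"
  let ?Q = "\<Union>j\<in>{..<D}. actp (inv2 (?d j)) ` {actp k x0 |k. k \<in> GO}"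
  have fin: "finite (\<Union>q\<in>?Q. {actp k q |k. k \<in> GO})"
  proof (intro finite_UN_I finite_imageI finite_lessThan)
    show "finite {actp k x0 |k. k \<in> GO}" by (rule finite_GO_orbit[OF xp_path]) simp
    fix q assume "q \<in> ?Q"
    then obtain j k where q: "q = actp (inv2 (?d j)) (actp k x0)" "k \<in> GO" by blast
    have "q \<in> X" unfolding q(1)
      by (rule actp_path[OF x0_X[OF GO_inv[OF q(2)]] invertible_inv2]) (simp del: power_int_of_nat)
    then show "finite {actp k q |k. k \<in> GO}" by (rule finite_GO_orbit) simp
  qed
  have "a \<in> (\<Union>q\<in>?Q. {actp k q |k. k \<in> GO})" if a: "sf w a \<noteq> 0" for a
  proof -
    have aX: "a \<in> X" by (rule sf_X[OF a])
    have r: "invertible (rep a)" by (rule rep(1)[OF aX])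
    obtain z k1 j k2 where g: "z \<noteq> 0" "k1 \<in> GO" "k2 \<in> GO" "inv2 (rep a) = mat z ** (k1 ** ?d j ** k2)"
      using cartan[OF invertible_inv2[OF r]] by blast
    have j: "j < D"
    proof (rule ccontr)
      assume "\<not> j < D"
      then have "eK (int (Suc n)) (rho (inv2 (rep a)) w) = 0"
        unfolding g(4) rho_scalar[OF g(1) w] using D[of j k1 k2] g(2,3) by simp
      then have "ell (rho (inv2 (rep a)) w) = 0"
        by (intro ell_eqI W_rho invertible_inv2 r w) simp
      then show False using a aX by (simp add: sf_def)
    qed
    have di: "invertible (?d j)" by (simp del: power_int_of_nat)
    have i1: "invertible k1" and i2: "invertible k2" using g(2,3) GO_inv by blast+
    have k2a: "actp k2 a \<in> X" by (rule actp_path[OF aX i2])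
    have dk2a: "actp (?d j) (actp k2 a) \<in> X" by (rule actp_path[OF k2a di])
    have "x0 = actp (inv2 (rep a)) a" using actp_inv2(1)[OF xp_path r, of "Suc n"] rep(2)[OF aX] by simp
    then have "x0 = actp (k1 ** ?d j ** k2) a" unfolding g(4) actp_scalar[OF g(1)] .
    then have e: "x0 = actp k1 (actp (?d j) (actp k2 a))"
      unfolding actp_mult[OF aX] actp_mult[OF k2a] by (simp only: matrix_mul_assoc actp_mult[OF aX])
    have "actp (inv2 k1) x0 = actp (?d j) (actp k2 a)" using actp_inv2(1)[OF dk2a i1] e by simp
    then have "actp (inv2 (?d j)) (actp (inv2 k1) x0) = actp k2 a" using actp_inv2(1)[OF k2a di] by simp
    then have "a = actp (inv2 k2) (actp (inv2 (?d j)) (actp (inv2 k1) x0))" using actp_inv2(1)[OF aX i2] by simp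
    moreover have "inv2 k1 \<in> GO" "inv2 k2 \<in> GO" using GO_inv2 g(2,3) by blast+
    ultimately show ?thesis using j by blast
  qed
  then show ?thesis by (intro finite_subset[OF _ fin]) blast
qed

text \<open>In classical terms the inverse of the formal degree, for the Haar measure on
  \<open>PGL2\<close> that gives the image of \<open>K\<close> total mass 1.\<close>

definition N0 :: complex where "N0 = pair (sf w0) (\<lambda>a. cnj (sf w0 a))"

lemma N0_real: "cnj N0 = N0"
  by (simp add: N0_def pair_def mult.commute)

lemma sf_w0_x0: "sf w0 x0 = 1"
proof -
  have "sf w0 (actp (mat 1) x0) = ell (rho (inv2 (mat 1)) w0)" by (rule sf_actp[OF _ w0_W]) simp
  moreover have "actp (mat 1) x0 = x0" by (rule actp_one[OF xp_path])
  ultimately show ?thesis by (simp add: inv2_one ell_w0)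
qed

lemma N0_nz: "N0 \<noteq> 0"
proof -
  have N0_eq: "N0 = of_real (\<Sum>a | sf w0 a \<noteq> 0. (cmod (sf w0 a))\<^sup>2)"
    unfolding N0_def pair_def of_real_sum by (rule sum.cong[OF refl], rule complex_norm_square[symmetric])
  have "(\<Sum>a | sf w0 a \<noteq> 0. (cmod (sf w0 a))\<^sup>2) > 0"
  proof (rule sum_pos[OF finite_sf[OF w0_W]])
    have "x0 \<in> {a. sf w0 a \<noteq> 0}" by (simp add: sf_w0_x0)
    then show "{a. sf w0 a \<noteq> 0} \<noteq> {}" by blast
  qed simp
  then show ?thesis unfolding N0_eq of_real_eq_0_iff by linarith
qed

text \<open>As a function of \<open>w\<close> the pairing is a \<open>K\<close>-invariant
  functional, so \<open>ell_unique\<close> determines it up to its value at \<open>w0\<close>. This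
  is the source of the orthogonality relations.\<close>

lemma pair_sf_unique:
  fixes F :: "('f ^ 2) set set list \<Rightarrow> complex"
  assumes F: "\<And>k a. k \<in> K \<Longrightarrow> a \<in> X \<Longrightarrow> F (actp k a) = F a" and w: "w \<in> W"
  shows "pair (sf w) F = ell w * pair (sf w0) F"
proof (rule ell_unique[where lam = "\<lambda>w. pair (sf w) F", OF _ _ _ w])
  show "pair (sf (v + x)) F = pair (sf v) F + pair (sf x) F" if "v \<in> W" "x \<in> W" for v x
    unfolding sf_add[OF that] by (rule pair_add[OF finite_sf[OF that(1)] finite_sf[OF that(2)]])
  show "pair (sf (sc z x)) F = z * pair (sf x) F" if "x \<in> W" for z x
    unfolding sf_sc[OF that] by (rule pair_sc)
  show "pair (sf (rho k x)) F = pair (sf x) F" if x: "x \<in> W" and k: "k \<in> K" for k x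
  proof (rule pair_shift[OF K_inv[OF k], where k = "Suc n"])
    show "sf (rho k x) (actp k a) = sf x a" if "a \<in> X" for a by (rule sf_shift[OF that K_inv[OF k] x])
    show "F (actp k a) = F a" if "a \<in> X" for a by (rule F[OF k that])
  qed (rule sf_X, assumption)+
qed

text \<open>In a unitary model this is the symmetry of the inner product. Here the form is the
  pairing of \<open>sf w\<close> with the conjugate of \<open>sf w0\<close>, equal to
  \<open>ell w * N0\<close> by \<open>pair_sf_unique\<close>; a shift of the paths by
  \<open>g\<close> moves the translation from one argument to the other.\<close>

lemma ell_cnj: assumes g: "invertible g" shows "ell (rho g w0) = cnj (ell (rho (inv2 g) w0))"
proof -
  have kinv: "sf w0 (actp k a) = sf w0 a" if "k \<in> K" "a \<in> X" for k a
    using sf_shift[OF that(2) K_inv[OF that(1)] w0_W] Fx_rho[OF w0(1) that(1)] by simp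
  have H: "pair (sf w) (\<lambda>a. cnj (sf w0 a)) = ell w * N0" if "w \<in> W" for w
    unfolding N0_def by (rule pair_sf_unique[OF _ that]) (simp only: kinv)
  have gW: "rho g w0 \<in> W" "rho (inv2 g) w0 \<in> W" by (rule W_rho[OF _ w0_W], rule g invertible_inv2[OF g])+
  have 1: "pair (sf w0) (\<lambda>a. cnj (sf (rho g w0) a)) = ell (rho (inv2 g) w0) * N0"
  proof -
    have "pair (sf w0) (\<lambda>a. cnj (sf (rho g w0) a)) = pair (sf (rho (inv2 g) w0)) (\<lambda>a. cnj (sf w0 a))"
    proof (rule pair_shift[OF g, where k = "Suc n"])
      show "sf w0 (actp g a) = sf (rho (inv2 g) w0) a" if "a \<in> X" for a
        using sf_shift[OF that g gW(2)] rho_inv2(2)[OF g] by simp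
      show "cnj (sf (rho g w0) (actp g a)) = cnj (sf w0 a)" if "a \<in> X" for a
        using sf_shift[OF that g w0_W] by simp
    qed (rule sf_X, assumption)+
    then show ?thesis using H[OF gW(2)] by simp
  qed
  let ?B = "{a. sf w0 a \<noteq> 0} \<union> {a. sf (rho g w0) a \<noteq> 0}"
  have B: "finite ?B" using finite_sf[OF w0_W] finite_sf[OF gW(1)] by simp
  have 2: "pair (sf w0) (\<lambda>a. cnj (sf (rho g w0) a)) = (\<Sum>a\<in>?B. sf w0 a * cnj (sf (rho g w0) a))"
    by (rule pair_eq[OF B]) auto
  have 3: "pair (sf (rho g w0)) (\<lambda>a. cnj (sf w0 a)) = (\<Sum>a\<in>?B. sf (rho g w0) a * cnj (sf w0 a))"
    by (rule pair_eq[OF B]) auto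
  have "ell (rho g w0) * N0 = cnj (ell (rho (inv2 g) w0) * N0)"
    unfolding H[OF gW(1), symmetric] 1[symmetric] 2 3 by (simp add: mult.commute)
  then show ?thesis using N0_real N0_nz by simp
qed

section \<open>The map from cochains back to the representation\<close>

definition P1 :: "(('f ^ 2) set set list \<Rightarrow> complex) \<Rightarrow> 'f ^ 2 ^ 2 \<Rightarrow> complex"
  where "P1 h = (\<Sum>a | h a \<noteq> 0. sc (h a) (fv a))"

lemma P1_apply: "P1 h x = pair h (\<lambda>a. fv a x)"
  by (simp add: P1_def pair_def sum_fun_apply sc_def)

text \<open>The sum is \<open>K\<close>-fixed and so a multiple of \<open>w0\<close>. Applying
  \<open>ell\<close> finds the multiple, because \<open>ell_cnj\<close> turns
  \<open>ell (fv a)\<close> into the conjugate of \<open>sf w0 a\<close>.\<close>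

lemma P1_sf_w0: "P1 (sf w0) = sc N0 w0"
proof -
  have S: "finite {a. sf w0 a \<noteq> 0}" by (rule finite_sf[OF w0_W])
  have inW: "sc (sf w0 a) (fv a) \<in> W" if "a \<in> {a. sf w0 a \<noteq> 0}" for a
    using that by (auto intro!: W_sc fv_W sf_X)
  have PW: "P1 (sf w0) \<in> W" unfolding P1_def by (rule W_sum[OF inW])
  have "rho k (P1 (sf w0)) = P1 (sf w0)" if k: "k \<in> K" for k
  proof
    fix x
    have "P1 (sf w0) x = pair (sf w0) (\<lambda>a. fv a x)" by (rule P1_apply)
    moreover have "pair (sf w0) (\<lambda>a. fv a x) = pair (sf w0) (\<lambda>a. rho k (fv a) x)"
    proof (rule pair_shift[OF K_inv[OF k], where k = "Suc n"])
      show "sf w0 (actp k a) = sf w0 a" if "a \<in> X" for a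
        using sf_shift[OF that K_inv[OF k] w0_W] Fx_rho[OF w0(1) k] by simp
      show "fv (actp k a) x = rho k (fv a) x" if "a \<in> X" for a
        by (simp only: fv_shift[OF that K_inv[OF k]])
    qed (rule sf_X, assumption)+
    moreover have "pair (sf w0) (\<lambda>a. rho k (fv a) x) = P1 (sf w0) (x ** k)"
      by (simp add: P1_apply rho_def)
    ultimately show "rho k (P1 (sf w0)) x = P1 (sf w0) x" by (simp add: rho_def)
  qed
  then have "P1 (sf w0) \<in> Fx K" using PW by (simp add: Fx_def)
  then obtain z where z: "P1 (sf w0) = sc z w0" using newform_unique[OF w0] by blast
  have "ell (P1 (sf w0)) = (\<Sum>a | sf w0 a \<noteq> 0. ell (sc (sf w0 a) (fv a)))"
    unfolding P1_def by (rule linear_sum[OF ell_add ell_sc S inW])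
  also have "\<dots> = (\<Sum>a | sf w0 a \<noteq> 0. sf w0 a * cnj (sf w0 a))"
  proof (rule sum.cong)
    fix a assume "a \<in> {a. sf w0 a \<noteq> 0}"
    then have a: "a \<in> X" by (auto intro: sf_X)
    have "ell (fv a) = cnj (sf w0 a)" using ell_cnj[OF rep(1)[OF a]] a by (simp add: fv_def sf_def)
    then show "ell (sc (sf w0 a) (fv a)) = sf w0 a * cnj (sf w0 a)" by (simp add: ell_sc[OF fv_W[OF a]])
  qed simp
  finally have "ell (P1 (sf w0)) = N0" by (simp add: N0_def pair_def)
  moreover have "ell (P1 (sf w0)) = z" unfolding z ell_sc[OF w0_W] ell_w0 by simp
  ultimately show ?thesis using z by simp
qed

lemma fiber_sum:
  assumes S: "finite S" "S \<subseteq> X" and g: "invertible g"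
    and st: "\<And>B a. B \<in> Kg 0 (int n) \<Longrightarrow> a \<in> S \<Longrightarrow> actp (g ** B ** inv2 g) a \<in> S"
  shows "(\<Sum>a\<in>S. fv a) = 0"
proof -
  let ?u = "\<Sum>a\<in>S. fv a"
  have gi: "invertible (inv2 g)" by (rule invertible_inv2[OF g])
  have uW: "?u \<in> W" by (rule W_sum) (use S(2) fv_W in blast)
  have "rho B (rho (inv2 g) ?u) = rho (inv2 g) ?u" if B: "B \<in> Kg 0 (int n)" for B
  proof -
    let ?h = "g ** B ** inv2 g"
    have hi: "invertible ?h" by (intro invertible_mm g gi Kg_inv[OF B]) (use n1 in simp_all)
    have inj: "inj_on (actp ?h) S" by (rule inj_on_subset[OF inj_actp[OF hi] S(2)])
    have "actp ?h ` S \<subseteq> S" using st[OF B] by blast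
    then have img: "actp ?h ` S = S" by (rule endo_inj_surj[OF S(1) _ inj])
    have "rho ?h ?u = (\<Sum>a\<in>S. rho ?h (fv a))" by (rule rho_sum)
    moreover have "(\<Sum>a\<in>S. rho ?h (fv a)) = (\<Sum>a\<in>S. fv (actp ?h a))"
      by (rule sum.cong) (use fv_shift[OF _ hi] S(2) in auto)
    moreover have "(\<Sum>a\<in>S. fv (actp ?h a)) = (\<Sum>a\<in>actp ?h ` S. fv a)"
      unfolding sum.reindex[OF inj] comp_def ..
    ultimately have hu: "rho ?h ?u = ?u" using img by simp
    have hB: "rho B (rho (inv2 g) ?u) = rho (inv2 g ** ?h) ?u"
      by (simp only: rho_mult matrix_mul_assoc[symmetric] inv2_cancel(1)[OF g])
    show ?thesis using hB unfolding rho_mult[of "inv2 g" ?h ?u, symmetric] hu .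
  qed
  then have "rho (inv2 g) ?u \<in> Fx (Kg 0 (int n))" using W_rho[OF gi uW] by (simp add: Fx_def)
  then have "rho (inv2 g) ?u = 0" using old_zero[of "rho (inv2 g) ?u"] by simp
  then show ?thesis using rho_inv2(2)[OF g, of ?u] by simp
qed

text \<open>Meant for \<open>tl\<close> and \<open>butlast\<close>, of which only equivariance and
  finiteness of fibres matter. The sum is grouped by fibres, and each fibre is stable under the
  stabilizer of its base path, a conjugate of the group of level \<open>n\<close>.\<close>

lemma fiber_map_sum:
  fixes t :: "('f ^ 2) set set list \<Rightarrow> ('f ^ 2) set set list"
  assumes t: "\<And>A a. a \<in> X \<Longrightarrow> t (actp A a) = actp A (t a)"
    and fin: "\<And>p. p \<in> tree_paths n \<Longrightarrow> finite {a \<in> X. t a = p}"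
    and f: "finite {p. f p \<noteq> 0}" "\<And>p. f p \<noteq> 0 \<Longrightarrow> p \<in> tree_paths n"
  shows "finite {a \<in> X. f (t a) \<noteq> 0}" "(\<Sum>a | a \<in> X \<and> f (t a) \<noteq> 0. sc (f (t a)) (fv a)) = 0"
proof -
  let ?A = "{a \<in> X. f (t a) \<noteq> 0}"
  have U: "?A = (\<Union>p\<in>{p. f p \<noteq> 0}. {a \<in> X. t a = p})" by auto
  show finA: "finite ?A" unfolding U using f fin by (intro finite_UN_I) auto
  have z: "(\<Sum>a | a \<in> X \<and> t a = p. fv a) = 0" if p: "p \<in> tree_paths n" for p
  proof -
    obtain g where g: "invertible g" "p = actp g (xp n)" using path_transitive[OF p] by blast
    show ?thesis
    proof (rule fiber_sum[OF fin[OF p] _ g(1)])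
      fix B :: "'f ^ 2 ^ 2" and a :: "('f ^ 2) set set list" assume B: "B \<in> Kg 0 (int n)" and "a \<in> {a \<in> X. t a = p}"
      then have a: "a \<in> X" "t a = p" by auto
      have Bi: "invertible B" by (rule Kg_inv[OF B]) (use n1 in simp_all)
      have i: "invertible (g ** B ** inv2 g)" by (intro invertible_mm g(1) Bi invertible_inv2)
      have "actp (g ** B ** inv2 g) p = actp (g ** B) (actp (inv2 g) p)" by (rule actp_mult[OF p, symmetric])
      moreover have "actp (inv2 g) p = xp n" unfolding g(2) by (rule actp_inv2(1)[OF xp_path g(1)])
      moreover have "actp (g ** B) (xp n) = actp g (actp B (xp n))" by (rule actp_mult[OF xp_path, symmetric])
      moreover have "actp B (xp n) = xp n" by (rule fix_xp[OF B n1])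
      ultimately have "actp (g ** B ** inv2 g) p = p" by (simp only: g(2)[symmetric])
      then show "actp (g ** B ** inv2 g) a \<in> {a \<in> X. t a = p}"
        using t[OF a(1), of "g ** B ** inv2 g"] a(2) actp_path[OF a(1) i] by simp
    qed auto
  qed
  have "(\<Sum>a\<in>?A. sc (f (t a)) (fv a)) = (\<Sum>p | f p \<noteq> 0. \<Sum>a | a \<in> ?A \<and> t a = p. sc (f (t a)) (fv a))"
    by (rule sum.group[symmetric, OF finA f(1)]) auto
  moreover have "(\<Sum>a | a \<in> ?A \<and> t a = p. sc (f (t a)) (fv a)) = 0" if "f p \<noteq> 0" for p
  proof -
    have e: "{a. a \<in> ?A \<and> t a = p} = {a. a \<in> X \<and> t a = p}" using that by auto
    have "(\<Sum>a | a \<in> X \<and> t a = p. sc (f (t a)) (fv a)) = (\<Sum>a | a \<in> X \<and> t a = p. sc (f p) (fv a))"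
      by (rule sum.cong) auto
    also have "\<dots> = 0" unfolding sc_sum[symmetric] z[OF f(2)[OF that]] by simp
    finally show ?thesis unfolding e .
  qed
  ultimately show "(\<Sum>a | a \<in> X \<and> f (t a) \<noteq> 0. sc (f (t a)) (fv a)) = 0" by simp
qed

lemma sum_two_supports:
  fixes p q :: "('f ^ 2) set set list \<Rightarrow> complex"
  assumes h: "\<And>a. h a = p a - q a" and fin: "finite {a. p a \<noteq> 0}" "finite {a. q a \<noteq> 0}"
  shows "P1 h = (\<Sum>a | p a \<noteq> 0. sc (p a) (fv a)) - (\<Sum>a | q a \<noteq> 0. sc (q a) (fv a))"
proof
  fix x
  have hh: "h = (\<lambda>a. p a + (- 1) * q a)" using h by auto
  have "pair (\<lambda>a. p a + (- 1) * q a) (\<lambda>a. fv a x) = pair p (\<lambda>a. fv a x) + pair (\<lambda>a. (- 1) * q a) (\<lambda>a. fv a x)"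
    by (rule pair_add) (simp_all add: fin)
  then have "P1 h x = P1 p x - P1 q x" unfolding P1_apply hh pair_sc by simp
  then show "P1 h x = ((\<Sum>a | p a \<noteq> 0. sc (p a) (fv a)) - (\<Sum>a | q a \<noteq> 0. sc (q a) (fv a))) x"
    by (simp only: P1_def minus_apply)
qed

lemma P1_coboundary:
  assumes f: "finite {p. f p \<noteq> 0}" "\<And>p. f p \<noteq> 0 \<Longrightarrow> p \<in> tree_paths n"
  shows "P1 (coboundary n f) = 0"
proof -
  let ?p = "\<lambda>a. if a \<in> X then f (tl a) else 0" and ?q = "\<lambda>a. if a \<in> X then f (butlast a) else 0"
  have tl: "finite {a \<in> X. f (tl a) \<noteq> 0}" "(\<Sum>a | a \<in> X \<and> f (tl a) \<noteq> 0. sc (f (tl a)) (fv a)) = 0"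
    by (rule fiber_map_sum[where t = tl, OF map_tl[symmetric] finite_tl_fiber[OF _ n1] f]; assumption)+
  have bl: "finite {a \<in> X. f (butlast a) \<noteq> 0}" "(\<Sum>a | a \<in> X \<and> f (butlast a) \<noteq> 0. sc (f (butlast a)) (fv a)) = 0"
    by (rule fiber_map_sum[where t = butlast, OF map_butlast[symmetric] finite_butlast_fiber[OF _ n1] f]; assumption)+
  have sp: "{a. ?p a \<noteq> 0} = {a \<in> X. f (tl a) \<noteq> 0}" "{a. ?q a \<noteq> 0} = {a \<in> X. f (butlast a) \<noteq> 0}" by auto
  have "P1 (coboundary n f) = (\<Sum>a | ?p a \<noteq> 0. sc (?p a) (fv a)) - (\<Sum>a | ?q a \<noteq> 0. sc (?q a) (fv a))"
    by (rule sum_two_supports) (use tl(1) bl(1) in \<open>simp_all add: coboundary_def sp\<close>)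
  moreover have "(\<Sum>a | ?p a \<noteq> 0. sc (?p a) (fv a)) = 0" unfolding sp tl(2)[symmetric] by (rule sum.cong) auto
  moreover have "(\<Sum>a | ?q a \<noteq> 0. sc (?q a) (fv a)) = 0" unfolding sp bl(2)[symmetric] by (rule sum.cong) auto
  ultimately show ?thesis by simp
qed

lemma sf_not_coboundary:
  assumes f: "finite {p. f p \<noteq> 0}" "\<And>p. f p \<noteq> 0 \<Longrightarrow> p \<in> tree_paths n"
    and e: "(\<lambda>a. z * sf w0 a) = coboundary n f"
  shows "z = 0"
proof -
  have "P1 (\<lambda>a. z * sf w0 a) = sc z (P1 (sf w0))"
    by (rule ext) (simp add: P1_apply pair_sc sc_def)
  then have "sc (z * N0) w0 = 0" using P1_coboundary[OF f] e by (simp add: P1_sf_w0)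
  then show ?thesis using w0(2) N0_nz by (simp add: sc_eq_0)
qed

text \<open>The kernel \<open>G b a\<close> is invariant under simultaneous translation of both
  paths, by the \<open>K\<close>-invariance of \<open>Y\<close>. Moving \<open>b\<close> to
  \<open>x0\<close> replaces \<open>w0\<close> by its translate under the inverse of
  \<open>rep b\<close>; on that vector the pairing with \<open>G x0\<close> is a
  \<open>K\<close>-invariant functional, hence \<open>sf w0 b\<close> times its value at
  \<open>w0\<close>.\<close>

lemma convolution:
  fixes Y :: "('f ^ 2) set set list \<Rightarrow> complex"
  assumes Y: "\<And>k a. k \<in> K \<Longrightarrow> a \<in> X \<Longrightarrow> Y (actp k a) = Y a"
  shows "\<exists>\<mu>. \<forall>b\<in>X. (\<Sum>a | sf w0 a \<noteq> 0. sf w0 a * Y (actp (inv2 (rep a)) b)) = \<mu> * sf w0 b"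
proof -
  define G where "G b a = Y (actp (inv2 (rep a)) b)" for a b
  have G: "G b (actp g x0) = Y (actp (inv2 g) b)" if g: "invertible g" and b: "b \<in> X" for g b
  proof -
    obtain z C where C: "z \<noteq> 0" "C \<in> K" "rep (actp g x0) = mat z ** (g ** C)" using rep_actp[OF g] by blast
    have Ci: "invertible C" by (rule K_inv[OF C(2)])
    have i: "inv2 (g ** C) = inv2 C ** inv2 g" by (rule inv2_mm[OF g Ci])
    have r: "invertible (rep (actp g x0))" by (rule rep(1)[OF x0_X[OF g]])
    let ?y = "actp (inv2 (rep (actp g x0))) b"
    have yX: "?y \<in> X" by (rule actp_path[OF b invertible_inv2[OF r]])
    have "b = actp (rep (actp g x0)) ?y" by (rule actp_inv2(2)[OF b r, symmetric])
    then have "b = actp g (actp C ?y)" unfolding C(3) actp_scalar[OF C(1)] actp_mult[OF yX, symmetric]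
      using actp_mult[OF yX, of g C] C(3) actp_scalar[OF C(1), of "g ** C"] by metis
    then have e: "actp (inv2 g) b = actp C ?y" using actp_inv2(1)[OF actp_path[OF yX Ci] g] by metis
    show ?thesis unfolding G_def e by (rule Y[OF C(2) yX, symmetric])
  qed
  have Gs: "G (actp h b) (actp h a) = G b a" if h: "invertible h" and a: "a \<in> X" and b: "b \<in> X" for h a b
  proof -
    have r: "invertible (rep a)" by (rule rep(1)[OF a])
    have "actp h a = actp (h ** rep a) x0" using actp_mult[OF xp_path, of h "rep a" "Suc n"] rep(2)[OF a] by simp
    then have g1: "G (actp h b) (actp h a) = Y (actp (inv2 (h ** rep a)) (actp h b))"
      using G[OF invertible_mm[OF h r] actp_path[OF b h]] by simp
    have g2: "actp (inv2 (h ** rep a)) (actp h b) = actp (inv2 (rep a)) b"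
      unfolding inv2_mm[OF h r] actp_mult[OF actp_path[OF b h], symmetric] using actp_inv2(1)[OF b h] by simp
    show ?thesis unfolding g1 g2 by (simp only: G_def)
  qed
  have x0X: "x0 \<in> X" by (rule xp_path)
  have "pair (sf w0) (G b) = pair (sf w0) (G x0) * sf w0 b" if b: "b \<in> X" for b
  proof -
    have r: "invertible (rep b)" by (rule rep(1)[OF b])
    have rW: "rho (inv2 (rep b)) w0 \<in> W" by (rule W_rho[OF invertible_inv2[OF r] w0_W])
    have "pair (sf w0) (G b) = pair (sf (rho (inv2 (rep b)) w0)) (G x0)"
    proof (rule pair_shift[OF r, where k = "Suc n"])
      show "sf w0 (actp (rep b) a) = sf (rho (inv2 (rep b)) w0) a" if "a \<in> X" for a
        using sf_shift[OF that r rW] rho_inv2(2)[OF r] by simp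
      show "G b (actp (rep b) a) = G x0 a" if "a \<in> X" for a
        using Gs[OF r that x0X] rep(2)[OF b] by simp
    qed (rule sf_X, assumption)+
    also have "\<dots> = ell (rho (inv2 (rep b)) w0) * pair (sf w0) (G x0)"
    proof (rule pair_sf_unique[OF _ rW])
      show "G x0 (actp k a) = G x0 a" if "k \<in> K" "a \<in> X" for k a
        using Gs[OF K_inv[OF that(1)] that(2) x0X] fix_xp[OF that(1)] by simp
    qed
    finally show ?thesis using b by (simp add: sf_def)
  qed
  then show ?thesis by (intro exI[of _ "pair (sf w0) (G x0)"]) (simp add: pair_def G_def)
qed

end

section \<open>Linear functionals and one-dimensional spaces\<close>

lemma complex_ring_simps [simp]:
  "carrier complex_ring = UNIV" "monoid.mult complex_ring = (*)" "one complex_ring = 1"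
  "zero complex_ring = 0" "add complex_ring = (+)"
  by (simp_all add: complex_ring_def)

lemma field_complex_ring: "field complex_ring"
proof -
  have "ring complex_ring"
    by (rule ringI) (auto intro!: abelian_groupI monoidI bexI[of _ "- x" for x] simp: algebra_simps)
  then have "cring complex_ring"
    by (intro cring.intro) (auto intro!: comm_monoidI simp: algebra_simps)
  then show ?thesis
  proof (rule cring.cring_fieldI2)
    fix a assume "a \<in> carrier complex_ring" "a \<noteq> \<zero>\<^bsub>complex_ring\<^esub>"
    then show "\<exists>b\<in>carrier complex_ring. a \<otimes>\<^bsub>complex_ring\<^esub> b = \<one>\<^bsub>complex_ring\<^esub>"
      by (intro bexI[of _ "inverse a"]) simp_all
  qed simp
qed

lemma has_dimension_1I:
  fixes M :: "(complex, 'v) module"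
  assumes surj: "carrier M = range F"
    and add: "\<And>a b. F a \<oplus>\<^bsub>M\<^esub> F b = F (a + b)"
    and smult: "\<And>c a. c \<odot>\<^bsub>M\<^esub> F a = F (c * a)"
    and zero: "\<zero>\<^bsub>M\<^esub> = F 0" and nz: "F 1 \<noteq> F 0"
  shows "has_dimension M 1"
proof -
  interpret C: field complex_ring by (rule field_complex_ring)
  have ab: "abelian_group M"
  proof (rule abelian_groupI)
    fix x assume "x \<in> carrier M"
    then obtain a where "x = F a" using surj by auto
    then show "\<exists>y\<in>carrier M. y \<oplus>\<^bsub>M\<^esub> x = \<zero>\<^bsub>M\<^esub>"
      unfolding surj zero by (intro bexI[of _ "F (- a)"]) (simp_all add: add)
  qed (auto simp: surj add zero add_ac)
  have md: "module complex_ring M"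
    by (rule module.intro[OF C.is_cring ab], unfold_locales) (auto simp: surj add smult algebra_simps)
  interpret vectorspace complex_ring M by (rule vectorspace.intro[OF md field_complex_ring])
  have F1: "F 1 \<in> carrier M" using surj by simp
  have "F a \<in> span {F 1}" for a
  proof -
    have c: "a \<odot>\<^bsub>M\<^esub> F 1 \<in> carrier M" unfolding smult surj by simp
    have "lincomb (\<lambda>_. a) {F 1} = a \<odot>\<^bsub>M\<^esub> F 1"
      unfolding lincomb_def using c by (subst finsum_insert) (auto simp: smult surj)
    then have "F a = lincomb (\<lambda>_. a) {F 1}" by (simp add: smult)
    then show ?thesis unfolding span_def by (intro CollectI exI[of _ "\<lambda>_. a"] exI[of _ "{F 1}"]) simp
  qed
  then have gen: "gen_set {F 1}" using surj span_is_subset2[of "{F 1}"] F1 by auto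
  have "dim = 1" by (rule dim1I[OF gen _ F1]) (simp add: zero nz)
  moreover have "fin_dim" unfolding fin_dim_def using gen F1 by (intro exI[of _ "{F 1}"]) simp
  ultimately show ?thesis unfolding has_dimension_def using vectorspace_axioms by simp
qed

text \<open>Zorn's lemma gives a submodule maximal among those that avoid \<open>v0\<close>. It is a
  complement of the line through \<open>v0\<close>, and the functional reads off the coordinate
  along that line.\<close>

lemma ex_functional:
  fixes V :: "(complex, 'v) module"
  assumes V: "vectorspace complex_ring V" and v0: "v0 \<in> carrier V" "v0 \<noteq> \<zero>\<^bsub>V\<^esub>"
  shows "\<exists>lam :: 'v \<Rightarrow> complex. (\<forall>v\<in>carrier V. \<forall>w\<in>carrier V. lam (v \<oplus>\<^bsub>V\<^esub> w) = lam v + lam w) \<and>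
    (\<forall>z. \<forall>v\<in>carrier V. lam (z \<odot>\<^bsub>V\<^esub> v) = z * lam v) \<and> lam v0 = 1"
proof -
  interpret vectorspace complex_ring V by (rule V)
  let ?A = "{M. submodule complex_ring M V \<and> v0 \<notin> M}"
  have sm: "c \<odot>\<^bsub>V\<^esub> v \<in> carrier V" if "v \<in> carrier V" for c v using that by simp
  have ld: "(a + b) \<odot>\<^bsub>V\<^esub> v = a \<odot>\<^bsub>V\<^esub> v \<oplus>\<^bsub>V\<^esub> b \<odot>\<^bsub>V\<^esub> v" if "v \<in> carrier V" for a b v
    using smult_l_distr[of a b v] that by simp
  have rd: "a \<odot>\<^bsub>V\<^esub> (v \<oplus>\<^bsub>V\<^esub> w) = a \<odot>\<^bsub>V\<^esub> v \<oplus>\<^bsub>V\<^esub> a \<odot>\<^bsub>V\<^esub> w" if "v \<in> carrier V" "w \<in> carrier V" for a v w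
    using smult_r_distr[of a v w] that by simp
  have ss: "a \<odot>\<^bsub>V\<^esub> (b \<odot>\<^bsub>V\<^esub> v) = (a * b) \<odot>\<^bsub>V\<^esub> v" if "v \<in> carrier V" for a b v
    using smult_assoc1[of a b v] that by simp
  have s1: "1 \<odot>\<^bsub>V\<^esub> v = v" if "v \<in> carrier V" for v using smult_one[of v] that by simp
  have s0: "0 \<odot>\<^bsub>V\<^esub> v = \<zero>\<^bsub>V\<^esub>" if "v \<in> carrier V" for v using lmult_0[of v] that by simp
  have "\<exists>M\<in>?A. \<forall>X\<in>?A. M \<subseteq> X \<longrightarrow> X = M"
  proof (rule subset_Zorn_nonempty)
    have "submodule complex_ring {\<zero>\<^bsub>V\<^esub>} V"
      by (rule submodule.intro) (simp_all add: module_axioms)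
    then show "?A \<noteq> {}" using v0(2) by blast
    fix C assume C: "C \<noteq> {}" "subset.chain ?A C"
    have CA: "C \<subseteq> ?A" using C(2) by (simp add: subset.chain_def)
    have "submodule complex_ring (\<Union>C) V"
    proof (rule submodule.intro)
      show "module complex_ring V" by (rule module_axioms)
      show "\<Union>C \<subseteq> carrier V" using CA submodule.subset by blast
      show "\<zero>\<^bsub>V\<^esub> \<in> \<Union>C" using CA C(1) submodule.zero_closed by blast
      show "c \<odot>\<^bsub>V\<^esub> v \<in> \<Union>C" if cv: "c \<in> carrier complex_ring" "v \<in> \<Union>C" for c v
      proof -
        obtain M where M: "M \<in> C" "v \<in> M" using cv(2) by blast
        then have "c \<odot>\<^bsub>V\<^esub> v \<in> M" using CA submodule.smult_closed[OF _ cv(1) M(2)] by blast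
        then show ?thesis using M(1) by blast
      qed
      show "v \<oplus>\<^bsub>V\<^esub> w \<in> \<Union>C" if vw: "v \<in> \<Union>C" "w \<in> \<Union>C" for v w
      proof -
        obtain M N where M: "M \<in> C" "v \<in> M" and N: "N \<in> C" "w \<in> N" using vw by blast
        have "M \<subseteq> N \<or> N \<subseteq> M" using C(2) M(1) N(1) by (auto simp: subset.chain_def)
        then obtain Q where Q: "Q \<in> C" "v \<in> Q" "w \<in> Q" using M N by blast
        then have "v \<oplus>\<^bsub>V\<^esub> w \<in> Q" using CA submodule.m_closed[OF _ Q(2,3)] by blast
        then show ?thesis using Q(1) by blast
      qed
    qed
    then show "\<Union>C \<in> ?A" using CA by blast
  qed
  then obtain M where M: "submodule complex_ring M V" "v0 \<notin> M"
    and max: "\<And>X. submodule complex_ring X V \<Longrightarrow> v0 \<notin> X \<Longrightarrow> M \<subseteq> X \<Longrightarrow> X = M" by blast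
  have MV: "m \<in> carrier V" if "m \<in> M" for m using submodule.subset[OF M(1)] that by blast
  have M0: "\<zero>\<^bsub>V\<^esub> \<in> M" by (rule submodule.zero_closed[OF M(1)])
  have Ma: "m \<oplus>\<^bsub>V\<^esub> m' \<in> M" if "m \<in> M" "m' \<in> M" for m m' by (rule submodule.m_closed[OF M(1) that])
  have Ms: "c \<odot>\<^bsub>V\<^esub> m \<in> M" if "m \<in> M" for c m by (rule submodule.smult_closed[OF M(1) _ that]) simp
  have comb: "(m \<oplus>\<^bsub>V\<^esub> a \<odot>\<^bsub>V\<^esub> v) \<oplus>\<^bsub>V\<^esub> (m' \<oplus>\<^bsub>V\<^esub> b \<odot>\<^bsub>V\<^esub> v) = (m \<oplus>\<^bsub>V\<^esub> m') \<oplus>\<^bsub>V\<^esub> (a + b) \<odot>\<^bsub>V\<^esub> v"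
    if "m \<in> carrier V" "m' \<in> carrier V" "v \<in> carrier V" for m m' v a b
    using that by (simp add: ld a_ac)
  have dec: "\<exists>z. \<exists>m\<in>M. v = m \<oplus>\<^bsub>V\<^esub> z \<odot>\<^bsub>V\<^esub> v0" if v: "v \<in> carrier V" for v
  proof (cases "v \<in> M")
    case True
    then have "v = v \<oplus>\<^bsub>V\<^esub> 0 \<odot>\<^bsub>V\<^esub> v0" using v v0 by (simp add: s0)
    then show ?thesis using True by blast
  next
    case False
    define N where "N = {m \<oplus>\<^bsub>V\<^esub> z \<odot>\<^bsub>V\<^esub> v |m z. m \<in> M}"
    have MN: "m \<in> N" if "m \<in> M" for m
    proof -
      have "m = m \<oplus>\<^bsub>V\<^esub> 0 \<odot>\<^bsub>V\<^esub> v" using v MV[OF that] by (simp add: s0)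
      then show ?thesis unfolding N_def using that by blast
    qed
    have "v = \<zero>\<^bsub>V\<^esub> \<oplus>\<^bsub>V\<^esub> 1 \<odot>\<^bsub>V\<^esub> v" using v by (simp add: s1)
    then have vN: "v \<in> N" unfolding N_def using M0 by blast
    have "submodule complex_ring N V"
    proof (rule submodule.intro)
      show "module complex_ring V" by (rule module_axioms)
      show "N \<subseteq> carrier V" using MV v by (auto simp: N_def)
      show "\<zero>\<^bsub>V\<^esub> \<in> N" by (rule MN[OF M0])
      show "x \<oplus>\<^bsub>V\<^esub> y \<in> N" if xy: "x \<in> N" "y \<in> N" for x y
      proof -
        obtain m a where x: "x = m \<oplus>\<^bsub>V\<^esub> a \<odot>\<^bsub>V\<^esub> v" "m \<in> M" using xy(1) by (auto simp: N_def)
        obtain m' b where y: "y = m' \<oplus>\<^bsub>V\<^esub> b \<odot>\<^bsub>V\<^esub> v" "m' \<in> M" using xy(2) by (auto simp: N_def)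
        have "x \<oplus>\<^bsub>V\<^esub> y = (m \<oplus>\<^bsub>V\<^esub> m') \<oplus>\<^bsub>V\<^esub> (a + b) \<odot>\<^bsub>V\<^esub> v"
          unfolding x(1) y(1) by (rule comb[OF MV[OF x(2)] MV[OF y(2)] v])
        then show ?thesis unfolding N_def using Ma[OF x(2) y(2)] by blast
      qed
      show "c \<odot>\<^bsub>V\<^esub> x \<in> N" if cx: "c \<in> carrier complex_ring" "x \<in> N" for c x
      proof -
        obtain m a where x: "x = m \<oplus>\<^bsub>V\<^esub> a \<odot>\<^bsub>V\<^esub> v" "m \<in> M" using cx(2) by (auto simp: N_def)
        have "c \<odot>\<^bsub>V\<^esub> x = c \<odot>\<^bsub>V\<^esub> m \<oplus>\<^bsub>V\<^esub> (c * a) \<odot>\<^bsub>V\<^esub> v"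
          unfolding x(1) using MV[OF x(2)] v by (simp add: rd ss)
        then show ?thesis unfolding N_def using Ms[OF x(2)] by blast
      qed
    qed
    then have "v0 \<in> N" using max[of N] MN vN False by blast
    then obtain m z where m: "v0 = m \<oplus>\<^bsub>V\<^esub> z \<odot>\<^bsub>V\<^esub> v" "m \<in> M" by (auto simp: N_def)
    have z: "z \<noteq> 0"
    proof
      assume "z = 0"
      then have "v0 = m" using m(1) MV[OF m(2)] v by (simp add: s0)
      then show False using m(2) M(2) by blast
    qed
    have "(1 / z) \<odot>\<^bsub>V\<^esub> v0 = (1 / z) \<odot>\<^bsub>V\<^esub> m \<oplus>\<^bsub>V\<^esub> v"
      unfolding m(1) using MV[OF m(2)] v z by (simp add: rd ss s1)
    then have "(- 1 / z) \<odot>\<^bsub>V\<^esub> m \<oplus>\<^bsub>V\<^esub> (1 / z) \<odot>\<^bsub>V\<^esub> v0 = ((- 1 / z) \<odot>\<^bsub>V\<^esub> m \<oplus>\<^bsub>V\<^esub> (1 / z) \<odot>\<^bsub>V\<^esub> m) \<oplus>\<^bsub>V\<^esub> v"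
      using MV[OF m(2)] v by (simp add: a_assoc)
    also have "(- 1 / z) \<odot>\<^bsub>V\<^esub> m \<oplus>\<^bsub>V\<^esub> (1 / z) \<odot>\<^bsub>V\<^esub> m = \<zero>\<^bsub>V\<^esub>"
      using ld[OF MV[OF m(2)], of "- 1 / z" "1 / z"] s0[OF MV[OF m(2)]] by simp
    finally have "v = (- 1 / z) \<odot>\<^bsub>V\<^esub> m \<oplus>\<^bsub>V\<^esub> (1 / z) \<odot>\<^bsub>V\<^esub> v0" using v by simp
    then show ?thesis using Ms[OF m(2)] by blast
  qed
  have uniq: "z = z'" if e: "m \<oplus>\<^bsub>V\<^esub> z \<odot>\<^bsub>V\<^esub> v0 = m' \<oplus>\<^bsub>V\<^esub> z' \<odot>\<^bsub>V\<^esub> v0" and m: "m \<in> M" "m' \<in> M" for m m' z z'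
  proof (rule ccontr)
    assume ne: "z \<noteq> z'"
    have c: "m \<in> carrier V" "m' \<in> carrier V" "v0 \<in> carrier V" using m MV v0 by auto
    have mm: "(- 1) \<odot>\<^bsub>V\<^esub> m \<in> M" by (rule Ms[OF m(1)])
    have "(m \<oplus>\<^bsub>V\<^esub> z \<odot>\<^bsub>V\<^esub> v0) \<oplus>\<^bsub>V\<^esub> ((- 1) \<odot>\<^bsub>V\<^esub> m \<oplus>\<^bsub>V\<^esub> (- z') \<odot>\<^bsub>V\<^esub> v0) = (m \<oplus>\<^bsub>V\<^esub> (- 1) \<odot>\<^bsub>V\<^esub> m) \<oplus>\<^bsub>V\<^esub> (z + - z') \<odot>\<^bsub>V\<^esub> v0"
      by (rule comb[OF c(1) MV[OF mm] c(3)])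
    moreover have "m \<oplus>\<^bsub>V\<^esub> (- 1) \<odot>\<^bsub>V\<^esub> m = \<zero>\<^bsub>V\<^esub>"
      using ld[OF c(1), of 1 "- 1"] s0[OF c(1)] s1[OF c(1)] by simp
    moreover have "(m' \<oplus>\<^bsub>V\<^esub> z' \<odot>\<^bsub>V\<^esub> v0) \<oplus>\<^bsub>V\<^esub> ((- 1) \<odot>\<^bsub>V\<^esub> m \<oplus>\<^bsub>V\<^esub> (- z') \<odot>\<^bsub>V\<^esub> v0) = (m' \<oplus>\<^bsub>V\<^esub> (- 1) \<odot>\<^bsub>V\<^esub> m) \<oplus>\<^bsub>V\<^esub> (z' + - z') \<odot>\<^bsub>V\<^esub> v0"
      by (rule comb[OF c(2) MV[OF mm] c(3)])
    ultimately have "(z - z') \<odot>\<^bsub>V\<^esub> v0 = m' \<oplus>\<^bsub>V\<^esub> (- 1) \<odot>\<^bsub>V\<^esub> m"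
      using e c MV[OF mm] by (simp add: s0)
    then have "(z - z') \<odot>\<^bsub>V\<^esub> v0 \<in> M" using Ma[OF m(2) mm] by simp
    then have "(1 / (z - z')) \<odot>\<^bsub>V\<^esub> ((z - z') \<odot>\<^bsub>V\<^esub> v0) \<in> M" by (rule Ms)
    then show False using ne c(3) M(2) by (simp add: ss s1)
  qed
  define lam where "lam v = (SOME z. \<exists>m\<in>M. v = m \<oplus>\<^bsub>V\<^esub> z \<odot>\<^bsub>V\<^esub> v0)" for v
  have lam: "lam (m \<oplus>\<^bsub>V\<^esub> z \<odot>\<^bsub>V\<^esub> v0) = z" if "m \<in> M" for m z
    unfolding lam_def by (rule some_equality) (use that uniq in blast)+
  show ?thesis
  proof (intro exI[of _ lam] conjI ballI allI)
    fix v w assume vw: "v \<in> carrier V" "w \<in> carrier V"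
    obtain m a where x: "v = m \<oplus>\<^bsub>V\<^esub> a \<odot>\<^bsub>V\<^esub> v0" "m \<in> M" using dec[OF vw(1)] by blast
    obtain m' b where y: "w = m' \<oplus>\<^bsub>V\<^esub> b \<odot>\<^bsub>V\<^esub> v0" "m' \<in> M" using dec[OF vw(2)] by blast
    have "v \<oplus>\<^bsub>V\<^esub> w = (m \<oplus>\<^bsub>V\<^esub> m') \<oplus>\<^bsub>V\<^esub> (a + b) \<odot>\<^bsub>V\<^esub> v0"
      unfolding x(1) y(1) by (rule comb[OF MV[OF x(2)] MV[OF y(2)] v0(1)])
    then show "lam (v \<oplus>\<^bsub>V\<^esub> w) = lam v + lam w"
      using lam[OF Ma[OF x(2) y(2)]] lam[OF x(2)] lam[OF y(2)] x(1) y(1) by simp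
  next
    fix z v assume v: "v \<in> carrier V"
    obtain m a where x: "v = m \<oplus>\<^bsub>V\<^esub> a \<odot>\<^bsub>V\<^esub> v0" "m \<in> M" using dec[OF v] by blast
    have "z \<odot>\<^bsub>V\<^esub> v = z \<odot>\<^bsub>V\<^esub> m \<oplus>\<^bsub>V\<^esub> (z * a) \<odot>\<^bsub>V\<^esub> v0"
      unfolding x(1) using MV[OF x(2)] v0(1) by (simp add: rd ss)
    then show "lam (z \<odot>\<^bsub>V\<^esub> v) = z * lam v" using lam[OF Ms[OF x(2)]] lam[OF x(2)] x(1) by simp
  next
    have "v0 = \<zero>\<^bsub>V\<^esub> \<oplus>\<^bsub>V\<^esub> 1 \<odot>\<^bsub>V\<^esub> v0" using v0(1) by (simp add: s1)
    then show "lam v0 = 1" using lam[OF M0, of 1] by simp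
  qed
qed

subsection \<open>The group PGL(2,F)\<close>

lemma carrier_GL2: "carrier GL2 = {A. invertible A}" by (simp add: GL2_def)

lemma carrier_PGL2: "carrier PGL2 = pgl ` {A :: 'f::nonarch_local_field ^ 2 ^ 2. invertible A}"
  by (auto simp: PGL2_def FactGroup_def RCOSETS_def pgl_def carrier_GL2)

lemma mult_PGL2: "pgl A \<otimes>\<^bsub>PGL2\<^esub> pgl B = pgl (A ** B)" for A B :: "'f::nonarch_local_field ^ 2 ^ 2"
proof -
  have e: "mat a ** A ** (mat b ** B) = mat (a * b) ** (A ** B)" for a b
  proof -
    have "mat a ** A ** (mat b ** B) = mat a ** ((A ** mat b) ** B)" by (simp only: matrix_mul_assoc)
    also have "\<dots> = (mat a ** mat b) ** (A ** B)" unfolding mat_comm[of A b] by (simp only: matrix_mul_assoc)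
    finally show ?thesis by (simp only: mat_mult)
  qed
  have "pgl A \<otimes>\<^bsub>PGL2\<^esub> pgl B = {x ** y |x y. x \<in> pgl A \<and> y \<in> pgl B}"
    by (auto simp: PGL2_def FactGroup_def set_mult_def GL2_def)
  also have "\<dots> = pgl (A ** B)"
  proof (intro subset_antisym subsetI)
    fix u assume "u \<in> {x ** y |x y. x \<in> pgl A \<and> y \<in> pgl B}"
    then obtain a b where "a \<noteq> 0" "b \<noteq> 0" "u = mat a ** A ** (mat b ** B)" unfolding pgl_eq by blast
    then show "u \<in> pgl (A ** B)" unfolding pgl_eq e by (intro CollectI exI[of _ "a * b"]) simp
  next
    fix u assume "u \<in> pgl (A ** B)"
    then obtain a where a: "a \<noteq> 0" "u = mat a ** (A ** B)" unfolding pgl_eq by blast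
    have "u = (mat a ** A) ** B" using a(2) by (simp only: matrix_mul_assoc)
    moreover have "mat a ** A \<in> pgl A" unfolding pgl_eq using a(1) by blast
    ultimately show "u \<in> {x ** y |x y. x \<in> pgl A \<and> y \<in> pgl B}" using pgl_self[of B] by blast
  qed
  finally show ?thesis .
qed

lemma one_PGL2: "\<one>\<^bsub>PGL2\<^esub> = pgl (mat 1 :: 'f::nonarch_local_field ^ 2 ^ 2)"
  unfolding pgl_eq by (simp add: PGL2_def FactGroup_def scalar_matrices_def)

lemma open_P:
  fixes S :: "'f::nonarch_local_field set"
  assumes "open S" "x \<in> S"
  shows "\<exists>m\<ge>1. \<forall>y. y - x \<in> P m \<longrightarrow> y \<in> S"
proof -
  obtain e where e: "e > 0" "\<And>y. dist y x < e \<Longrightarrow> y \<in> S" using assms unfolding open_dist by blast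
  obtain k where k: "nrm (unif::'f) ^ k < e" using real_arch_pow_inv[OF e(1) unif(2)] by blast
  have "y \<in> S" if y: "y - x \<in> P (int (Suc k))" for y
  proof -
    have "dist y x = nrm (y - x)" using dist_translate[of "y - x" x 0] by simp
    also have "\<dots> \<le> nrm (unif::'f) ^ Suc k" using y by (simp only: P_def mem_Collect_eq power_int_of_nat)
    also have "\<dots> \<le> nrm (unif::'f) ^ k" by (rule power_decreasing) (use unif(1,2)[where 'f='f] in auto)
    finally show ?thesis using k e(2) by simp
  qed
  then show ?thesis by (intro exI[of _ "int (Suc k)"]) simp
qed

text \<open>Passes a neighbourhood basis from entries to vectors of length two; it is applied to
  rows first and then to matrices.\<close>

lemma open_vec2:
  assumes "open_x": "\<And>S x. open (S :: 'a::topological_space set) \<Longrightarrow> x \<in> S \<Longrightarrow> \<exists>m\<ge>1. \<forall>y. Q x m y \<longrightarrow> y \<in> S"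
    and mono: "\<And>x m m' y. m \<le> m' \<Longrightarrow> Q x m' y \<Longrightarrow> Q x m y"
    and S: "open (S :: ('a ^ 2) set)" "x \<in> S"
  shows "\<exists>m\<ge>(1::int). \<forall>y. Q (x$1) m (y$1) \<and> Q (x$2) m (y$2) \<longrightarrow> y \<in> S"
proof -
  obtain A where A: "\<And>i. open (A i) \<and> x $ i \<in> A i" "\<And>y. (\<forall>i. y $ i \<in> A i) \<Longrightarrow> y \<in> S"
    using S unfolding open_vec_def by blast
  obtain m1 where m1: "m1 \<ge> 1" "\<And>y. Q (x$1) m1 y \<Longrightarrow> y \<in> A 1" using open_x[of "A 1" "x$1"] A(1) by blast
  obtain m2 where m2: "m2 \<ge> 1" "\<And>y. Q (x$2) m2 y \<Longrightarrow> y \<in> A 2" using open_x[of "A 2" "x$2"] A(1) by blast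
  have "y \<in> S" if "Q (x$1) (max m1 m2) (y$1)" "Q (x$2) (max m1 m2) (y$2)" for y
  proof (rule A(2))
    have "Q (x$1) m1 (y$1)" "Q (x$2) m2 (y$2)" using mono[of m1 "max m1 m2"] mono[of m2 "max m1 m2"] that by auto
    then show "\<forall>i. y $ i \<in> A i" using m1(2) m2(2) by (simp add: forall_2)
  qed
  then show ?thesis using m1(1) by (intro exI[of _ "max m1 m2"]) auto
qed

lemma open_Kc:
  fixes S :: "('f::nonarch_local_field ^ 2 ^ 2) set"
  assumes "open S" "mat 1 \<in> S"
  shows "\<exists>m\<ge>1. Kc m \<subseteq> S"
proof -
  let ?e = "mat 1 :: 'f ^ 2 ^ 2"
  have "\<exists>m\<ge>(1::int). \<forall>y. (y$1$1 - ?e$1$1 \<in> P m \<and> y$1$2 - ?e$1$2 \<in> P m) \<and>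
      (y$2$1 - ?e$2$1 \<in> P m \<and> y$2$2 - ?e$2$2 \<in> P m) \<longrightarrow> y \<in> S"
  proof (rule open_vec2[where Q = "\<lambda>x m y. y$1 - x$1 \<in> P m \<and> y$2 - x$2 \<in> P m", OF _ _ assms])
    show "\<exists>m\<ge>1. \<forall>y. y$1 - x$1 \<in> P m \<and> y$2 - x$2 \<in> P m \<longrightarrow> y \<in> T"
      if "open T" "x \<in> T" for T and x :: "'f ^ 2"
      by (rule open_vec2[where Q = "\<lambda>x m y. y - x \<in> P m", OF open_P _ that]) (auto intro: P_mono)
  qed (auto intro: P_mono)
  then obtain m :: int where m: "m \<ge> 1" "\<And>y. y$1$1 - 1 \<in> P m \<and> y$1$2 \<in> P m \<and> y$2$1 \<in> P m \<and> y$2$2 - 1 \<in> P m \<Longrightarrow> y \<in> S"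
    by (auto simp: mat_mat2)
  then show ?thesis by (intro exI[of _ m]) (auto simp: Kc_def)
qed

section \<open>The realization of the module by matrix coefficients\<close>

locale supercuspidal =
  fixes V :: "(complex, 'v) module" and \<pi> :: "('f::nonarch_local_field ^ 2 ^ 2) set \<Rightarrow> 'v \<Rightarrow> 'v"
  assumes irred_sc: "irreducible_supercuspidal V \<pi>"
begin

lemma repr: "representation PGL2 V \<pi>" and irrep: "irreducible_rep PGL2 V \<pi>" and smoothrep: "smooth_rep V \<pi>"
  and jacquet: "carrier (jacquet_module V \<pi>) = {\<zero>\<^bsub>jacquet_module V \<pi>\<^esub>}"
  using irred_sc by (simp_all add: irreducible_supercuspidal_def smooth_rep_def)

lemma group_PGL2: "group (PGL2 :: ('f ^ 2 ^ 2) set monoid)" and vs: "vectorspace complex_ring V"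
  using repr by (simp_all add: representation_def)

sublocale vs: vectorspace complex_ring V by (rule vs)

lemma vs_smult: "v \<in> carrier V \<Longrightarrow> c \<odot>\<^bsub>V\<^esub> v \<in> carrier V" by simp

definition gv :: "'f ^ 2 ^ 2 \<Rightarrow> 'v \<Rightarrow> 'v" where "gv A v = \<pi> (pgl A) v"

lemma pgl_carrier: "invertible A \<Longrightarrow> pgl A \<in> carrier PGL2" for A :: "'f ^ 2 ^ 2"
  by (simp add: carrier_PGL2)

lemma inv_PGL2:
  fixes A :: "'f ^ 2 ^ 2"
  assumes "invertible A"
  shows "inv\<^bsub>PGL2\<^esub> (pgl A) = pgl (inv2 A)"
proof (rule group.inv_equality[OF group_PGL2])
  show "pgl (inv2 A) \<otimes>\<^bsub>PGL2\<^esub> pgl A = \<one>\<^bsub>PGL2\<^esub>" by (simp add: mult_PGL2 one_PGL2 inv2 assms)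
qed (simp_all add: pgl_carrier assms invertible_inv2)

lemma hom: "invertible A \<Longrightarrow> \<pi> (pgl A) \<in> module_hom complex_ring V V" for A :: "'f ^ 2 ^ 2"
  using repr pgl_carrier by (simp add: representation_def)

lemma gv_closed: "invertible A \<Longrightarrow> v \<in> carrier V \<Longrightarrow> gv A v \<in> carrier V"
  and gv_add: "invertible A \<Longrightarrow> v \<in> carrier V \<Longrightarrow> w \<in> carrier V \<Longrightarrow> gv A (v \<oplus>\<^bsub>V\<^esub> w) = gv A v \<oplus>\<^bsub>V\<^esub> gv A w"
  and gv_smult: "invertible A \<Longrightarrow> v \<in> carrier V \<Longrightarrow> gv A (c \<odot>\<^bsub>V\<^esub> v) = c \<odot>\<^bsub>V\<^esub> gv A v"
  using hom[of A] by (auto simp: module_hom_def gv_def)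

lemma gv_mult: "invertible A \<Longrightarrow> invertible B \<Longrightarrow> v \<in> carrier V \<Longrightarrow> gv (A ** B) v = gv A (gv B v)"
  using repr pgl_carrier[of A] pgl_carrier[of B] unfolding representation_def gv_def mult_PGL2[symmetric] by blast

lemma gv_one: "v \<in> carrier V \<Longrightarrow> gv (mat 1) v = v"
  using repr unfolding representation_def gv_def one_PGL2[symmetric] by blast

lemma gv_mat: "a \<noteq> 0 \<Longrightarrow> v \<in> carrier V \<Longrightarrow> gv (mat a ** A) v = gv A v"
  by (simp add: gv_def pgl_mat)

lemma gv_smooth: assumes v: "v \<in> carrier V" shows "\<exists>m\<ge>1. \<forall>h\<in>Kc m. gv h v = v"
proof -
  let ?S = "{A \<in> carrier GL2. pgl A \<in> stabilizer PGL2 \<pi> v}"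
  have "openin (top_of_set (carrier GL2)) ?S"
    using smoothrep v by (auto simp: smooth_rep_def open_PGL2_def)
  then obtain T where T: "open T" "?S = carrier GL2 \<inter> T" unfolding openin_open by blast
  have "mat 1 \<in> ?S" using gv_one[OF v] pgl_carrier[of "mat 1"] by (simp add: carrier_GL2 stabilizer_def gv_def)
  then obtain m where m: "m \<ge> 1" "Kc m \<subseteq> T" using open_Kc[OF T(1)] T(2) by blast
  have "gv h v = v" if h: "h \<in> Kc m" for h
  proof -
    have "h \<in> ?S" unfolding T(2) using m h Kc_inv[OF h m(1)] by (auto simp: carrier_GL2)
    then show ?thesis by (simp add: stabilizer_def gv_def)
  qed
  then show ?thesis using m(1) by blast
qed

lemma subspaceI:
  assumes "S \<subseteq> carrier V" "\<zero>\<^bsub>V\<^esub> \<in> S" "\<And>v w. v \<in> S \<Longrightarrow> w \<in> S \<Longrightarrow> v \<oplus>\<^bsub>V\<^esub> w \<in> S"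
    "\<And>c v. v \<in> S \<Longrightarrow> c \<odot>\<^bsub>V\<^esub> v \<in> S"
  shows "VectorSpace.subspace complex_ring S V"
  using assms by (intro VectorSpace.subspace.intro vs submodule.intro) (auto simp: vs.module_axioms)

lemma gv_irred:
  assumes "S \<subseteq> carrier V" "\<zero>\<^bsub>V\<^esub> \<in> S" "\<And>v w. v \<in> S \<Longrightarrow> w \<in> S \<Longrightarrow> v \<oplus>\<^bsub>V\<^esub> w \<in> S"
    "\<And>c v. v \<in> S \<Longrightarrow> c \<odot>\<^bsub>V\<^esub> v \<in> S" "\<And>A v. invertible A \<Longrightarrow> v \<in> S \<Longrightarrow> gv A v \<in> S"
  shows "S = {\<zero>\<^bsub>V\<^esub>} \<or> S = carrier V"
proof -
  have "VectorSpace.subspace complex_ring S V" using assms by (intro subspaceI) auto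
  moreover have "\<forall>g\<in>carrier PGL2. \<pi> g ` S \<subseteq> S" using assms(5) by (auto simp: carrier_PGL2 gv_def)
  ultimately show ?thesis using irrep by (auto simp: irreducible_rep_def)
qed

lemma ex_nonzero: "\<exists>v\<in>carrier V. v \<noteq> \<zero>\<^bsub>V\<^esub>"
  using irrep vs.zero_closed by (auto simp: irreducible_rep_def)

definition lam :: "'v \<Rightarrow> complex"
  where "lam = (SOME l. (\<forall>v\<in>carrier V. \<forall>w\<in>carrier V. l (v \<oplus>\<^bsub>V\<^esub> w) = l v + l w) \<and>
    (\<forall>z. \<forall>v\<in>carrier V. l (z \<odot>\<^bsub>V\<^esub> v) = z * l v) \<and> (\<exists>v\<in>carrier V. l v = 1))"

lemma lam: "(\<forall>v\<in>carrier V. \<forall>w\<in>carrier V. lam (v \<oplus>\<^bsub>V\<^esub> w) = lam v + lam w) \<and>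
    (\<forall>z. \<forall>v\<in>carrier V. lam (z \<odot>\<^bsub>V\<^esub> v) = z * lam v) \<and> (\<exists>v\<in>carrier V. lam v = 1)"
proof -
  obtain v where v: "v \<in> carrier V" "v \<noteq> \<zero>\<^bsub>V\<^esub>" using ex_nonzero by blast
  have "\<exists>l. (\<forall>v\<in>carrier V. \<forall>w\<in>carrier V. l (v \<oplus>\<^bsub>V\<^esub> w) = l v + l w) \<and>
    (\<forall>z. \<forall>v\<in>carrier V. l (z \<odot>\<^bsub>V\<^esub> v) = z * l v) \<and> (\<exists>v\<in>carrier V. l v = (1::complex))"
    using ex_functional[OF vs v] v(1) by blast
  then show ?thesis unfolding lam_def by (rule someI_ex)
qed

lemma lam_add: "v \<in> carrier V \<Longrightarrow> w \<in> carrier V \<Longrightarrow> lam (v \<oplus>\<^bsub>V\<^esub> w) = lam v + lam w"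
  and lam_smult: "v \<in> carrier V \<Longrightarrow> lam (z \<odot>\<^bsub>V\<^esub> v) = z * lam v"
  and lam_1: "\<exists>v\<in>carrier V. lam v = 1"
  using lam by blast+

text \<open>Matrix coefficients with a fixed functional realize the representation on functions on GL(2,F),
  where addition and scalar multiplication are pointwise and the action is right translation.\<close>

definition \<Phi> :: "'v \<Rightarrow> 'f ^ 2 ^ 2 \<Rightarrow> complex"
  where "\<Phi> v = (\<lambda>x. if invertible x then lam (gv x v) else 0)"

abbreviation W :: "('f ^ 2 ^ 2 \<Rightarrow> complex) set" where "W \<equiv> \<Phi> ` carrier V"

lemma Phi_add: "v \<in> carrier V \<Longrightarrow> w \<in> carrier V \<Longrightarrow> \<Phi> (v \<oplus>\<^bsub>V\<^esub> w) = \<Phi> v + \<Phi> w"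
  by (auto simp: \<Phi>_def fun_simps gv_add gv_closed lam_add)

lemma Phi_smult: "v \<in> carrier V \<Longrightarrow> \<Phi> (c \<odot>\<^bsub>V\<^esub> v) = sc c (\<Phi> v)"
  by (auto simp: \<Phi>_def sc_def gv_smult gv_closed lam_smult)

lemma invertible_mult_right: "invertible g \<Longrightarrow> invertible (x ** g) \<longleftrightarrow> invertible x" for x g :: "'f ^ 2 ^ 2"
  by (simp add: invertible_det_nz det_mul)

lemma Phi_rho: "invertible g \<Longrightarrow> v \<in> carrier V \<Longrightarrow> rho g (\<Phi> v) = \<Phi> (gv g v)"
  by (auto simp: \<Phi>_def rho_def invertible_mult_right gv_mult)

lemma Phi_zero: "\<Phi> \<zero>\<^bsub>V\<^esub> = 0"
proof -
  have "0 \<odot>\<^bsub>V\<^esub> \<zero>\<^bsub>V\<^esub> = \<zero>\<^bsub>V\<^esub>" using vs.lmult_0[of "\<zero>\<^bsub>V\<^esub>"] by simp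
  then show ?thesis using Phi_smult[of "\<zero>\<^bsub>V\<^esub>" 0] by simp
qed

text \<open>The vectors killed by \<open>\<Phi>\<close> form an invariant subspace, and it is proper
  because the value at the identity recovers the nonzero functional \<open>lam\<close>.\<close>

lemma Phi_kernel: assumes "v \<in> carrier V" "\<Phi> v = 0" shows "v = \<zero>\<^bsub>V\<^esub>"
proof -
  let ?S = "{v \<in> carrier V. \<Phi> v = 0}"
  have "?S = {\<zero>\<^bsub>V\<^esub>} \<or> ?S = carrier V"
    by (rule gv_irred) (auto simp: Phi_zero Phi_add Phi_smult gv_closed Phi_rho[symmetric])
  moreover have "?S \<noteq> carrier V"
  proof
    assume e: "?S = carrier V"
    obtain v where v: "v \<in> carrier V" "lam v = 1" using lam_1 by blast
    then have "\<Phi> v = 0" using e by blast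
    then have "\<Phi> v (mat 1) = 0" by (simp add: fun_simps)
    then show False using v by (simp add: \<Phi>_def gv_one)
  qed
  ultimately show ?thesis using assms by blast
qed

lemma Phi_inj: assumes "v \<in> carrier V" "w \<in> carrier V" "\<Phi> v = \<Phi> w" shows "v = w"
proof -
  let ?u = "v \<oplus>\<^bsub>V\<^esub> (- 1) \<odot>\<^bsub>V\<^esub> w"
  have c: "(- 1) \<odot>\<^bsub>V\<^esub> w \<in> carrier V" by (rule vs_smult[OF assms(2)])
  have "\<Phi> ?u = 0" unfolding Phi_add[OF assms(1) c] Phi_smult[OF assms(2)] assms(3) by (simp add: sc_minus_1)
  then have u: "?u = \<zero>\<^bsub>V\<^esub>" by (intro Phi_kernel) (use assms c in auto)
  have "(- 1) \<odot>\<^bsub>V\<^esub> w \<oplus>\<^bsub>V\<^esub> w = (- 1 + 1) \<odot>\<^bsub>V\<^esub> w"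
    using vs.smult_l_distr[of "- 1" 1 w] vs.smult_one[of w] assms(2) by simp
  then have "(- 1) \<odot>\<^bsub>V\<^esub> w \<oplus>\<^bsub>V\<^esub> w = \<zero>\<^bsub>V\<^esub>" using vs.lmult_0[of w] assms(2) by simp
  then have "v = ?u \<oplus>\<^bsub>V\<^esub> w" using assms c by (simp add: vs.a_assoc)
  then show ?thesis using u assms(2) by simp
qed

text \<open>A zero Jacquet module means that the span has a single coset.\<close>

lemma span_all: "vs.span {\<pi> u v \<ominus>\<^bsub>V\<^esub> v | u v. u \<in> upper_unipotents \<and> v \<in> carrier V} = carrier V" (is "vs.span ?X = _")
proof
  have X: "?X \<subseteq> carrier V"
  proof clarify
    fix u :: "('f ^ 2 ^ 2) set" and v assume "u \<in> upper_unipotents" "v \<in> carrier V"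
    moreover then obtain A where "u = pgl A" "A$1$1 = 1" "A$2$2 = 1" "A$2$1 = 0" by (auto simp: upper_unipotents_def)
    moreover then have "invertible A" by (simp add: invertible_det_nz det_2)
    ultimately show "\<pi> u v \<ominus>\<^bsub>V\<^esub> v \<in> carrier V" using gv_closed[of A v] by (simp add: gv_def)
  qed
  have sm: "submodule complex_ring (vs.span ?X) V" by (rule vs.span_is_submodule[OF X])
  then show "vs.span ?X \<subseteq> carrier V" by (rule submodule.subset)
  show "carrier V \<subseteq> vs.span ?X"
  proof
    fix v assume v: "v \<in> carrier V"
    have j: "a_rcosets\<^bsub>V\<^esub> (vs.span ?X) = {vs.span ?X}"
      using jacquet by (simp add: jacquet_module_def quotient_space_def)
    have "vs.span ?X +>\<^bsub>V\<^esub> v \<in> a_rcosets\<^bsub>V\<^esub> (vs.span ?X)"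
      using v by (auto simp: A_RCOSETS_def')
    then have "vs.span ?X +>\<^bsub>V\<^esub> v = vs.span ?X" unfolding j by simp
    moreover have "\<zero>\<^bsub>V\<^esub> \<oplus>\<^bsub>V\<^esub> v \<in> vs.span ?X +>\<^bsub>V\<^esub> v"
      using submodule.zero_closed[OF sm] by (auto simp: a_r_coset_def')
    ultimately show "v \<in> vs.span ?X" using v by simp
  qed
qed

sublocale cuspidal_model W
proof
  show "0 \<in> W" by (rule image_eqI[of _ _ "\<zero>\<^bsub>V\<^esub>"]) (simp_all add: Phi_zero)
  show "v + w \<in> W" if "v \<in> W" "w \<in> W" for v w
    using that by (auto simp: Phi_add[symmetric])
  show scW: "sc c w \<in> W" if "w \<in> W" for c w using that by (auto simp: Phi_smult[symmetric])
  show rW: "rho g w \<in> W" if "invertible g" "w \<in> W" for g w using that by (auto simp: Phi_rho gv_closed)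
  show "rho (mat a) w = w" if "a \<noteq> 0" "w \<in> W" for a w
    using that gv_mat[of a _ "mat 1"] by (auto simp: Phi_rho gv_one)
  show "\<exists>m\<ge>1. \<forall>h\<in>Kc m. rho h w = w" if w: "w \<in> W" for w
  proof -
    obtain v where v: "w = \<Phi> v" "v \<in> carrier V" using w by blast
    obtain m where m: "m \<ge> 1" "\<And>h. h \<in> Kc m \<Longrightarrow> gv h v = v" using gv_smooth[OF v(2)] by blast
    have "rho h w = w" if "h \<in> Kc m" for h unfolding v(1) Phi_rho[OF Kc_inv[OF that m(1)] v(2)] m(2)[OF that] ..
    then show ?thesis using m(1) by blast
  qed
  show "Y = W" if Y: "Y \<subseteq> W" "0 \<in> Y" "\<And>v w. v \<in> Y \<Longrightarrow> w \<in> Y \<Longrightarrow> v + w \<in> Y" "\<And>c v. v \<in> Y \<Longrightarrow> sc c v \<in> Y"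
    "\<And>g v. invertible g \<Longrightarrow> v \<in> Y \<Longrightarrow> rho g v \<in> Y" "Y \<noteq> {0}" for Y
  proof -
    let ?S = "{v \<in> carrier V. \<Phi> v \<in> Y}"
    have "?S = {\<zero>\<^bsub>V\<^esub>} \<or> ?S = carrier V"
      by (rule gv_irred) (auto simp: Phi_zero Phi_add Phi_smult gv_closed Phi_rho[symmetric] Y(2-5))
    moreover have YS: "Y = \<Phi> ` ?S" using Y(1) by blast
    moreover have "?S \<noteq> {\<zero>\<^bsub>V\<^esub>}" using Y(6) YS Phi_zero by auto
    ultimately show ?thesis by auto
  qed
  show "W \<noteq> {0}" using ex_nonzero Phi_kernel by blast
  show "\<exists>N. w \<in> J W N" if w: "w \<in> W" for w
  proof -
    let ?X = "{\<pi> u v \<ominus>\<^bsub>V\<^esub> v | u v. u \<in> upper_unipotents \<and> v \<in> carrier V}"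
    let ?S = "{v \<in> carrier V. \<exists>N. \<Phi> v \<in> J W N}"
    have "VectorSpace.subspace complex_ring ?S V"
    proof (rule subspaceI)
      show "\<zero>\<^bsub>V\<^esub> \<in> ?S" by (simp add: Phi_zero J.J_0)
      show "v \<oplus>\<^bsub>V\<^esub> w \<in> ?S" if vw: "v \<in> ?S" "w \<in> ?S" for v w
      proof -
        obtain N where N: "\<Phi> v \<in> J W N" using vw(1) by blast
        obtain N' where N': "\<Phi> w \<in> J W N'" using vw(2) by blast
        have "\<Phi> v + \<Phi> w \<in> J W (max N N')"
          by (rule J_add[OF J_mono[OF N'] J_mono[OF N]]) simp_all
        then show ?thesis using vw by (auto simp: Phi_add)
      qed
      show "c \<odot>\<^bsub>V\<^esub> v \<in> ?S" if v: "v \<in> ?S" for c v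
      proof -
        obtain N where "\<Phi> v \<in> J W N" using v by blast
        then have "sc c (\<Phi> v) \<in> J W N" by (rule J_sc_closed) (rule scW)
        then show ?thesis using v by (auto simp: Phi_smult)
      qed
    qed auto
    then have sm: "submodule complex_ring ?S V" by (rule vs.is_module)
    have "?X \<subseteq> ?S"
    proof clarify
      fix u :: "('f ^ 2 ^ 2) set" and v assume uv: "u \<in> upper_unipotents" "v \<in> carrier V"
      then obtain A where A: "u = pgl A" "A$1$1 = 1" "A$2$2 = 1" "A$2$1 = 0" by (auto simp: upper_unipotents_def)
      have AU: "A = U (A$1$2)" using A by (cases A rule: mat2_cases) (simp add: U_def)
      have i: "invertible (U (A$1$2))" by (simp add: U_def invertible_mat2)
      have e: "\<pi> u v = gv (U (A$1$2)) v" using A(1) AU by (simp add: gv_def)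
      have gc: "gv (U (A$1$2)) v \<in> carrier V" by (rule gv_closed[OF i uv(2)])
      have m: "\<ominus>\<^bsub>V\<^esub> v = (- 1) \<odot>\<^bsub>V\<^esub> v" 
      proof -
        have "(- 1) \<odot>\<^bsub>V\<^esub> v \<oplus>\<^bsub>V\<^esub> v = (- 1 + 1) \<odot>\<^bsub>V\<^esub> v"
          using vs.smult_l_distr[of "- 1" 1 v] vs.smult_one[of v] uv(2) by simp
        then have "(- 1) \<odot>\<^bsub>V\<^esub> v \<oplus>\<^bsub>V\<^esub> v = \<zero>\<^bsub>V\<^esub>" using vs.lmult_0[of v] uv(2) by simp
        then show ?thesis using vs.minus_equality[of "(- 1) \<odot>\<^bsub>V\<^esub> v" v] vs_smult[OF uv(2)] uv(2) by simp
      qed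
      have "\<Phi> (\<pi> u v \<ominus>\<^bsub>V\<^esub> v) = rho (U (A$1$2)) (\<Phi> v) - \<Phi> v"
        unfolding e a_minus_def m Phi_add[OF gc vs_smult[OF uv(2)]] Phi_smult[OF uv(2)] Phi_rho[OF i uv(2)]
        by (simp add: sc_minus_1)
      moreover have "\<exists>N. A$1$2 \<in> P (- N)" by (rule exI[of _ "- val (A$1$2)"]) (simp add: P_iff)
      then obtain N where "A$1$2 \<in> P (- N)" by blast
      then have "0 + (rho (U (A$1$2)) (\<Phi> v) - \<Phi> v) \<in> J W N" using uv(2) by (intro J.J_step J.J_0) auto
      ultimately show "\<pi> u v \<ominus>\<^bsub>V\<^esub> v \<in> carrier V \<and> (\<exists>N. \<Phi> (\<pi> u v \<ominus>\<^bsub>V\<^esub> v) \<in> J W N)"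
        using e gc uv(2) by auto
    qed
    then have "vs.span ?X \<subseteq> ?S" by (rule vs.span_is_subset[OF _ sm])
    then show ?thesis using w unfolding span_all by blast
  qed
qed

end

subsection \<open>Cohomology classes\<close>

definition cobs :: "nat \<Rightarrow> (('f::nonarch_local_field ^ 2) set set list \<Rightarrow> complex) set"
  where "cobs n = coboundary n ` carrier (cochains0 n)"

text \<open>Written with differences so that it makes sense for arbitrary functions;
  \<open>coset_cl\<close> identifies it with the coset that forms an element of the
  quotient.\<close>

definition cl :: "nat \<Rightarrow> (('f::nonarch_local_field ^ 2) set set list \<Rightarrow> complex) \<Rightarrow> (('f ^ 2) set set list \<Rightarrow> complex) set"
  where "cl n y = {x. x - y \<in> cobs n}"

text \<open>The action of a matrix rather than of its class, for paths of any length, so that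
  vertices and edges of the path graph share one notion.\<close>

definition tr :: "nat \<Rightarrow> 'f::nonarch_local_field ^ 2 ^ 2 \<Rightarrow> (('f ^ 2) set set list \<Rightarrow> complex) \<Rightarrow> ('f ^ 2) set set list \<Rightarrow> complex"
  where "tr k A f = (\<lambda>a. if a \<in> tree_paths k then f (actp (inv2 A) a) else 0)"

lemma finsupp_carrier: "f \<in> carrier (finsupp_space S) \<longleftrightarrow> finite {x. f x \<noteq> 0} \<and> (\<forall>x. f x \<noteq> 0 \<longrightarrow> x \<in> S)"
  by (auto simp: finsupp_space_def)

lemma finsupp_add [simp]: "add (finsupp_space S) = (+)"
  by (intro ext) (simp add: finsupp_space_def plus_fun_apply)

lemma finsupp_smult [simp]: "smult (finsupp_space S) = sc"
  by (intro ext) (simp add: finsupp_space_def sc_def)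

lemma finsupp_closed:
  "f \<in> carrier (finsupp_space S) \<Longrightarrow> g \<in> carrier (finsupp_space S) \<Longrightarrow> f + g \<in> carrier (finsupp_space S)"
  "f \<in> carrier (finsupp_space S) \<Longrightarrow> sc z f \<in> carrier (finsupp_space S)"
  "0 \<in> carrier (finsupp_space S)"
proof -
  assume f: "f \<in> carrier (finsupp_space S)" and g: "g \<in> carrier (finsupp_space S)"
  have "{x. (f + g) x \<noteq> 0} \<subseteq> {x. f x \<noteq> 0} \<union> {x. g x \<noteq> 0}" by (auto simp: plus_fun_apply)
  then have "finite {x. (f + g) x \<noteq> 0}" by (rule finite_subset) (use f g in \<open>simp add: finsupp_carrier\<close>)
  moreover have "x \<in> S" if "(f + g) x \<noteq> 0" for x using that f g by (cases "f x = 0") (auto simp: finsupp_carrier plus_fun_apply)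
  ultimately show "f + g \<in> carrier (finsupp_space S)" by (simp add: finsupp_carrier)
next
  assume f: "f \<in> carrier (finsupp_space S)"
  have "{x. sc z f x \<noteq> 0} \<subseteq> {x. f x \<noteq> 0}" by (auto simp: sc_def)
  then have "finite {x. sc z f x \<noteq> 0}" by (rule finite_subset) (use f in \<open>simp add: finsupp_carrier\<close>)
  then show "sc z f \<in> carrier (finsupp_space S)" using f by (auto simp: finsupp_carrier sc_def)
next
  show "0 \<in> carrier (finsupp_space S)" by (simp add: finsupp_carrier zero_fun_apply)
qed

lemma tl_path: assumes "a \<in> tree_paths (Suc k)" shows "tl a \<in> tree_paths k"
proof -
  obtain A where A: "invertible A" "a = actp A (xp (Suc k))" using path_transitive[OF assms] by blast
  have i: "invertible (Dg 1 unif :: 'a ^ 2 ^ 2)" by simp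
  have "tl a = actp A (actp (Dg 1 unif) (xp k))" unfolding A(2) map_tl[symmetric] tl_xp ..
  then show ?thesis using actp_path[OF actp_path[OF xp_path i] A(1)] by simp
qed

lemma butlast_path: assumes "a \<in> tree_paths (Suc k)" shows "butlast a \<in> tree_paths k"
proof -
  obtain A where A: "invertible A" "a = actp A (xp (Suc k))" using path_transitive[OF assms] by blast
  have "butlast a = actp A (xp k)" unfolding A(2) map_butlast[symmetric] butlast_xp ..
  then show ?thesis using actp_path[OF xp_path A(1)] by simp
qed

lemma tr_diff: "tr k A (f - g) = tr k A f - tr k A g" by (auto simp: tr_def fun_simps)
lemma tr_sc: "tr k A (sc z f) = sc z (tr k A f)" by (auto simp: tr_def sc_def)

lemma tr_mult:
  assumes "invertible A" "invertible B"
  shows "tr k A (tr k B f) = tr k (A ** B) f"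
proof
  fix a
  show "tr k A (tr k B f) a = tr k (A ** B) f a"
  proof (cases "a \<in> tree_paths k")
    case True
    have "actp (inv2 B) (actp (inv2 A) a) = actp (inv2 (A ** B)) a"
      unfolding inv2_mm[OF assms] by (rule actp_mult[OF True])
    then show ?thesis using True actp_path[OF True invertible_inv2[OF assms(1)]] by (simp only: tr_def if_True)
  qed (simp add: tr_def)
qed

lemma tr_one: assumes "\<And>a. f a \<noteq> 0 \<Longrightarrow> a \<in> tree_paths k" shows "tr k (mat 1) f = f"
proof
  fix a show "tr k (mat 1) f a = f a"
  proof (cases "a \<in> tree_paths k")
    case True
    have "actp (inv2 (mat 1)) a = a" unfolding inv2_one by (rule actp_one[OF True])
    then show ?thesis using True by (simp only: tr_def if_True)
  qed (use assms[of a] in \<open>auto simp: tr_def\<close>)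
qed

lemma tr_supp:
  assumes "finite {a. f a \<noteq> 0}" "invertible A"
  shows "finite {a. tr k A f a \<noteq> 0}" "tr k A f a \<noteq> 0 \<Longrightarrow> a \<in> tree_paths k"
proof -
  have "{a. tr k A f a \<noteq> 0} \<subseteq> actp A ` {a. f a \<noteq> 0}"
  proof clarify
    fix a assume "tr k A f a \<noteq> 0"
    then have a: "a \<in> tree_paths k" "f (actp (inv2 A) a) \<noteq> 0" by (auto simp: tr_def split: if_splits)
    then show "a \<in> actp A ` {a. f a \<noteq> 0}"
      using actp_inv2(2)[OF a(1) assms(2)] by (intro image_eqI[of _ _ "actp (inv2 A) a"]) auto
  qed
  then show "finite {a. tr k A f a \<noteq> 0}" by (rule finite_subset) (simp add: assms(1))
qed (auto simp: tr_def split: if_splits)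

lemma tr_coboundary:
  assumes "invertible A"
  shows "tr (Suc n) A (coboundary n f) = coboundary n (tr n A f)"
proof
  fix a
  show "tr (Suc n) A (coboundary n f) a = coboundary n (tr n A f) a"
  proof (cases "a \<in> tree_paths (Suc n)")
    case True
    have "actp (inv2 A) a \<in> tree_paths (Suc n)" by (rule actp_path[OF True invertible_inv2[OF assms]])
    then show ?thesis using True tl_path[OF True] butlast_path[OF True]
      by (simp add: tr_def coboundary_def map_tl map_butlast)
  qed (simp add: tr_def coboundary_def)
qed

lemma cobs_0: "0 \<in> cobs n"
proof -
  have "coboundary n 0 = 0" by (auto simp: coboundary_def fun_simps)
  moreover have "0 \<in> carrier (cochains0 n)" unfolding cochains0_def by (rule finsupp_closed(3))
  ultimately show ?thesis unfolding cobs_def by (metis imageI)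
qed

lemma cobs_add: assumes "x \<in> cobs n" "y \<in> cobs n" shows "x + y \<in> cobs n"
proof -
  obtain f where f: "x = coboundary n f" "f \<in> carrier (cochains0 n)" using assms(1) unfolding cobs_def by blast
  obtain g where g: "y = coboundary n g" "g \<in> carrier (cochains0 n)" using assms(2) unfolding cobs_def by blast
  have "x + y = coboundary n (f + g)" unfolding f(1) g(1) by (auto simp: coboundary_def fun_simps)
  moreover have "f + g \<in> carrier (cochains0 n)" using f(2) g(2) unfolding cochains0_def by (rule finsupp_closed(1))
  ultimately show ?thesis unfolding cobs_def by blast
qed

lemma cobs_sc: assumes "x \<in> cobs n" shows "sc z x \<in> cobs n"
proof -
  obtain f where f: "x = coboundary n f" "f \<in> carrier (cochains0 n)" using assms(1) unfolding cobs_def by blast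
  have "sc z x = coboundary n (sc z f)" unfolding f(1) by (auto simp: coboundary_def sc_def algebra_simps)
  moreover have "sc z f \<in> carrier (cochains0 n)" using f(2) unfolding cochains0_def by (rule finsupp_closed(2))
  ultimately show ?thesis unfolding cobs_def by blast
qed

lemma cobs_tr: assumes "x \<in> cobs n" "invertible A" shows "tr (Suc n) A x \<in> cobs n"
proof -
  obtain f where f: "x = coboundary n f" "f \<in> carrier (cochains0 n)" using assms(1) unfolding cobs_def by blast
  have "tr n A f \<in> carrier (cochains0 n)"
    using f(2) tr_supp[OF _ assms(2), of f n] by (auto simp: cochains0_def finsupp_carrier)
  then show ?thesis unfolding f(1) tr_coboundary[OF assms(2)] cobs_def by blast
qed

lemma cobs_minus: "x \<in> cobs n \<Longrightarrow> - x \<in> cobs n"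
  using cobs_sc[of x n "- 1"] by (simp add: sc_minus_1)

text \<open>An edge in the support of a coboundary has its head or its tail in the support of
  \<open>f\<close>, and both fibres over a path are finite.\<close>

lemma cobs_cochains1: assumes "1 \<le> n" "x \<in> cobs n" shows "x \<in> carrier (cochains1 n)"
proof -
  obtain f where f: "x = coboundary n f" "f \<in> carrier (cochains0 n)" using assms(2) unfolding cobs_def by blast
  let ?A = "(\<Union>p\<in>{p. f p \<noteq> 0}. {a \<in> tree_paths (Suc n). tl a = p}) \<union> (\<Union>p\<in>{p. f p \<noteq> 0}. {a \<in> tree_paths (Suc n). butlast a = p})"
  have "finite ?A"
    using f(2) finite_tl_fiber[OF _ assms(1)] finite_butlast_fiber[OF _ assms(1)]
    by (intro finite_UnI finite_UN_I) (auto simp: cochains0_def finsupp_carrier)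
  moreover have "{a. x a \<noteq> 0} \<subseteq> ?A" unfolding f(1) by (auto simp: coboundary_def split: if_splits)
  ultimately have "finite {a. x a \<noteq> 0}" by (rule rev_finite_subset)
  then show ?thesis unfolding f(1) by (auto simp: cochains1_def finsupp_carrier coboundary_def split: if_splits)
qed

lemma cl_eq_iff: "cl n x = cl n y \<longleftrightarrow> x - y \<in> cobs n"
proof
  assume "cl n x = cl n y"
  moreover have "x \<in> cl n x" by (simp add: cl_def cobs_0)
  ultimately show "x - y \<in> cobs n" by (simp add: cl_def)
next
  assume d: "x - y \<in> cobs n"
  show "cl n x = cl n y"
  proof (intro Set.set_eqI iffI)
    fix u assume "u \<in> cl n x"
    then have "(u - x) + (x - y) \<in> cobs n" unfolding cl_def by (intro cobs_add d) simp
    moreover have "(u - x) + (x - y) = u - y" by (simp add: algebra_simps)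
    ultimately show "u \<in> cl n y" by (simp add: cl_def)
  next
    fix u assume "u \<in> cl n y"
    then have "(u - y) + - (x - y) \<in> cobs n" unfolding cl_def by (intro cobs_add cobs_minus d) simp
    moreover have "(u - y) + - (x - y) = u - x" by (simp add: algebra_simps)
    ultimately show "u \<in> cl n x" by (simp add: cl_def)
  qed
qed

lemma cl_self: "x \<in> cl n x" by (simp add: cl_def cobs_0)

lemma cl_memI: "x \<in> cl n y \<Longrightarrow> cl n y = cl n x"
  using cl_eq_iff[of n x y] by (simp add: cl_def)

lemma coset_cl: "cobs n +>\<^bsub>cochains1 n\<^esub> y = cl n y"
proof (intro Set.set_eqI iffI)
  fix x assume "x \<in> cobs n +>\<^bsub>cochains1 n\<^esub> y"
  then obtain d where "d \<in> cobs n" "x = d + y" by (auto simp: a_r_coset_def' cochains1_def)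
  then show "x \<in> cl n y" by (simp add: cl_def)
next
  fix x assume "x \<in> cl n y"
  then have "x - y \<in> cobs n" "x = (x - y) + y" by (simp_all add: cl_def)
  then show "x \<in> cobs n +>\<^bsub>cochains1 n\<^esub> y" unfolding a_r_coset_def' cochains1_def finsupp_add by blast
qed

lemma H1c_carrier: "carrier (H1c n) = cl n ` carrier (cochains1 n)"
  by (auto simp: H1c_def quotient_space_def A_RCOSETS_def' cobs_def[symmetric] coset_cl)

lemma H1c_zero: "\<zero>\<^bsub>H1c n\<^esub> = cl n 0"
  by (simp add: H1c_def quotient_space_def cobs_def[symmetric] cl_def)

lemma H1c_add: "cl n x \<oplus>\<^bsub>H1c n\<^esub> cl n y = cl n (x + y)"
proof -
  have "cl n x \<oplus>\<^bsub>H1c n\<^esub> cl n y = {u + v |u v. u \<in> cl n x \<and> v \<in> cl n y}"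
    by (auto simp: H1c_def quotient_space_def set_add_defs cochains1_def)
  also have "\<dots> = cl n (x + y)"
  proof (intro Set.set_eqI iffI)
    fix w assume "w \<in> {u + v |u v. u \<in> cl n x \<and> v \<in> cl n y}"
    then obtain u v where w: "w = u + v" "u - x \<in> cobs n" "v - y \<in> cobs n" by (auto simp: cl_def)
    have e: "w - (x + y) = (u - x) + (v - y)" unfolding w(1) by (simp add: algebra_simps)
    show "w \<in> cl n (x + y)" unfolding cl_def mem_Collect_eq e by (rule cobs_add[OF w(2,3)])
  next
    fix w assume w: "w \<in> cl n (x + y)"
    have e: "w - y - x = w - (x + y)" by simp
    have "w - y \<in> cl n x" using w unfolding cl_def mem_Collect_eq e .
    moreover have "w = (w - y) + y" by simp
    ultimately show "w \<in> {u + v |u v. u \<in> cl n x \<and> v \<in> cl n y}" using cl_self by blast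
  qed
  finally show ?thesis .
qed

lemma H1c_smult: "c \<odot>\<^bsub>H1c n\<^esub> cl n x = cl n (sc c x)"
proof -
  have s: "c \<odot>\<^bsub>H1c n\<^esub> cl n x = (\<Union>u\<in>cl n x. cl n (sc c u))"
    by (simp add: H1c_def quotient_space_def cobs_def[symmetric] coset_cl) (simp add: cochains1_def)
  have e: "cl n (sc c u) = cl n (sc c x)" if "u \<in> cl n x" for u
  proof -
    have "u - x \<in> cobs n" using that by (simp add: cl_def)
    then show ?thesis unfolding cl_eq_iff sc_diff[symmetric] by (rule cobs_sc)
  qed
  have "(\<Union>u\<in>cl n x. cl n (sc c u)) = (\<Union>u\<in>cl n x. cl n (sc c x))" by (rule SUP_cong[OF refl e])
  also have "\<dots> = cl n (sc c x)" by (intro UN_constant_eq[OF cl_self] ballI refl)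
  finally show ?thesis unfolding s .
qed

section \<open>Equivariant maps into the cohomology\<close>

context newform_vector
begin

lemma sf_0: "sf 0 = 0"
proof
  fix a
  have "sf (sc 0 0) a = 0 * sf 0 a" by (simp only: sf_sc[OF W_0])
  then show "sf 0 a = 0 a" by (simp add: zero_fun_apply)
qed

lemma sf_rho: assumes "invertible g" "w \<in> W" shows "sf (rho g w) = tr (Suc n) g (sf w)"
proof
  fix a show "sf (rho g w) a = tr (Suc n) g (sf w) a"
    using sf_translate[OF _ assms, of a] by (cases "a \<in> X") (simp_all add: tr_def sf_def)
qed

lemma sf_cochain: "w \<in> W \<Longrightarrow> sf w \<in> carrier (cochains1 n)"
  using finite_sf[of w] sf_X by (auto simp: cochains1_def finsupp_carrier)

text \<open>All translates are supported in one finite set of paths and take values in one finite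
  set. This allows the average over \<open>K\<close> to be formed as a finite sum over the
  orbit.\<close>

lemma finite_tr_orbit:
  assumes y: "y \<in> carrier (cochains1 n)"
  shows "finite {tr (Suc n) k y |k. k \<in> K}"
proof -
  let ?A = "\<Union>a\<in>{a. y a \<noteq> 0}. {actp g a |g. g \<in> GO}"
  let ?B = "insert 0 (y ` {a. y a \<noteq> 0})"
  have ys: "finite {a. y a \<noteq> 0}" "\<And>a. y a \<noteq> 0 \<Longrightarrow> a \<in> X" using y by (auto simp: cochains1_def finsupp_carrier)
  have "finite ?A" using ys finite_GO_orbit[where k = "Suc n"] by (intro finite_UN_I) auto
  moreover have "finite ?B" using ys(1) by simp
  ultimately have fin: "finite {f. \<forall>x. (x \<in> ?A \<longrightarrow> f x \<in> ?B) \<and> (x \<notin> ?A \<longrightarrow> f x = 0)}"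
    by (rule finite_set_of_finite_funs)
  have "{tr (Suc n) k y |k. k \<in> K} \<subseteq> {f. \<forall>x. (x \<in> ?A \<longrightarrow> f x \<in> ?B) \<and> (x \<notin> ?A \<longrightarrow> f x = 0)}"
  proof clarify
    fix k :: "'f ^ 2 ^ 2" and x assume k: "k \<in> K"
    have "tr (Suc n) k y x \<in> ?B" by (auto simp: tr_def)
    moreover have "x \<in> ?A" if nz: "tr (Suc n) k y x \<noteq> 0"
    proof -
      have x: "x \<in> X" "y (actp (inv2 k) x) \<noteq> 0" using nz by (auto simp: tr_def split: if_splits)
      have "x = actp k (actp (inv2 k) x)" by (rule actp_inv2(2)[OF x(1) K_inv[OF k], symmetric])
      then show ?thesis using x(2) K_GO[OF k] by blast
    qed
    ultimately show "(x \<in> ?A \<longrightarrow> tr (Suc n) k y x \<in> ?B) \<and> (x \<notin> ?A \<longrightarrow> tr (Suc n) k y x = 0)" by blast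
  qed
  then show ?thesis by (rule finite_subset[OF _ fin])
qed

text \<open>A relation stands for an equivariant map to a quotient of the space of cochains: \<open>Th w\<close> is
  the set of representatives of the image of \<open>w\<close>.\<close>

lemma hom_classify:
  fixes Th :: "('f ^ 2 ^ 2 \<Rightarrow> complex) \<Rightarrow> (('f ^ 2) set set list \<Rightarrow> complex) set"
  assumes Th: "\<And>w y. w \<in> W \<Longrightarrow> y \<in> Th w \<Longrightarrow> y \<in> carrier (cochains1 n)" and ne: "y0 \<in> Th w0"
    and add: "\<And>w w' y y'. w \<in> W \<Longrightarrow> w' \<in> W \<Longrightarrow> y \<in> Th w \<Longrightarrow> y' \<in> Th w' \<Longrightarrow> y + y' \<in> Th (w + w')"
    and scal: "\<And>w y z. w \<in> W \<Longrightarrow> y \<in> Th w \<Longrightarrow> sc z y \<in> Th (sc z w)"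
    and equiv: "\<And>g w y. invertible g \<Longrightarrow> w \<in> W \<Longrightarrow> y \<in> Th w \<Longrightarrow> tr (Suc n) g y \<in> Th (rho g w)"
  shows "\<exists>z. \<forall>w\<in>W. sc z (sf w) \<in> Th w"
proof -
  have zero: "0 \<in> Th 0" using scal[OF w0_W ne, of 0] by simp
  have sumI: "(\<Sum>i\<in>A. F i) \<in> Th (\<Sum>i\<in>A. u i)" if "finite A" "\<And>i. i \<in> A \<Longrightarrow> u i \<in> W" "\<And>i. i \<in> A \<Longrightarrow> F i \<in> Th (u i)"
    for A :: "'i set" and F u
    using that
  proof (induction A rule: finite_induct)
    case empty
    show ?case using zero by simp
  next
    case (insert x B)
    have 1: "u x \<in> W" "(\<Sum>i\<in>B. u i) \<in> W" using insert.prems(1) by (auto intro: W_sum)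
    have 2: "(\<Sum>i\<in>B. F i) \<in> Th (\<Sum>i\<in>B. u i)" using insert.prems by (intro insert.IH) auto
    show ?case unfolding sum.insert[OF insert.hyps(1,2)] using insert.prems(2) by (intro add[OF 1 _ 2]) auto
  qed
  have y0: "y0 \<in> carrier (cochains1 n)" by (rule Th[OF w0_W ne])
  have y0X: "y0 a \<noteq> 0 \<Longrightarrow> a \<in> X" for a using y0 by (simp add: cochains1_def finsupp_carrier)
  let ?O = "{tr (Suc n) k y0 |k. k \<in> K}"
  have finO: "finite ?O" by (rule finite_tr_orbit[OF y0])
  have "tr (Suc n) (mat 1) y0 \<in> ?O" by (intro CollectI exI[of _ "mat 1"]) simp
  then have cO: "of_nat (card ?O) \<noteq> (0 :: complex)" using finO by auto
  have O_Th: "f \<in> Th w0" if f: "f \<in> ?O" for f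
  proof -
    obtain k where k: "f = tr (Suc n) k y0" "k \<in> K" using f by blast
    show ?thesis using equiv[OF K_inv[OF k(2)] w0_W ne] Fx_rho[OF w0(1) k(2)] k(1) by simp
  qed
  \<comment> \<open>The average of \<open>y0\<close> over its finite \<open>K\<close>-orbit. It
    still represents the image of \<open>w0\<close>, because each translate of \<open>y0\<close>
    represents that of a translate of \<open>w0\<close>, which is \<open>w0\<close> again.\<close>
  define Y where "Y = sc (1 / of_nat (card ?O)) (\<Sum>f\<in>?O. f)"
  have "(\<Sum>f\<in>?O. f) \<in> Th (\<Sum>f\<in>?O. w0)" by (rule sumI[OF finO w0_W O_Th])
  then have "(\<Sum>f\<in>?O. f) \<in> Th (sc (of_nat (card ?O)) w0)" by (simp only: sum_const_sc)
  then have "Y \<in> Th (sc (1 / of_nat (card ?O)) (sc (of_nat (card ?O)) w0))"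
    unfolding Y_def by (rule scal[OF W_sc[OF w0_W]])
  then have Y: "Y \<in> Th w0" using cO by simp
  have Yinv: "Y (actp k a) = Y a" if k: "k \<in> K" and a: "a \<in> X" for k a
  proof -
    have ki: "invertible k" by (rule K_inv[OF k])
    have kk: "inv2 k \<in> K" by (rule K_inv2[OF k])
    have kki: "invertible (inv2 k)" by (rule K_inv[OF kk])
    have sub: "tr (Suc n) (inv2 k) ` ?O \<subseteq> ?O"
    proof clarify
      fix h :: "'f ^ 2 ^ 2" assume h: "h \<in> K"
      show "\<exists>k'. tr (Suc n) (inv2 k) (tr (Suc n) h y0) = tr (Suc n) k' y0 \<and> k' \<in> K"
        by (intro exI[of _ "inv2 k ** h"] conjI tr_mult kki K_inv[OF h] K_mm kk h)
    qed
    have inj: "inj_on (tr (Suc n) (inv2 k)) ?O"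
    proof (rule inj_onI)
      fix f g assume fg: "f \<in> ?O" "g \<in> ?O" "tr (Suc n) (inv2 k) f = tr (Suc n) (inv2 k) g"
      have c: "tr (Suc n) k (tr (Suc n) (inv2 k) f) = f" if "f \<in> ?O" for f
      proof -
        have "tr (Suc n) k (tr (Suc n) (inv2 k) f) = tr (Suc n) (mat 1) f"
          unfolding tr_mult[OF ki kki] by (simp only: inv2(1)[OF ki])
        moreover have "tr (Suc n) (mat 1) f = f"
          by (rule tr_one) (use that in \<open>auto simp: tr_def split: if_splits\<close>)
        ultimately show ?thesis by (rule trans)
      qed
      show "f = g"
        by (rule trans[OF trans[OF c[OF fg(1), symmetric] arg_cong[OF fg(3), of "tr (Suc n) k"]] c[OF fg(2)]])
    qed
    have img: "tr (Suc n) (inv2 k) ` ?O = ?O" by (rule endo_inj_surj[OF finO sub inj])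
    have v: "tr (Suc n) (inv2 k) f a = f (actp k a)" for f using a by (simp add: tr_def inv2_inv2[OF ki])
    have "(\<Sum>f\<in>tr (Suc n) (inv2 k) ` ?O. f a) = (\<Sum>f\<in>?O. f (actp k a))"
      unfolding sum.reindex[OF inj] comp_def v ..
    then have "(\<Sum>f\<in>?O. f a) = (\<Sum>f\<in>?O. f (actp k a))" unfolding img .
    then show ?thesis by (simp only: Y_def sc_def sum_fun_apply)
  qed
  have "\<exists>\<mu>. \<forall>b\<in>X. (\<Sum>a | sf w0 a \<noteq> 0. sf w0 a * Y (actp (inv2 (rep a)) b)) = \<mu> * sf w0 b"
  proof (rule convolution)
    show "Y (actp k a) = Y a" if "k \<in> K" "a \<in> X" for k a by (rule Yinv[OF that])
  qed
  then obtain \<mu> where mu': "\<forall>b\<in>X. (\<Sum>a | sf w0 a \<noteq> 0. sf w0 a * Y (actp (inv2 (rep a)) b)) = \<mu> * sf w0 b" ..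
  note mu = bspec[OF mu']
  let ?S = "{a. sf w0 a \<noteq> 0}"
  have SX: "a \<in> X" if "a \<in> ?S" for a using that sf_X by blast
  have Z: "(\<Sum>a\<in>?S. sc (sf w0 a) (tr (Suc n) (rep a) Y)) = sc \<mu> (sf w0)"
  proof
    fix b
    show "(\<Sum>a\<in>?S. sc (sf w0 a) (tr (Suc n) (rep a) Y)) b = sc \<mu> (sf w0) b"
    proof (cases "b \<in> X")
      case True
      then show ?thesis using mu[OF True] by (simp add: sum_fun_apply sc_def tr_def)
    next
      case False
      then have "sf w0 b = 0" by (simp add: sf_def)
      then show ?thesis using False by (simp add: sum_fun_apply sc_def tr_def)
    qed
  qed
  have "(\<Sum>a\<in>?S. sc (sf w0 a) (tr (Suc n) (rep a) Y)) \<in> Th (\<Sum>a\<in>?S. sc (sf w0 a) (rho (rep a) w0))"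
  proof (rule sumI[OF finite_sf[OF w0_W]])
    fix a assume "a \<in> ?S"
    then have r: "invertible (rep a)" by (rule rep(1)[OF SX])
    show "sc (sf w0 a) (rho (rep a) w0) \<in> W" by (rule W_sc[OF W_rho[OF r w0_W]])
    show "sc (sf w0 a) (tr (Suc n) (rep a) Y) \<in> Th (sc (sf w0 a) (rho (rep a) w0))"
      by (rule scal[OF W_rho[OF r w0_W] equiv[OF r w0_W Y]])
  qed
  then have "sc \<mu> (sf w0) \<in> Th (sc N0 w0)" unfolding Z using P1_sf_w0 by (simp add: P1_def fv_def)
  then have "sc (1 / N0) (sc \<mu> (sf w0)) \<in> Th (sc (1 / N0) (sc N0 w0))" by (rule scal[OF W_sc[OF w0_W]])
  then have base: "sc (\<mu> / N0) (sf w0) \<in> Th w0" using N0_nz by simp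
  \<comment> \<open>The relation spreads from \<open>w0\<close> to the combinations of its
    translates, which by irreducibility are all of \<open>W\<close>.\<close>
  have "w \<in> W \<and> sc (\<mu> / N0) (sf w) \<in> Th w" if "w \<in> GS w0" for w
    using that
  proof (induction rule: GS.induct)
    case GS_0
    show ?case using zero W_0 by (simp add: sf_0)
  next
    case (GS_step w g t)
    have gW: "rho g w0 \<in> W" by (rule W_rho[OF GS_step.hyps(2) w0_W])
    have tW: "sc t (rho g w0) \<in> W" by (rule W_sc[OF gW])
    have e: "sf (w + sc t (rho g w0)) = sf w + sc t (tr (Suc n) g (sf w0))"
      using sf_add[of w "sc t (rho g w0)"] GS_step.IH tW sf_sc[OF gW, of t] sf_rho[OF GS_step.hyps(2) w0_W]
      by (simp add: fun_eq_iff plus_fun_apply sc_def)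
    have "tr (Suc n) g (sc (\<mu> / N0) (sf w0)) \<in> Th (rho g w0)" by (rule equiv[OF GS_step.hyps(2) w0_W base])
    then have "sc t (tr (Suc n) g (sc (\<mu> / N0) (sf w0))) \<in> Th (sc t (rho g w0))" by (rule scal[OF gW])
    then have "sc (\<mu> / N0) (sf w) + sc t (tr (Suc n) g (sc (\<mu> / N0) (sf w0))) \<in> Th (w + sc t (rho g w0))"
      using GS_step.IH by (intro add tW) auto
    moreover have "sc (\<mu> / N0) (sf w) + sc t (tr (Suc n) g (sc (\<mu> / N0) (sf w0))) = sc (\<mu> / N0) (sf (w + sc t (rho g w0)))"
      unfolding e tr_sc sc_add sc_sc by (simp add: mult.commute)
    ultimately show ?case using W_add[OF _ tW] GS_step.IH by simp
  qed
  then show ?thesis using GS_W[OF w0_W w0(2)] by blast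
qed

end

section \<open>The conductor index and the space of homomorphisms\<close>

context supercuspidal
begin

lemma act_H1c_cl:
  fixes A :: "'f ^ 2 ^ 2"
  assumes A: "invertible A" and y: "y \<in> carrier (cochains1 n)"
  shows "act_H1c n (pgl A) (cl n y) = cl n (tr (Suc n) A y)"
proof -
  have yX: "a \<in> tree_paths (Suc n)" if "y a \<noteq> 0" for a using y that by (simp add: cochains1_def finsupp_carrier)
  have iA: "invertible (inv2 A)" by (rule invertible_inv2[OF A])
  have a: "act_cochain1 n (pgl A) = tr (Suc n) A"
    by (intro ext) (simp add: act_cochain1_def tr_def inv_PGL2[OF A])
  show ?thesis unfolding act_H1c_def a
  proof (intro Set.set_eqI iffI)
    fix x assume "x \<in> tr (Suc n) A ` cl n y"
    then obtain u where u: "x = tr (Suc n) A u" "u - y \<in> cobs n" by (auto simp: cl_def)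
    show "x \<in> cl n (tr (Suc n) A y)" using cobs_tr[OF u(2) A] by (simp add: cl_def u(1) tr_diff)
  next
    fix x assume "x \<in> cl n (tr (Suc n) A y)"
    then have d: "x - tr (Suc n) A y \<in> cobs n" by (simp add: cl_def)
    \<comment> \<open>A member of the class is only known up to a coboundary, but coboundaries and
      translates both vanish off the paths; this makes the translation invertible on the
      class.\<close>
    have xX: "b \<in> tree_paths (Suc n)" if "x b \<noteq> 0" for b
    proof (rule ccontr)
      assume b: "b \<notin> tree_paths (Suc n)"
      obtain f where "x - tr (Suc n) A y = coboundary n f" using d unfolding cobs_def by blast
      then have "(x - tr (Suc n) A y) b = 0" using b by (simp only:) (simp add: coboundary_def)
      then show False using b that by (simp add: tr_def minus_apply)
    qed
    have c: "tr (Suc n) (inv2 A) (tr (Suc n) A y) = y"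
      unfolding tr_mult[OF iA A] inv2(2)[OF A] by (rule tr_one[OF yX])
    have c': "tr (Suc n) A (tr (Suc n) (inv2 A) x) = x"
      unfolding tr_mult[OF A iA] inv2(1)[OF A] by (rule tr_one[OF xX])
    have "tr (Suc n) (inv2 A) x - y \<in> cobs n" using cobs_tr[OF d iA] by (simp add: tr_diff c)
    then have "tr (Suc n) (inv2 A) x \<in> cl n y" by (simp add: cl_def)
    then show "x \<in> tr (Suc n) A ` cl n y" using c' by (intro image_eqI[of _ _ "tr (Suc n) (inv2 A) x"]) simp_all
  qed
qed

lemma fixed_zero:
  assumes "\<And>h. h \<in> H \<Longrightarrow> invertible h"
  shows "fixed_vectors V \<pi> (pgl ` H) = {\<zero>\<^bsub>V\<^esub>} \<longleftrightarrow> Fx H = {0}"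
proof -
  have f: "v \<in> fixed_vectors V \<pi> (pgl ` H) \<longleftrightarrow> \<Phi> v \<in> Fx H" if v: "v \<in> carrier V" for v
  proof -
    have "gv h v = v \<longleftrightarrow> rho h (\<Phi> v) = \<Phi> v" if "h \<in> H" for h
      using Phi_inj[OF gv_closed[OF assms[OF that] v] v] Phi_rho[OF assms[OF that] v] by auto
    then show ?thesis using v by (auto simp: fixed_vectors_def Fx_def gv_def)
  qed
  have sub: "fixed_vectors V \<pi> (pgl ` H) \<subseteq> carrier V" by (auto simp: fixed_vectors_def)
  have z: "\<zero>\<^bsub>V\<^esub> \<in> fixed_vectors V \<pi> (pgl ` H)" using f[OF vs.zero_closed] by (simp add: Phi_zero Fx_0)
  show ?thesis
  proof
    assume e: "fixed_vectors V \<pi> (pgl ` H) = {\<zero>\<^bsub>V\<^esub>}"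
    have "w = 0" if w: "w \<in> Fx H" for w
    proof -
      obtain v where v: "v \<in> carrier V" "w = \<Phi> v" using Fx_W[OF w] by blast
      then have "v \<in> fixed_vectors V \<pi> (pgl ` H)" using f w by blast
      then show ?thesis using e v(2) Phi_zero by simp
    qed
    then show "Fx H = {0}" using Fx_0 by blast
  next
    assume e: "Fx H = {0}"
    have "v = \<zero>\<^bsub>V\<^esub>" if v: "v \<in> fixed_vectors V \<pi> (pgl ` H)" for v
      using Phi_kernel[of v] f[of v] sub v e by blast
    then show "fixed_vectors V \<pi> (pgl ` H) = {\<zero>\<^bsub>V\<^esub>}" using z by blast
  qed
qed

text \<open>The least level with nonzero fixed vectors exceeds 1, the Iwahori level. In the
  uniqueness part \<open>k = 0\<close> is excluded first, because level 1 has no nonzero fixed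
  vectors; all comparisons then take place at positive levels, where \<open>Gamma0\<close> is the
  image of \<open>Kg\<close>.\<close>

lemma ex_newform: "\<exists>n w0. newform_vector W n w0 \<and> conductor_index V \<pi> = n"
proof -
  define Q where "Q k \<longleftrightarrow> Fx (Kg 0 (int k)) \<noteq> {0}" for k
  have Qmono: "Q k'" if "Q k" "k \<le> k'" for k k'
  proof -
    have "Kg 0 (int k') \<subseteq> (Kg 0 (int k) :: ('f ^ 2 ^ 2) set)" using that(2) by (auto simp: Kg_def intro: P_mono)
    then show ?thesis using that(1) Fx_mono Fx_0 unfolding Q_def by blast
  qed
  have Q1: "\<not> Q 1" using iwahori_fixed_zero Fx_0 unfolding Q_def by auto
  obtain m :: int and w where m: "m \<ge> 1" "w \<in> Fx (Kg 0 m)" "w \<noteq> 0" using ex_Hecke_fixed by blast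
  then have Qm: "Q (nat m)" unfolding Q_def by auto
  define N where "N = (LEAST k. Q k)"
  have QN: "Q N" unfolding N_def by (rule LeastI[of Q, OF Qm])
  have Nle: "N \<le> k" if "Q k" for k unfolding N_def by (rule Least_le[of Q, OF that])
  have "1 < N"
  proof (rule ccontr)
    assume "\<not> 1 < N"
    then have "Q 1" using Qmono[OF QN] by simp
    then show False using Q1 by simp
  qed
  then obtain n where n: "N = Suc n" "1 \<le> n" by (cases N) auto
  obtain w0 where w0: "w0 \<in> Fx (Kg 0 (int (Suc n)))" "w0 \<noteq> 0" using QN Fx_0 unfolding Q_def n(1) by blast
  have old: "w = 0" if "w \<in> Fx (Kg 0 (int (Suc n) - 1))" for w
  proof (rule ccontr)
    assume "w \<noteq> 0"
    then have "Q n" using that unfolding Q_def by auto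
    then show False using Nle[of n] n by simp
  qed
  have "newform_vector W n w0"
  proof
    show "1 \<le> int (Suc n)" "2 \<le> int (Suc n)" using n(2) by simp_all
    show "w = 0" if "w \<in> Fx (Kg 0 (int (Suc n) - 1))" for w by (rule old[OF that])
  qed (rule w0)+
  moreover have "conductor_index V \<pi> = n"
  proof -
    have G: "fixed_vectors V \<pi> (Gamma0 k) = {\<zero>\<^bsub>V\<^esub>} \<longleftrightarrow> \<not> Q k" if "1 \<le> k" for k
      unfolding Gamma0_eq[OF that] Q_def not_not by (rule fixed_zero, rule Kg_inv, assumption) (use that in simp)
    show ?thesis unfolding conductor_index_def
    proof (rule the_equality)
      show "fixed_vectors V \<pi> (Gamma0 (n + 1)) \<noteq> {\<zero>\<^bsub>V\<^esub>} \<and> fixed_vectors V \<pi> (Gamma0 n) = {\<zero>\<^bsub>V\<^esub>}"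
        using G[of "n + 1"] G[of n] QN Nle[of n] n by auto
    next
      fix k assume k: "fixed_vectors V \<pi> (Gamma0 (k + 1)) \<noteq> {\<zero>\<^bsub>V\<^esub>} \<and> fixed_vectors V \<pi> (Gamma0 k) = {\<zero>\<^bsub>V\<^esub>}"
      have Qk: "Q (k + 1)" using k G[of "k + 1"] by simp
      then have k1: "1 \<le> k" using Q1 by (cases k) auto
      then have "\<not> Q k" using k G[of k] by simp
      then have "k < N" using Qmono[OF QN, of k] by (meson not_less)
      then show "k = n" using Nle[OF Qk] n(1) by simp
    qed
  qed
  ultimately show ?thesis by blast
qed

theorem Hom_dimension:
  "has_dimension (Hom_rep PGL2 V \<pi> (H1c (conductor_index V \<pi>)) (act_H1c (conductor_index V \<pi>))) 1"
proof -
  obtain n w0 where nv: "newform_vector W n w0" and ci: "conductor_index V \<pi> = n" using ex_newform by blast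
  interpret nv: newform_vector W n w0 by (rule nv)
  obtain v0 where v0: "v0 \<in> carrier V" "w0 = \<Phi> v0" using nv.w0_W by blast
  let ?H = "H1c n" and ?M = "Hom_rep PGL2 V \<pi> (H1c n) (act_H1c n)"
  define F where "F z = (\<lambda>v\<in>carrier V. cl n (sc z (nv.sf (\<Phi> v))))" for z
  have PhiW: "\<Phi> v \<in> W" if "v \<in> carrier V" for v using that by blast
  have co: "sc z (nv.sf (\<Phi> v)) \<in> carrier (cochains1 n)" if "v \<in> carrier V" for v z
    using nv.sf_cochain[OF PhiW[OF that]] unfolding cochains1_def by (rule finsupp_closed(2))
  have F: "F z v = cl n (sc z (nv.sf (\<Phi> v)))" if "v \<in> carrier V" for z v using that by (simp add: F_def)
  have sf_add: "nv.sf (\<Phi> v + \<Phi> w) = nv.sf (\<Phi> v) + nv.sf (\<Phi> w)" if "v \<in> carrier V" "w \<in> carrier V" for v w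
    using nv.sf_add[OF PhiW[OF that(1)] PhiW[OF that(2)]] by (simp add: fun_eq_iff plus_fun_apply)
  have sf_sc: "nv.sf (sc c (\<Phi> v)) = sc c (nv.sf (\<Phi> v))" if "v \<in> carrier V" for v c
    using nv.sf_sc[OF PhiW[OF that]] by (simp add: fun_eq_iff sc_def)
  have FM: "F z \<in> carrier ?M" for z
  proof -
    have "F z \<in> module_hom complex_ring V ?H"
      unfolding module_hom_def
    proof (intro CollectI conjI allI impI)
      show "F z \<in> carrier V \<rightarrow> carrier ?H" using co by (auto simp: F H1c_carrier)
      show "F z (v \<oplus>\<^bsub>V\<^esub> w) = F z v \<oplus>\<^bsub>?H\<^esub> F z w" if "v \<in> carrier V \<and> w \<in> carrier V" for v w
        using that by (simp add: F H1c_add Phi_add sf_add sc_add)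
      show "F z (c \<odot>\<^bsub>V\<^esub> v) = c \<odot>\<^bsub>?H\<^esub> F z v" if "c \<in> carrier complex_ring \<and> v \<in> carrier V" for c v
        using that by (simp add: F H1c_smult Phi_smult sf_sc vs_smult mult.commute)
    qed
    moreover have "F z (\<pi> g v) = act_H1c n g (F z v)" if g: "g \<in> carrier PGL2" and v: "v \<in> carrier V" for g v
    proof -
      obtain A :: "'f ^ 2 ^ 2" where A: "invertible A" "g = pgl A" using g unfolding carrier_PGL2 by blast
      have "\<pi> g v = gv A v" by (simp add: A(2) gv_def)
      then have "F z (\<pi> g v) = cl n (sc z (nv.sf (rho A (\<Phi> v))))" using F[OF gv_closed[OF A(1) v]] Phi_rho[OF A(1) v] by simp
      then show ?thesis
        unfolding A(2) F[OF v] act_H1c_cl[OF A(1) co[OF v]] tr_sc nv.sf_rho[OF A(1) PhiW[OF v]] by simp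
    qed
    ultimately show ?thesis by (simp add: Hom_rep_def F_def)
  qed
  have surj: "\<phi> \<in> range F" if \<phi>: "\<phi> \<in> carrier ?M" for \<phi>
  proof -
    have M: "\<phi> \<in> module_hom complex_ring V ?H \<inter> extensional (carrier V) \<and>
        (\<forall>g\<in>carrier PGL2. \<forall>v\<in>carrier V. \<phi> (\<pi> g v) = act_H1c n g (\<phi> v))"
      using \<phi> unfolding Hom_rep_def partial_object.select_convs mem_Collect_eq .
    have hom: "\<phi> \<in> module_hom complex_ring V ?H" and ext: "\<phi> \<in> extensional (carrier V)"
      using conjunct1[OF M] by simp_all
    note eq = bspec[OF bspec[OF conjunct2[OF M]]]
    have im: "\<exists>y\<in>carrier (cochains1 n). \<phi> v = cl n y" if v: "v \<in> carrier V" for v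
    proof -
      have "\<phi> v \<in> cl n ` carrier (cochains1 n)"
        unfolding H1c_carrier[symmetric] by (rule funcset_mem[OF module_hom_closed[OF hom] v])
      then show ?thesis by (rule imageE) (rule bexI)
    qed
    have hadd: "\<phi> (v \<oplus>\<^bsub>V\<^esub> w) = \<phi> v \<oplus>\<^bsub>?H\<^esub> \<phi> w" if "v \<in> carrier V" "w \<in> carrier V" for v w
      by (rule module_hom_add[OF hom that])
    have hsm: "\<phi> (c \<odot>\<^bsub>V\<^esub> v) = c \<odot>\<^bsub>?H\<^esub> \<phi> v" if "v \<in> carrier V" for c v
      by (rule module_hom_smult[OF hom _ that]) simp
    \<comment> \<open>An element of the quotient is itself a set of cochains, so
      \<open>\<phi>\<close> provides the relation required by \<open>hom_classify\<close> once
      \<open>\<Phi>\<close> is inverted.\<close>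
    define Th where "Th w = \<phi> (inv_into (carrier V) \<Phi> w)" for w
    have injP: "inj_on \<Phi> (carrier V)" by (rule inj_onI) (rule Phi_inj)
    have Th: "Th (\<Phi> v) = \<phi> v" if "v \<in> carrier V" for v by (simp add: Th_def inv_into_f_f[OF injP that])
    have n1: "1 \<le> n" by (rule nv.n1)
    have memC: "y \<in> carrier (cochains1 n)" if v: "v \<in> carrier V" and y: "y \<in> \<phi> v" for v y
    proof -
      obtain y1 where y1: "y1 \<in> carrier (cochains1 n)" "\<phi> v = cl n y1" using im[OF v] by blast
      have "y - y1 \<in> carrier (cochains1 n)" using y y1(2) cobs_cochains1[OF n1] by (simp add: cl_def)
      then have "(y - y1) + y1 \<in> carrier (cochains1 n)" using y1(1) unfolding cochains1_def by (rule finsupp_closed(1))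
      then show ?thesis by simp
    qed
    have clm: "\<phi> v = cl n y" if v: "v \<in> carrier V" and y: "y \<in> \<phi> v" for v y
    proof -
      obtain y1 where y1: "\<phi> v = cl n y1" using im[OF v] by blast
      then show ?thesis using cl_memI[of y n y1] y by simp
    qed
    obtain y0 where y0: "\<phi> v0 = cl n y0" using im[OF v0(1)] by blast
    have "\<exists>z. \<forall>w\<in>W. sc z (nv.sf w) \<in> Th w"
    proof (rule nv.hom_classify)
      show "y0 \<in> Th w0" unfolding v0(2) Th[OF v0(1)] y0 by (rule cl_self)
      show "y \<in> carrier (cochains1 n)" if "w \<in> W" "y \<in> Th w" for w y
        using that memC Th by auto
      show "y + y' \<in> Th (w + w')" if w: "w \<in> W" "w' \<in> W" and y: "y \<in> Th w" "y' \<in> Th w'" for w w' y y'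
      proof -
        obtain v where v: "v \<in> carrier V" "w = \<Phi> v" using w(1) by blast
        obtain v' where v': "v' \<in> carrier V" "w' = \<Phi> v'" using w(2) by blast
        have "Th (w + w') = \<phi> v \<oplus>\<^bsub>?H\<^esub> \<phi> v'"
          unfolding v(2) v'(2) Phi_add[OF v(1) v'(1), symmetric] using Th[of "v \<oplus>\<^bsub>V\<^esub> v'"] hadd[OF v(1) v'(1)] v(1) v'(1) by simp
        also have "\<dots> = cl n (y + y')"
          using clm[OF v(1), of y] clm[OF v'(1), of y'] y unfolding v(2) v'(2) Th[OF v(1)] Th[OF v'(1)] by (simp add: H1c_add)
        finally show ?thesis using cl_self by blast
      qed
      show "sc z y \<in> Th (sc z w)" if w: "w \<in> W" and y: "y \<in> Th w" for w y z
      proof -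
        obtain v where v: "v \<in> carrier V" "w = \<Phi> v" using w by blast
        have "Th (sc z w) = z \<odot>\<^bsub>?H\<^esub> \<phi> v"
          unfolding v(2) Phi_smult[OF v(1), symmetric] using Th[OF vs_smult[OF v(1)]] hsm[OF v(1)] by simp
        also have "\<dots> = cl n (sc z y)" using clm[OF v(1), of y] y unfolding v(2) Th[OF v(1)] by (simp add: H1c_smult)
        finally show ?thesis using cl_self by blast
      qed
      show "tr (Suc n) g y \<in> Th (rho g w)" if g: "invertible g" and w: "w \<in> W" and y: "y \<in> Th w" for g w y
      proof -
        obtain v where v: "v \<in> carrier V" "w = \<Phi> v" using w by blast
        have yv: "y \<in> \<phi> v" using y unfolding v(2) Th[OF v(1)] .
        have "Th (rho g w) = act_H1c n (pgl g) (\<phi> v)"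
          unfolding v(2) Phi_rho[OF g v(1)] Th[OF gv_closed[OF g v(1)]] using eq[OF pgl_carrier[OF g] v(1)] by (simp add: gv_def)
        also have "\<dots> = cl n (tr (Suc n) g y)"
          unfolding clm[OF v(1) yv] by (rule act_H1c_cl[OF g memC[OF v(1) yv]])
        finally show ?thesis using cl_self by blast
      qed
    qed
    then obtain z where z: "\<And>w. w \<in> W \<Longrightarrow> sc z (nv.sf w) \<in> Th w" by blast
    have "\<phi> = F z"
    proof (rule extensionalityI[OF ext])
      show "F z \<in> extensional (carrier V)" by (simp add: F_def)
      show "\<phi> v = F z v" if v: "v \<in> carrier V" for v
        unfolding F[OF v] by (rule clm[OF v]) (use z[OF PhiW[OF v]] Th[OF v] in simp)
    qed
    then show ?thesis by simp
  qed
  show ?thesis unfolding ci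
  proof (rule has_dimension_1I[where F = F])
    show "carrier ?M = range F" using FM surj by blast
    show "F a \<oplus>\<^bsub>?M\<^esub> F b = F (a + b)" for a b
      by (rule extensionalityI[where A = "carrier V"]) (simp_all add: Hom_rep_def F F_def[of "a + b"] H1c_add sc_add_left)
    show "c \<odot>\<^bsub>?M\<^esub> F a = F (c * a)" for c a
      by (rule extensionalityI[where A = "carrier V"]) (simp_all add: Hom_rep_def F F_def[of "c * a"] H1c_smult)
    show "\<zero>\<^bsub>?M\<^esub> = F 0"
      by (rule extensionalityI[where A = "carrier V"]) (simp_all add: Hom_rep_def F F_def[of 0] H1c_zero)
    show "F 1 \<noteq> F 0"
    proof
      assume "F 1 = F 0"
      then have "F 1 v0 = F 0 v0" by simp
      then have "nv.sf w0 \<in> cobs n" unfolding F[OF v0(1)] v0(2)[symmetric] cl_eq_iff by simp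
      then obtain f where f: "nv.sf w0 = coboundary n f" "f \<in> carrier (cochains0 n)" unfolding cobs_def by blast
      have "(1 :: complex) = 0"
        by (rule nv.sf_not_coboundary[of f]) (use f in \<open>auto simp: cochains0_def finsupp_carrier\<close>)
      then show False by simp
    qed
  qed
qed

end

theorem mainTheorem2:
  fixes V :: "(complex, 'v) module"
    and \<pi> :: "('f::nonarch_local_field ^ 2 ^ 2) set \<Rightarrow> 'v \<Rightarrow> 'v"
  assumes "irreducible_supercuspidal V \<pi>"
  shows "has_dimension
           (Hom_rep PGL2 V \<pi> (H1c (conductor_index V \<pi>)) (act_H1c (conductor_index V \<pi>))) 1"
  by (rule supercuspidal.Hom_dimension[OF supercuspidal.intro[OF assms]])

end
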